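(* Let $n\geq 5$ and let $\varrho\in\mathcal{P}H_n$. Then $\varrho$ is basic if and only if $\varrho$ is discrete and faithful (that is, $\varrho$ is injective and its image is a discrete subgroup of $\mathrm{PU}(1,1)$).
   Context: $\mathbb D$ is the Poincaré disc (hyperbolic plane) and $\mathrm{PU}(1,1)=\mathrm{SU}(1,1)/\{\pm1\}$ is its group of orientation-preserving isometries. For $q\in\mathbb D$, $R^q\in\mathrm{PU}(1,1)$ denotes the reflection in the point $q$, i.e. the rotation by angle $\pi$ about $q$; every nontrivial involution in $\mathrm{PU}(1,1)$ is of this form for a unique $q$. For a positive integer $n$, let $H_n:=\langle r_1,\dots,r_n\mid r_1^2=\dots=r_n^2=r_n\cdots r_1=1\rangle$ (the hyperelliptic group when $n\ge5$, the cancellation group when $n=2$), and let $\mathcal{P}H_n$ be the set of homomorphisms $\varrho:H_n\to\mathrm{PU}(1,1)$ with $\varrho(r_i)\ne1$ for all $i$. Such $\varrho$ correspond bijectively to tuples $(q_1,\dots,q_n)\in\mathbb D^n$ satisfying the relation $R^{q_n}\cdots R^{q_1}=1$ in $\mathrm{PU}(1,1)$, via $\varrho(r_i)=R^{q_i}$. Bendings: let $\varrho\in\mathcal{P}H_n$ be given by $(q_1,\dots,q_n)$, and let $i$ be an index modulo $n$ (so the pair $(q_n,q_1)$ is allowed) with $q_i\neq q_{i+1}$. A bending replaces $q_i,q_{i+1}$ by points $q_i',q_{i+1}'$ obtained by moving both along the geodesic line through $q_i,q_{i+1}$ by a common translation along that line; then $R^{q_{i+1}'}R^{q_i'}=R^{q_{i+1}}R^{q_i}$,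 so the new tuple again defines an element of $\mathcal{P}H_n$. A representation obtained from $\varrho$ by finitely many bendings is a bending-deformation of $\varrho$. Concatenation: if $\varrho_1\in\mathcal{P}H_k$ is given by $(p_1,\dots,p_k)$ and $\varrho_2\in\mathcal{P}H_\ell$ is given by $(q_1,\dots,q_\ell)$, then for $i\in\{0,1,\dots,\ell\}$ the representation $\varrho_1\odot_i\varrho_2\in\mathcal{P}H_{k+\ell}$ is the one given by the tuple $(q_1,\dots,q_i,p_1,\dots,p_k,q_{i+1},\dots,q_\ell)$. Basic: $\varrho\in\mathcal{P}H_n$, $n\ge5$, is basic if no bending-deformation of $\varrho$ (including $\varrho$ itself) is of the form $\varrho_1\odot_i\varrho_2$ with $\varrho_1\in\mathcal{P}H_k$, $\varrho_2\in\mathcal{P}H_\ell$, $k,\ell\ge1$, $k+\ell=n$, $i\in\{0,\dots,\ell\}$. *)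

theory Defs
  imports "HOL-Analysis.Analysis" "HOL-Algebra.Coset"
begin

section \<open>Groups given by generators and relators\<close>

text \<open>A letter \<open>(x, True)\<close> stands for the generator \<open>x\<close> and \<open>(x, False)\<close> for its formal inverse.
  Two words are identified if they are related by inserting or deleting subwords
  \<open>x x\<^sup>-\<^sup>1\<close>, \<open>x\<^sup>-\<^sup>1 x\<close> and relators.\<close>

definition group_words :: "'a set \<Rightarrow> ('a \<times> bool) list set" where
  "group_words S = lists (S \<times> UNIV)"

inductive word_equiv ::
    "'a set \<Rightarrow> ('a \<times> bool) list set \<Rightarrow> ('a \<times> bool) list \<Rightarrow> ('a \<times> bool) list \<Rightarrow> bool"
  for S :: "'a set" and R :: "('a \<times> bool) list set" where
  word_refl: "w \<in> group_words S \<Longrightarrow> word_equiv S R w w"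
| word_sym: "word_equiv S R v w \<Longrightarrow> word_equiv S R w v"
| word_trans: "word_equiv S R u v \<Longrightarrow> word_equiv S R v w \<Longrightarrow> word_equiv S R u w"
| word_cancel: "u \<in> group_words S \<Longrightarrow> v \<in> group_words S \<Longrightarrow> x \<in> S \<Longrightarrow>
    word_equiv S R (u @ [(x, b), (x, \<not> b)] @ v) (u @ v)"
| word_relator: "u \<in> group_words S \<Longrightarrow> v \<in> group_words S \<Longrightarrow> r \<in> R \<Longrightarrow> r \<in> group_words S \<Longrightarrow>
    word_equiv S R (u @ r @ v) (u @ v)"

definition word_class ::
    "'a set \<Rightarrow> ('a \<times> bool) list set \<Rightarrow> ('a \<times> bool) list \<Rightarrow> ('a \<times> bool) list set" where
  "word_class S R w = {v. word_equiv S R w v}"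

definition presented_group ::
    "'a set \<Rightarrow> ('a \<times> bool) list set \<Rightarrow> ('a \<times> bool) list set monoid" where
  "presented_group S R =
     \<lparr> carrier = word_class S R ` group_words S,
       mult = (\<lambda>X Y. \<Union>u\<in>X. \<Union>v\<in>Y. word_class S R (u @ v)),
       one = word_class S R [] \<rparr>"

lemma group_words_append [simp]:
  "u @ v \<in> group_words S \<longleftrightarrow> u \<in> group_words S \<and> v \<in> group_words S"
  by (auto simp: group_words_def)

lemma group_words_Nil [simp]: "[] \<in> group_words S"
  by (simp add: group_words_def)

lemma word_equiv_words:
  "word_equiv S R v w \<Longrightarrow> v \<in> group_words S \<and> w \<in> group_words S"
  by (induction rule: word_equiv.induct) (auto simp: group_words_def)

lemma word_equiv_append_left:
  assumes "word_equiv S R v w" "u \<in> group_words S"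
  shows "word_equiv S R (u @ v) (u @ w)"
  using assms
proof (induction rule: word_equiv.induct)
  case (word_cancel a b x c)
  then show ?case using word_equiv.word_cancel[of "u @ a" S b x R c] by simp
next
  case (word_relator a b r)
  then show ?case using word_equiv.word_relator[of "u @ a" S b r R] by simp
qed (auto intro: word_equiv.word_refl word_equiv.word_sym word_equiv.word_trans)

lemma word_equiv_append_right:
  assumes "word_equiv S R v w" "u \<in> group_words S"
  shows "word_equiv S R (v @ u) (w @ u)"
  using assms
proof (induction rule: word_equiv.induct)
  case (word_cancel a b x c)
  then show ?case using word_equiv.word_cancel[of a S "b @ u" x R c] by simp
next
  case (word_relator a b r)
  then show ?case using word_equiv.word_relator[of a S "b @ u" r R] by simp
qed (auto intro: word_equiv.word_refl word_equiv.word_sym word_equiv.word_trans)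

lemma word_class_eq_iff:
  assumes "v \<in> group_words S"
  shows "word_class S R v = word_class S R w \<longleftrightarrow> word_equiv S R v w"
proof
  assume "word_class S R v = word_class S R w"
  then show "word_equiv S R v w"
    using word_equiv.word_refl[OF assms, of R] by (auto simp: word_class_def intro: word_equiv.word_sym)
next
  assume "word_equiv S R v w"
  then show "word_class S R v = word_class S R w"
    by (auto simp: word_class_def intro: word_equiv.word_sym word_equiv.word_trans)
qed

lemma presented_group_mult:
  assumes "u \<in> group_words S" "v \<in> group_words S"
  shows "word_class S R u \<otimes>\<^bsub>presented_group S R\<^esub> word_class S R v = word_class S R (u @ v)"
proof -
  have "word_class S R (u' @ v') = word_class S R (u @ v)"
    if "u' \<in> word_class S R u" "v' \<in> word_class S R v" for u' v'
  proof -
    have *: "word_equiv S R u u'" "word_equiv S R v v'"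
      using that by (auto simp: word_class_def)
    then have "word_equiv S R (u @ v) (u' @ v')"
      using word_equiv.word_trans[OF word_equiv_append_left[OF *(2) assms(1)]
          word_equiv_append_right[OF *(1), of v']] word_equiv_words[OF *(2)] by simp
    then have "word_class S R (u @ v) = word_class S R (u' @ v')"
      using assms by (simp add: word_class_eq_iff)
    then show ?thesis by simp
  qed
  moreover have "u \<in> word_class S R u" "v \<in> word_class S R v"
    using assms by (auto simp: word_class_def intro: word_equiv.word_refl)
  ultimately have "(\<Union>u'\<in>word_class S R u. \<Union>v'\<in>word_class S R v. word_class S R (u' @ v')) =
      word_class S R (u @ v)"
    by blast
  then show ?thesis
    by (simp add: presented_group_def)
qed

lemma word_equiv_inverse:
  assumes "w \<in> group_words S"
  shows "word_equiv S R (rev (map (\<lambda>(x, b). (x, \<not> b)) w) @ w) []"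
  using assms
proof (induction w)
  case Nil
  then show ?case by (simp add: word_equiv.word_refl)
next
  case (Cons a w)
  obtain x b where a: "a = (x, b)" by (cases a)
  have w: "w \<in> group_words S" "x \<in> S" and
    w': "rev (map (\<lambda>(x, b). (x, \<not> b)) w) \<in> group_words S"
    using Cons.prems a by (auto simp: group_words_def)
  show ?case
    using word_equiv.word_trans[OF word_equiv.word_cancel[OF w' w(1) w(2), of R "\<not> b"] Cons.IH[OF w(1)]] a
    by simp
qed

lemma group_presented_group: "group (presented_group S R)"
proof (rule groupI)
  fix X Y assume "X \<in> carrier (presented_group S R)" "Y \<in> carrier (presented_group S R)"
  then obtain u v where "u \<in> group_words S" "v \<in> group_words S"
    "X = word_class S R u" "Y = word_class S R v"
    by (auto simp: presented_group_def)
  then show "X \<otimes>\<^bsub>presented_group S R\<^esub> Y \<in> carrier (presented_group S R)"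
    by (simp add: presented_group_mult) (simp add: presented_group_def)
next
  show "\<one>\<^bsub>presented_group S R\<^esub> \<in> carrier (presented_group S R)"
    by (simp add: presented_group_def)
next
  fix X Y Z assume "X \<in> carrier (presented_group S R)" "Y \<in> carrier (presented_group S R)"
    "Z \<in> carrier (presented_group S R)"
  then obtain u v w where "u \<in> group_words S" "v \<in> group_words S" "w \<in> group_words S"
    "X = word_class S R u" "Y = word_class S R v" "Z = word_class S R w"
    by (auto simp: presented_group_def)
  then show "X \<otimes>\<^bsub>presented_group S R\<^esub> Y \<otimes>\<^bsub>presented_group S R\<^esub> Z =
      X \<otimes>\<^bsub>presented_group S R\<^esub> (Y \<otimes>\<^bsub>presented_group S R\<^esub> Z)"
    by (simp add: presented_group_mult)
next
  have one: "\<one>\<^bsub>presented_group S R\<^esub> = word_class S R []"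
    by (simp add: presented_group_def)
  fix X assume "X \<in> carrier (presented_group S R)"
  then obtain u where u: "u \<in> group_words S" "X = word_class S R u"
    by (auto simp: presented_group_def)
  then show "\<one>\<^bsub>presented_group S R\<^esub> \<otimes>\<^bsub>presented_group S R\<^esub> X = X"
    by (simp add: one presented_group_mult)
  let ?u = "rev (map (\<lambda>(x, b). (x, \<not> b)) u)"
  have u': "?u \<in> group_words S"
    using u(1) by (auto simp: group_words_def)
  then have "word_class S R ?u \<otimes>\<^bsub>presented_group S R\<^esub> X = \<one>\<^bsub>presented_group S R\<^esub>"
    using word_equiv_inverse[OF u(1)] u by (simp add: one presented_group_mult word_class_eq_iff)
  with u' show "\<exists>Y\<in>carrier (presented_group S R).
      Y \<otimes>\<^bsub>presented_group S R\<^esub> X = \<one>\<^bsub>presented_group S R\<^esub>"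
    by (intro bexI[of _ "word_class S R ?u"]) (auto simp: presented_group_def)
qed

definition H_relators :: "nat \<Rightarrow> (nat \<times> bool) list set" where
  "H_relators n = {[(i, True), (i, True)] | i. i \<in> {1..n}} \<union>
     {rev (map (\<lambda>i. (i, True)) [1..<Suc n])}"

definition H_group :: "nat \<Rightarrow> (nat \<times> bool) list set monoid" where
  "H_group n = presented_group {1..n} (H_relators n)"

definition H_gen :: "nat \<Rightarrow> nat \<Rightarrow> (nat \<times> bool) list set" where
  "H_gen n i = word_class {1..n} (H_relators n) [(i, True)]"


section \<open>The group \<open>PU(1,1)\<close> and its topology\<close>

definition J11 :: "complex ^ 2 ^ 2" where
  "J11 = vector [vector [1, 0], vector [0, - 1]]"

definition adjoint_matrix :: "complex ^ 'n ^ 'm \<Rightarrow> complex ^ 'm ^ 'n" where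
  "adjoint_matrix A = map_matrix cnj (Finite_Cartesian_Product.transpose A)"

definition SU11 :: "(complex ^ 2 ^ 2) monoid" where
  "SU11 = \<lparr> carrier = {A. adjoint_matrix A ** J11 ** A = J11 \<and> Determinants.det A = 1},
            mult = (**), one = Finite_Cartesian_Product.mat 1 \<rparr>"

definition PU11 :: "(complex ^ 2 ^ 2) set monoid" where
  "PU11 = SU11 Mod {Finite_Cartesian_Product.mat 1, - Finite_Cartesian_Product.mat 1}"

definition PU11_class :: "complex ^ 2 ^ 2 \<Rightarrow> (complex ^ 2 ^ 2) set" where
  "PU11_class A =
     {Finite_Cartesian_Product.mat 1, - Finite_Cartesian_Product.mat 1} #>\<^bsub>SU11\<^esub> A"

text \<open>The quotient topology induced by \<open>SU(1,1)\<close>, which carries the topology of the space of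
  matrices.\<close>

definition PU11_topology :: "(complex ^ 2 ^ 2) set topology" where
  "PU11_topology = topology (\<lambda>U. U \<subseteq> carrier PU11 \<and>
     openin (top_of_set (carrier SU11)) {A \<in> carrier SU11. PU11_class A \<in> U})"

lemma openin_PU11_topology:
  "openin PU11_topology U \<longleftrightarrow> U \<subseteq> carrier PU11 \<and>
     openin (top_of_set (carrier SU11)) {A \<in> carrier SU11. PU11_class A \<in> U}"
proof -
  let ?P = "\<lambda>U. {A \<in> carrier SU11. PU11_class A \<in> U}"
  have "istopology (\<lambda>U. U \<subseteq> carrier PU11 \<and> openin (top_of_set (carrier SU11)) (?P U))"
    unfolding istopology_def
  proof (rule conjI; intro allI impI)
    fix U V
    assume U: "U \<subseteq> carrier PU11 \<and> openin (top_of_set (carrier SU11)) (?P U)"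
      and V: "V \<subseteq> carrier PU11 \<and> openin (top_of_set (carrier SU11)) (?P V)"
    have "?P (U \<inter> V) = ?P U \<inter> ?P V" by blast
    moreover have "openin (top_of_set (carrier SU11)) (?P U \<inter> ?P V)"
      using U V by (intro openin_Int) simp_all
    ultimately show "U \<inter> V \<subseteq> carrier PU11 \<and>
        openin (top_of_set (carrier SU11)) (?P (U \<inter> V))"
      using U by (simp only:) blast
  next
    fix \<U> assume *: "\<forall>U\<in>\<U>. U \<subseteq> carrier PU11 \<and> openin (top_of_set (carrier SU11)) (?P U)"
    have "?P (\<Union>\<U>) = (\<Union>U\<in>\<U>. ?P U)" by blast
    moreover have "openin (top_of_set (carrier SU11)) (\<Union>U\<in>\<U>. ?P U)"
      using * by (intro openin_Union) blast
    ultimately show "\<Union>\<U> \<subseteq> carrier PU11 \<and> openin (top_of_set (carrier SU11)) (?P (\<Union>\<U>))"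
      using * by (simp only:) blast
  qed
  then show ?thesis
    by (simp add: PU11_topology_def)
qed

lemma PU11_class_carrier: "PU11_class ` carrier SU11 = carrier PU11"
  by (auto simp: PU11_def PU11_class_def carrier_FactGroup)

lemma quotient_map_PU11_class:
  "quotient_map (top_of_set (carrier SU11)) PU11_topology PU11_class"
proof -
  have "{A \<in> carrier SU11. PU11_class A \<in> carrier PU11} = carrier SU11"
    using PU11_class_carrier by blast
  then have "openin PU11_topology (carrier PU11)"
    by (simp add: openin_PU11_topology)
  moreover have "topspace PU11_topology \<subseteq> carrier PU11"
    using openin_PU11_topology[of "topspace PU11_topology"] by simp
  ultimately have "topspace PU11_topology = carrier PU11"
    using openin_subset by blast
  then show ?thesis
    by (simp add: quotient_map_def PU11_class_carrier openin_PU11_topology)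
qed

definition discrete_in :: "'a topology \<Rightarrow> 'a set \<Rightarrow> bool" where
  "discrete_in X S \<longleftrightarrow> S \<subseteq> topspace X \<and> subtopology X S = discrete_topology S"


section \<open>The Poincare disc\<close>

definition poincare_disc :: "complex set" where
  "poincare_disc = ball 0 1"

definition moebius :: "complex ^ 2 ^ 2 \<Rightarrow> complex \<Rightarrow> complex" where
  "moebius A z = (A$1$1 * z + A$1$2) / (A$2$1 * z + A$2$2)"

definition poincare_dist :: "complex \<Rightarrow> complex \<Rightarrow> real" where
  "poincare_dist z w =
     arcosh (1 + 2 * (cmod (z - w))\<^sup>2 / ((1 - (cmod z)\<^sup>2) * (1 - (cmod w)\<^sup>2)))"

text \<open>A unit-speed parametrization of a complete geodesic.\<close>

definition geodesic_line :: "(real \<Rightarrow> complex) \<Rightarrow> bool" where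
  "geodesic_line \<gamma> \<longleftrightarrow> range \<gamma> \<subseteq> poincare_disc \<and>
     (\<forall>s t. poincare_dist (\<gamma> s) (\<gamma> t) = \<bar>s - t\<bar>)"

text \<open>In homogeneous coordinates, with \<open>v = (q, 1)\<close> and the Hermitian form
  \<open>\<langle>x, y\<rangle> = x\<^sub>1 cnj y\<^sub>1 - x\<^sub>2 cnj y\<^sub>2\<close>, this is \<open>x \<mapsto> \<i> (x - 2 (\<langle>x, v\<rangle> / \<langle>v, v\<rangle>) v)\<close>.
  See \<open>PU11_class_eq_point_reflection_iff\<close> below.\<close>

definition point_reflection_matrix :: "complex \<Rightarrow> complex ^ 2 ^ 2" where
  "point_reflection_matrix q =
     (let c = \<i> / (1 - q * cnj q) in
       vector [vector [c * (1 + q * cnj q), - (c * (2 * q))],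
               vector [c * (2 * cnj q), - (c * (1 + q * cnj q))]])"

definition point_reflection :: "complex \<Rightarrow> (complex ^ 2 ^ 2) set" where
  "point_reflection q = PU11_class (point_reflection_matrix q)"

lemma SU11_iff:
  "A \<in> carrier SU11 \<longleftrightarrow>
     A$2$1 = cnj (A$1$2) \<and> A$2$2 = cnj (A$1$1) \<and> A$1$1 * cnj (A$1$1) - A$1$2 * cnj (A$1$2) = 1"
proof -
  define a b c d where defs: "a = A$1$1" "b = A$1$2" "c = A$2$1" "d = A$2$2"
  have "A \<in> carrier SU11 \<longleftrightarrow>
      cnj a * a - cnj c * c = 1 \<and> cnj a * b - cnj c * d = 0 \<and>
      cnj b * a - cnj d * c = 0 \<and> cnj b * b - cnj d * d = -1 \<and> a * d - b * c = 1"
    by (simp add: SU11_def adjoint_matrix_def J11_def matrix_matrix_mult_def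
        Finite_Cartesian_Product.transpose_def Determinants.det_2 sum_2 vec_eq_iff forall_2 defs conj_ac)
  also have "\<dots> \<longleftrightarrow> c = cnj b \<and> d = cnj a \<and> a * cnj a - b * cnj b = 1"
  proof
    assume *: "cnj a * a - cnj c * c = 1 \<and> cnj a * b - cnj c * d = 0 \<and>
      cnj b * a - cnj d * c = 0 \<and> cnj b * b - cnj d * d = -1 \<and> a * d - b * c = 1"
    have "d = (cnj a * a - cnj c * c) * d" using * by simp
    also have "\<dots> = cnj a * (a * d - b * c) + (cnj a * b - cnj c * d) * c"
      by (simp add: algebra_simps)
    finally have d: "d = cnj a" using * by simp
    have "cnj c = cnj c * (a * d - b * c)" using * by simp
    also have "\<dots> = (cnj a * a - cnj c * c) * b - a * (cnj a * b - cnj c * d)"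
      by (simp add: algebra_simps)
    finally have "cnj c = b" using * by simp
    then have "c = cnj b" by auto
    with d * show "c = cnj b \<and> d = cnj a \<and> a * cnj a - b * cnj b = 1"
      by (simp add: mult.commute)
  qed (auto simp: algebra_simps)
  finally show ?thesis by (simp add: defs)
qed

lemma group_SU11: "group SU11"
proof (rule groupI)
  fix A B assume "A \<in> carrier SU11" "B \<in> carrier SU11"
  moreover have "adjoint_matrix (A ** B) = adjoint_matrix B ** adjoint_matrix A"
    by (simp add: adjoint_matrix_def matrix_matrix_mult_def vec_eq_iff
        Finite_Cartesian_Product.transpose_def mult.commute)
  ultimately show "A \<otimes>\<^bsub>SU11\<^esub> B \<in> carrier SU11"
    by (simp add: SU11_def det_mul) (metis matrix_mul_assoc)
next
  fix A B C :: "complex ^ 2 ^ 2"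
  show "A \<otimes>\<^bsub>SU11\<^esub> B \<otimes>\<^bsub>SU11\<^esub> C = A \<otimes>\<^bsub>SU11\<^esub> (B \<otimes>\<^bsub>SU11\<^esub> C)"
    by (simp add: SU11_def matrix_mul_assoc)
next
  show "\<one>\<^bsub>SU11\<^esub> \<in> carrier SU11"
    by (simp add: SU11_iff) (simp add: SU11_def Finite_Cartesian_Product.mat_def)
next
  fix A assume A: "A \<in> carrier SU11"
  then show "\<one>\<^bsub>SU11\<^esub> \<otimes>\<^bsub>SU11\<^esub> A = A" by (simp add: SU11_def)
  let ?B = "vector [vector [A$2$2, - A$1$2], vector [- A$2$1, A$1$1]] :: complex ^ 2 ^ 2"
  have "?B \<in> carrier SU11" using A by (auto simp: SU11_iff algebra_simps)
  moreover have "?B \<otimes>\<^bsub>SU11\<^esub> A = \<one>\<^bsub>SU11\<^esub>"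
    using A by (simp add: SU11_iff) (simp add: SU11_def matrix_matrix_mult_def vec_eq_iff forall_2 sum_2
        Finite_Cartesian_Product.mat_def algebra_simps)
  ultimately show "\<exists>B\<in>carrier SU11. B \<otimes>\<^bsub>SU11\<^esub> A = \<one>\<^bsub>SU11\<^esub>" by blast
qed

lemma matrix_mul_uminus_left: "(- A) ** B = - (A ** B)" for A :: "complex ^ 'n ^ 'm"
  by (simp add: matrix_matrix_mult_def vec_eq_iff sum_negf)

lemma matrix_mul_uminus_right: "A ** (- B) = - (A ** B)" for A :: "complex ^ 'n ^ 'm"
  by (simp add: matrix_matrix_mult_def vec_eq_iff sum_negf)

lemma uminus_SU11: "A \<in> carrier SU11 \<Longrightarrow> - A \<in> carrier SU11"
  by (simp add: SU11_iff)

lemma normal_pm1_SU11: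
  "{Finite_Cartesian_Product.mat 1, - Finite_Cartesian_Product.mat 1} \<lhd> SU11"
proof -
  interpret group SU11 by (rule group_SU11)
  let ?N = "{Finite_Cartesian_Product.mat 1, - Finite_Cartesian_Product.mat 1 :: complex ^ 2 ^ 2}"
  have one: "\<one>\<^bsub>SU11\<^esub> = Finite_Cartesian_Product.mat 1" and mul: "\<And>A B. A \<otimes>\<^bsub>SU11\<^esub> B = A ** B"
    by (simp_all add: SU11_def)
  have N: "?N \<subseteq> carrier SU11"
    using one_closed uminus_SU11 by (auto simp: one)
  have inv: "inv\<^bsub>SU11\<^esub> A = A" if "A \<in> ?N" for A
  proof (rule inv_equality)
    show "A \<otimes>\<^bsub>SU11\<^esub> A = \<one>\<^bsub>SU11\<^esub>"
      using that by (auto simp: one mul matrix_mul_uminus_left matrix_mul_uminus_right)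
  qed (use that N in blast)+
  have sub: "subgroup ?N SU11"
  proof (rule subgroupI)
    show "A \<otimes>\<^bsub>SU11\<^esub> B \<in> ?N" if "A \<in> ?N" "B \<in> ?N" for A B
      using that by (auto simp: mul matrix_mul_uminus_left matrix_mul_uminus_right)
    show "inv\<^bsub>SU11\<^esub> A \<in> ?N" if "A \<in> ?N" for A
      using that by (simp only: inv)
  qed (use N in simp_all)
  have "A \<otimes>\<^bsub>SU11\<^esub> B \<otimes>\<^bsub>SU11\<^esub> inv\<^bsub>SU11\<^esub> A = B" if "A \<in> carrier SU11" "B \<in> ?N" for A B
  proof -
    have "A \<otimes>\<^bsub>SU11\<^esub> B = B \<otimes>\<^bsub>SU11\<^esub> A"
      using that by (auto simp: mul matrix_mul_uminus_left matrix_mul_uminus_right)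
    moreover have B: "B \<in> carrier SU11" using that N by blast
    ultimately show ?thesis
      using that(1) by (simp add: m_assoc del: insert_iff)
  qed
  with sub show ?thesis by (simp add: normal_inv_iff)
qed

lemma group_PU11: "group PU11"
  unfolding PU11_def by (rule normal.factorgroup_is_group[OF normal_pm1_SU11])

lemma PU11_class_eq: "PU11_class A = {A, - A}"
  by (auto simp: PU11_class_def r_coset_def SU11_def matrix_mul_uminus_left)

text \<open>The distance is invariant under \<open>SU(1,1)\<close>.\<close>

lemma moebius_denominator:
  assumes "A \<in> carrier SU11" "z \<in> poincare_disc"
  shows "A$2$1 * z + A$2$2 \<noteq> 0"
proof
  define a b where ab: "a = A$1$1" "b = A$1$2"
  have A: "A$2$1 = cnj b" "A$2$2 = cnj a" "a * cnj a - b * cnj b = 1"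
    using assms(1) by (auto simp: SU11_iff ab)
  assume "A$2$1 * z + A$2$2 = 0"
  then have "cnj a = - (cnj b * z)" by (simp add: A add_eq_0_iff2)
  then have "cmod a = cmod b * cmod z" by (metis complex_mod_cnj norm_minus_cancel norm_mult)
  moreover have "cmod z \<le> 1" using assms(2) by (simp add: poincare_disc_def)
  ultimately have "cmod a \<le> cmod b" by (simp add: mult_left_le)
  then have le: "(cmod a)\<^sup>2 \<le> (cmod b)\<^sup>2" by (simp add: power_mono)
  have "complex_of_real ((cmod a)\<^sup>2 - (cmod b)\<^sup>2) = 1"
    using A(3) unfolding of_real_diff complex_norm_square .
  then have "(cmod a)\<^sup>2 - (cmod b)\<^sup>2 = 1" using of_real_eq_1_iff by blast
  with le show False by linarith
qed

lemma moebius_one_minus_norm: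
  assumes "A \<in> carrier SU11" "z \<in> poincare_disc"
  shows "1 - (cmod (moebius A z))\<^sup>2 = (1 - (cmod z)\<^sup>2) / (cmod (A$2$1 * z + A$2$2))\<^sup>2"
proof -
  define a b where ab: "a = A$1$1" "b = A$1$2"
  have A: "A$2$1 = cnj b" "A$2$2 = cnj a" "a * cnj a - b * cnj b = 1"
    using assms(1) by (auto simp: SU11_iff ab)
  have nz: "cnj b * z + cnj a \<noteq> 0" using moebius_denominator[OF assms] by (simp add: A)
  have "complex_of_real ((cmod (cnj b * z + cnj a))\<^sup>2 - (cmod (a * z + b))\<^sup>2) =
      (a * cnj a - b * cnj b) * (1 - z * cnj z)"
    unfolding of_real_diff complex_norm_square by (simp add: algebra_simps)
  also have "\<dots> = complex_of_real (1 - (cmod z)\<^sup>2)"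
    unfolding A(3) of_real_diff complex_norm_square by simp
  finally have "(cmod (cnj b * z + cnj a))\<^sup>2 - (cmod (a * z + b))\<^sup>2 = 1 - (cmod z)\<^sup>2"
    using of_real_eq_iff by blast
  then show ?thesis
    using nz by (simp add: moebius_def A ab[symmetric] norm_divide power_divide field_simps)
qed

lemma moebius_poincare_disc:
  assumes "A \<in> carrier SU11" "z \<in> poincare_disc"
  shows "moebius A z \<in> poincare_disc"
proof -
  have "(cmod z)\<^sup>2 < 1" using assms(2) by (simp add: poincare_disc_def power_less_one_iff)
  then have "1 - (cmod (moebius A z))\<^sup>2 > 0"
    using moebius_one_minus_norm[OF assms] moebius_denominator[OF assms] by simp
  then show ?thesis by (simp add: poincare_disc_def power_less_one_iff)
qed

lemma poincare_dist_moebius: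
  assumes "A \<in> carrier SU11" "z \<in> poincare_disc" "w \<in> poincare_disc"
  shows "poincare_dist (moebius A z) (moebius A w) = poincare_dist z w"
proof -
  define y x where yx: "y = A$2$1 * z + A$2$2" "x = A$2$1 * w + A$2$2"
  have nz: "y \<noteq> 0" "x \<noteq> 0"
    using moebius_denominator assms by (auto simp: yx)
  have "A$1$1 * A$2$2 - A$1$2 * A$2$1 = 1"
    using assms(1) by (simp add: SU11_iff)
  then have "(A$1$1 * z + A$1$2) * x - (A$1$1 * w + A$1$2) * y = z - w"
    unfolding yx by algebra
  then have "moebius A z - moebius A w = (z - w) / (y * x)"
    unfolding moebius_def yx[symmetric] using nz by (simp add: field_simps)
  then have "cmod (moebius A z - moebius A w) = cmod (z - w) / (cmod y * cmod x)"
    by (simp add: norm_divide norm_mult)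
  moreover have "1 - (cmod (moebius A z))\<^sup>2 = (1 - (cmod z)\<^sup>2) / (cmod y)\<^sup>2"
    "1 - (cmod (moebius A w))\<^sup>2 = (1 - (cmod w)\<^sup>2) / (cmod x)\<^sup>2"
    using moebius_one_minus_norm assms by (simp_all add: yx)
  ultimately show ?thesis
    unfolding poincare_dist_def using nz by (simp add: power_divide power_mult_distrib)
qed

lemma poincare_disc_norm_ne_1:
  assumes "q \<in> poincare_disc"
  shows "1 - q * cnj q \<noteq> 0"
proof
  assume "1 - q * cnj q = 0"
  then have "complex_of_real ((cmod q)\<^sup>2) = 1" by (simp only: complex_norm_square) simp
  then have "(cmod q)\<^sup>2 = 1" using of_real_eq_1_iff by blast
  moreover have "(cmod q)\<^sup>2 < 1"
    using assms by (simp add: poincare_disc_def power_less_one_iff)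
  ultimately show False by simp
qed

lemma point_reflection_matrix_SU11:
  assumes "q \<in> poincare_disc"
  shows "point_reflection_matrix q \<in> carrier SU11"
proof -
  have nz: "1 - q * cnj q \<noteq> 0" by (rule poincare_disc_norm_ne_1[OF assms])
  define c where "c = \<i> / (1 - q * cnj q)"
  have c: "c * (1 - q * cnj q) = \<i>" "cnj c = - c"
    using nz by (simp_all add: c_def mult.commute)
  let ?M = "point_reflection_matrix q"
  have M: "?M$1$1 = c * (1 + q * cnj q)" "?M$1$2 = - (c * (2 * q))"
    "?M$2$1 = c * (2 * cnj q)" "?M$2$2 = - (c * (1 + q * cnj q))"
    by (simp_all add: point_reflection_matrix_def c_def[symmetric] Let_def)
  have "?M$1$1 * cnj (?M$1$1) - ?M$1$2 * cnj (?M$1$2) = - (c * (1 - q * cnj q))\<^sup>2"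
    unfolding M by (simp add: c algebra_simps power2_eq_square)
  also have "\<dots> = 1" by (simp add: c)
  finally show ?thesis
    by (simp add: SU11_iff) (simp add: M c)
qed

text \<open>\<open>point_reflection q\<close> is the rotation by the angle \<open>\<pi>\<close> about \<open>q\<close>.\<close>

lemma PU11_class_eq_point_reflection_iff:
  assumes "A \<in> carrier SU11" "q \<in> poincare_disc"
  shows "PU11_class A = point_reflection q \<longleftrightarrow>
    moebius A q = q \<and> (moebius A has_field_derivative - 1) (at q)"
proof -
  let ?M = "point_reflection_matrix q"
  define a b where ab: "a = A$1$1" "b = A$1$2"
  have A: "A$2$1 = cnj b" "A$2$2 = cnj a" "a * cnj a - b * cnj b = 1"
    using assms(1) by (auto simp: SU11_iff ab)
  have nz: "1 - q * cnj q \<noteq> 0" by (rule poincare_disc_norm_ne_1[OF assms(2)])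
  have cls: "PU11_class A = point_reflection q \<longleftrightarrow> A = ?M \<or> A = - ?M"
    by (auto simp: point_reflection_def PU11_class_eq doubleton_eq_iff)
  have der: "(moebius B has_field_derivative 1 / (B$2$1 * q + B$2$2)\<^sup>2) (at q)"
    if "B \<in> carrier SU11" for B
  proof -
    have "B$1$1 * B$2$2 - B$1$2 * B$2$1 = 1" using that by (simp add: SU11_iff)
    then have *: "B$1$1 * (B$2$1 * q + B$2$2) - (B$1$1 * q + B$1$2) * B$2$1 = 1"
      by (simp add: algebra_simps)
    show ?thesis
      unfolding moebius_def [abs_def] using moebius_denominator[OF that assms(2)] *
      by (auto intro!: derivative_eq_intros simp: power2_eq_square)
  qed
  have M: "?M$2$1 * q + ?M$2$2 = - \<i>" "?M$1$1 * q + ?M$1$2 = - \<i> * q"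
  proof -
    define c where "c = \<i> / (1 - q * cnj q)"
    have c: "c * (1 - q * cnj q) = \<i>" using nz by (simp add: c_def)
    have "?M$2$1 * q + ?M$2$2 = - (c * (1 - q * cnj q))"
      "?M$1$1 * q + ?M$1$2 = - (c * (1 - q * cnj q)) * q"
      by (simp_all add: point_reflection_matrix_def Let_def c_def[symmetric] algebra_simps)
    then show "?M$2$1 * q + ?M$2$2 = - \<i>" "?M$1$1 * q + ?M$1$2 = - \<i> * q"
      by (simp_all only: c)
  qed
  define y where "y = cnj b * q + cnj a"
  have y: "y \<noteq> 0" using moebius_denominator[OF assms] by (simp add: y_def A)
  have "moebius A q = q \<and> (moebius A has_field_derivative - 1) (at q) \<longleftrightarrow>
      a * q + b = q * y \<and> y\<^sup>2 = - 1"
  proof -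
    have "(moebius A has_field_derivative - 1) (at q) \<longleftrightarrow> 1 / y\<^sup>2 = - 1"
      using der[OF assms(1)] DERIV_unique by (auto simp: A y_def)
    also have "\<dots> \<longleftrightarrow> y\<^sup>2 = - 1" using y by (simp add: field_simps) (metis add.inverse_inverse)
    finally show ?thesis
      using y by (simp add: moebius_def A ab[symmetric] y_def[symmetric] nonzero_divide_eq_eq)
  qed
  also have "\<dots> \<longleftrightarrow> A = ?M \<or> A = - ?M"
  proof
    assume *: "a * q + b = q * y \<and> y\<^sup>2 = - 1"
    then have "y = \<i> \<or> y = - \<i>"
      by (metis i_squared power2_eq_iff power2_eq_square)
    then have cy: "cnj y = - y" by auto
    have b: "b = q * y - a * q" using * by (simp add: algebra_simps)
    have "b * cnj q + a = - y" using cy by (simp add: y_def)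
    then have "a * (1 - q * cnj q) = - y * (1 + q * cnj q)"
      unfolding b by (simp add: algebra_simps)
    then have a: "a = - y * (1 + q * cnj q) / (1 - q * cnj q)"
      using nz by (metis nonzero_mult_div_cancel_right)
    have b': "b = 2 * q * y / (1 - q * cnj q)"
      unfolding b a using nz by (simp add: field_simps)
    have entries: "A = B \<longleftrightarrow> a = B$1$1 \<and> b = B$1$2" if "B \<in> carrier SU11" for B
      using that A by (auto simp: SU11_iff vec_eq_iff forall_2 ab)
    have MS: "?M \<in> carrier SU11" "- ?M \<in> carrier SU11"
      using point_reflection_matrix_SU11[OF assms(2)] uminus_SU11 by auto
    show "A = ?M \<or> A = - ?M"
      using \<open>y = \<i> \<or> y = - \<i>\<close> unfolding entries[OF MS(1)] entries[OF MS(2)]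
      by (auto simp: a b' point_reflection_matrix_def Let_def)
  next
    assume "A = ?M \<or> A = - ?M"
    then show "a * q + b = q * y \<and> y\<^sup>2 = - 1"
    proof
      assume "A = ?M"
      then have "y = - \<i>" "a * q + b = - \<i> * q" using M A ab by (simp_all add: y_def)
      then show ?thesis by simp
    next
      assume eq: "A = - ?M"
      have "y = - (?M$2$1 * q + ?M$2$2)"
        unfolding y_def A(1,2)[symmetric] eq by simp
      moreover have "a * q + b = - (?M$1$1 * q + ?M$1$2)" by (simp add: ab eq)
      ultimately show ?thesis by (simp add: M)
    qed
  qed
  finally show ?thesis using cls by simp
qed


section \<open>Representations, bendings, concatenations\<close>

type_synonym H_rep = "(nat \<times> bool) list set \<Rightarrow> (complex ^ 2 ^ 2) set"

definition PH :: "nat \<Rightarrow> H_rep set" where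
  "PH n = {\<rho> \<in> hom (H_group n) PU11. \<forall>i\<in>{1..n}. \<rho> (H_gen n i) \<noteq> \<one>\<^bsub>PU11\<^esub>}"

text \<open>The tuple \<open>(q\<^sub>1, \<dots>, q\<^sub>n)\<close> is a list, so that \<open>q\<^sub>i\<close> is \<open>qs ! (i - 1)\<close>.\<close>

definition given_by :: "nat \<Rightarrow> H_rep \<Rightarrow> complex list \<Rightarrow> bool" where
  "given_by n \<rho> qs \<longleftrightarrow> length qs = n \<and> set qs \<subseteq> poincare_disc \<and>
     (\<forall>i\<in>{1..n}. \<rho> (H_gen n i) = point_reflection (qs ! (i - 1)))"

definition tuple_bending :: "complex list \<Rightarrow> complex list \<Rightarrow> bool" where
  "tuple_bending qs qs' \<longleftrightarrow>
     (\<exists>i j \<gamma> a b t. i < length qs \<and> j = Suc i mod length qs \<and> qs ! i \<noteq> qs ! j \<and>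
        geodesic_line \<gamma> \<and> \<gamma> a = qs ! i \<and> \<gamma> b = qs ! j \<and>
        qs' = qs[i := \<gamma> (a + t), j := \<gamma> (b + t)])"

definition bending :: "nat \<Rightarrow> H_rep \<Rightarrow> H_rep \<Rightarrow> bool" where
  "bending n \<rho> \<rho>' \<longleftrightarrow> \<rho> \<in> PH n \<and> \<rho>' \<in> PH n \<and>
     (\<exists>qs qs'. given_by n \<rho> qs \<and> given_by n \<rho>' qs' \<and> tuple_bending qs qs')"

definition bending_deformation :: "nat \<Rightarrow> H_rep \<Rightarrow> H_rep \<Rightarrow> bool" where
  "bending_deformation n = (bending n)\<^sup>*\<^sup>*"

text \<open>\<open>is_concatenation k l i \<rho>1 \<rho>2 \<rho>\<close> expresses \<open>\<rho> = \<rho>1 \<odot>\<^sub>i \<rho>2\<close>. It is a relation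
  because \<open>\<rho>\<close> is determined only on the carrier of \<open>H_group (k + l)\<close>.\<close>

definition is_concatenation ::
    "nat \<Rightarrow> nat \<Rightarrow> nat \<Rightarrow> H_rep \<Rightarrow> H_rep \<Rightarrow> H_rep \<Rightarrow> bool" where
  "is_concatenation k l i \<rho>1 \<rho>2 \<rho> \<longleftrightarrow>
     \<rho>1 \<in> PH k \<and> \<rho>2 \<in> PH l \<and> \<rho> \<in> PH (k + l) \<and> i \<le> l \<and>
     (\<exists>ps qs. given_by k \<rho>1 ps \<and> given_by l \<rho>2 qs \<and>
        given_by (k + l) \<rho> (take i qs @ ps @ drop i qs))"

definition basic_rep :: "nat \<Rightarrow> H_rep \<Rightarrow> bool" where
  "basic_rep n \<rho> \<longleftrightarrow> \<rho> \<in> PH n \<and>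
     \<not> (\<exists>\<sigma> k l i \<rho>1 \<rho>2. bending_deformation n \<rho> \<sigma> \<and> k \<ge> 1 \<and> l \<ge> 1 \<and> k + l = n \<and>
          is_concatenation k l i \<rho>1 \<rho>2 \<sigma>)"

definition faithful_rep :: "nat \<Rightarrow> H_rep \<Rightarrow> bool" where
  "faithful_rep n \<rho> \<longleftrightarrow> inj_on \<rho> (carrier (H_group n))"

definition discrete_rep :: "nat \<Rightarrow> H_rep \<Rightarrow> bool" where
  "discrete_rep n \<rho> \<longleftrightarrow> subgroup (\<rho> ` carrier (H_group n)) PU11 \<and>
     discrete_in PU11_topology (\<rho> ` carrier (H_group n))"

end

theory Submission
  imports Defs
begin

text \<open>
  A point \<open>q\<close> of the disc is a unit vector of Minkowski space, and \<open>R\<^sup>q\<close> lifts to a linear map of \<open>\<real>\<^sup>2 = \<complex>\<close>.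
  Applying the reflections \<open>R\<^sub>1, \<dots>, R\<^sub>n\<close> of a tuple with \<open>R\<^sub>n \<dots> R\<^sub>1 = \<plusminus>1\<close> one after the other turns every vector
  by the same total angle, a multiple of \<open>\<pi>\<close> that is invariant under bendings. Being basic, and being
  discrete and faithful, both amount to this angle being \<open>2\<pi>\<close> for the tuple or for its mirror image.

  If the angle is \<open>2\<pi>\<close>, then there is no concatenation, because the angle is additive, is at least \<open>\<pi>\<close>, and is at
  least \<open>2\<pi>\<close> if there are three or more points; and the images of an eigenvector of \<open>R\<^sub>2R\<^sub>1\<close> cut the projective
  line into arcs on which a ping-pong argument applies, so the representation is discrete and faithful.

  Conversely, suppose that for all tuples obtained by braid moves \<open>(p, q) \<mapsto> (q, R\<^sup>q p)\<close>, which are bendings, the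
  third and the fourth of four consecutive points lie strictly on the same side of the line through the first
  two. Then all triples of points of the tuple are equally oriented, and braid moves that push points to
  infinity show that the angle is \<open>2\<pi>\<close>. A basic representation satisfies this condition, because otherwise two
  bendings bring the two middle points together, and two equal neighbours split off. A discrete and
  faithful representation satisfies it by comparison with the regular tuple, whose group is cocompact: the
  isomorphism of the two groups is a coarse equivalence and therefore preserves the sides of a line through
  two neighbouring points at a large distance from it. The two ends of the orbit of the third point under the
  product of the reflections in the third and the fourth point lie on the same side for the regular tuple,
  and would lie on different sides if the condition failed.
\<close>

text \<open>The lift to the plane is chosen because \<open>z \<mapsto> om z (rf u z)\<close> is
  positive definite for every point \<open>u\<close>: all reflections turn all vectors
  counterclockwise, so angles only add up, and closed tuples can be compared by counting multiples
  of \<pi>. The invariant is a form of the Euler number. In the mirror image every angle is replaced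
  by its complement to \<pi>, so the two cases of the criterion are its two extreme values. The
  converse has two obstacles. The orientation condition has to be local, so that one failure can be
  repaired by two bendings, and yet has to control all triples; this is why it is demanded for all
  tuples reached by braid moves. And being discrete and faithful has to survive braid moves, which
  change the generators. Both properties are therefore merged into one condition on words,
  \<open>isolated_id\<close>, and the facts about the abstract group are read off from the regular
  tuple, for which the ping-pong argument has already shown that its representation is faithful. The
  ping-pong argument thus serves both directions.\<close>

section \<open>The hyperboloid model and the spinor action\<close>

text \<open>A point of the hyperbolic plane is a future unit vector \<open>u\<close> for the Minkowski form \<open>mk\<close>. Its reflection acts on
  vectors by \<open>hrefl u\<close> and on \<open>\<complex>\<close>, seen as the vectors \<open>(z, cnj z)\<close> of \<open>\<complex>\<^sup>2\<close>, by \<open>rf u\<close>. The map \<open>nullv\<close> onto the future light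
  cone, two-to-one away from \<open>0\<close>, intertwines the two actions. The determinant \<open>tri p q r\<close> is the signed distance of \<open>r\<close> from the line
  through \<open>p\<close> and \<open>q\<close>, up to monotone rescaling.\<close>

type_synonym mvec = "real \<times> complex"

definition mk :: "mvec \<Rightarrow> mvec \<Rightarrow> real" where
  "mk u v = fst u * fst v - Re (snd u) * Re (snd v) - Im (snd u) * Im (snd v)"

definition tri :: "mvec \<Rightarrow> mvec \<Rightarrow> mvec \<Rightarrow> real" where
  "tri u v w =
     fst u * (Re (snd v) * Im (snd w) - Im (snd v) * Re (snd w))
   - Re (snd u) * (fst v * Im (snd w) - Im (snd v) * fst w)
   + Im (snd u) * (fst v * Re (snd w) - Re (snd v) * fst w)"

definition hyp :: "mvec set" where
  "hyp = {u. mk u u = 1 \<and> fst u > 0}"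

definition hrefl :: "mvec \<Rightarrow> mvec \<Rightarrow> mvec" where
  "hrefl p v = (2 * mk p v) *\<^sub>R p - v"

definition rf :: "mvec \<Rightarrow> complex \<Rightarrow> complex" where
  "rf u z = \<i> * (of_real (fst u) * z - snd u * cnj z)"

definition om :: "complex \<Rightarrow> complex \<Rightarrow> real" where
  "om z w = Re z * Im w - Im z * Re w"

definition nullv :: "complex \<Rightarrow> mvec" where
  "nullv z = ((Re z)\<^sup>2 + (Im z)\<^sup>2, z\<^sup>2)"

lemma mvec_eq_iff: "u = v \<longleftrightarrow> fst u = fst v \<and> Re (snd u) = Re (snd v) \<and> Im (snd u) = Im (snd v)" for u v :: mvec
  by (auto simp: prod_eq_iff complex_eq_iff)

lemma mk_sym: "mk u v = mk v u"
  by (simp add: mk_def)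

lemma mk_simps [simp]:
  "mk (u + v) w = mk u w + mk v w" "mk w (u + v) = mk w u + mk w v"
  "mk (u - v) w = mk u w - mk v w" "mk w (u - v) = mk w u - mk w v"
  "mk (r *\<^sub>R u) w = r * mk u w" "mk w (r *\<^sub>R u) = r * mk w u"
  "mk (- u) w = - mk u w" "mk w (- u) = - mk w u"
  "mk 0 w = 0" "mk w 0 = 0"
  by (simp_all add: mk_def algebra_simps)

lemma tri_simps [simp]:
  "tri (u + v) w x = tri u w x + tri v w x" "tri w (u + v) x = tri w u x + tri w v x"
  "tri w x (u + v) = tri w x u + tri w x v"
  "tri (u - v) w x = tri u w x - tri v w x" "tri w (u - v) x = tri w u x - tri w v x"
  "tri w x (u - v) = tri w x u - tri w x v"
  "tri (r *\<^sub>R u) w x = r * tri u w x" "tri w (r *\<^sub>R u) x = r * tri w u x"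
  "tri w x (r *\<^sub>R u) = r * tri w x u"
  "tri (- u) w x = - tri u w x" "tri w (- u) x = - tri w u x" "tri w x (- u) = - tri w x u"
  by (simp_all add: tri_def algebra_simps)

lemma tri_same [simp]: "tri u u v = 0" "tri u v u = 0" "tri v u u = 0"
  by (simp_all add: tri_def algebra_simps)

lemma tri_swap: "tri v u w = - tri u v w" "tri u w v = - tri u v w"
  by (simp_all add: tri_def algebra_simps)

lemma rf_simps [simp]:
  "rf u (z + w) = rf u z + rf u w" "rf u (z - w) = rf u z - rf u w"
  "rf u (r *\<^sub>R z) = r *\<^sub>R rf u z" "rf u (- z) = - rf u z" "rf u 0 = 0"
  by (simp_all add: rf_def algebra_simps scaleR_conv_of_real)

lemma om_simps [simp]:
  "om (u + v) w = om u w + om v w" "om w (u + v) = om w u + om w v"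
  "om (u - v) w = om u w - om v w" "om w (u - v) = om w u - om w v"
  "om (r *\<^sub>R u) w = r * om u w" "om w (r *\<^sub>R u) = r * om w u"
  "om (- u) w = - om u w" "om w (- u) = - om w u"
  "om 0 w = 0" "om w 0 = 0" "om u u = 0"
  by (simp_all add: om_def algebra_simps)

lemma om_swap: "om w z = - om z w"
  by (simp add: om_def)

lemma Re_rf: "Re (rf u z) = - (fst u * Im z - Im (snd u) * Re z + Re (snd u) * Im z)"
  and Im_rf: "Im (rf u z) = fst u * Re z - Re (snd u) * Re z - Im (snd u) * Im z"
  by (simp_all add: rf_def algebra_simps)

lemma om_rf_rf: "om (rf u z) (rf u w) = mk u u * om z w"
  by (simp add: om_def Re_rf Im_rf mk_def algebra_simps)

lemma rf_rf: "rf u (rf u z) = - (mk u u *\<^sub>R z)"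
  by (simp add: complex_eq_iff Re_rf Im_rf mk_def algebra_simps)

text \<open>For \<open>u\<close> in \<open>hyp\<close> the right hand side is positive on nonzero
  vectors (\<open>mk_nullv_pos\<close>): this is why a reflection turns every vector
  counterclockwise by less than \<pi>.\<close>

lemma om_rf_nullv: "om z (rf u z) = mk u (nullv z)"
  by (simp add: om_def Re_rf Im_rf mk_def nullv_def power2_eq_square algebra_simps)

lemma nullv_rf: "mk p p = 1 \<Longrightarrow> nullv (rf p z) = hrefl p (nullv z)"
  unfolding mvec_eq_iff hrefl_def mk_def nullv_def
  by (simp add: Re_rf Im_rf power2_eq_square) algebra

lemma mk_nullv: "mk (nullv a) (nullv b) = 2 * (om a b)\<^sup>2"
  by (simp add: mk_def nullv_def om_def power2_eq_square algebra_simps)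

text \<open>Translates the side of a line between two ideal points into the sign of
  \<open>om\<close>; \<open>om_pos\<close> uses it to advance by one reflection.\<close>

lemma tri_nullv: "tri (nullv a) (nullv b) p = 2 * om a b * om a (rf p b)"
  by (simp add: tri_def nullv_def om_def Re_rf Im_rf power2_eq_square algebra_simps)

text \<open>The reflection in an image point is a conjugate; the sign appears because the inverse of
  \<open>rf p\<close> is \<open>- rf p\<close>.\<close>

lemma rf_refl: "mk p p = 1 \<Longrightarrow> rf (hrefl p v) z = - rf p (rf v (rf p z))"
  unfolding complex_eq_iff Re_rf Im_rf hrefl_def mk_def
  by (simp add: Re_rf Im_rf) algebra

lemma hrefl_refl: "mk p p = 1 \<Longrightarrow> hrefl p (hrefl p v) = v"
  by (simp add: hrefl_def algebra_simps)

lemma mk_refl: "mk p p = 1 \<Longrightarrow> mk (hrefl p u) (hrefl p v) = mk u v"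
  by (simp add: hrefl_def algebra_simps mk_sym)

lemma mk_refl_left: "mk (hrefl p u) v = mk u (hrefl p v)"
  by (simp add: hrefl_def algebra_simps mk_sym)

lemma hrefl_simps [simp]:
  "hrefl p (u + v) = hrefl p u + hrefl p v" "hrefl p (u - v) = hrefl p u - hrefl p v"
  "hrefl p (r *\<^sub>R u) = r *\<^sub>R hrefl p u" "hrefl p (- u) = - hrefl p u" "hrefl p 0 = 0"
  by (simp_all add: hrefl_def algebra_simps)

lemma hrefl_self: "mk p p = 1 \<Longrightarrow> hrefl p p = p"
  by (simp add: hrefl_def) (metis add_diff_cancel_left' scaleR_2)

text \<open>The Gram determinant, with sign + because the form has two negative directions. That the
  left hand side is a square is the source of the distance estimates below.\<close>

lemma gram: "(tri y z n)\<^sup>2 = mk y y * mk z z * mk n n + 2 * mk y z * mk y n * mk z n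
   - mk y y * (mk z n)\<^sup>2 - mk z z * (mk y n)\<^sup>2 - mk n n * (mk y z)\<^sup>2"
  unfolding tri_def mk_def by algebra

text \<open>Cramer's relation for four vectors of a three-dimensional space. Pairing it with a
  suitable vector, as in \<open>no_zigzag\<close> and \<open>om_pos\<close>, yields scalar
  relations.\<close>

lemma cramer4: "tri v w x *\<^sub>R u - tri u w x *\<^sub>R v + tri u v x *\<^sub>R w - tri u v w *\<^sub>R x = 0"
  unfolding mvec_eq_iff tri_def by (simp add: algebra_simps)

definition om3 where "om3 p q r z = rf r (rf q (rf p z))"

text \<open>Cayley-Hamilton for a map of determinant 1 and trace \<open>- 2 * tri p q r\<close>. The
  product of three reflections thus squares to -1 if the points are collinear, which makes
  collinearity visible in the group.\<close>

lemma om3_square: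
  assumes "mk p p = 1" "mk q q = 1" "mk r r = 1"
  shows "om3 p q r (om3 p q r z) = - z - (2 * tri p q r) *\<^sub>R om3 p q r z"
  using assms unfolding om3_def complex_eq_iff mk_def tri_def
  apply (simp add: Re_rf Im_rf)
  apply (intro conjI)
  subgoal by algebra
  subgoal by algebra
  done

section \<open>Points of the hyperboloid and the light cone\<close>

lemma hypD: "u \<in> hyp \<Longrightarrow> mk u u = 1" "u \<in> hyp \<Longrightarrow> fst u > 0"
  by (auto simp: hyp_def)

text \<open>The reversed Cauchy-Schwarz inequality; \<open>mk u v\<close> is the hyperbolic cosine
  of the distance. The defect is a sum of three squares, which also settles the equality case in
  \<open>mk_eq_1\<close>.\<close>

lemma mk_ge_1: assumes "u \<in> hyp" "v \<in> hyp" shows "mk u v \<ge> 1"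
proof -
  define a b where "a = fst u" "b = fst v"
  define x y x' y' where "x = Re (snd u)" "y = Im (snd u)" "x' = Re (snd v)" "y' = Im (snd v)"
  note d = a_b_def x_y_x'_y'_def
  have *: "a\<^sup>2 = 1 + x\<^sup>2 + y\<^sup>2" "b\<^sup>2 = 1 + x'\<^sup>2 + y'\<^sup>2" "a > 0" "b > 0"
    using assms by (auto simp: hyp_def mk_def d power2_eq_square)
  define c where "c = x * x' + y * y'"
  have "(a * b)\<^sup>2 - (1 + c)\<^sup>2 = (x - x')\<^sup>2 + (y - y')\<^sup>2 + (x * y' - y * x')\<^sup>2"
    unfolding power_mult_distrib * c_def by (simp add: power2_eq_square algebra_simps)
  then have "(1 + c)\<^sup>2 \<le> (a * b)\<^sup>2" by (metis diff_ge_0_iff_ge sum_power2_ge_zero add_nonneg_nonneg zero_le_power2)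
  then have "1 + c \<le> a * b" using * by (meson less_eq_real_def mult_pos_pos power2_le_imp_le)
  then show ?thesis by (simp add: mk_def d c_def)
qed

lemma mk_eq_1: assumes "u \<in> hyp" "v \<in> hyp" "mk u v = 1" shows "u = v"
proof -
  define a b where "a = fst u" "b = fst v"
  define x y x' y' where "x = Re (snd u)" "y = Im (snd u)" "x' = Re (snd v)" "y' = Im (snd v)"
  note d = a_b_def x_y_x'_y'_def
  have *: "a\<^sup>2 = 1 + x\<^sup>2 + y\<^sup>2" "b\<^sup>2 = 1 + x'\<^sup>2 + y'\<^sup>2" "a > 0" "b > 0"
    using assms by (auto simp: hyp_def mk_def d power2_eq_square)
  define c where "c = x * x' + y * y'"
  have ab: "a * b = 1 + c" using assms(3) by (simp add: mk_def d c_def)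
  have "(a * b)\<^sup>2 - (1 + c)\<^sup>2 = (x - x')\<^sup>2 + (y - y')\<^sup>2 + (x * y' - y * x')\<^sup>2"
    unfolding power_mult_distrib * c_def by (simp add: power2_eq_square algebra_simps)
  then have "(x - x')\<^sup>2 + (y - y')\<^sup>2 + (x * y' - y * x')\<^sup>2 = 0" by (simp add: ab)
  then have xy: "x = x'" "y = y'"
    by (smt (verit) eq_iff_diff_eq_0 power2_eq_iff zero_le_power2 zero_eq_power2)+
  then have "a\<^sup>2 = b\<^sup>2" using * by simp
  then have "a = b" using *(3,4) by (simp only: power2_eq_iff) linarith
  with xy show ?thesis by (simp add: mvec_eq_iff d)
qed

text \<open>The same identity with the strictly positive remainder
  \<open>(r\<^sup>2 + s\<^sup>2)\<^sup>2\<close>, which is due to \<open>u\<close> being timelike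
  and not null.\<close>

lemma mk_nullv_pos: assumes "u \<in> hyp" "z \<noteq> 0" shows "mk u (nullv z) > 0"
proof -
  define a x y where "a = fst u" "x = Re (snd u)" "y = Im (snd u)"
  note d = a_x_y_def
  have a: "a > 0" "a\<^sup>2 = 1 + x\<^sup>2 + y\<^sup>2"
    using assms by (auto simp: hyp_def mk_def d power2_eq_square)
  define r s where "r = Re z" "s = Im z"
  have rs: "r\<^sup>2 + s\<^sup>2 > 0" using assms(2) by (simp add: r_s_def complex_eq_iff sum_power2_gt_zero_iff)
  have eq: "mk u (nullv z) = a * (r\<^sup>2 + s\<^sup>2) - x * (r\<^sup>2 - s\<^sup>2) - y * (2 * r * s)"
    by (simp add: mk_def nullv_def d r_s_def power2_eq_square)
  define t where "t = x * (r\<^sup>2 - s\<^sup>2) + y * (2 * r * s)"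
  have "(a * (r\<^sup>2 + s\<^sup>2))\<^sup>2 - t\<^sup>2 = (r\<^sup>2 + s\<^sup>2)\<^sup>2 + (x * (2 * r * s) - y * (r\<^sup>2 - s\<^sup>2))\<^sup>2"
    unfolding power_mult_distrib a t_def by (simp add: power2_eq_square algebra_simps)
  moreover have "(r\<^sup>2 + s\<^sup>2)\<^sup>2 > 0" using rs by (rule zero_less_power)
  ultimately have "t\<^sup>2 < (a * (r\<^sup>2 + s\<^sup>2))\<^sup>2" by (smt (verit) zero_le_power2)
  moreover have "a * (r\<^sup>2 + s\<^sup>2) \<ge> 0" using a rs by simp
  ultimately have "t < a * (r\<^sup>2 + s\<^sup>2)" by (rule power2_less_imp_less)
  then show ?thesis by (simp add: eq t_def)
qed

lemma om_rf_pos: "u \<in> hyp \<Longrightarrow> z \<noteq> 0 \<Longrightarrow> om z (rf u z) > 0"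
  by (simp add: om_rf_nullv mk_nullv_pos)

text \<open>The image is a unit vector and lies on one of the two sheets; the past sheet is excluded
  because the pairing with the fixed point \<open>p\<close> is preserved.\<close>

lemma hrefl_hyp: assumes "p \<in> hyp" "q \<in> hyp" shows "hrefl p q \<in> hyp"
proof -
  define w where "w = hrefl p q"
  have w: "mk w w = 1" "mk p w = mk p q"
    using assms mk_refl[of p p q] by (auto simp: w_def mk_refl hypD hrefl_self)
  have "fst w \<noteq> 0"
  proof
    assume "fst w = 0"
    then have "- (Re (snd w))\<^sup>2 - (Im (snd w))\<^sup>2 = 1" using w(1) by (simp add: mk_def power2_eq_square)
    then show False by (smt (verit) zero_le_power2)
  qed
  moreover have "\<not> fst w < 0"
  proof
    assume "fst w < 0"
    then have "- w \<in> hyp" using w by (simp add: hyp_def)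
    then have "mk p (- w) \<ge> 1" using assms mk_ge_1 by blast
    with w mk_ge_1[OF assms] show False by simp
  qed
  ultimately show ?thesis using w by (simp add: hyp_def w_def[symmetric])
qed

lemma rf_nonzero: "u \<in> hyp \<Longrightarrow> z \<noteq> 0 \<Longrightarrow> rf u z \<noteq> 0"
  using om_rf_pos[of u z] by force

lemma rf_rf_hyp: "u \<in> hyp \<Longrightarrow> rf u (rf u z) = - z"
  by (simp add: rf_rf hypD)

lemma om_rf_hyp: "u \<in> hyp \<Longrightarrow> om (rf u z) (rf u w) = om z w"
  by (simp add: om_rf_rf hypD)

lemma om_eq_0_iff: assumes "z \<noteq> 0" shows "om z w = 0 \<longleftrightarrow> (\<exists>r. w = r *\<^sub>R z)"
proof
  assume 0: "om z w = 0"
  have n: "(Re z)\<^sup>2 + (Im z)\<^sup>2 \<noteq> 0" using assms by (simp add: complex_eq_iff sum_power2_eq_zero_iff)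
  define r where "r = (Re z * Re w + Im z * Im w) / ((Re z)\<^sup>2 + (Im z)\<^sup>2)"
  have "((Re z)\<^sup>2 + (Im z)\<^sup>2) *\<^sub>R w = (Re z * Re w + Im z * Im w) *\<^sub>R z"
    using 0 unfolding complex_eq_iff om_def by (simp add: power2_eq_square) algebra
  then have "((Re z)\<^sup>2 + (Im z)\<^sup>2) *\<^sub>R w = ((Re z)\<^sup>2 + (Im z)\<^sup>2) *\<^sub>R (r *\<^sub>R z)"
    using n by (simp add: r_def)
  then have "w = r *\<^sub>R z" using n by (metis scaleR_left_imp_eq)
  then show "\<exists>r. w = r *\<^sub>R z" ..
qed auto

lemma nullv_eqD: assumes "nullv z = nullv w" shows "z = w \<or> z = - w"
  using assms by (simp add: nullv_def power2_eq_iff)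

lemma nullv_scale: "nullv (r *\<^sub>R z) = r\<^sup>2 *\<^sub>R nullv z" "nullv (- z) = nullv z"
  by (simp_all add: nullv_def power2_eq_square scaleR_conv_of_real algebra_simps)

lemma nullv_surj: assumes "mk E E = 0" "fst E \<ge> 0" obtains z where "E = nullv z"
proof -
  define z where "z = csqrt (snd E)"
  have z2: "z\<^sup>2 = snd E" by (simp add: z_def)
  have "(fst E)\<^sup>2 = (cmod (snd E))\<^sup>2" using assms(1) by (simp only: mk_def cmod_power2) (simp add: power2_eq_square)
  then have "fst E = cmod (snd E)" using assms(2) by simp
  also have "\<dots> = (cmod z)\<^sup>2" by (simp add: z2[symmetric] norm_power)
  finally have "E = nullv z" by (simp add: nullv_def z2 prod_eq_iff cmod_power2)
  then show ?thesis using that by blast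
qed

section \<open>Rotation numbers of closed tuples of points\<close>

primrec run :: "mvec list \<Rightarrow> complex \<Rightarrow> complex" where
  "run [] z = z"
| "run (q # qs) z = run qs (rf q z)"

text \<open>No \<open>Arg\<close> vanishes here: a reflection turns every vector by an angle strictly between \<open>0\<close> and \<open>\<pi>\<close>.\<close>

primrec turning :: "mvec list \<Rightarrow> complex \<Rightarrow> real" where
  "turning [] z = 0"
| "turning (q # qs) z = Arg (rf q z / z) + turning qs (rf q z)"

text \<open>Both signs are allowed because the relation is imposed in \<open>PU(1,1)\<close>, while
  \<open>run\<close> is the action of a lift to \<open>SU(1,1)\<close>.\<close>

definition closing :: "mvec list \<Rightarrow> bool" where
  "closing qs \<longleftrightarrow> set qs \<subseteq> hyp \<and> ((\<forall>z. run qs z = z) \<or> (\<forall>z. run qs z = - z))"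

lemma run_append [simp]: "run (a @ b) z = run b (run a z)"
  by (induction a arbitrary: z) auto

lemma turning_append [simp]: "turning (a @ b) z = turning a z + turning b (run a z)"
  by (induction a arbitrary: z) auto

lemma run_simps [simp]:
  "run qs (z + w) = run qs z + run qs w" "run qs (r *\<^sub>R z) = r *\<^sub>R run qs z" "run qs (- z) = - run qs z" "run qs 0 = 0"
  by (induction qs arbitrary: z w) auto

lemma rf_eq_0_iff: "q \<in> hyp \<Longrightarrow> rf q z = 0 \<longleftrightarrow> z = 0"
  by (metis rf_nonzero rf_simps(5))

lemma turning_minus [simp]: "turning qs (- z) = turning qs z"
  by (induction qs arbitrary: z) auto

lemma run_nonzero: "set qs \<subseteq> hyp \<Longrightarrow> z \<noteq> 0 \<Longrightarrow> run qs z \<noteq> 0"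
  by (induction qs arbitrary: z) (auto simp: rf_nonzero)

lemma Im_rf_div_pos: assumes "q \<in> hyp" "z \<noteq> 0" shows "Im (rf q z / z) > 0"
proof -
  have "Im (rf q z / z) = om z (rf q z) / ((Re z)\<^sup>2 + (Im z)\<^sup>2)"
    by (simp add: Im_divide om_def algebra_simps)
  moreover have "(Re z)\<^sup>2 + (Im z)\<^sup>2 > 0"
    using assms(2) by (simp add: complex_eq_iff sum_power2_gt_zero_iff)
  ultimately show ?thesis using om_rf_pos[OF assms] by simp
qed

lemma Arg_rf: assumes "q \<in> hyp" "z \<noteq> 0" shows "0 < Arg (rf q z / z)" "Arg (rf q z / z) < pi"
  using Im_rf_div_pos[OF assms] Arg_lt_pi by blast+

lemma turning_pos: "set qs \<subseteq> hyp \<Longrightarrow> z \<noteq> 0 \<Longrightarrow> qs \<noteq> [] \<Longrightarrow> turning qs z > 0"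
proof (induction qs arbitrary: z)
  case (Cons q qs)
  then have "Arg (rf q z / z) > 0" "rf q z \<noteq> 0" by (auto simp: Arg_rf rf_nonzero)
  then show ?case using Cons by (cases "qs = []") (auto intro: add_pos_pos)
qed simp

text \<open>\<open>turning\<close> determines the argument of \<open>run qs z / z\<close> together
  with the number of full turns, which the quotient alone forgets.\<close>

lemma run_polar: "set qs \<subseteq> hyp \<Longrightarrow> z \<noteq> 0 \<Longrightarrow> \<exists>r>0. run qs z = of_real r * cis (turning qs z) * z"
proof (induction qs arbitrary: z)
  case Nil
  then show ?case by (intro exI[of _ 1]) simp
next
  case (Cons q qs)
  let ?w = "rf q z"
  have w: "?w \<noteq> 0" "q \<in> hyp" using Cons by (auto simp: rf_nonzero)
  obtain r where r: "r > 0" "run qs ?w = of_real r * cis (turning qs ?w) * ?w"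
    using Cons.IH[of ?w] Cons.prems w by auto
  define a where "a = ?w / z"
  have a: "?w = a * z" "a \<noteq> 0" using w Cons.prems by (auto simp: a_def)
  have pol: "a = of_real (cmod a) * cis (Arg a)"
    using Arg_eq[OF a(2)] by (simp add: cis_conv_exp mult.commute)
  have "run qs ?w = of_real r * cis (turning qs ?w) * (of_real (cmod a) * cis (Arg a)) * z"
    unfolding pol[symmetric] using r(2) a(1) by (simp only: mult.assoc)
  also have "\<dots> = of_real (r * cmod a) * cis (turning (q # qs) z) * z"
    by (simp add: cis_mult[symmetric] a_def)
  finally have "run (q # qs) z = of_real (r * cmod a) * cis (turning (q # qs) z) * z" by simp
  moreover have "r * cmod a > 0" using r a by simp
  ultimately show ?case by blast
qed

lemma run_real_turning:
  assumes "set qs \<subseteq> hyp" "z \<noteq> 0" "run qs z = c *\<^sub>R z"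
  obtains k :: int where "turning qs z = k * pi" "c > 0 \<longleftrightarrow> even k" "c \<noteq> 0"
proof -
  obtain r where r: "r > 0" "run qs z = of_real r * cis (turning qs z) * z"
    using run_polar[OF assms(1,2)] by auto
  then have "of_real r * cis (turning qs z) = of_real c" using assms by (simp add: scaleR_conv_of_real)
  then have *: "r * sin (turning qs z) = 0" "r * cos (turning qs z) = c"
    by (simp_all add: complex_eq_iff)
  then have "sin (turning qs z) = 0" using r by simp
  then obtain k :: int where k: "turning qs z = k * pi" by (auto simp: sin_zero_iff_int2)
  have "cos (turning qs z) = (if even k then 1 else -1)"
  proof (cases "even k")
    case True
    then obtain m where "k = 2 * m" by blast
    then show ?thesis using True k cos_int_2pin[of m] by (simp add: mult_ac)
  next
    case False
    then obtain m where "k = 2 * m + 1" by (metis oddE)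
    then have "turning qs z = 2 * pi * of_int m + pi" using k by (simp add: algebra_simps)
    then show ?thesis using False cos_int_2pin[of m] by simp
  qed
  then show ?thesis using that[OF k] r * by (auto split: if_splits)
qed

lemma closing_sign:
  assumes "closing qs" shows "\<exists>c. (c = 1 \<or> c = (-1::real)) \<and> (\<forall>z. run qs z = c *\<^sub>R z)"
  using assms unfolding closing_def by (metis scaleR_minus1_left scaleR_one)

lemma closing_turning:
  assumes "closing qs" "z \<noteq> 0" shows "\<exists>k::int. turning qs z = k * pi"
proof -
  obtain c where "\<And>z. run qs z = c *\<^sub>R z" using closing_sign[OF assms(1)] by metis
  then show ?thesis using run_real_turning[of qs z c] assms by (metis closing_def)
qed

lemma continuous_on_rf [continuous_intros]: "continuous_on S f \<Longrightarrow> continuous_on S (\<lambda>x. rf q (f x))"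
  unfolding rf_def by (intro continuous_intros)

lemma continuous_on_turning: "set qs \<subseteq> hyp \<Longrightarrow> continuous_on (- {0}) (turning qs)"
proof (induction qs)
  case (Cons q qs)
  have q: "q \<in> hyp" using Cons by simp
  have "continuous_on (- {0}) (\<lambda>x. turning qs (rf q x))"
    by (rule continuous_on_compose2[where t = "- {0}", OF _ continuous_on_rf[OF continuous_on_id]])
      (use Cons q in \<open>auto simp: rf_eq_0_iff\<close>)
  moreover have "continuous_on (- {0}) (\<lambda>x. Arg (rf q x / x))"
  proof (rule continuous_on_compose2[where g = Arg and t = "- \<real>\<^sub>\<le>\<^sub>0"])
    show "continuous_on (- \<real>\<^sub>\<le>\<^sub>0) Arg"
      by (simp add: continuous_at_imp_continuous_on continuous_at_Arg)
    show "continuous_on (- {0}) (\<lambda>x. rf q x / x)" by (intro continuous_intros) auto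
    show "(\<lambda>x. rf q x / x) ` (- {0}) \<subseteq> - \<real>\<^sub>\<le>\<^sub>0"
      using Im_rf_div_pos[OF q] by (force simp: complex_nonpos_Reals_iff)
  qed
  ultimately show ?case by (simp add: continuous_on_add)
qed simp

text \<open>The punctured plane is connected, \<open>turning\<close> is continuous there, and its
  values are multiples of \<pi>, hence at least \<pi> apart when distinct.\<close>

lemma closing_turning_const:
  assumes "closing qs" "z \<noteq> 0" "w \<noteq> 0" shows "turning qs z = turning qs w"
proof -
  have sub: "set qs \<subseteq> hyp" using assms by (simp add: closing_def)
  have "connected (- {0::complex})" by (rule connected_punctured_universe) simp
  moreover have "\<exists>e>0. \<forall>y. y \<in> - {0} \<and> turning qs y \<noteq> turning qs x \<longrightarrow> e \<le> norm (turning qs y - turning qs x)"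
    if "x \<in> - {0}" for x
  proof (intro exI[of _ pi] conjI allI impI)
    fix y assume y: "y \<in> - {0} \<and> turning qs y \<noteq> turning qs x"
    then obtain k l :: int where kl: "turning qs x = k * pi" "turning qs y = l * pi"
      using closing_turning[OF assms(1)] \<open>x \<in> - {0}\<close> by (metis ComplD singletonI)
    with y have "l \<noteq> k" by auto
    then have "\<bar>real_of_int (l - k)\<bar> \<ge> 1" by linarith
    then show "pi \<le> norm (turning qs y - turning qs x)"
      unfolding kl by (simp add: left_diff_distrib[symmetric] abs_mult)
  qed simp
  ultimately have "turning qs constant_on - {0}"
    using continuous_discrete_range_constant[of "- {0}" "turning qs"] continuous_on_turning[OF sub] by blast
  then show ?thesis using assms by (auto simp: constant_on_def)
qed

lemma closing_turning_ge:
  assumes "closing qs" "z \<noteq> 0" "turning qs z > real k * pi" shows "turning qs z \<ge> (real k + 1) * pi"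
proof -
  obtain l :: int where l: "turning qs z = l * pi" using closing_turning assms by blast
  with assms(3) have "real_of_int l > real k" by simp
  then have "l > int k" by (metis of_int_less_iff of_int_of_nat_eq)
  then have "real_of_int l \<ge> real k + 1" by linarith
  then show ?thesis unfolding l by (simp add: mult_right_mono)
qed

section \<open>Products of two reflections and lower bounds for the rotation number\<close>

lemma turning_pair_bounds:
  assumes "p \<in> hyp" "q \<in> hyp" "z \<noteq> 0" shows "0 < turning [p, q] z" "turning [p, q] z < 2 * pi"
  using Arg_rf[of p z] Arg_rf[of q "rf p z"] assms by (auto simp: rf_nonzero)

text \<open>The only multiple of \<pi> strictly between 0 and 2\<pi> is \<pi> itself, and a half
  turn means a negative eigenvalue.\<close>

lemma turning_pair_eigen:
  assumes "p \<in> hyp" "q \<in> hyp" "z \<noteq> 0" "run [p, q] z = c *\<^sub>R z" shows "turning [p, q] z = pi" "c < 0"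
proof -
  obtain k :: int where k: "turning [p, q] z = k * pi" "c > 0 \<longleftrightarrow> even k" "c \<noteq> 0"
    using run_real_turning[of "[p, q]" z c] assms by auto
  have "0 < real_of_int k * pi" "real_of_int k * pi < 2 * pi"
    using turning_pair_bounds[OF assms(1-3)] k(1) by auto
  then have "0 < k" "k < 2" by (auto simp: zero_less_mult_iff)
  then have "k = 1" by simp
  with k show "turning [p, q] z = pi" "c < 0" by auto
qed

text \<open>\<open>l\<close> is the exponential of the distance, and \<open>nullv u\<close>
  represents the end of the line on the side of \<open>q\<close>, the attracting fixed point of the
  product. The light cone determines the eigenvalue up to sign only;
  \<open>turning_pair_eigen\<close> selects the negative one.\<close>

lemma eigen_pair:
  assumes "p \<in> hyp" "q \<in> hyp" "p \<noteq> q"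
  obtains l u where "l > 1" "u \<noteq> 0" "nullv u = q - (1 / l) *\<^sub>R p" "run [p, q] u = - (l *\<^sub>R u)" "l + 1 / l = 2 * mk p q"
proof -
  define x where "x = mk p q"
  have x: "x > 1" using mk_ge_1[OF assms(1,2)] mk_eq_1[OF assms(1,2)] assms(3) by (force simp: x_def)
  define s where "s = sqrt (x\<^sup>2 - 1)"
  have "x\<^sup>2 - 1 \<ge> 0" using x by simp
  then have s: "s * s = x\<^sup>2 - 1" "s \<ge> 0" by (simp_all add: s_def)
  define l where "l = x + s"
  have "l * (x - s) = 1" using s(1) by (simp add: l_def algebra_simps power2_eq_square)
  moreover have "l > 1" using x s by (simp add: l_def)
  ultimately have "1 / l = x - s" by (simp add: field_simps)
  then have l: "l + 1 / l = 2 * x" "l > 1" using \<open>l > 1\<close> by (simp_all add: l_def)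
  have ll: "l * l = 2 * x * l - 1" using l by (simp add: field_simps)
  define E where "E = q - (1 / l) *\<^sub>R p"
  have pp: "mk p p = 1" "mk q q = 1" "mk p q = x" "mk q p = x" using assms by (auto simp: hypD x_def mk_sym)
  have EE: "mk E E = 0"
  proof -
    define m where "m = 1 / l"
    have m: "l * m = 1" "2 * x = l + m" using l by (auto simp: m_def)
    have "mk E E = 1 - m * (2 * x) + m * m" by (simp add: E_def pp m_def[symmetric] algebra_simps)
    also have "\<dots> = 0" unfolding m(2) using m(1) by (simp add: algebra_simps)
    finally show ?thesis .
  qed
  have Ep: "mk p E > 0"
  proof -
    have "mk p E = x - 1 / l" by (simp add: E_def pp)
    moreover have "1 / l < 1" using l by simp
    ultimately show ?thesis using x by linarith
  qed
  \<comment> \<open>If \<open>E\<close> were past directed, its pairing with the point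
    \<open>p\<close> would be negative, against \<open>Ep\<close>.\<close>
  have E0: "fst E \<ge> 0"
  proof (rule ccontr)
    assume "\<not> fst E \<ge> 0"
    then obtain z where z: "- E = nullv z" using nullv_surj[of "- E"] EE by auto
    then have "mk p (nullv z) < 0" using Ep by (metis mk_simps(8) neg_less_0_iff_less)
    moreover have "mk p (nullv z) \<ge> 0" using mk_nullv_pos[OF assms(1), of z] by (cases "z = 0") (auto simp: nullv_def mk_def)
    ultimately show False by simp
  qed
  obtain u where u: "E = nullv u" using nullv_surj[OF EE E0] by blast
  have u0: "u \<noteq> 0" using Ep u by (auto simp: nullv_def mk_def)
  have "nullv (run [p, q] u) = hrefl q (hrefl p E)" using pp by (simp add: nullv_rf u)
  also have "hrefl p E = l *\<^sub>R p - q"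
  proof -
    have "2 * mk p E = l - 1 / l" using l by (simp add: E_def pp algebra_simps)
    then show ?thesis by (simp add: hrefl_def) (simp add: E_def algebra_simps)
  qed
  also have "hrefl q (l *\<^sub>R p - q) = (l * l) *\<^sub>R E"
  proof -
    have *: "2 * mk q (l *\<^sub>R p - q) = l * l - 1" using ll by (simp add: pp)
    have "hrefl q (l *\<^sub>R p - q) = (l * l) *\<^sub>R q - l *\<^sub>R p"
      unfolding hrefl_def * by (simp add: algebra_simps)
    also have "\<dots> = (l * l) *\<^sub>R E" using l by (simp add: E_def algebra_simps)
    finally show ?thesis .
  qed
  also have "\<dots> = nullv (l *\<^sub>R u)" by (simp add: nullv_scale u power2_eq_square)
  finally have "run [p, q] u = l *\<^sub>R u \<or> run [p, q] u = - (l *\<^sub>R u)" using nullv_eqD by blast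
  moreover have "run [p, q] u \<noteq> l *\<^sub>R u" using turning_pair_eigen(2)[OF assms(1,2) u0, of l] l by auto
  ultimately show ?thesis using that[of l u] l u0 u by (auto simp: E_def x_def)
qed

lemma eigen_pair_turning:
  assumes "p \<in> hyp" "q \<in> hyp" obtains u where "u \<noteq> 0" "turning [p, q] u = pi"
proof (cases "p = q")
  case True
  then have "run [p, q] 1 = (-1) *\<^sub>R 1" using assms by (simp add: rf_rf_hyp)
  then show ?thesis using turning_pair_eigen(1)[OF assms, of 1 "-1"] that[of 1] by simp
next
  case False
  obtain l u where "u \<noteq> 0" "run [p, q] u = - (l *\<^sub>R u)" by (rule eigen_pair[OF assms False]) blast
  then show ?thesis using turning_pair_eigen(1)[OF assms, of u "- l"] that[of u] by simp
qed

lemma closing_turning_pi: assumes "closing qs" "qs \<noteq> []" "z \<noteq> 0" shows "turning qs z \<ge> pi"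
  using closing_turning_ge[of qs z 0] turning_pos[of qs z] assms by (auto simp: closing_def)

text \<open>The first two reflections turn one of their eigenvectors by exactly \<pi>, the third
  adds a positive angle, and the next multiple of \<pi> is 2\<pi>.\<close>

lemma closing_turning_2pi:
  assumes "closing qs" "length qs \<ge> 3" "z \<noteq> 0" shows "turning qs z \<ge> 2 * pi"
proof -
  obtain p q r rs where qs: "qs = p # q # r # rs"
    using assms(2) by (metis One_nat_def Suc_le_length_iff numeral_3_eq_3)
  have h: "p \<in> hyp" "q \<in> hyp" "set (r # rs) \<subseteq> hyp" using assms(1) by (auto simp: closing_def qs)
  obtain u where u: "u \<noteq> 0" "turning [p, q] u = pi" by (rule eigen_pair_turning[OF h(1,2)])
  have "qs = [p, q] @ (r # rs)" by (simp add: qs)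
  then have "turning qs u = turning [p, q] u + turning (r # rs) (run [p, q] u)" by (metis turning_append)
  moreover have "turning (r # rs) (run [p, q] u) > 0"
    by (rule turning_pos[OF h(3)]) (use u h in \<open>auto simp: rf_nonzero\<close>)
  ultimately have "turning qs u \<ge> 2 * pi" using closing_turning_ge[OF assms(1) u(1), of 1] u by simp
  then show ?thesis using closing_turning_const[OF assms(1) assms(3) u(1)] by simp
qed

lemma closing_rotate: assumes "closing (a @ b)" shows "closing (b @ a)"
proof -
  obtain c where c: "c = 1 \<or> c = (-1::real)" "\<And>z. run (a @ b) z = c *\<^sub>R z" using closing_sign[OF assms] by metis
  have a: "set a \<subseteq> hyp" using assms by (simp add: closing_def)
  have "\<exists>w. run a w = z" for z
    using a
  proof (induction a arbitrary: z)
    case (Cons q a)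
    then obtain w where "run a w = z" by auto
    moreover have "rf q (- rf q w) = w" using Cons.prems by (simp add: rf_rf_hyp)
    ultimately show ?case by (metis run.simps(2))
  qed simp
  then have "run (b @ a) z = c *\<^sub>R z" for z using c(2) by (metis run_append run_simps(2))
  then show ?thesis using assms c(1) by (auto simp: closing_def)
qed

lemma turning_rotate: assumes "closing (a @ b)" shows "turning (b @ a) (run a z) = turning (a @ b) z"
proof -
  obtain c where c: "c = 1 \<or> c = (-1::real)" "\<And>z. run (a @ b) z = c *\<^sub>R z" using closing_sign[OF assms] by metis
  have "run b (run a z) = z \<or> run b (run a z) = - z" using c(1) c(2)[of z] by auto
  then show ?thesis by auto
qed

section \<open>Mirror images and extremal tuples\<close>

definition mir :: "mvec \<Rightarrow> mvec" where "mir u = (fst u, cnj (snd u))"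

lemma mir_mir [simp]: "mir (mir u) = u" by (simp add: mir_def)
lemma mk_mir [simp]: "mk (mir u) (mir v) = mk u v" by (simp add: mir_def mk_def)
lemma tri_mir [simp]: "tri (mir u) (mir v) (mir w) = - tri u v w" by (simp add: mir_def tri_def algebra_simps)
lemma mir_hyp [simp]: "mir u \<in> hyp \<longleftrightarrow> u \<in> hyp" by (simp add: hyp_def) (simp add: mir_def)
lemma mir_simps: "mir (u + v) = mir u + mir v" "mir (u - v) = mir u - mir v" "mir (r *\<^sub>R u) = r *\<^sub>R mir u"
  by (simp_all add: mir_def prod_eq_iff scaleR_conv_of_real)
lemma mir_hrefl: "mir (hrefl p q) = hrefl (mir p) (mir q)"
  by (simp add: hrefl_def mir_simps)
lemma rf_mir: "rf (mir u) z = - cnj (rf u (cnj z))" by (simp add: rf_def mir_def algebra_simps)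
lemma run_mir: "run (map mir qs) z = (if even (length qs) then cnj (run qs (cnj z)) else - cnj (run qs (cnj z)))"
  by (induction qs arbitrary: z) (simp_all add: rf_mir)

lemma closing_mir [simp]: "closing (map mir qs) \<longleftrightarrow> closing qs"
proof -
  have *: "closing (map mir qs)" if "closing qs" for qs
    using that unfolding closing_def run_mir by (auto)
  show ?thesis using *[of qs] *[of "map mir qs"] by (auto simp: o_def)
qed

text \<open>By \<open>rf_mir\<close> each angle becomes its complement to \<pi> in the mirror image.
  The second alternative thus says that the angle of \<open>qs\<close> itself is
  \<open>length qs - 2\<close> times \<pi>, the largest possible value for three or more points, as
  2\<pi> is the smallest.\<close>

definition extremal :: "mvec list \<Rightarrow> bool" where
  "extremal qs \<longleftrightarrow> closing qs \<and> ((\<forall>z. z \<noteq> 0 \<longrightarrow> turning qs z = 2 * pi) \<or> (\<forall>z. z \<noteq> 0 \<longrightarrow> turning (map mir qs) z = 2 * pi))"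

lemma extremal_iff:
  assumes "closing qs" "z \<noteq> 0" "w \<noteq> 0"
  shows "extremal qs \<longleftrightarrow> turning qs z = 2 * pi \<or> turning (map mir qs) w = 2 * pi"
  using assms closing_turning_const[OF assms(1), of z] closing_turning_const[of "map mir qs" w]
  unfolding extremal_def by (metis closing_mir)

lemma turning_insert:
  assumes "closing ps" shows "turning (a @ ps @ b) z = turning (a @ b) z + turning ps (run a z)"
proof -
  obtain c where c: "c = 1 \<or> c = (-1::real)" "\<And>z. run ps z = c *\<^sub>R z" using closing_sign[OF assms] by metis
  then have "run ps (run a z) = run a z \<or> run ps (run a z) = - run a z" by auto
  then show ?thesis by auto
qed

lemma not_extremal_insert:
  assumes "closing ps" "closing (a @ b)" "ps \<noteq> []" "a @ b \<noteq> []" "length (a @ ps @ b) \<ge> 5"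
  shows "\<not> extremal (a @ ps @ b)"
proof
  have *: "turning (a @ ps @ b) z \<noteq> 2 * pi"
    if "closing ps" "closing (a @ b)" "ps \<noteq> []" "a @ b \<noteq> []" "length (a @ ps @ b) \<ge> 5" "z \<noteq> 0" for ps a b z
  proof -
    have w: "run a z \<noteq> 0" using that by (intro run_nonzero) (auto simp: closing_def)
    have "length ps \<ge> 3 \<or> length (a @ b) \<ge> 3" using that by auto
    then have "turning (a @ b) z + turning ps (run a z) \<ge> 3 * pi"
      using closing_turning_2pi[OF that(1) _ w] closing_turning_2pi[OF that(2) _ that(6)]
        closing_turning_pi[OF that(1,3) w] closing_turning_pi[OF that(2,4,6)] by fastforce
    then have "turning (a @ ps @ b) z \<ge> 3 * pi" unfolding turning_insert[OF that(1)] .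
    then show ?thesis by (smt (verit) pi_gt_zero)
  qed
  assume "extremal (a @ ps @ b)"
  then have "turning (a @ ps @ b) 1 = 2 * pi \<or> turning (map mir a @ map mir ps @ map mir b) 1 = 2 * pi"
    by (auto simp: extremal_def)
  moreover have "turning (a @ ps @ b) 1 \<noteq> 2 * pi" using * assms by simp
  moreover have "turning (map mir a @ map mir ps @ map mir b) 1 \<noteq> 2 * pi"
    using *[of "map mir ps" "map mir a" "map mir b" 1] assms by (simp add: map_append[symmetric] del: map_append)
  ultimately show False by simp
qed

section \<open>Replacing a pair of points by one with the same product\<close>

definition shift :: "mvec \<Rightarrow> mvec \<Rightarrow> mvec \<Rightarrow> mvec \<Rightarrow> bool" where
  "shift p q p' q' \<longleftrightarrow> p \<in> hyp \<and> q \<in> hyp \<and> p' \<in> hyp \<and> q' \<in> hyp \<and> (\<forall>z. run [p', q'] z = run [p, q] z)"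

lemma shift_mir: "shift p q p' q' \<Longrightarrow> shift (mir p) (mir q) (mir p') (mir q')"
  using run_mir[of "[p, q]"] run_mir[of "[p', q']"] by (simp add: shift_def)

lemma shift_closing: "shift p q p' q' \<Longrightarrow> closing (a @ [p, q] @ b) \<longleftrightarrow> closing (a @ [p', q'] @ b)"
  by (auto simp: shift_def closing_def)

text \<open>Equal products turn a vector by angles that agree modulo 2\<pi>, and both angles lie
  strictly between 0 and 2\<pi>.\<close>

lemma shift_turning: assumes "shift p q p' q'" "z \<noteq> 0" shows "turning [p', q'] z = turning [p, q] z"
proof -
  have h: "p \<in> hyp" "q \<in> hyp" "p' \<in> hyp" "q' \<in> hyp" and eq: "run [p', q'] z = run [p, q] z"
    using assms(1) by (auto simp: shift_def)
  obtain r where r: "r > 0" "run [p, q] z = of_real r * cis (turning [p, q] z) * z"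
    using run_polar[of "[p, q]" z] h assms by auto
  obtain s where s: "s > 0" "run [p', q'] z = of_real s * cis (turning [p', q'] z) * z"
    using run_polar[of "[p', q']" z] h assms by auto
  have e: "of_real r * cis (turning [p, q] z) = of_real s * cis (turning [p', q'] z)"
    using r s eq assms(2) by (metis mult_cancel_right)
  then have "cmod (of_real r * cis (turning [p, q] z)) = cmod (of_real s * cis (turning [p', q'] z))" by simp
  then have "r = s" using r s by (simp add: norm_mult)
  then have "cis (turning [p, q] z) = cis (turning [p', q'] z)" using e r by simp
  then have "exp (\<i> * of_real (turning [p, q] z)) = exp (\<i> * of_real (turning [p', q'] z))" by (simp add: cis_conv_exp)
  then obtain k :: int where "\<i> * of_real (turning [p, q] z) = \<i> * of_real (turning [p', q'] z) + (of_int (2 * k) * pi) * \<i>"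
    by (auto simp: exp_eq)
  then have k: "turning [p, q] z = turning [p', q'] z + 2 * k * pi"
    by (simp add: complex_eq_iff)
  have "\<bar>turning [p, q] z - turning [p', q'] z\<bar> < 2 * pi"
    using turning_pair_bounds[OF h(1,2) assms(2)] turning_pair_bounds[OF h(3,4) assms(2)] by linarith
  then have "\<bar>2 * real_of_int k * pi\<bar> < 2 * pi" using k by simp
  then have "\<bar>real_of_int k\<bar> < 1" by (simp add: abs_mult)
  then have "k = 0" by linarith
  with k show ?thesis by simp
qed

lemma shift_extremal:
  assumes "shift p q p' q'" "closing (a @ [p, q] @ b)"
  shows "extremal (a @ [p, q] @ b) \<longleftrightarrow> extremal (a @ [p', q'] @ b)"
proof -
  have *: "turning (a @ [p', q'] @ b) 1 = turning (a @ [p, q] @ b) 1"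
    if s: "shift p q p' q'" and "closing (a @ [p, q] @ b)" for p q p' q' a b
  proof -
    have "run a 1 \<noteq> 0" using that by (intro run_nonzero) (auto simp: closing_def)
    then have "turning [p', q'] (run a 1) = turning [p, q] (run a 1)" by (rule shift_turning[OF s])
    moreover have "run [p', q'] (run a 1) = run [p, q] (run a 1)" using s by (simp add: shift_def)
    ultimately show ?thesis by (simp only: turning_append run_append)
  qed
  have "turning (map mir (a @ [p', q'] @ b)) 1 = turning (map mir (a @ [p, q] @ b)) 1"
    using *[OF shift_mir[OF assms(1)], of "map mir a" "map mir b"] closing_mir[of "a @ [p, q] @ b"] assms(2) by simp
  then show ?thesis
    using *[OF assms] extremal_iff[OF assms(2), of 1 1] extremal_iff[of "a @ [p', q'] @ b" 1 1]
      shift_closing[OF assms(1)] assms(2) by simp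
qed

lemma extremal_rotate: assumes "extremal (a @ b)" shows "extremal (b @ a)"
proof -
  have c: "closing (a @ b)" "closing (b @ a)" using assms closing_rotate by (auto simp: extremal_def)
  have a: "set a \<subseteq> hyp" "set (map mir a) \<subseteq> hyp" using c by (auto simp: closing_def)
  have "turning (b @ a) (run a 1) = turning (a @ b) 1" by (rule turning_rotate[OF c(1)])
  moreover have "turning (map mir b @ map mir a) (run (map mir a) 1) = turning (map mir a @ map mir b) 1"
    by (rule turning_rotate) (use c in \<open>simp add: map_append[symmetric] del: map_append\<close>)
  ultimately show ?thesis
    using assms extremal_iff[OF c(1), of 1 1] extremal_iff[OF c(2), of "run a 1" "run (map mir a) 1"] run_nonzero[OF a(1), of 1] run_nonzero[OF a(2), of 1]
    by (auto simp: add.commute)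
qed

section \<open>The Poincare disc and the hyperboloid\<close>

definition hy :: "complex \<Rightarrow> mvec" where
  "hy q = ((1 + (cmod q)\<^sup>2) / (1 - (cmod q)\<^sup>2), (2 / (1 - (cmod q)\<^sup>2)) *\<^sub>R q)"

text \<open>Stereographic projection of the hyperboloid from \<open>(-1, 0)\<close>, the inverse of
  \<open>hy\<close>.\<close>

definition pdisc :: "mvec \<Rightarrow> complex" where
  "pdisc u = (1 / (1 + fst u)) *\<^sub>R snd u"

lemma disc_norm: "q \<in> poincare_disc \<Longrightarrow> (cmod q)\<^sup>2 < 1"
  by (simp add: poincare_disc_def power_less_one_iff)

lemma hy_hyp: assumes "q \<in> poincare_disc" shows "hy q \<in> hyp"
proof -
  define r where "r = (cmod q)\<^sup>2"
  have r: "r < 1" "r \<ge> 0" using disc_norm[OF assms] by (simp_all add: r_def)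
  have rq: "(Re q)\<^sup>2 + (Im q)\<^sup>2 = r" by (simp add: r_def cmod_power2)
  have "mk (hy q) (hy q) = ((1 + r)\<^sup>2 - 4 * ((Re q)\<^sup>2 + (Im q)\<^sup>2)) / (1 - r)\<^sup>2"
    unfolding mk_def hy_def fst_conv snd_conv r_def[symmetric] scaleR_complex.sel
    using r by (simp add: divide_simps power2_eq_square)
  also have "\<dots> = ((1 - r)\<^sup>2) / (1 - r)\<^sup>2" unfolding rq by (simp add: power2_eq_square algebra_simps)
  also have "\<dots> = 1" using r by simp
  finally show ?thesis using r by (simp add: hyp_def hy_def r_def[symmetric])
qed

lemma fst_hyp: "u \<in> hyp \<Longrightarrow> (fst u)\<^sup>2 = 1 + (cmod (snd u))\<^sup>2"
  by (simp only: cmod_power2) (simp add: hyp_def mk_def power2_eq_square)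

lemma pdisc_norm: assumes "u \<in> hyp" shows "(cmod (pdisc u))\<^sup>2 = (fst u - 1) / (fst u + 1)"
proof -
  have u: "fst u > 0" using assms by (simp add: hypD)
  have "(cmod (pdisc u))\<^sup>2 = (cmod (snd u))\<^sup>2 / (1 + fst u)\<^sup>2"
    by (simp add: pdisc_def power_mult_distrib power_divide)
  also have "(cmod (snd u))\<^sup>2 = (fst u - 1) * (fst u + 1)"
    using fst_hyp[OF assms] by (simp add: power2_eq_square algebra_simps)
  also have "(fst u - 1) * (fst u + 1) / (1 + fst u)\<^sup>2 = (fst u - 1) / (fst u + 1)"
    using u by (simp add: power2_eq_square add.commute)
  finally show ?thesis .
qed

lemma pdisc_disc: assumes "u \<in> hyp" shows "pdisc u \<in> poincare_disc"
proof -
  have u: "fst u > 0" using assms by (simp add: hypD)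
  have "(cmod (pdisc u))\<^sup>2 < 1" unfolding pdisc_norm[OF assms] using u by (simp add: field_simps)
  then show ?thesis by (simp add: poincare_disc_def power_less_one_iff)
qed

lemma hy_pdisc: assumes "u \<in> hyp" shows "hy (pdisc u) = u"
proof -
  have u: "fst u > 0" using assms by (simp add: hypD)
  have e: "1 - (fst u - 1) / (fst u + 1) = 2 / (fst u + 1)" "1 + (fst u - 1) / (fst u + 1) = 2 * fst u / (fst u + 1)"
    using u by (simp_all add: field_simps)
  show ?thesis unfolding hy_def pdisc_norm[OF assms] e
    using u by (simp add: prod_eq_iff pdisc_def field_simps)
qed

lemma pdisc_hy: assumes "q \<in> poincare_disc" shows "pdisc (hy q) = q"
proof -
  have r: "(cmod q)\<^sup>2 < 1" by (rule disc_norm[OF assms])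
  then have "1 + (1 + (cmod q)\<^sup>2) / (1 - (cmod q)\<^sup>2) = 2 / (1 - (cmod q)\<^sup>2)" by (simp add: field_simps)
  moreover have "(1 / c) *\<^sub>R (c *\<^sub>R q) = q" if "c \<noteq> 0" for c using that by simp
  ultimately show ?thesis unfolding pdisc_def hy_def fst_conv snd_conv
    using r by (metis diff_gt_0_iff_gt divide_pos_pos less_numeral_extra(3) zero_less_numeral)
qed

lemma hy_inj: "p \<in> poincare_disc \<Longrightarrow> q \<in> poincare_disc \<Longrightarrow> hy p = hy q \<longleftrightarrow> p = q"
  by (metis pdisc_hy)

lemma poincare_dist_hy:
  assumes "z \<in> poincare_disc" "w \<in> poincare_disc"
  shows "poincare_dist z w = arcosh (mk (hy z) (hy w))"
proof -
  define a b where "a = (cmod z)\<^sup>2" "b = (cmod w)\<^sup>2"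
  have ab: "a < 1" "b < 1" using disc_norm assms by (auto simp: a_b_def)
  have a: "a = (Re z)\<^sup>2 + (Im z)\<^sup>2" and b: "b = (Re w)\<^sup>2 + (Im w)\<^sup>2" by (simp_all add: a_b_def cmod_power2)
  have zw: "(cmod (z - w))\<^sup>2 = a + b - 2 * (Re z * Re w + Im z * Im w)"
    unfolding a b cmod_power2 by (simp add: power2_eq_square algebra_simps)
  have "mk (hy z) (hy w) = ((1 + a) * (1 + b) - 4 * (Re z * Re w + Im z * Im w)) / ((1 - a) * (1 - b))"
    unfolding mk_def hy_def fst_conv snd_conv a_b_def[symmetric] scaleR_complex.sel using ab by (simp add: divide_simps)
  also have "\<dots> = 1 + 2 * (cmod (z - w))\<^sup>2 / ((1 - a) * (1 - b))"
  proof -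
    define D where "D = (1 - a) * (1 - b)"
    have "D \<noteq> 0" using ab by (simp add: D_def)
    moreover have "(1 + a) * (1 + b) - 4 * (Re z * Re w + Im z * Im w) = D + 2 * (cmod (z - w))\<^sup>2"
      unfolding zw D_def by (simp add: algebra_simps)
    ultimately show ?thesis by (simp add: D_def[symmetric] add_divide_distrib)
  qed
  finally show ?thesis by (simp add: poincare_dist_def a_b_def)
qed

section \<open>Geodesics on the hyperboloid\<close>

definition geo :: "mvec \<Rightarrow> mvec \<Rightarrow> real \<Rightarrow> mvec" where
  "geo p n t = cosh t *\<^sub>R p + sinh t *\<^sub>R n"

lemma mk_geo:
  assumes "p \<in> hyp" "mk p n = 0" "mk n n = -1"
  shows "mk (geo p n s) (geo p n t) = cosh (s - t)"
  using assms hypD(1)[OF assms(1)] by (simp add: geo_def mk_sym[of n p] cosh_diff)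

lemma geo_hyp:
  assumes "p \<in> hyp" "mk p n = 0" "mk n n = -1" shows "geo p n t \<in> hyp"
proof -
  define w where "w = geo p n t"
  have w: "mk w w = 1" using mk_geo[OF assms] by (simp add: w_def)
  have "mk p w = cosh t" using assms by (simp add: w_def geo_def hypD)
  then have pw: "mk p w > 0" by simp
  have "fst w \<noteq> 0"
  proof
    assume "fst w = 0"
    then have "- (Re (snd w))\<^sup>2 - (Im (snd w))\<^sup>2 = 1" using w(1) by (simp add: mk_def power2_eq_square)
    then show False by (smt (verit) zero_le_power2)
  qed
  moreover have "\<not> fst w < 0"
  proof
    assume "fst w < 0"
    then have "- w \<in> hyp" using w by (simp add: hyp_def)
    then have "mk p (- w) \<ge> 1" using assms mk_ge_1 by blast
    with pw show False by simp
  qed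
  ultimately show ?thesis using w by (simp add: hyp_def w_def[symmetric])
qed

lemma geodesic_line_geo:
  assumes "p \<in> hyp" "mk p n = 0" "mk n n = -1" shows "geodesic_line (\<lambda>t. pdisc (geo p n t))"
  unfolding geodesic_line_def
proof (intro conjI allI)
  show "range (\<lambda>t. pdisc (geo p n t)) \<subseteq> poincare_disc"
    using pdisc_disc[OF geo_hyp[OF assms]] by auto
  fix s t :: real
  have "mk (geo p n s) (geo p n t) = cosh \<bar>s - t\<bar>" by (simp add: mk_geo[OF assms] abs_if cosh_minus[of "s - t", symmetric] del: cosh_minus)
  then show "poincare_dist (pdisc (geo p n s)) (pdisc (geo p n t)) = \<bar>s - t\<bar>"
    using geo_hyp[OF assms] by (simp add: poincare_dist_hy pdisc_disc hy_pdisc arcosh_cosh_real del: cosh_real_abs)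
qed

lemma line_through:
  assumes "p \<in> hyp" "q \<in> hyp" "p \<noteq> q"
  obtains n d where "mk p n = 0" "mk n n = -1" "d > 0" "geo p n d = q"
proof -
  define x where "x = mk p q"
  have x: "x > 1" using mk_ge_1[OF assms(1,2)] mk_eq_1[OF assms(1,2)] assms(3) by (force simp: x_def)
  define d where "d = arcosh x"
  have c: "cosh d = x" using x by (simp add: d_def cosh_arcosh_real)
  have d: "d > 0" using x by (simp add: d_def arcosh_real_gt_1_iff)
  have s: "sinh d > 0" using d by simp
  have s2: "sinh d * sinh d = x * x - 1" using hyperbolic_pythagoras[of d] c by (simp add: power2_eq_square)
  define n where "n = (1 / sinh d) *\<^sub>R (q - x *\<^sub>R p)"
  have pp: "mk p p = 1" "mk q q = 1" "mk p q = x" "mk q p = x" using assms by (auto simp: hypD x_def mk_sym)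
  have 1: "mk p n = 0" by (simp add: n_def pp)
  have "mk (q - x *\<^sub>R p) (q - x *\<^sub>R p) = 1 - x * x" by (simp add: pp algebra_simps)
  then have "mk n n = (1 - x * x) / (sinh d * sinh d)" unfolding n_def mk_simps(5,6) by simp
  moreover have "1 - x * x = - (sinh d * sinh d)" using s2 by simp
  ultimately have 2: "mk n n = -1" using s by simp
  have "geo p n d = q" using s by (simp add: geo_def n_def c)
  then show ?thesis using that[OF 1 2 d] by simp
qed

lemma rf_add_left [simp]: "rf (u + v) z = rf u z + rf v z" "rf (r *\<^sub>R u) z = r *\<^sub>R rf u z"
  by (simp_all add: complex_eq_iff Re_rf Im_rf algebra_simps)

lemma rf_anticomm: "rf n (rf p z) + rf p (rf n z) = - (2 * mk p n) *\<^sub>R z"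
  by (simp add: complex_eq_iff Re_rf Im_rf mk_def algebra_simps)

text \<open>\<open>rf p\<close> and \<open>rf n\<close> square to -1 and 1 and anticommute because
  \<open>p\<close> and \<open>n\<close> are orthogonal, so the addition theorems apply. Only
  \<open>b - a\<close> enters, which is why a common translation of a pair keeps its
  product.\<close>

lemma rf_geo:
  assumes "p \<in> hyp" "mk p n = 0" "mk n n = -1"
  shows "rf (geo p n b) (rf (geo p n a) z) = - cosh (b - a) *\<^sub>R z + sinh (b - a) *\<^sub>R rf n (rf p z)"
proof -
  have 1: "rf p (rf p z) = - z" "rf n (rf n z) = z" "rf p (rf n z) = - rf n (rf p z)"
    using rf_anticomm[of n p z] assms(2) by (simp_all only: rf_rf hypD(1)[OF assms(1)] assms(3)) (simp_all add: eq_neg_iff_add_eq_0 add.commute)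
  show ?thesis by (simp add: geo_def 1 cosh_diff sinh_diff algebra_simps)
qed

text \<open>The direction \<open>n\<close> is built from the points at times 0 and 1; the distances
  to these two points then give \<open>mk (P t) (geo (P 0) n t) = 1\<close>, the equality case of
  \<open>mk_ge_1\<close>.\<close>

lemma geodesic_line_eq_geo:
  assumes "geodesic_line \<gamma>"
  obtains p n where "p \<in> hyp" "mk p n = 0" "mk n n = -1" "\<And>t. hy (\<gamma> t) = geo p n t"
proof -
  define P where "P t = hy (\<gamma> t)" for t
  have g: "\<gamma> t \<in> poincare_disc" for t using assms by (auto simp: geodesic_line_def)
  have P: "P t \<in> hyp" for t using g hy_hyp by (simp add: P_def)
  have PP: "mk (P s) (P t) = cosh (s - t)" for s t
  proof -
    have "arcosh (mk (P s) (P t)) = \<bar>s - t\<bar>"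
      using assms g by (simp add: geodesic_line_def poincare_dist_hy P_def)
    then have "mk (P s) (P t) = cosh \<bar>s - t\<bar>" using mk_ge_1[OF P P] by (metis cosh_arcosh_real)
    then show ?thesis by simp
  qed
  define n where "n = (1 / sinh 1) *\<^sub>R (P 1 - cosh 1 *\<^sub>R P 0)"
  have s: "sinh (1::real) > 0" by simp
  have s2: "sinh 1 * sinh 1 = cosh 1 * cosh (1::real) - 1" using hyperbolic_pythagoras[of "1::real"] by (simp add: power2_eq_square)
  have n0: "mk (P 0) n = 0" by (simp add: n_def PP)
  have "mk (P 1 - cosh 1 *\<^sub>R P 0) (P 1 - cosh 1 *\<^sub>R P 0) = 1 - cosh 1 * cosh 1" by (simp add: PP algebra_simps)
  then have "mk n n = (1 - cosh 1 * cosh 1) / (sinh 1 * sinh 1)" unfolding n_def mk_simps(5,6) by simp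
  moreover have "1 - cosh 1 * cosh 1 = - (sinh 1 * sinh (1::real))" using s2 by simp
  ultimately have nn: "mk n n = -1" using s by simp
  have eq: "P t = geo (P 0) n t" for t
  proof (rule mk_eq_1[OF P geo_hyp[OF P n0 nn]])
    have "mk (P t) n = - sinh t" using s by (simp add: n_def PP cosh_diff)
    then have "mk (P t) (geo (P 0) n t) = (cosh t)\<^sup>2 - (sinh t)\<^sup>2" by (simp add: geo_def PP power2_eq_square)
    then show "mk (P t) (geo (P 0) n t) = 1" by (simp add: hyperbolic_pythagoras)
  qed
  show ?thesis by (rule that[OF P[of 0] n0 nn]) (fold P_def, rule eq)
qed

text \<open>The Gram determinant of collinear vectors vanishes, and this says that the two
  coordinates of \<open>c\<close> are a hyperbolic cosine and sine.\<close>

lemma on_line_geo: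
  assumes "p \<in> hyp" "mk p n = 0" "mk n n = -1" "c \<in> hyp" "tri p n c = 0"
  obtains s where "geo p n s = c"
proof -
  define B where "B = - mk n c"
  define s where "s = arsinh B"
  have s: "sinh s = B" by (simp add: s_def)
  have "(mk p c)\<^sup>2 = 1 + B\<^sup>2" using gram[of p n c] assms by (simp add: hypD B_def)
  also have "\<dots> = (cosh s)\<^sup>2" using hyperbolic_pythagoras[of s] s by simp
  finally have c: "mk p c = cosh s"
    using mk_ge_1[OF assms(1,4)] by (smt (verit) cosh_real_pos power2_eq_iff)
  have "mk (geo p n s) c = (cosh s)\<^sup>2 - (sinh s)\<^sup>2" using s c by (simp add: geo_def B_def power2_eq_square)
  then have "mk (geo p n s) c = 1" by (simp add: hyperbolic_pythagoras)
  then show ?thesis using that mk_eq_1[OF geo_hyp[OF assms(1-3)] assms(4)] by blast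
qed

lemma geodesic_shift:
  assumes "geodesic_line \<gamma>"
  shows "rf (hy (\<gamma> (b + t))) (rf (hy (\<gamma> (a + t))) z) = rf (hy (\<gamma> b)) (rf (hy (\<gamma> a)) z)"
proof -
  obtain p n where "p \<in> hyp" "mk p n = 0" "mk n n = -1" "\<And>t. hy (\<gamma> t) = geo p n t"
    by (rule geodesic_line_eq_geo[OF assms]) blast
  then show ?thesis by (simp add: rf_geo)
qed

text \<open>The values at \<open>d + d\<close> and \<open>- d\<close> exhibit both braid moves as
  translations by the length of the pair; the last property serves to bring one member of the pair
  to a prescribed point of the line.\<close>

lemma geodesic_through:
  assumes "p \<in> poincare_disc" "q \<in> poincare_disc" "p \<noteq> q"
  obtains \<gamma> d where "geodesic_line \<gamma>" "\<gamma> 0 = p" "\<gamma> d = q"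
    "hy (\<gamma> (d + d)) = hrefl (hy q) (hy p)" "hy (\<gamma> (- d)) = hrefl (hy p) (hy q)"
    "\<And>c. c \<in> poincare_disc \<Longrightarrow> tri (hy p) (hy q) (hy c) = 0 \<Longrightarrow> \<exists>s. \<gamma> s = c"
proof -
  have h: "hy p \<in> hyp" "hy q \<in> hyp" "hy p \<noteq> hy q" using assms by (auto simp: hy_hyp hy_inj)
  obtain n d where n: "mk (hy p) n = 0" "mk n n = -1" "d > 0" "geo (hy p) n d = hy q"
    by (rule line_through[OF h]) blast
  define \<gamma> where "\<gamma> = (\<lambda>t. pdisc (geo (hy p) n t))"
  have G: "geo (hy p) n t \<in> hyp" for t by (rule geo_hyp[OF h(1) n(1,2)])
  have hg: "hy (\<gamma> t) = geo (hy p) n t" for t by (simp add: \<gamma>_def hy_pdisc G)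
  have g0: "geo (hy p) n 0 = hy p" by (simp add: geo_def)
  have g1: "geodesic_line \<gamma>" unfolding \<gamma>_def by (rule geodesic_line_geo[OF h(1) n(1,2)])
  have g2: "\<gamma> 0 = p" "\<gamma> d = q" using n assms by (simp_all add: \<gamma>_def g0 pdisc_hy)
  have g3: "hy (\<gamma> (d + d)) = hrefl (hy q) (hy p)"
  proof -
    have x: "mk (hy q) (hy p) = cosh d" using mk_geo[OF h(1) n(1,2), of d 0] by (simp add: g0 n)
    have sd: "sinh d *\<^sub>R n = hy q - cosh d *\<^sub>R hy p" unfolding n(4)[symmetric] geo_def by simp
    have "geo (hy p) n (d + d) = ((cosh d)\<^sup>2 + (sinh d)\<^sup>2) *\<^sub>R hy p + (2 * cosh d) *\<^sub>R (sinh d *\<^sub>R n)"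
      unfolding geo_def cosh_add sinh_add by (simp add: power2_eq_square mult_ac)
    also have "(sinh d)\<^sup>2 = (cosh d)\<^sup>2 - 1" using hyperbolic_pythagoras[of d] by simp
    finally show ?thesis unfolding sd hg hrefl_def x by (simp add: algebra_simps power2_eq_square)
  qed
  have g4: "hy (\<gamma> (- d)) = hrefl (hy p) (hy q)"
  proof -
    have x: "mk (hy p) (hy q) = cosh d" using mk_geo[OF h(1) n(1,2), of 0 d] by (simp add: g0 n)
    show ?thesis unfolding hg hrefl_def x unfolding n(4)[symmetric] geo_def by (simp add: mvec_eq_iff algebra_simps)
  qed
  have g5: "\<exists>s. \<gamma> s = c" if c: "c \<in> poincare_disc" "tri (hy p) (hy q) (hy c) = 0" for c
  proof -
    have "tri (hy p) (hy q) (hy c) = sinh d * tri (hy p) n (hy c)"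
      unfolding n(4)[symmetric] geo_def by simp
    then have "tri (hy p) n (hy c) = 0" using c n(3) by simp
    then obtain s where "geo (hy p) n s = hy c" using on_line_geo[OF h(1) n(1,2) hy_hyp[OF c(1)]] by blast
    then show ?thesis using c by (intro exI[of _ s]) (simp add: \<gamma>_def pdisc_hy)
  qed
  show ?thesis by (rule that[OF g1 g2 g3 g4 g5])
qed

section \<open>Words and their evaluation\<close>

text \<open>As the generators are involutions, words without formal inverses suffice. They act from right to left.\<close>

definition tw :: "nat list \<Rightarrow> (nat \<times> bool) list" where "tw w = map (\<lambda>i. (i, True)) w"

definition weq :: "nat \<Rightarrow> nat list \<Rightarrow> nat list \<Rightarrow> bool" where
  "weq n v w \<longleftrightarrow> word_equiv {1..n} (H_relators n) (tw v) (tw w)"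

definition wds :: "nat \<Rightarrow> nat list set" where "wds n = lists {1..n}"

lemma wds_simps [simp]: "[] \<in> wds n" "i # w \<in> wds n \<longleftrightarrow> 1 \<le> i \<and> i \<le> n \<and> w \<in> wds n"
  "v @ w \<in> wds n \<longleftrightarrow> v \<in> wds n \<and> w \<in> wds n" "rev w \<in> wds n \<longleftrightarrow> w \<in> wds n"
  by (auto simp: wds_def)

lemma wds_iff: "w \<in> wds n \<longleftrightarrow> set w \<subseteq> {1..n}" by (auto simp: wds_def)

lemma tw_words [simp]: "tw w \<in> group_words {1..n} \<longleftrightarrow> w \<in> wds n"
  by (auto simp: tw_def group_words_def wds_def)

lemmas tw_words' [simp] = tw_words[unfolded One_nat_def]

lemma tw_append: "tw (v @ w) = tw v @ tw w" by (simp add: tw_def)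

lemma weq_refl: "w \<in> wds n \<Longrightarrow> weq n w w"
  by (simp add: weq_def tw_words word_equiv.word_refl)

lemma weq_sym: "weq n v w \<Longrightarrow> weq n w v"
  by (simp add: weq_def word_equiv.word_sym)

lemma weq_trans [trans]: "weq n u v \<Longrightarrow> weq n v w \<Longrightarrow> weq n u w"
  unfolding weq_def by (rule word_equiv.word_trans)

lemma weq_wds: "weq n v w \<Longrightarrow> v \<in> wds n \<and> w \<in> wds n"
  using word_equiv_words[of "{1..n}" "H_relators n" "tw v" "tw w"] by (simp add: weq_def tw_words)

lemma weq_append: assumes "weq n a b" "weq n c d" shows "weq n (a @ c) (b @ d)"
proof -
  have w: "a \<in> wds n" "b \<in> wds n" "c \<in> wds n" "d \<in> wds n" using assms weq_wds by blast+
  have "weq n (a @ c) (b @ c)" unfolding weq_def tw_append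
    by (rule word_equiv_append_right) (use assms w in \<open>auto simp: weq_def tw_words\<close>)
  also have "weq n (b @ c) (b @ d)" unfolding weq_def tw_append
    by (rule word_equiv_append_left) (use assms w in \<open>auto simp: weq_def tw_words\<close>)
  finally show ?thesis .
qed

lemma weq_Cons: "weq n v w \<Longrightarrow> 1 \<le> i \<Longrightarrow> i \<le> n \<Longrightarrow> weq n (i # v) (i # w)"
  using weq_append[OF weq_refl[of "[i]" n], of v w] by simp

lemma weq_cancel: assumes "a \<in> wds n" "b \<in> wds n" "1 \<le> i" "i \<le> n" shows "weq n (a @ [i, i] @ b) (a @ b)"
proof -
  have "[(i, True), (i, True)] \<in> H_relators n" using assms by (auto simp: H_relators_def)
  from word_equiv.word_relator[OF _ _ this, of "tw a" "{1..n}" "tw b"]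
  moreover have "[(i, True), (i, True)] \<in> group_words {1..n}" using assms by (simp add: group_words_def)
  moreover have "tw (i # i # w) = (i, True) # (i, True) # tw w" for w by (simp add: tw_def)
  ultimately show ?thesis using assms by (simp add: weq_def tw_append tw_def[of "[i, i]"])
qed

lemma weq_cancel_Cons: assumes "w \<in> wds n" "1 \<le> i" "i \<le> n" shows "weq n (i # i # w) w"
  using weq_cancel[of "[]" n w i] assms by simp

lemma weq_inverse: "w \<in> wds n \<Longrightarrow> weq n (w @ rev w) []"
proof (induction w)
  case (Cons i w)
  then have "weq n ([i] @ (w @ rev w) @ [i]) ([i] @ [] @ [i])"
    by (intro weq_append weq_refl) auto
  also have "weq n ([i] @ [] @ [i]) []" using weq_cancel[of "[]" n "[]" i] Cons.prems by simp
  finally show ?case by simp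
qed (simp add: weq_refl)

lemma weq_inverse': "w \<in> wds n \<Longrightarrow> weq n (rev w @ w) []"
  using weq_inverse[of "rev w" n] by simp

lemma weq_relator: "weq n (rev [1..<Suc n]) []"
proof -
  have "tw (rev [1..<Suc n]) \<in> H_relators n" by (simp add: H_relators_def tw_def rev_map del: upt_Suc)
  from word_equiv.word_relator[OF _ _ this, of "[]" "{1..n}" "[]"]
  moreover have "rev [1..<Suc n] \<in> wds n" by (auto simp: wds_iff)
  ultimately show ?thesis by (simp add: weq_def tw_def[of "[]"] del: upt_Suc)
qed

lemma weq_rev: assumes "weq n v w" shows "weq n (rev v) (rev w)"
proof -
  have w: "v \<in> wds n" "w \<in> wds n" using weq_wds[OF assms] by auto
  have "weq n (rev v @ []) (rev v @ (w @ rev w))"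
    by (intro weq_append weq_refl weq_sym[OF weq_inverse]) (use w in auto)
  also have "rev v @ (w @ rev w) = (rev v @ w) @ rev w" by simp
  also have "weq n \<dots> ((rev v @ v) @ rev w)"
    by (intro weq_append weq_refl weq_sym[OF assms]) (use w in auto)
  also have "weq n \<dots> ([] @ rev w)"
    by (intro weq_append weq_refl weq_inverse') (use w in auto)
  finally show ?thesis by simp
qed

text \<open>The relator \<open>[(i, True), (i, True)]\<close> makes a generator its own inverse, so
  the signs of the letters may be forgotten.\<close>

lemma word_equiv_tw:
  assumes "w \<in> group_words {1..n}" shows "word_equiv {1..n} (H_relators n) w (tw (map fst w))"
  using assms
proof (induction w)
  case Nil
  then show ?case by (simp add: tw_def word_equiv.word_refl)
next
  case (Cons a w)
  obtain i b where a: "a = (i, b)" by (cases a)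
  let ?S = "{1..n}" and ?R = "H_relators n"
  have w: "w \<in> group_words ?S" "i \<in> ?S" using Cons.prems a by (auto simp: group_words_def)
  have i: "[(i, True)] \<in> group_words ?S" "[(i, False)] \<in> group_words ?S" using w by (auto simp: group_words_def)
  have "word_equiv ?S ?R [(i, b)] [(i, True)]"
  proof (cases b)
    case True
    then show ?thesis using i by (simp add: word_equiv.word_refl)
  next
    case False
    have "[(i, True), (i, True)] \<in> ?R" using w by (auto simp: H_relators_def)
    then have "word_equiv ?S ?R ([(i, False)] @ [(i, True), (i, True)] @ []) ([(i, False)] @ [])"
      by (rule word_equiv.word_relator[rotated 2]) (use w in \<open>auto simp: group_words_def\<close>)
    moreover have "word_equiv ?S ?R ([] @ [(i, False), (i, \<not> False)] @ [(i, True)]) ([] @ [(i, True)])"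
      by (rule word_equiv.word_cancel) (use w in \<open>auto simp: group_words_def\<close>)
    ultimately show ?thesis using False by (auto intro: word_equiv.word_trans word_equiv.word_sym)
  qed
  from word_equiv_append_right[OF this w(1)]
  have "word_equiv ?S ?R (a # w) ([(i, True)] @ w)" by (simp add: a)
  moreover have "word_equiv ?S ?R ([(i, True)] @ w) ([(i, True)] @ tw (map fst w))"
    by (rule word_equiv_append_left[OF Cons.IH[OF w(1)] i(1)])
  ultimately show ?case using word_equiv.word_trans by (fastforce simp: tw_def a)
qed

section \<open>Words as linear maps, and soundness of the relators\<close>

primrec evw :: "(nat \<Rightarrow> mvec) \<Rightarrow> nat list \<Rightarrow> complex \<Rightarrow> complex" where
  "evw Q [] z = z"
| "evw Q (i # w) z = rf (Q i) (evw Q w z)"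

lemma evw_append [simp]: "evw Q (v @ w) z = evw Q v (evw Q w z)"
  by (induction v) auto

lemma evw_simps [simp]: "evw Q w (a + b) = evw Q w a + evw Q w b" "evw Q w (r *\<^sub>R a) = r *\<^sub>R evw Q w a"
  "evw Q w (- a) = - evw Q w a" "evw Q w 0 = 0"
  by (induction w) auto

lemma evw_run: "evw Q w z = run (map Q (rev w)) z"
  by (induction w) auto

text \<open>Equality in \<open>PU(1,1)\<close>, expressed by lifts: one sign for all
  vectors.\<close>

definition pm :: "(complex \<Rightarrow> complex) \<Rightarrow> (complex \<Rightarrow> complex) \<Rightarrow> bool" where
  "pm f g \<longleftrightarrow> (\<forall>z. f z = g z) \<or> (\<forall>z. f z = - g z)"

lemma pm_refl: "pm f f" by (simp add: pm_def)
lemma pm_sym: "pm f g \<Longrightarrow> pm g f" by (auto simp: pm_def)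
lemma pm_trans: "pm f g \<Longrightarrow> pm g h \<Longrightarrow> pm f h" unfolding pm_def by (metis minus_minus)

definition tuple :: "nat \<Rightarrow> (nat \<Rightarrow> mvec) \<Rightarrow> mvec list" where "tuple n Q = map Q [1..<Suc n]"

lemma closing_tuple_hyp: "closing (tuple n Q) \<Longrightarrow> 1 \<le> i \<Longrightarrow> i \<le> n \<Longrightarrow> Q i \<in> hyp"
  by (auto simp: closing_def tuple_def simp del: upt_Suc)

lemma word_equiv_sound:
  assumes "closing (tuple n Q)" "word_equiv {1..n} (H_relators n) v w"
  shows "pm (evw Q (map fst v)) (evw Q (map fst w))"
  using assms(2)
proof (induction rule: word_equiv.induct)
  case (word_sym v w)
  then show ?case by (rule_tac pm_sym)
next
  case (word_trans u v w)
  then show ?case by (rule_tac pm_trans)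
next
  case (word_cancel u v x b)
  then have "Q x \<in> hyp" using closing_tuple_hyp[OF assms(1)] by simp
  then show ?case by (simp add: pm_def rf_rf_hyp)
next
  case (word_relator u v r)
  from word_relator(3) consider i where "i \<in> {1..n}" "r = [(i, True), (i, True)]"
    | "r = rev (map (\<lambda>i. (i, True)) [1..<Suc n])"
    by (auto simp: H_relators_def)
  then show ?case
  proof cases
    case 1
    then have "Q i \<in> hyp" using closing_tuple_hyp[OF assms(1)] by simp
    then show ?thesis by (simp add: pm_def rf_rf_hyp 1)
  next
    case 2
    have "map fst r = rev [1..<Suc n]" by (simp add: 2 rev_map o_def)
    then have "evw Q (map fst r) z = run (tuple n Q) z" for z by (simp add: evw_run tuple_def)
    then have "(\<forall>z. evw Q (map fst r) z = z) \<or> (\<forall>z. evw Q (map fst r) z = - z)"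
      using assms(1) by (simp add: closing_def)
    then show ?thesis by (auto simp: pm_def)
  qed
qed (simp add: pm_refl)

lemma weq_sound: assumes "closing (tuple n Q)" "weq n v w" shows "pm (evw Q v) (evw Q w)"
  using word_equiv_sound[OF assms(1), of "tw v" "tw w"] assms(2) by (simp add: weq_def tw_def o_def)

lemma evw_mir: "pm (evw (\<lambda>i. mir (Q i)) w) (\<lambda>z. cnj (evw Q w (cnj z)))"
proof (induction w)
  case (Cons i w)
  then show ?case by (auto simp: pm_def rf_mir)
qed (simp add: pm_def)

lemma tuple_mir: "tuple n (\<lambda>i. mir (Q i)) = map mir (tuple n Q)" by (simp add: tuple_def)

section \<open>The ping-pong argument\<close>

text \<open>The three-term Pluecker relation; it makes positivity of \<open>om\<close> transitive
  within a half plane.\<close>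

lemma om_jacobi: "om u b * om a c = om u a * om b c + om u c * om a b"
  by (simp add: om_def algebra_simps)

lemma om_basis: "om a b *\<^sub>R z = om z b *\<^sub>R a + om a z *\<^sub>R b"
  by (simp add: complex_eq_iff om_def algebra_simps)

text \<open>The powers of the product \<open>r\<^sub>n \<dots> r\<^sub>3\<close>, which is \<open>r\<^sub>1r\<^sub>2\<close> in the group.\<close>

definition powD :: "nat \<Rightarrow> nat list \<Rightarrow> bool" where
  "powD n w \<longleftrightarrow> (\<exists>k. weq n w (concat (replicate k (rev [3..<Suc n]))) \<or> weq n w (concat (replicate k [3..<Suc n])))"

lemma upt_split: assumes "n \<ge> 2" shows "[1..<Suc n] = [1, 2] @ [3..<Suc n]"
  using assms by (simp add: upt_conv_Cons numeral_eq_Suc del: upt_Suc)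

lemma D_wds: "[3..<Suc n] \<in> wds n" by (auto simp: wds_iff)

lemma concat_replicate_wds: "w \<in> wds n \<Longrightarrow> concat (replicate k w) \<in> wds n"
  by (auto simp: wds_iff)

lemma powD_wds: "powD n w \<Longrightarrow> w \<in> wds n" using weq_wds by (auto simp: powD_def)

lemma powD_weq: "weq n v w \<Longrightarrow> powD n w \<Longrightarrow> powD n v" unfolding powD_def using weq_trans by blast

lemma powD_step:
  assumes "powD n w" "e = rev [3..<Suc n] \<or> e = [3..<Suc n]" shows "powD n (e @ w)"
proof -
  have D: "[3..<Suc n] \<in> wds n" "rev [3..<Suc n] \<in> wds n" "e \<in> wds n" using D_wds assms(2) by auto
  obtain k f where k: "weq n w (concat (replicate k f))" "f = rev [3..<Suc n] \<or> f = [3..<Suc n]"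
    using assms(1) unfolding powD_def by blast
  have ew: "weq n (e @ w) (e @ concat (replicate k f))" by (intro weq_append weq_refl k D)
  show ?thesis
  proof (cases "f = e")
    case True
    then have "weq n (e @ w) (concat (replicate (Suc k) e))" using ew by simp
    then show ?thesis using assms(2) unfolding powD_def by blast
  next
    case False
    then have f: "weq n (e @ f) []"
      using k(2) assms(2) weq_inverse[OF D(1)] weq_inverse'[OF D(1)] by (auto simp del: upt_Suc)
    show ?thesis
    proof (cases k)
      case 0
      then have "weq n (e @ w) (concat (replicate 1 e))" using ew by simp
      then show ?thesis using assms(2) unfolding powD_def by blast
    next
      case (Suc m)
      have ff: "concat (replicate m f) \<in> wds n" using k(2) D by (auto intro!: concat_replicate_wds simp del: upt_Suc)
      have "weq n ((e @ f) @ concat (replicate m f)) ([] @ concat (replicate m f))"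
        by (intro weq_append weq_refl ff) (rule f)
      then have "weq n (e @ w) (concat (replicate m f))" using ew Suc weq_trans[OF ew] by simp
      then show ?thesis using k(2) unfolding powD_def by blast
    qed
  qed
qed

lemma weq_21: assumes "n \<ge> 2" shows "weq n [3..<Suc n] [2, 1]"
proof -
  let ?D = "rev [3..<Suc n]" and ?E = "[3..<Suc n]"
  have D: "?D \<in> wds n" "?E \<in> wds n" using D_wds by auto
  have 12: "[2, 1] \<in> wds n" using assms by auto
  have "[1..<Suc n] = [1, 2] @ ?E" by (rule upt_split[OF assms])
  then have rel: "weq n (?D @ [2, 1]) []" using weq_relator[of n] by (simp del: upt_Suc)
  have "weq n (?E @ ?D @ [2, 1]) (?E @ [])" by (intro weq_append weq_refl rel D)
  moreover have "weq n ((?E @ ?D) @ [2, 1]) ([] @ [2, 1])"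
    by (intro weq_append weq_refl 12) (use weq_inverse[OF D(2)] in simp)
  ultimately show ?thesis by (metis append.assoc append_Nil append_Nil2 weq_sym weq_trans)
qed

text \<open>Conjugation by \<open>r\<^sub>1\<close> inverts the cyclic group generated by
  \<open>r\<^sub>1r\<^sub>2\<close>, the amalgamated subgroup. A power between two letters 1 can
  therefore be rewritten without them.\<close>

lemma powD_conj:
  assumes "powD n w" "n \<ge> 3" shows "\<exists>w'. weq n ([1] @ w @ [1]) w' \<and> set w' \<subseteq> {3..n}"
proof -
  let ?D = "rev [3..<Suc n]" and ?E = "[3..<Suc n]"
  have D: "?D \<in> wds n" "?E \<in> wds n" using D_wds by auto
  have 12: "[1] \<in> wds n" "[2] \<in> wds n" "[1, 2] \<in> wds n" "[2, 1] \<in> wds n" using assms(2) by auto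
  have E: "weq n ?E [2, 1]" by (rule weq_21) (use assms in simp)
  then have D12: "weq n ?D [1, 2]" using weq_rev[OF E] by simp
  have one: "weq n ([1] @ f @ [1]) g" if "weq n f [1, 2] \<and> weq n g [2, 1] \<or> weq n f [2, 1] \<and> weq n g [1, 2]" for f g
  proof -
    from that show ?thesis
    proof
      assume *: "weq n f [1, 2] \<and> weq n g [2, 1]"
      then have "weq n ([1] @ f @ [1]) ([1] @ [1, 2] @ [1])" by (intro weq_append weq_refl 12) auto
      also have "weq n \<dots> ([] @ [2, 1])" using weq_cancel[of "[]" n "[2,1]" 1] 12 assms(2) by simp
      finally show ?thesis using * weq_sym weq_trans by (metis append_Nil)
    next
      assume *: "weq n f [2, 1] \<and> weq n g [1, 2]"
      then have "weq n ([1] @ f @ [1]) ([1] @ [2, 1] @ [1])" by (intro weq_append weq_refl 12) auto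
      also have "weq n \<dots> ([1, 2] @ [])" using weq_cancel[of "[1,2]" n "[]" 1] 12 assms(2) by simp
      finally show ?thesis using * weq_sym weq_trans by (metis append_Nil2)
    qed
  qed
  have pow: "weq n ([1] @ concat (replicate k f) @ [1]) (concat (replicate k g))"
    if fg: "weq n ([1] @ f @ [1]) g" "f \<in> wds n" for f g k
  proof (induction k)
    case 0
    then show ?case using weq_cancel[of "[]" n "[]" 1] assms(2) by simp
  next
    case (Suc k)
    have g: "g \<in> wds n" using fg weq_wds by blast
    have c: "concat (replicate k f) \<in> wds n" by (rule concat_replicate_wds[OF fg(2)])
    have *: "weq n (([1] @ f) @ [1, 1] @ (concat (replicate k f) @ [1])) (([1] @ f) @ (concat (replicate k f) @ [1]))"
      by (rule weq_cancel) (use assms(2) c fg(2) in auto)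
    have "weq n ([1] @ concat (replicate (Suc k) f) @ [1]) (([1] @ f @ [1]) @ ([1] @ concat (replicate k f) @ [1]))"
      using weq_sym[OF *] by simp
    also have "weq n \<dots> (g @ concat (replicate k g))" by (intro weq_append fg(1) Suc)
    finally show ?case by simp
  qed
  obtain k where k: "weq n w (concat (replicate k ?D)) \<or> weq n w (concat (replicate k ?E))"
    using assms(1) unfolding powD_def by blast
  have wr: "weq n ([1] @ w @ [1]) ([1] @ v @ [1])" if "weq n w v" for v by (intro weq_append weq_refl 12 that)
  from k show ?thesis
  proof
    assume "weq n w (concat (replicate k ?D))"
    then have "weq n ([1] @ w @ [1]) ([1] @ concat (replicate k ?D) @ [1])" by (rule wr)
    also have "weq n \<dots> (concat (replicate k ?E))" by (rule pow[OF one D(1)], rule disjI1, rule conjI[OF D12 E])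
    finally have "weq n ([1] @ w @ [1]) (concat (replicate k ?E))" .
    then show ?thesis by (intro exI[of _ "concat (replicate k ?E)"]) auto
  next
    assume "weq n w (concat (replicate k ?E))"
    then have "weq n ([1] @ w @ [1]) ([1] @ concat (replicate k ?E) @ [1])" by (rule wr)
    also have "weq n \<dots> (concat (replicate k ?D))" by (rule pow[OF one D(2)], rule disjI2, rule conjI[OF E D12])
    finally have "weq n ([1] @ w @ [1]) (concat (replicate k ?D))" .
    then show ?thesis by (intro exI[of _ "concat (replicate k ?D)"]) auto
  qed
qed

text \<open>All that survives of the total angle 2\<pi>: the first two reflections use up \<pi> on
  the eigenvector \<open>u\<close>, so its images under the others stay in the half plane to its
  left until the last one.\<close>

locale ping_pong =
  fixes n :: nat and Q :: "nat \<Rightarrow> mvec" and u :: complex and l :: real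
  assumes n: "n \<ge> 5" and cl: "closing (tuple n Q)" and u0: "u \<noteq> 0" and l: "l > 1"
    and eig: "run [Q 1, Q 2] u = - (l *\<^sub>R u)"
    and pos: "\<And>j. 3 \<le> j \<Longrightarrow> j < n \<Longrightarrow> om u (run (map Q [3..<Suc j]) u) > 0"
begin

lemma Qh: "1 \<le> i \<Longrightarrow> i \<le> n \<Longrightarrow> Q i \<in> hyp" using closing_tuple_hyp[OF cl] .

definition v :: "nat \<Rightarrow> complex" where "v j = run (map Q [3..<Suc j]) u"
text \<open>The other eigenvector of \<open>R\<^sub>2R\<^sub>1\<close>, with eigenvalue
  \<open>- 1 / l\<close>: the reflection in \<open>Q 1\<close> exchanges the ends of the
  line.\<close>

definition f :: complex where "f = rf (Q 1) u"
definition g :: "nat \<Rightarrow> complex" where "g j = run (map Q [3..<Suc j]) f"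

lemma v_2: "v 2 = u" and g_2: "g 2 = f" by (simp_all add: v_def g_def)

lemma v_Suc: "2 \<le> j \<Longrightarrow> v (Suc j) = rf (Q (Suc j)) (v j)"
  and g_Suc: "2 \<le> j \<Longrightarrow> g (Suc j) = rf (Q (Suc j)) (g j)"
  by (simp_all add: v_def g_def)

lemma v_nz: "2 \<le> j \<Longrightarrow> j \<le> n \<Longrightarrow> v j \<noteq> 0"
proof (induction j rule: dec_induct)
  case base
  then show ?case by (simp add: v_2 u0)
next
  case (step j)
  then show ?case using rf_nonzero[OF Qh] by (simp add: v_Suc)
qed

lemma v_step: "2 \<le> j \<Longrightarrow> j < n \<Longrightarrow> om (v j) (v (Suc j)) > 0"
  using om_rf_pos[OF Qh v_nz, of "Suc j" j] by (simp add: v_Suc)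

lemma v_pos: "3 \<le> j \<Longrightarrow> j < n \<Longrightarrow> om u (v j) > 0" using pos by (simp add: v_def)

lemma om_uf: "om u f > 0" using om_rf_pos[OF Qh u0, of 1] n by (simp add: f_def)

lemma om_vg: "2 \<le> j \<Longrightarrow> j \<le> n \<Longrightarrow> om (v j) (g j) = om u f"
proof (induction j rule: dec_induct)
  case (step j)
  then show ?case using om_rf_hyp[OF Qh, of "Suc j"] by (simp add: v_Suc g_Suc)
qed (simp add: v_2 g_2)

lemma rf1_f: "rf (Q 1) f = - u" using Qh[of 1] n by (simp add: f_def rf_rf_hyp)

lemma rf2_f: "rf (Q 2) f = - (l *\<^sub>R u)" using eig by (simp add: f_def)

lemma rf2_u: "rf (Q 2) u = (1 / l) *\<^sub>R f"
proof -
  have "rf (Q 2) (rf (Q 2) f) = - f" using Qh[of 2] n by (simp add: rf_rf_hyp)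
  then have "l *\<^sub>R rf (Q 2) u = f" by (simp add: rf2_f)
  then show ?thesis using l by (metis divide_inverse_commute less_numeral_extra(4) mult_1 not_one_less_zero real_vector_eq_affinity real_vector_affinity_eq scaleR_scaleR scaleR_one left_inverse)
qed

lemma tuple_split: "tuple n Q = [Q 1, Q 2] @ map Q [3..<Suc n]"
  unfolding tuple_def by (subst upt_split) (use n in simp_all)

lemma v_n: "v n = - ((1 / l) *\<^sub>R u)" and run_f: "run (map Q [3..<Suc n]) f = - (l *\<^sub>R f)"
proof -
  obtain c where c: "c = 1 \<or> c = (-1::real)" "\<And>z. run (tuple n Q) z = c *\<^sub>R z"
    using closing_sign[OF cl] by metis
  have "run (map Q [3..<Suc n]) (- (l *\<^sub>R u)) = c *\<^sub>R u"
    using c(2)[of u] eig unfolding tuple_split by simp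
  then have lv: "- (l *\<^sub>R v n) = c *\<^sub>R u" by (simp add: v_def)
  have "v n = (1 / l) *\<^sub>R (l *\<^sub>R v n)" using l by simp
  also have "l *\<^sub>R v n = - (c *\<^sub>R u)" using lv by (metis minus_minus)
  finally have vn: "v n = - ((c / l) *\<^sub>R u)" by simp
  have "Suc (n - 1) = n" using n by simp
  \<comment> \<open>This determines the sign \<open>c\<close> of the relation: the last reflection
    turns \<open>v (n - 1)\<close>, which lies to the left of \<open>u\<close>, counterclockwise
    into the line of \<open>u\<close>.\<close>
  then have "om (v (n - 1)) (v n) > 0" using v_step[of "n - 1"] n by simp
  then have "(c / l) * om u (v (n - 1)) > 0" unfolding vn using om_swap[of u "v (n - 1)"] by simp
  moreover have "om u (v (n - 1)) > 0" using v_pos[of "n - 1"] n by simp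
  ultimately have "c / l > 0" using zero_less_mult_pos2 by blast
  then have c1: "c = 1" using c(1) l by (auto simp: zero_less_divide_iff)
  then show "v n = - ((1 / l) *\<^sub>R u)" using vn by simp
  have "run (map Q [3..<Suc n]) (rf (Q 2) (rf (Q 1) f)) = f"
    using c(2)[of f] c1 unfolding tuple_split by simp
  then have "- ((1 / l) *\<^sub>R run (map Q [3..<Suc n]) f) = f" by (simp add: rf1_f[simplified] rf2_u del: upt_Suc)
  then have "l *\<^sub>R f = - (l *\<^sub>R (1 / l) *\<^sub>R run (map Q [3..<Suc n]) f)" by (metis scaleR_minus_right)
  then show "run (map Q [3..<Suc n]) f = - (l *\<^sub>R f)" using l by simp
qed

text \<open>Consecutive images turn left by \<open>v_step\<close>, and all lie to the left of
  \<open>u\<close>; the Pluecker relation then orders them by induction.\<close>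

lemma om_v_v: "2 \<le> i \<Longrightarrow> i < j \<Longrightarrow> j < n \<Longrightarrow> om (v i) (v j) > 0"
proof (induction j)
  case (Suc j)
  show ?case
  proof (cases "i = j")
    case True
    then show ?thesis using v_step Suc by simp
  next
    case False
    then have ij: "om (v i) (v j) > 0" using Suc by simp
    show ?thesis
    proof (cases "i = 2")
      case True
      then show ?thesis using v_pos[of "Suc j"] Suc by (simp add: v_2)
    next
      case i2: False
      have p: "om u (v i) > 0" "om u (v j) > 0" "om u (v (Suc j)) > 0" "om (v j) (v (Suc j)) > 0"
        using v_pos v_step Suc i2 False by auto
      have "om u (v j) * om (v i) (v (Suc j)) > 0"
        unfolding om_jacobi[of u "v j"] using p ij by (simp add: add_pos_pos)
      then show ?thesis using p by (simp add: zero_less_mult_iff)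
    qed
  qed
qed simp

lemma om_v_n: "3 \<le> i \<Longrightarrow> i < n \<Longrightarrow> om (v i) (v n) > 0"
  using v_pos[of i] l om_swap[of u "v i"] by (simp add: v_n divide_neg_pos)

lemma om_v_nonneg: "2 \<le> i \<Longrightarrow> i \<le> j \<Longrightarrow> j \<le> n \<Longrightarrow> om (v i) (v j) \<ge> 0"
proof -
  assume a: "2 \<le> i" "i \<le> j" "j \<le> n"
  consider "i = j" | "i < j" "j < n" | "j = n" "i = 2" | "j = n" "3 \<le> i" "i < n" using a by linarith
  then show ?thesis
  proof cases
    case 3
    then show ?thesis by (simp add: v_n v_2)
  qed (use om_v_v[of i j] om_v_n[of i] a in \<open>auto simp: less_imp_le\<close>)
qed

text \<open>Up to sign, \<open>I s\<close> is the arc of the projective line from \<open>v (s - 1)\<close> to \<open>v s\<close>; these arcs cover the line and \<open>rf (Q s)\<close> maps the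
  complement \<open>Ic s\<close> into \<open>I s\<close>. The arcs \<open>J j\<close> from \<open>g j\<close> to \<open>v j\<close> are the images of \<open>J 2 = J n\<close>, which \<open>rf (Q 1)\<close> exchanges
  with its complement. The group is the product of \<open>\<langle>r\<^sub>1\<rangle>\<close> and \<open>\<langle>r\<^sub>3, \<dots>, r\<^sub>n\<rangle>\<close> with one amalgamated relation.\<close>

definition I :: "nat \<Rightarrow> complex set" where "I s = {z. om (v (s - 1)) z * om z (v s) \<ge> 0}"
definition Ic :: "nat \<Rightarrow> complex set" where "Ic s = {z. om (v (s - 1)) z * om z (v s) \<le> 0}"
definition J :: "nat \<Rightarrow> complex set" where "J j = {z. om (g j) z * om (v j) z \<ge> 0}"
definition Jc :: "nat \<Rightarrow> complex set" where "Jc j = {z. om (g j) z * om (v j) z \<le> 0}"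

lemma neg_simps [simp]: "- z \<in> I s \<longleftrightarrow> z \<in> I s" "- z \<in> Ic s \<longleftrightarrow> z \<in> Ic s" "- z \<in> J j \<longleftrightarrow> z \<in> J j" "- z \<in> Jc j \<longleftrightarrow> z \<in> Jc j"
  by (simp_all add: I_def Ic_def J_def Jc_def)

text \<open>The reflection carries \<open>v (t - 1)\<close> to \<open>v t\<close> and
  \<open>v t\<close> to \<open>- v (t - 1)\<close>: it swaps the ends of the arc and therefore the
  arc and its complement.\<close>

lemma rf_I:
  assumes "3 \<le> t" "t \<le> n" shows "z \<in> Ic t \<longleftrightarrow> rf (Q t) z \<in> I t"
proof -
  have q: "Q t \<in> hyp" using Qh assms by simp
  have vt: "v t = rf (Q t) (v (t - 1))" using v_Suc[of "t - 1"] assms by simp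
  then have vt': "rf (Q t) (v t) = - v (t - 1)" using q by (simp add: rf_rf_hyp)
  have "om (v (t - 1)) (rf (Q t) z) = - om (rf (Q t) (v t)) (rf (Q t) z)" by (simp add: vt')
  also have "\<dots> = om z (v t)" using om_rf_hyp[OF q] om_swap[of z "v t"] by simp
  finally have 1: "om (v (t - 1)) (rf (Q t) z) = om z (v t)" .
  have "om (rf (Q t) z) (v t) = om z (v (t - 1))" unfolding vt by (rule om_rf_hyp[OF q])
  then have 2: "om (rf (Q t) z) (v t) = - om (v (t - 1)) z" using om_swap[of z "v (t - 1)"] by linarith
  show ?thesis unfolding I_def Ic_def mem_Collect_eq 1 2 by (simp only: mult_minus_right neg_0_le_iff_le mult.commute)
qed

lemma rf_J:
  assumes "3 \<le> t" "t \<le> n"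
  shows "rf (Q t) z \<in> J t \<longleftrightarrow> z \<in> J (t - 1)" "rf (Q t) z \<in> Jc t \<longleftrightarrow> z \<in> Jc (t - 1)"
proof -
  have q: "Q t \<in> hyp" using Qh assms by simp
  have "v t = rf (Q t) (v (t - 1))" "g t = rf (Q t) (g (t - 1))"
    using v_Suc[of "t - 1"] g_Suc[of "t - 1"] assms by simp_all
  then show "rf (Q t) z \<in> J t \<longleftrightarrow> z \<in> J (t - 1)" "rf (Q t) z \<in> Jc t \<longleftrightarrow> z \<in> Jc (t - 1)"
    using om_rf_hyp[OF q] by (simp_all add: J_def Jc_def)
qed

lemma rf_J': assumes "3 \<le> t" "t \<le> n" "z \<in> J t" shows "rf (Q t) z \<in> J (t - 1)"
proof -
  have "rf (Q t) (rf (Q t) z) \<in> J t" using assms Qh[of t] by (simp add: rf_rf_hyp)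
  then show ?thesis using rf_J[OF assms(1,2)] by simp
qed

lemma g_n: "g n = - (l *\<^sub>R f)" using run_f by (simp add: g_def)

lemma J_n: "J n = J 2" and Jc_n: "Jc n = Jc 2"
  using l by (simp_all add: J_def Jc_def g_n v_n g_2 v_2 del: One_nat_def)

lemma rf1_J: "z \<in> Jc 2 \<Longrightarrow> rf (Q 1) z \<in> J 2"
proof -
  assume z: "z \<in> Jc 2"
  have q: "Q 1 \<in> hyp" using Qh n by simp
  have 1: "om f (rf (Q 1) z) = om u z" unfolding f_def by (rule om_rf_hyp[OF q])
  have "om u (rf (Q 1) z) = - om (rf (Q 1) f) (rf (Q 1) z)" by (simp add: rf1_f[simplified])
  then have 2: "om u (rf (Q 1) z) = - om f z" using om_rf_hyp[OF q] by simp
  show ?thesis using z unfolding J_def Jc_def by (simp only: mem_Collect_eq g_2 v_2 1 2) (simp add: mult.commute)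
qed

lemma I_cone:
  assumes "3 \<le> s" "s \<le> n" "z \<in> I s"
  obtains a b c where "a \<ge> 0" "b \<ge> 0" "c = 1 \<or> c = (-1::real)" "z = c *\<^sub>R (a *\<^sub>R v (s - 1) + b *\<^sub>R v s)"
proof -
  define D where "D = om (v (s - 1)) (v s)"
  have D: "D > 0" using v_step[of "s - 1"] assms by (simp add: D_def)
  define a b where "a = om z (v s) / D" "b = om (v (s - 1)) z / D"
  have "D *\<^sub>R z = om z (v s) *\<^sub>R v (s - 1) + om (v (s - 1)) z *\<^sub>R v s" unfolding D_def by (rule om_basis)
  then have "(1 / D) *\<^sub>R (D *\<^sub>R z) = a *\<^sub>R v (s - 1) + b *\<^sub>R v s" by (simp add: a_b_def scaleR_add_right)
  then have z: "z = a *\<^sub>R v (s - 1) + b *\<^sub>R v s" using D by simp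
  have "a * b \<ge> 0" using assms(3) D by (simp add: I_def a_b_def mult.commute)
  then consider "a \<ge> 0" "b \<ge> 0" | "a \<le> 0" "b \<le> 0" by (auto simp: zero_le_mult_iff)
  then show ?thesis
  proof cases
    case 1
    then show ?thesis using that[of a b 1] z by simp
  next
    case 2
    then show ?thesis using that[of "- a" "- b" "-1"] z by simp
  qed
qed

text \<open>By the cyclic order in \<open>om_v_nonneg\<close>, distinct arcs share at most
  endpoints; this is tested on the cone over the first arc.\<close>

lemma I_Ic:
  assumes "3 \<le> s" "s \<le> n" "3 \<le> t" "t \<le> n" "s \<noteq> t" shows "I s \<subseteq> Ic t"
proof
  fix z assume "z \<in> I s"
  then obtain a b c where abc: "a \<ge> 0" "b \<ge> 0" "c = 1 \<or> c = (-1::real)" "z = c *\<^sub>R (a *\<^sub>R v (s - 1) + b *\<^sub>R v s)"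
    using I_cone[OF assms(1,2)] by metis
  define y where "y = a *\<^sub>R v (s - 1) + b *\<^sub>R v s"
  have "om (v (t - 1)) y * om y (v t) \<le> 0"
  proof (cases "s < t")
    case True
    then have "om (v (s - 1)) (v (t - 1)) \<ge> 0" "om (v s) (v (t - 1)) \<ge> 0" "om (v (s - 1)) (v t) \<ge> 0" "om (v s) (v t) \<ge> 0"
      using assms by (auto intro!: om_v_nonneg)
    then have "om (v (t - 1)) y \<le> 0" "om y (v t) \<ge> 0"
      unfolding y_def om_simps om_swap[of "v (t - 1)" "v s"] om_swap[of "v (t - 1)" "v (s - 1)"]
      using mult_nonneg_nonneg[OF abc(1)] mult_nonneg_nonneg[OF abc(2)]
      by (smt (verit) mult_minus_right)+
    then show ?thesis by (simp add: mult_nonpos_nonneg)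
  next
    case False
    then have "om (v (t - 1)) (v (s - 1)) \<ge> 0" "om (v (t - 1)) (v s) \<ge> 0" "om (v t) (v (s - 1)) \<ge> 0" "om (v t) (v s) \<ge> 0"
      using assms by (auto intro!: om_v_nonneg)
    then have "om (v (t - 1)) y \<ge> 0" "om y (v t) \<le> 0"
      unfolding y_def om_simps om_swap[of "v s" "v t"] om_swap[of "v (s - 1)" "v t"]
      using mult_nonneg_nonneg[OF abc(1)] mult_nonneg_nonneg[OF abc(2)]
      by (smt (verit) mult_minus_right)+
    then show ?thesis by (simp add: mult_nonneg_nonpos)
  qed
  moreover have "z = y \<or> z = - y" using abc by (auto simp: y_def)
  ultimately show "z \<in> Ic t" by (auto simp: Ic_def)
qed

text \<open>The fixed point \<open>f\<close> lies in the last arc because \<open>u\<close> is the attracting fixed point of \<open>R\<^sub>2R\<^sub>1\<close>.\<close>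

lemma run_I: "z \<in> Ic 3 \<Longrightarrow> run (map Q [3..<Suc n]) z \<in> I n"
proof -
  assume z: "z \<in> Ic 3"
  have "run (map Q [3..<Suc j]) z \<in> I j" if "3 \<le> j" "j \<le> n" for j
    using that
  proof (induction j rule: dec_induct)
    case base
    then show ?case using z rf_I[of 3 z] n by (simp add: upt_rec)
  next
    case (step j)
    then have "run (map Q [3..<Suc j]) z \<in> Ic (Suc j)" using I_Ic[of j "Suc j"] by auto
    then show ?case using rf_I[of "Suc j"] step by simp
  qed
  then show ?thesis using n by simp
qed

lemma f_last: "om (v (n - 1)) f \<ge> 0"
proof -
  have vn: "om f (v n) > 0" using om_uf l om_swap[of f u] by (simp add: v_n)
  have n1: "3 < n - 1" "n - 1 < n" using n by auto
  have out: "om (v (n - 1)) z \<ge> 0" if "z \<in> I n" "om u z > 0" for z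
  proof -
    have "om z (v n) > 0" using that l om_swap[of z u] by (simp add: v_n)
    then show ?thesis using that(1) by (auto simp: I_def zero_le_mult_iff)
  qed
  show ?thesis
  proof (cases "om f (v 3) > 0")
    case False
    then have "f \<in> Ic 3" using om_uf v_2 by (simp add: Ic_def mult_nonneg_nonpos)
    then have "- (l *\<^sub>R f) \<in> I n" using run_I run_f by metis
    then have "om (v (n - 1)) (l *\<^sub>R f) \<ge> 0" using out[of "l *\<^sub>R f"] om_uf l by simp
    then show ?thesis using l by (simp add: zero_le_mult_iff)
  next
    case True
    \<comment> \<open>Now \<open>f\<close> lies strictly between \<open>u\<close> and
      \<open>v 3\<close>. The map \<open>C\<close> is inverse to \<open>R\<^sub>2R\<^sub>1\<close>
      up to sign and attracts towards \<open>f\<close>, so it sends \<open>v 3\<close> backwards,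
      whereas \<open>run_I\<close> places the image in the last arc.\<close>
    define C where "C = run (map Q [3..<Suc n])"
    have Cu: "C u = - ((1 / l) *\<^sub>R u)" and Cf: "C f = - (l *\<^sub>R f)"
      using v_n run_f by (simp_all add: C_def v_def)
    define a b where "a = om (v 3) f / om u f" "b = om u (v 3) / om u f"
    have "om u f *\<^sub>R v 3 = om (v 3) f *\<^sub>R u + om u (v 3) *\<^sub>R f" by (rule om_basis)
    then have "(1 / om u f) *\<^sub>R (om u f *\<^sub>R v 3) = a *\<^sub>R u + b *\<^sub>R f" by (simp add: a_b_def scaleR_add_right)
    then have v3: "v 3 = a *\<^sub>R u + b *\<^sub>R f" using om_uf by simp
    have ab: "a < 0" "b > 0" using True om_uf v_pos[of 3] n om_swap[of f "v 3"] by (auto simp: a_b_def divide_less_0_iff)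
    define w where "w = (a / l) *\<^sub>R u + (b * l) *\<^sub>R f"
    have Cv: "C (v 3) = - w" unfolding v3 using Cu Cf by (simp add: C_def w_def)
    have "v 3 \<in> Ic 3" by (simp add: Ic_def)
    then have "w \<in> I n" using run_I[of "v 3"] Cv by (simp add: C_def)
    moreover have uw: "om u w > 0" using ab l om_uf by (simp add: w_def)
    ultimately have "om (v (n - 1)) w \<ge> 0" by (rule out)
    moreover have "om (v 3) (v (n - 1)) > 0" "om u (v 3) > 0" "om u (v (n - 1)) > 0" using om_v_v v_pos n1 by auto
    ultimately have "om u (v (n - 1)) * om (v 3) w > 0"
      unfolding om_jacobi[of u "v (n - 1)"] using uw by (simp add: add_nonneg_pos)
    then have "om (v 3) w > 0" using \<open>om u (v (n - 1)) > 0\<close> by (simp add: zero_less_mult_iff)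
    moreover have "om (v 3) w = a * b * (l - 1 / l) * om u f"
      unfolding v3 w_def using om_swap[of f u] by (simp add: algebra_simps)
    moreover have "l - 1 / l > 0" using l by (simp add: field_simps) (smt (verit) l less_1_mult)
    moreover have "a * b < 0" using ab by (simp add: mult_neg_pos)
    ultimately show ?thesis using om_uf by (smt (verit) mult_neg_pos)
  qed
qed

text \<open>\<open>f_last\<close> puts \<open>J 2\<close>, which equals \<open>J n\<close>, into
  \<open>I n\<close>. From there the inclusion travels around the line: \<open>rf (Q j)\<close>
  sends \<open>J j\<close> into the preceding arc, which is outside \<open>I j\<close>, so
  \<open>J j\<close> lies in \<open>I j\<close>.\<close>

lemma J_I: "3 \<le> j \<Longrightarrow> j \<le> n \<Longrightarrow> J j \<subseteq> I j"
proof -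
  have Jn: "J 2 \<subseteq> I n"
  proof
    fix z assume z: "z \<in> J 2"
    define a b where "a = om u z" "b = om f z"
    have ab: "a * b \<ge> 0" using z by (simp add: J_def g_2 v_2 a_b_def mult.commute)
    have e: "om u f *\<^sub>R z = a *\<^sub>R f + b *\<^sub>R (- u)"
      using om_basis[of u f z] om_swap[of z f] by (simp add: a_b_def)
    have e1: "om u f * om (v (n - 1)) z = a * om (v (n - 1)) f + b * om u (v (n - 1))"
      using arg_cong[OF e, of "om (v (n - 1))"] om_swap[of "v (n - 1)" u] by simp
    have e2: "om u f * om z (v n) = a * om u f / l"
      using arg_cong[OF e, of "\<lambda>x. om x (v n)"] om_swap[of f u] by (simp add: v_n)
    have "(om u f * om u f) * (om (v (n - 1)) z * om z (v n)) = (a * om (v (n - 1)) f + b * om u (v (n - 1))) * (a * om u f / l)"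
      unfolding e1[symmetric] e2[symmetric] by (simp only: mult_ac)
    also have "\<dots> = (a\<^sup>2 * om (v (n - 1)) f + (a * b) * om u (v (n - 1))) * (om u f / l)"
      by (simp add: algebra_simps power2_eq_square)
    also have "\<dots> \<ge> 0" 
    proof -
      have "a\<^sup>2 * om (v (n - 1)) f \<ge> 0" using f_last by simp
      moreover have "om u (v (n - 1)) \<ge> 0" using om_v_nonneg[of 2 "n - 1"] n by (simp add: v_2)
      then have "(a * b) * om u (v (n - 1)) \<ge> 0" by (rule mult_nonneg_nonneg[OF ab])
      moreover have "om u f / l \<ge> 0" using om_uf l by simp
      ultimately show ?thesis by (intro mult_nonneg_nonneg[of _ "om u f / l"]) linarith+
    qed
    finally show "z \<in> I n" using om_uf unfolding I_def mem_Collect_eq by (smt (verit) mult_pos_neg mult_pos_pos)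
  qed
  show "J j \<subseteq> I j" if "3 \<le> j" "j \<le> n"
    using that
  proof (induction j rule: dec_induct)
    case base
    show ?case
    proof
      fix z assume "z \<in> J 3"
      then have "rf (Q 3) z \<in> J 2" using rf_J'[of 3 z] n by simp
      then have "rf (Q 3) z \<in> Ic 3" using Jn I_Ic[of n 3] n by auto
      then have "rf (Q 3) (rf (Q 3) z) \<in> I 3" using rf_I[of 3] n by auto
      then show "z \<in> I 3" using Qh[of 3] n by (simp add: rf_rf_hyp)
    qed
  next
    case (step j)
    show ?case
    proof
      fix z assume "z \<in> J (Suc j)"
      then have "rf (Q (Suc j)) z \<in> J j" using rf_J'[of "Suc j" z] step by simp
      then have "rf (Q (Suc j)) z \<in> Ic (Suc j)" using step I_Ic[of j "Suc j"] by auto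
      then have "rf (Q (Suc j)) (rf (Q (Suc j)) z) \<in> I (Suc j)" using rf_I[of "Suc j"] step by auto
      then show "z \<in> I (Suc j)" using Qh[of "Suc j"] step by (simp add: rf_rf_hyp)
    qed
  qed
qed

text \<open>\<open>J t\<close> and \<open>I t\<close> share the end \<open>v t\<close>, and the
  other end \<open>g t\<close> of \<open>J t\<close> lies in \<open>I t\<close>; hence leaving
  \<open>I t\<close> means leaving \<open>J t\<close>.\<close>

lemma Ic_Jc: assumes "3 \<le> t" "t \<le> n" shows "Ic t \<subseteq> Jc t"
proof
  fix z assume z: "z \<in> Ic t"
  define D where "D = om (v (t - 1)) (v t)"
  have D: "D > 0" using v_step[of "t - 1"] assms by (simp add: D_def)
  define a b c d where "a = om (g t) (v t)" "b = om (v (t - 1)) (g t)" "c = om z (v t)" "d = om (v (t - 1)) z"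
  have "g t \<in> I t" using J_I[OF assms] by (auto simp: J_def)
  then have ab: "b * a \<ge> 0" by (simp add: I_def a_b_c_d_def)
  have "a < 0" using om_vg[of t] om_uf assms om_swap[of "g t" "v t"] by (simp add: a_b_c_d_def)
  then have b: "a < 0" "b \<le> 0" using ab by (auto simp: zero_le_mult_iff)
  have cd: "c * d \<le> 0" using z by (simp add: Ic_def a_b_c_d_def mult.commute)
  have gz: "D *\<^sub>R g t = a *\<^sub>R v (t - 1) + b *\<^sub>R v t" unfolding D_def a_b_c_d_def by (rule om_basis)
  have "D * om (g t) z = a * d - b * c"
    using arg_cong[OF gz, of "\<lambda>x. om x z"] om_swap[of "v t" z] by (simp add: a_b_c_d_def)
  moreover have "om (v t) z = - c" using om_swap[of z "v t"] by (simp add: a_b_c_d_def)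
  ultimately have "D * (om (g t) z * om (v t) z) = (a * d - b * c) * (- c)" by (metis mult.assoc)
  also have "\<dots> = (- a) * (c * d) + b * c\<^sup>2" by (simp add: algebra_simps power2_eq_square)
  also have "\<dots> \<le> 0" using mult_nonneg_nonpos[of "- a" "c * d"] mult_nonpos_nonneg[of b "c\<^sup>2"] b cd by simp
  finally show "z \<in> Jc t" using D by (simp add: Jc_def mult_le_0_iff)
qed

lemma hd_mem: "xs \<noteq> [] \<Longrightarrow> set xs \<subseteq> A \<Longrightarrow> hd xs \<in> A"
  using hd_in_set by blast

lemma I_Jc2: "3 \<le> s \<Longrightarrow> s \<le> n \<Longrightarrow> z \<in> I s \<inter> Jc s \<Longrightarrow> z \<in> Jc 2"
proof (cases "s = n")
  case True
  then show "z \<in> I s \<inter> Jc s \<Longrightarrow> z \<in> Jc 2" using Jc_n by simp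
next
  case False
  then show "3 \<le> s \<Longrightarrow> s \<le> n \<Longrightarrow> z \<in> I s \<inter> Jc s \<Longrightarrow> z \<in> Jc 2"
    using I_Ic[of s n] Ic_Jc[of n] Jc_n n by auto
qed

text \<open>The invariant of the game for the letters 3 to \<open>n\<close>: to lie in the arc of
  the last letter but outside its subarc \<open>J\<close>. By \<open>I_Jc2\<close> such a point is
  outside \<open>J 2\<close>, so that a letter 1 can follow.\<close>

lemma step_out:
  assumes "3 \<le> s" "s \<le> n" "3 \<le> t" "t \<le> n" "s \<noteq> t" "z \<in> I s \<inter> Jc s"
  shows "rf (Q t) z \<in> I t \<inter> Jc t"
proof -
  have "z \<in> Jc (t - 1)"
  proof (cases "t = 3")
    case True
    then show ?thesis using I_Jc2[OF assms(1,2,6)] by simp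
  next
    case t3: False
    show ?thesis
    proof (cases "s = t - 1")
      case True
      then show ?thesis using assms by simp
    next
      case False
      then have "I s \<subseteq> Ic (t - 1)" using assms t3 by (intro I_Ic) auto
      moreover have "Ic (t - 1) \<subseteq> Jc (t - 1)" by (rule Ic_Jc) (use assms t3 in auto)
      ultimately show ?thesis using assms(6) by blast
    qed
  qed
  moreover have "z \<in> Ic t" using I_Ic[OF assms(1-5)] assms(6) by auto
  ultimately show ?thesis using rf_I[of t z] rf_J(2)[of t z] assms by simp
qed

text \<open>Test vectors. As the arcs cover the projective line, only multiples of the endpoints
  \<open>v j\<close> qualify; they suffice to detect that a map is far from the identity.\<close>

definition V :: "complex set" where "V = {z. \<forall>t. 3 \<le> t \<longrightarrow> t \<le> n \<longrightarrow> z \<in> Ic t}"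

lemma V_Jc: assumes "z \<in> V" "2 \<le> t" "t \<le> n" shows "z \<in> Jc t"
proof (cases "t = 2")
  case True
  then show ?thesis using assms Ic_Jc[of n] Jc_n n by (auto simp: V_def)
next
  case False
  then show ?thesis using assms Ic_Jc[of t] by (auto simp: V_def)
qed

lemma word_V:
  assumes "set h \<subseteq> {3..n}" "distinct_adj h" "h \<noteq> []" "z \<in> V"
  shows "evw Q h z \<in> I (hd h) \<inter> Jc (hd h)"
  using assms(1-3)
proof (induction h)
  case (Cons t h)
  have t: "3 \<le> t" "t \<le> n" using Cons.prems by auto
  show ?case
  proof (cases "h = []")
    case True
    then show ?thesis using rf_I[OF t, of z] rf_J(2)[OF t, of z] V_Jc[OF assms(4), of "t - 1"] assms(4) t by (auto simp: V_def)
  next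
    case False
    then have "hd h \<in> set h" by simp
    then have "hd h \<in> {3..n}" using Cons.prems by auto
    moreover have "t \<noteq> hd h" "distinct_adj h" using Cons.prems False by (auto simp: distinct_adj_Cons)
    ultimately show ?thesis using Cons False step_out[of "hd h" t "evw Q h z"] t by auto
  qed
qed simp

lemma up_J: "2 \<le> j \<Longrightarrow> j \<le> n \<Longrightarrow> z \<in> J 2 \<Longrightarrow> evw Q (rev [3..<Suc j]) z \<in> J j"
proof (induction j rule: dec_induct)
  case (step j)
  then show ?case using rf_J(1)[of "Suc j"] by simp
qed simp

lemma down_J: "2 \<le> j \<Longrightarrow> j \<le> n \<Longrightarrow> z \<in> J j \<Longrightarrow> evw Q [3..<Suc j] z \<in> J 2"
proof (induction j arbitrary: z rule: dec_induct)
  case (step j)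
  then have "rf (Q (Suc j)) z \<in> J j" using rf_J'[of "Suc j" z] by simp
  then have "evw Q [3..<Suc j] (rf (Q (Suc j)) z) \<in> J 2" using step by simp
  moreover have "[3..<Suc (Suc j)] = [3..<Suc j] @ [Suc j]" using step by simp
  ultimately show ?case by (simp del: upt_Suc)
qed simp

lemma weq_mem:
  assumes "weq n a b"
  shows "evw Q a z \<in> I s \<longleftrightarrow> evw Q b z \<in> I s" "evw Q a z \<in> J s \<longleftrightarrow> evw Q b z \<in> J s"
  using weq_sound[OF cl assms] by (auto simp: pm_def)

lemma powD_J: assumes "powD n e" "z \<in> J 2" shows "evw Q e z \<in> J 2"
proof -
  have *: "evw Q (concat (replicate k (rev [3..<Suc n]))) z \<in> J 2" "evw Q (concat (replicate k [3..<Suc n])) z \<in> J 2" for k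
  proof (induction k)
    case (Suc k)
    case 1 show ?case using up_J[of n] Suc J_n n by simp
    case 2 show ?case using down_J[of n] Suc J_n n by simp
  qed (use assms in simp_all)
  obtain k where "weq n e (concat (replicate k (rev [3..<Suc n]))) \<or> weq n e (concat (replicate k [3..<Suc n]))"
    using assms(1) unfolding powD_def by blast
  then show ?thesis using weq_mem(2) * by blast
qed

text \<open>The exceptional words in \<open>word_J\<close> below: they map \<open>J 2\<close> onto \<open>J j\<close>.\<close>

definition spiral :: "nat list \<Rightarrow> nat \<Rightarrow> bool" where
  "spiral w j \<longleftrightarrow> 2 \<le> j \<and> j < n \<and> (\<exists>e. powD n e \<and> weq n w (rev [3..<Suc j] @ e))"

lemma spiral_J: assumes "spiral w j" "z \<in> J 2" shows "evw Q w z \<in> J j"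
proof -
  obtain e where e: "powD n e" "weq n w (rev [3..<Suc j] @ e)" "2 \<le> j" "j < n" using assms(1) by (auto simp: spiral_def)
  have "evw Q (rev [3..<Suc j] @ e) z \<in> J j" using up_J[of j] powD_J[OF e(1) assms(2)] e by simp
  then show ?thesis using weq_mem(2)[OF e(2)] by blast
qed

lemma powD_Nil: "powD n []"
  unfolding powD_def by (intro exI[of _ 0]) (simp add: weq_refl)

text \<open>The letter \<open>j + 1\<close> prolongs the partial product, or completes a period if
  it is \<open>n\<close>; the letter \<open>j\<close> cancels; and at \<open>j = 2\<close> the
  letter \<open>n\<close> cancels against a period that is inserted together with its
  inverse.\<close>

lemma spiral_step:
  assumes "spiral w j" "3 \<le> t" "t \<le> n"
    "t = Suc j \<or> t = j \<or> (j = 2 \<and> t = n)"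
  shows "\<exists>j'. spiral (t # w) j'"
proof -
  obtain e where e: "powD n e" "weq n w (rev [3..<Suc j] @ e)" "2 \<le> j" "j < n" using assms(1) by (auto simp: spiral_def)
  have ew: "e \<in> wds n" by (rule powD_wds[OF e(1)])
  have tw: "weq n (t # w) (t # rev [3..<Suc j] @ e)" by (rule weq_Cons[OF e(2)]) (use assms in auto)
  consider "t = Suc j" "t < n" | "t = Suc j" "t = n" | "t = j" "j \<ge> 3" | "j = 2" "t = n"
    using assms e by linarith
  then show ?thesis
  proof cases
    case 1
    then have "t # rev [3..<Suc j] = rev [3..<Suc t]" using assms by simp
    then have "spiral (t # w) t" using tw e 1 unfolding spiral_def by (metis append_Cons le_Suc_eq)
    then show ?thesis ..
  next
    case 2
    then have "t # rev [3..<Suc j] = rev [3..<Suc n]" using assms by simp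
    then have "weq n (t # w) (rev [3..<Suc n] @ e)" using tw by (metis append_Cons)
    moreover have "powD n (rev [3..<Suc n] @ e)" by (rule powD_step[OF e(1)]) simp
    moreover have "rev [3..<Suc 2] = []" by simp
    ultimately have "spiral (t # w) 2" using n unfolding spiral_def by (intro conjI exI[of _ "rev [3..<Suc n] @ e"]) auto
    then show ?thesis ..
  next
    case 3
    then have r: "rev [3..<Suc j] = j # rev [3..<Suc (j - 1)]" by simp
    have "weq n (t # j # (rev [3..<Suc (j - 1)] @ e)) (rev [3..<Suc (j - 1)] @ e)"
      unfolding 3(1) by (rule weq_cancel_Cons) (use ew 3 e in \<open>auto simp: wds_iff\<close>)
    then have "weq n (t # w) (rev [3..<Suc (j - 1)] @ e)" using tw unfolding r by (auto intro: weq_trans)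
    then have "spiral (t # w) (j - 1)" using 3 e unfolding spiral_def by auto
    then show ?thesis ..
  next
    case 4
    have DE: "rev [3..<Suc n] = n # rev [3..<n]" using n by simp
    have E: "[3..<Suc n] \<in> wds n" "rev [3..<n] \<in> wds n" by (auto simp: wds_iff)
    let ?e = "[3..<Suc n] @ e"
    have "weq n ((rev [3..<Suc n] @ [3..<Suc n]) @ e) ([] @ e)" by (intro weq_append weq_inverse' weq_refl E ew)
    then have "weq n e (n # rev [3..<n] @ ?e)" using weq_sym by (simp add: DE del: upt_Suc)
    then have "weq n (n # e) (n # n # (rev [3..<n] @ ?e))" by (rule weq_Cons) (use n in auto)
    also have "weq n \<dots> (rev [3..<n] @ ?e)" by (rule weq_cancel_Cons) (use n E ew in \<open>auto simp del: upt_Suc\<close>)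
    finally have "weq n (t # w) (rev [3..<Suc (n - 1)] @ ?e)" using tw 4 n by (auto intro: weq_trans simp del: upt_Suc simp: Suc_diff_1)
    moreover have "powD n ?e" by (rule powD_step[OF e(1)]) simp
    ultimately have "spiral (t # w) (n - 1)" using n unfolding spiral_def by (intro conjI exI[of _ ?e]) auto
    then show ?thesis ..
  qed
qed

lemma J2_I: "J 2 \<subseteq> I n" using J_I[of n] J_n n by simp

lemma word_J:
  assumes "set h \<subseteq> {3..n}" "distinct_adj h"
  shows "(\<exists>j. spiral h j) \<or> (h \<noteq> [] \<and> (\<forall>z\<in>J 2. evw Q h z \<in> I (hd h) \<inter> Jc (hd h)))"
  using assms
proof (induction h)
  case Nil
  have "spiral [] 2" using n powD_Nil unfolding spiral_def by (intro conjI exI[of _ "[]"]) (auto simp: weq_refl)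
  then show ?case by blast
next
  case (Cons t h)
  have t: "3 \<le> t" "t \<le> n" using Cons.prems by auto
  have h: "set h \<subseteq> {3..n}" "distinct_adj h" using Cons.prems by (auto simp: distinct_adj_Cons)
  from Cons.IH[OF h] show ?case
  proof
    assume "\<exists>j. spiral h j"
    then obtain j where j: "spiral h j" ..
    show ?thesis
    proof (cases "t = Suc j \<or> t = j \<or> (j = 2 \<and> t = n)")
      case True
      then show ?thesis using spiral_step[OF j t] by blast
    next
      case False
      have jn: "2 \<le> j" "j < n" using j by (auto simp: spiral_def)
      \<comment> \<open>The index of an arc containing \<open>J j\<close>; for \<open>j = 2\<close>
        it is the last one, as \<open>J 2\<close> equals \<open>J n\<close>.\<close>
      define s where "s = (if j = 2 then n else j)"
      have s: "3 \<le> s" "s \<le> n" "s \<noteq> t" "J j \<subseteq> I s" using False jn n J_I[of j] J2_I by (auto simp: s_def)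
      have "rf (Q t) (evw Q h z) \<in> I t \<inter> Jc t" if "z \<in> J 2" for z
      proof -
        have y: "evw Q h z \<in> J j" by (rule spiral_J[OF j that])
        have "J j \<subseteq> Jc (t - 1)"
        proof (cases "t = 3")
          case True
          then have "s \<noteq> n" "J j \<subseteq> Ic n" using False jn n s I_Ic[of s n] by (auto simp: s_def)
          then show ?thesis using Ic_Jc[of n] Jc_n True n by auto
        next
          case t3: False
          then have "s \<noteq> t - 1" using False t jn by (auto simp: s_def)
          then have "I s \<subseteq> Ic (t - 1)" using s t t3 by (intro I_Ic) auto
          moreover have "Ic (t - 1) \<subseteq> Jc (t - 1)" by (rule Ic_Jc) (use t t3 in auto)
          ultimately show ?thesis using s by blast
        qed
        then show ?thesis using rf_J(2)[OF t] rf_I[OF t] I_Ic[OF s(1,2) t s(3)] s(4) y by auto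
      qed
      then show ?thesis by auto
    qed
  next
    assume *: "h \<noteq> [] \<and> (\<forall>z\<in>J 2. evw Q h z \<in> I (hd h) \<inter> Jc (hd h))"
    then have "t \<noteq> hd h" "hd h \<in> {3..n}" using Cons.prems hd_mem[OF _ h(1)] by (auto simp: distinct_adj_Cons)
    then show ?thesis using * step_out[of "hd h" t] t by auto
  qed
qed

lemma spiral_out: assumes "spiral h j" "j \<noteq> 2" "z \<in> J 2" shows "evw Q h z \<in> Jc 2"
proof -
  have j: "3 \<le> j" "j < n" using assms by (auto simp: spiral_def)
  then have "J j \<subseteq> Ic n" using J_I[of j] I_Ic[of j n] n by auto
  then show ?thesis using spiral_J[OF assms(1,3)] Ic_Jc[of n] Jc_n n by auto
qed

text \<open>A letter 1 throws the complement of \<open>J 2\<close> into \<open>J 2\<close>, and a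
  block between two letters 1 throws \<open>J 2\<close> back out unless it is a power of the
  amalgamated element, which the hypothesis on \<open>h\<close> excludes.\<close>

lemma word_start:
  assumes "set w \<subseteq> {1} \<union> {3..n}" "distinct_adj w" "z \<in> V"
    "\<And>a h b. w = a @ [1] @ h @ [1] @ b \<Longrightarrow> set h \<subseteq> {3..n} \<Longrightarrow> \<not> powD n h"
    "w = a @ 1 # b"
  shows "evw Q (1 # b) z \<in> J 2"
  using assms(5)
proof (induction b arbitrary: a rule: length_induct)
  case (1 b)
  define h where "h = takeWhile (\<lambda>i. i \<noteq> 1) b"
  define r where "r = dropWhile (\<lambda>i. i \<noteq> 1) b"
  have b: "b = h @ r" unfolding h_def r_def by (rule takeWhile_dropWhile_id[symmetric])
  have "1 \<notin> set h" unfolding h_def by (metis (mono_tags) set_takeWhileD)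
  moreover have "set h \<subseteq> set w" unfolding 1(2) b by auto
  ultimately have h: "set h \<subseteq> {3..n}" using assms(1) by auto
  have dh: "distinct_adj h" using assms(2) unfolding 1(2) b by (auto simp: distinct_adj_append_iff distinct_adj_Cons)
  have "evw Q b z \<in> Jc 2"
  proof (cases r)
    case Nil
    show ?thesis
    proof (cases "h = []")
      case True
      then show ?thesis using Nil b V_Jc[OF assms(3), of 2] n by simp
    next
      case False
      then have "hd h \<in> {3..n}" using hd_mem[OF _ h] by blast
      then show ?thesis using I_Jc2[OF _ _ word_V[OF h dh False assms(3)]] Nil b by auto
    qed
  next
    case (Cons i c)
    then have "i = 1" unfolding r_def by (metis (mono_tags, lifting) dropWhile_eq_Cons_conv)
    then have w: "w = (a @ 1 # h) @ 1 # c" using 1(2) b Cons by simp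
    have y: "evw Q (1 # c) z \<in> J 2" using 1(1) w b Cons by simp
    have np: "\<not> powD n h" using assms(4)[of a h c] w h by simp
    from word_J[OF h dh] have "evw Q h (evw Q (1 # c) z) \<in> Jc 2"
    proof
      assume "\<exists>j. spiral h j"
      then obtain j where j: "spiral h j" ..
      have "j \<noteq> 2"
      proof
        assume "j = 2"
        then have "\<exists>e. powD n e \<and> weq n h e" using j by (simp add: spiral_def)
        then show False using np powD_weq by blast
      qed
      then show ?thesis by (rule spiral_out[OF j _ y])
    next
      assume "h \<noteq> [] \<and> (\<forall>z\<in>J 2. evw Q h z \<in> I (hd h) \<inter> Jc (hd h))"
      moreover from this have "hd h \<in> {3..n}" using hd_mem[OF _ h] by blast
      ultimately show ?thesis using y I_Jc2 by auto
    qed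
    then show ?thesis using b Cons \<open>i = 1\<close> by simp
  qed
  then show ?case using rf1_J by simp
qed

lemma not_distinct_adj_split: "\<not> distinct_adj w \<Longrightarrow> \<exists>a i b. w = a @ [i, i] @ b"
proof (induction w)
  case (Cons x w)
  show ?case
  proof (cases "distinct_adj w")
    case True
    then have "w \<noteq> []" "hd w = x" using Cons.prems by (auto simp: distinct_adj_Cons)
    then have "x # w = [] @ [x, x] @ tl w" by (cases w) auto
    then show ?thesis by blast
  next
    case False
    then obtain a i b where "w = a @ [i, i] @ b" using Cons by blast
    then have "x # w = (x # a) @ [i, i] @ b" by simp
    then show ?thesis by blast
  qed
qed simp

lemma dichotomy_aux:
  assumes "set w \<subseteq> {1} \<union> {3..n}"
  shows "weq n w [] \<or> (\<exists>s\<in>{3..n}. \<forall>z\<in>V. evw Q w z \<in> I s)"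
  using assms
\<comment> \<open>Lexicographic measure: rewriting \<open>[1] @ h @ [1]\<close> may lengthen the
  word but removes two letters 1, and cancelling a pair shortens it without adding any.\<close>
proof (induction w rule: wf_induct_rule[OF wf_measures[of "[\<lambda>w. count_list w (1::nat), length]"]])
  case (1 w)
  have wd: "w \<in> wds n" using 1(2) n by (auto simp: wds_iff)
  have red: ?case if "weq n w w'" "set w' \<subseteq> {1} \<union> {3..n}" "(w', w) \<in> measures [\<lambda>w. count_list w (1::nat), length]" for w'
    using 1(1)[OF that(3,2)] that(1) weq_trans weq_mem(1)[OF that(1)] by blast
  consider (adj) a i b where "w = a @ [i, i] @ b"
    | (pow) a h b where "w = a @ [1] @ h @ [1] @ b" "set h \<subseteq> {3..n}" "powD n h"
    | (ok) "distinct_adj w" "\<And>a h b. w = a @ [1] @ h @ [1] @ b \<Longrightarrow> set h \<subseteq> {3..n} \<Longrightarrow> \<not> powD n h"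
    using not_distinct_adj_split by blast
  then show ?case
  proof cases
    case adj
    show ?thesis
    proof (rule red)
      show "weq n w (a @ b)" unfolding adj by (rule weq_cancel) (use wd adj in auto)
    qed (use 1(2) adj in \<open>auto simp: measures_def\<close>)
  next
    case pow
    obtain h' where h': "weq n ([1] @ h @ [1]) h'" "set h' \<subseteq> {3..n}" using powD_conj[OF pow(3)] n by auto
    show ?thesis
    proof (rule red)
      have "weq n (a @ ([1] @ h @ [1]) @ b) (a @ h' @ b)"
        by (intro weq_append weq_refl h'(1)) (use wd pow in auto)
      then show "weq n w (a @ h' @ b)" unfolding pow by simp
      have "count_list h' 1 = 0" using h'(2) by (auto simp: count_list_0_iff)
      then show "(a @ h' @ b, w) \<in> measures [\<lambda>w. count_list w (1::nat), length]" unfolding pow(1) by simp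
    qed (use 1(2) pow h' in auto)
  next
    case ok
    show ?thesis
    proof (cases "1 \<in> set w")
      case False
      then have w: "set w \<subseteq> {3..n}" using 1(2) by auto
      show ?thesis
      proof (cases "w = []")
        case True
        then show ?thesis by (simp add: weq_refl)
      next
        case False
        then have "hd w \<in> {3..n}" using hd_mem[OF _ w] by blast
        then show ?thesis using word_V[OF w ok(1) False] by blast
      qed
    next
      case True
      then obtain a b where ab: "w = a @ 1 # b" "1 \<notin> set a" using split_list_first by metis
      have a: "set a \<subseteq> {3..n}" "distinct_adj a"
        using ab 1(2) ok(1) by (auto simp: distinct_adj_append_iff)
      have y: "evw Q (1 # b) z \<in> J 2" if "z \<in> V" for z
        by (rule word_start[OF 1(2) ok(1) that _ ab(1)]) (rule ok(2))
      from word_J[OF a] have "\<exists>s\<in>{3..n}. \<forall>y\<in>J 2. evw Q a y \<in> I s"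
      proof
        assume "\<exists>j. spiral a j"
        then obtain j where j: "spiral a j" ..
        then have "2 \<le> j" "j < n" by (auto simp: spiral_def)
        then have "J j \<subseteq> I (if j = 2 then n else j)" "(if j = 2 then n else j) \<in> {3..n}" using J_I[of j] J2_I n by auto
        then show ?thesis using spiral_J[OF j] by blast
      next
        assume *: "a \<noteq> [] \<and> (\<forall>z\<in>J 2. evw Q a z \<in> I (hd a) \<inter> Jc (hd a))"
        then have "hd a \<in> {3..n}" using hd_mem[OF _ a(1)] by blast
        then show ?thesis using * by blast
      qed
      then obtain s where s: "s \<in> {3..n}" "\<And>y. y \<in> J 2 \<Longrightarrow> evw Q a y \<in> I s" by blast
      have "\<forall>z\<in>V. evw Q w z \<in> I s" unfolding ab(1) evw_append using y s(2) by blast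
      then show ?thesis using s(1) by blast
    qed
  qed
qed

lemma dichotomy:
  assumes "w \<in> wds n" shows "weq n w [] \<or> (\<exists>s\<in>{3..n}. \<forall>z\<in>V. evw Q w z \<in> I s)"
proof -
  have "\<exists>w'. weq n w w' \<and> set w' \<subseteq> {1} \<union> {3..n}"
    using assms
  proof (induction w)
    case Nil
    then show ?case by (intro exI[of _ "[]"]) (simp add: weq_refl)
  next
    case (Cons i w)
    then obtain w' where w': "weq n w w'" "set w' \<subseteq> {1} \<union> {3..n}" by auto
    have i: "1 \<le> i" "i \<le> n" using Cons.prems by auto
    show ?case
    proof (cases "i = 2")
      case False
      then show ?thesis using weq_Cons[OF w'(1) i] w'(2) i by (intro exI[of _ "i # w'"]) auto
    next
      case True
      \<comment> \<open>The letter 2 is eliminated: \<open>r\<^sub>2\<close> equals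
        \<open>r\<^sub>3 ... r\<^sub>n r\<^sub>1\<close> by the long relator.\<close>
      have 1: "[1] \<in> wds n" using n by simp
      have "weq n ([3..<Suc n] @ [1]) ([2, 1] @ [1])" by (intro weq_append weq_refl 1 weq_21) (use n in simp)
      also have "weq n ([2, 1] @ [1]) [2]" using weq_cancel[of "[2]" n "[]" 1] n by simp
      finally have "weq n [2] ([3..<Suc n] @ [1])" by (rule weq_sym)
      then have "weq n ([2] @ w) (([3..<Suc n] @ [1]) @ w')" by (intro weq_append w'(1))
      then show ?thesis using True w'(2) by (intro exI[of _ "([3..<Suc n] @ [1]) @ w'"]) auto
    qed
  qed
  then obtain w' where w': "weq n w w'" "set w' \<subseteq> {1} \<union> {3..n}" by blast
  from dichotomy_aux[OF w'(2)] show ?thesis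
    using weq_trans[OF w'(1)] weq_mem(1)[OF w'(1)] by blast
qed

lemma v_V: assumes "2 \<le> j" "j < n" shows "v j \<in> V"
  unfolding V_def
proof (intro CollectI allI impI)
  fix t assume t: "3 \<le> t" "t \<le> n"
  show "v j \<in> Ic t"
  proof (cases "j < t")
    case True
    then have "om (v j) (v (t - 1)) \<ge> 0" "om (v j) (v t) \<ge> 0" using assms t by (auto intro!: om_v_nonneg)
    then show ?thesis using om_swap[of "v j" "v (t - 1)"] by (simp add: Ic_def mult_nonpos_nonneg)
  next
    case False
    then have "om (v (t - 1)) (v j) \<ge> 0" "om (v t) (v j) \<ge> 0" using assms t by (auto intro!: om_v_nonneg)
    then show ?thesis using om_swap[of "v t" "v j"] by (simp add: Ic_def mult_nonneg_nonpos)
  qed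
qed

text \<open>There are \<open>n - 2\<close> arcs, hence at least three endpoints, and one of them is
  not an end of the given arc.\<close>

lemma not_all_I: assumes "3 \<le> s" "s \<le> n" shows "\<exists>j\<in>{2..<n}. om (v (s - 1)) (v j) * om (v j) (v s) < 0"
proof -
  consider "s = 3" | "s = 4" | "s \<ge> 5" using assms by linarith
  then show ?thesis
  proof cases
    case 1
    have "om (v 2) (v 4) > 0" "om (v 3) (v 4) > 0" using om_v_v n by auto
    then have "om (v 2) (v 4) * om (v 4) (v 3) < 0" using om_swap[of "v 3" "v 4"] by (simp add: mult_pos_neg)
    then show ?thesis using 1 n by (intro bexI[of _ 4]) auto
  next
    case 2
    have "om (v 2) (v 3) > 0" "om (v 2) (v 4) > 0" using om_v_v n by auto
    then have "om (v 3) (v 2) * om (v 2) (v 4) < 0" using om_swap[of "v 2" "v 3"] by (simp add: mult_neg_pos)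
    then show ?thesis using 2 n by (intro bexI[of _ 2]) auto
  next
    case 3
    have "om (v 3) (v (s - 1)) > 0" using om_v_v[of 3 "s - 1"] 3 assms n by auto
    moreover have "om (v 3) (v s) > 0" using om_v_v[of 3 s] om_v_n[of 3] 3 assms n by (cases "s = n") auto
    ultimately have "om (v (s - 1)) (v 3) * om (v 3) (v s) < 0" using om_swap[of "v 3" "v (s - 1)"] by (simp add: mult_neg_pos)
    then show ?thesis using n by (intro bexI[of _ 3]) auto
  qed
qed

theorem isolated:
  "\<exists>\<epsilon>>0. \<forall>w\<in>wds n. \<forall>c\<in>{1, -1}. dist (c *\<^sub>R evw Q w 1) 1 < \<epsilon> \<longrightarrow>
     dist (c *\<^sub>R evw Q w \<i>) \<i> < \<epsilon> \<longrightarrow> weq n w []"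
proof -
  \<comment> \<open>A linear map is encoded by the images \<open>p\<close> of \<open>1\<close> and
    \<open>\<i>\<close>; \<open>F s j p < 0\<close> says that it sends \<open>v j\<close> strictly
    outside \<open>I s\<close>, an open condition that the identity satisfies for some
    \<open>j\<close> by \<open>not_all_I\<close>.\<close>
  define F :: "nat \<Rightarrow> nat \<Rightarrow> complex \<times> complex \<Rightarrow> real" where "F = (\<lambda>s j p. om (v (s - 1)) (Re (v j) *\<^sub>R fst p + Im (v j) *\<^sub>R snd p) *
     om (Re (v j) *\<^sub>R fst p + Im (v j) *\<^sub>R snd p) (v s))"
  have cont: "isCont (F s j) p" for s j p
    unfolding F_def om_def isCont_def by (intro tendsto_intros)
  have vj: "v j = Re (v j) *\<^sub>R 1 + Im (v j) *\<^sub>R \<i>" for j by (simp add: complex_eq_iff)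
  have "\<forall>\<^sub>F p in nhds (1, \<i>). \<exists>j\<in>{2..<n}. F s j p < 0" if s: "s \<in> {3..n}" for s
  proof -
    have "3 \<le> s" "s \<le> n" using s by auto
    from not_all_I[OF this] obtain j where j: "j \<in> {2..<n}" "om (v (s - 1)) (v j) * om (v j) (v s) < 0" by blast
    have "F s j (1, \<i>) < 0" unfolding F_def fst_conv snd_conv vj[symmetric] by (rule j(2))
    moreover have "(F s j \<longlongrightarrow> F s j (1, \<i>)) (nhds (1, \<i>))" using cont unfolding isCont_def tendsto_at_iff_tendsto_nhds .
    ultimately have "\<forall>\<^sub>F p in nhds (1, \<i>). F s j p < 0" using order_tendstoD(2) by blast
    then show ?thesis by (rule eventually_mono) (use j in blast)
  qed
  then have "\<forall>\<^sub>F p in nhds (1, \<i>). \<forall>s\<in>{3..n}. \<exists>j\<in>{2..<n}. F s j p < 0"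
    by (intro eventually_ball_finite) auto
  then obtain d where d: "d > 0" "\<And>p. dist p (1, \<i>) < d \<Longrightarrow> \<forall>s\<in>{3..n}. \<exists>j\<in>{2..<n}. F s j p < 0"
    unfolding eventually_nhds_metric by blast
  have "weq n w []" if w: "w \<in> wds n" "dist (c *\<^sub>R evw Q w 1) 1 < d / 2" "dist (c *\<^sub>R evw Q w \<i>) \<i> < d / 2" "c \<in> {1, -1}" for w c
  proof (rule ccontr)
    assume "\<not> weq n w []"
    then obtain s where s: "s \<in> {3..n}" "\<And>z. z \<in> V \<Longrightarrow> evw Q w z \<in> I s" using dichotomy[OF w(1)] by blast
    let ?p = "(c *\<^sub>R evw Q w 1, c *\<^sub>R evw Q w \<i>)"
    have "dist ?p (1, \<i>) \<le> dist (c *\<^sub>R evw Q w 1) 1 + dist (c *\<^sub>R evw Q w \<i>) \<i>"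
      by (simp add: dist_Pair_Pair sqrt_sum_squares_le_sum)
    also have "\<dots> < d" using w by simp
    finally obtain j where j: "j \<in> {2..<n}" "F s j ?p < 0" using d(2) s(1) by blast
    have e: "evw Q w (c *\<^sub>R v j) = Re (v j) *\<^sub>R (c *\<^sub>R evw Q w 1) + Im (v j) *\<^sub>R (c *\<^sub>R evw Q w \<i>)"
      by (subst vj) (simp add: scaleR_add_right mult.commute)
    have "om (v (s - 1)) (evw Q w (c *\<^sub>R v j)) * om (evw Q w (c *\<^sub>R v j)) (v s) < 0" using j(2) unfolding F_def fst_conv snd_conv e[symmetric] .
    then show False using s(2)[OF v_V, of j] j(1) w(4) by (auto simp: I_def)
  qed
  then show ?thesis using d(1) by (intro exI[of _ "d / 2"]) simp
qed

end

text \<open>Discreteness and faithfulness in one condition: a word whose action is close to 1 or -1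
  is already trivial in the abstract group.\<close>

definition isolated_id :: "nat \<Rightarrow> (nat \<Rightarrow> mvec) \<Rightarrow> bool" where
  "isolated_id n Q \<longleftrightarrow> (\<exists>\<epsilon>>0. \<forall>w\<in>wds n. \<forall>c\<in>{1, -1}. dist (c *\<^sub>R evw Q w 1) 1 < \<epsilon> \<longrightarrow>
     dist (c *\<^sub>R evw Q w \<i>) \<i> < \<epsilon> \<longrightarrow> weq n w [])"

lemma isolated_id_mir: assumes "isolated_id n (\<lambda>i. mir (Q i))" shows "isolated_id n Q"
proof -
  obtain e where e: "e > 0" "\<And>w c. w \<in> wds n \<Longrightarrow> c \<in> {1, -1} \<Longrightarrow>
    dist (c *\<^sub>R evw (\<lambda>i. mir (Q i)) w 1) 1 < e \<Longrightarrow> dist (c *\<^sub>R evw (\<lambda>i. mir (Q i)) w \<i>) \<i> < e \<Longrightarrow> weq n w []"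
    using assms unfolding isolated_id_def by blast
  show ?thesis unfolding isolated_id_def
  proof (intro exI[of _ e] conjI ballI impI e(1))
    fix w and c :: real assume w: "w \<in> wds n" "c \<in> {1, -1}"
      "dist (c *\<^sub>R evw Q w 1) 1 < e" "dist (c *\<^sub>R evw Q w \<i>) \<i> < e"
    obtain s where s: "s = 1 \<or> s = (-1::real)" "\<And>z. evw (\<lambda>i. mir (Q i)) w z = s *\<^sub>R cnj (evw Q w (cnj z))"
      using evw_mir[of Q w] unfolding pm_def by (metis scaleR_minus1_left scaleR_one)
    have ss: "s * s = 1" using s(1) by auto
    have 1: "(c * s) *\<^sub>R evw (\<lambda>i. mir (Q i)) w 1 = cnj (c *\<^sub>R evw Q w 1)"
      using ss by (simp add: s(2) mult.assoc)
    have "(c * s) *\<^sub>R evw (\<lambda>i. mir (Q i)) w \<i> = - cnj (c *\<^sub>R evw Q w \<i>)"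
      using ss by (simp add: s(2) mult.assoc)
    then have 2: "(c * s) *\<^sub>R evw (\<lambda>i. mir (Q i)) w \<i> - \<i> = - cnj (c *\<^sub>R evw Q w \<i> - \<i>)" by simp
    have "cmod (cnj (c *\<^sub>R evw Q w 1) - 1) = cmod (cnj (c *\<^sub>R evw Q w 1 - 1))" by simp
    then have "dist ((c * s) *\<^sub>R evw (\<lambda>i. mir (Q i)) w 1) 1 < e"
      using w(3) unfolding 1 dist_norm by (simp only: complex_mod_cnj)
    moreover have "dist ((c * s) *\<^sub>R evw (\<lambda>i. mir (Q i)) w \<i>) \<i> < e"
      using w(4) unfolding dist_norm 2 by (simp only: complex_mod_cnj norm_minus_cancel)
    moreover have "c * s \<in> {1, -1}" using s(1) w(2) by auto
    ultimately show "weq n w []" using e(2)[OF w(1)] by blast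
  qed
qed

lemma turning_2pi_ping_pong:
  assumes n: "n \<ge> 5" and cl: "closing (tuple n Q)" and t: "\<And>z. z \<noteq> 0 \<Longrightarrow> turning (tuple n Q) z = 2 * pi"
  shows "\<exists>u l. ping_pong n Q u l"
proof -
  have sp: "tuple n Q = [Q 1, Q 2] @ map Q [3..<Suc n]"
    unfolding tuple_def by (subst upt_split) (use n in simp_all)
  have h: "Q 1 \<in> hyp" "Q 2 \<in> hyp" using closing_tuple_hyp[OF cl] n by auto
  have hj: "set (map Q [i..<j]) \<subseteq> hyp" if "1 \<le> i" "j \<le> Suc n" for i j
    using closing_tuple_hyp[OF cl] that by auto
  have ne: "Q 1 \<noteq> Q 2"
  proof
    assume eq: "Q 1 = Q 2"
    obtain c where c: "c = 1 \<or> c = (-1::real)" "\<And>z. run (tuple n Q) z = c *\<^sub>R z"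
      using closing_sign[OF cl] by metis
    have c1: "closing [Q 1, Q 2]" using h by (simp add: closing_def eq[simplified] rf_rf_hyp)
    have r2: "run (map Q [3..<Suc n]) z = - (c *\<^sub>R z)" for z
      using c(2)[of "- z"] unfolding sp by (simp add: eq[simplified] rf_rf_hyp[OF h(2)] del: upt_Suc)
    have c2: "closing ([] @ map Q [3..<Suc n])"
      unfolding closing_def using hj[of 3 "Suc n"] r2 c(1) by (auto simp del: upt_Suc)
    have "\<not> extremal ([] @ [Q 1, Q 2] @ map Q [3..<Suc n])"
      by (rule not_extremal_insert[OF c1 c2]) (use n in auto)
    moreover have "extremal (tuple n Q)" using cl t by (simp add: extremal_def)
    ultimately show False using sp by simp
  qed
  obtain l u where lu: "l > 1" "u \<noteq> 0" "run [Q 1, Q 2] u = - (l *\<^sub>R u)" by (rule eigen_pair[OF h ne]) blast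
  have pos: "om u (run (map Q [3..<Suc j]) u) > 0" if j: "3 \<le> j" "j < n" for j
  proof -
    let ?a = "[Q 1, Q 2] @ map Q [3..<Suc j]" and ?b = "map Q [Suc j..<Suc n]"
    have "[3..<Suc n] = [3..<Suc j] @ [Suc j..<Suc n]" using j upt_add_eq_append[of 3 "Suc j" "n - j"] by simp
    then have split: "tuple n Q = ?a @ ?b" by (simp add: sp del: upt_Suc)
    have ha: "set ?a \<subseteq> hyp" "set ?b \<subseteq> hyp" using h hj[of 3 "Suc j"] hj[of "Suc j" "Suc n"] j by (auto simp del: upt_Suc)
    have w: "run ?a u \<noteq> 0" by (rule run_nonzero[OF ha(1) lu(2)])
    have "?b \<noteq> []" using j by (simp del: upt_Suc)
    then have "turning ?b (run ?a u) > 0" by (rule turning_pos[OF ha(2) w])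
    then have up: "turning ?a u < 2 * pi" using t[OF lu(2)] unfolding split turning_append[of ?a ?b] by simp
    have "turning [Q 1, Q 2] u = pi" using turning_pair_eigen(1)[OF h lu(2), of "- l"] lu(3) by simp
    moreover have "turning (map Q [3..<Suc j]) (run [Q 1, Q 2] u) > 0"
      by (rule turning_pos) (use j ha run_nonzero[of "[Q 1, Q 2]" u] h lu in \<open>auto simp del: upt_Suc run.simps\<close>)
    ultimately have lo: "turning ?a u > pi" by (simp only: turning_append)
    obtain r where r: "r > 0" "run ?a u = of_real r * cis (turning ?a u) * u"
      using run_polar[OF ha(1) lu(2)] by blast
    \<comment> \<open>The angle lies strictly between \<pi> and 2\<pi>; removing the factor
      \<open>- l\<close> contributed by the first two reflections moves the vector to the left of
      \<open>u\<close>.\<close>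
    have "sin (turning ?a u) < 0" using lo up by (rule sin_lt_zero)
    moreover have "om u (run ?a u) = r * sin (turning ?a u) * ((Re u)\<^sup>2 + (Im u)\<^sup>2)"
      unfolding r(2) by (simp add: om_def power2_eq_square algebra_simps)
    moreover have "(Re u)\<^sup>2 + (Im u)\<^sup>2 > 0" using lu(2) by (simp add: complex_eq_iff sum_power2_gt_zero_iff)
    ultimately have "om u (run ?a u) < 0" using r(1) by (simp add: mult_pos_neg mult_neg_pos)
    moreover have "run ?a u = - (l *\<^sub>R run (map Q [3..<Suc j]) u)"
      unfolding run_append lu(3) by simp
    ultimately show ?thesis using lu(1) by (simp add: zero_less_mult_iff)
  qed
  have "ping_pong n Q u l" by unfold_locales (use n cl lu pos in auto)
  then show ?thesis by blast
qed

theorem extremal_isolated: assumes "n \<ge> 5" "extremal (tuple n Q)" shows "isolated_id n Q"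
proof -
  have cl: "closing (tuple n Q)" using assms(2) by (simp add: extremal_def)
  have *: "isolated_id n Q" if cl: "closing (tuple n Q)" and t: "\<And>z. z \<noteq> 0 \<Longrightarrow> turning (tuple n Q) z = 2 * pi" for Q
  proof -
    obtain u l where "ping_pong n Q u l" using turning_2pi_ping_pong[OF assms(1) cl t] by blast
    then show ?thesis unfolding isolated_id_def by (rule ping_pong.isolated)
  qed
  from assms(2) have "(\<forall>z. z \<noteq> 0 \<longrightarrow> turning (tuple n Q) z = 2 * pi) \<or> (\<forall>z. z \<noteq> 0 \<longrightarrow> turning (tuple n (\<lambda>i. mir (Q i))) z = 2 * pi)"
    by (simp add: extremal_def tuple_mir)
  then show ?thesis
  proof
    assume "\<forall>z. z \<noteq> 0 \<longrightarrow> turning (tuple n (\<lambda>i. mir (Q i))) z = 2 * pi"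
    then have "isolated_id n (\<lambda>i. mir (Q i))" using *[of "\<lambda>i. mir (Q i)"] cl by (simp add: tuple_mir)
    then show ?thesis by (rule isolated_id_mir)
  qed (use * cl in blast)
qed

section \<open>Braid moves and the orientation of triples\<close>

text \<open>The points \<open>r\<close> and \<open>s\<close> lie strictly on the same side of the line through \<open>p\<close> and \<open>q\<close>.\<close>

definition coherent :: "mvec list \<Rightarrow> bool" where
  "coherent Qs \<longleftrightarrow> (\<forall>a p q r s b. Qs = a @ [p, q, r, s] @ b \<longrightarrow> tri p q r * tri p q s > 0)"

definition braid_closed :: "mvec list set \<Rightarrow> bool" where
  "braid_closed S \<longleftrightarrow> (\<forall>a p q b. a @ [p, q] @ b \<in> S \<longrightarrow> a @ [q, hrefl q p] @ b \<in> S \<and> a @ [hrefl p q, p] @ b \<in> S)"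

lemma braidD: assumes "braid_closed S" "a @ [p, q] @ b \<in> S"
  shows "a @ [q, hrefl q p] @ b \<in> S" "a @ [hrefl p q, p] @ b \<in> S"
  using assms unfolding braid_closed_def by blast+

lemma tri_hrefl [simp]:
  "tri x q (hrefl q p) = tri x p q" "tri q (hrefl q p) x = tri p q x"
  "tri x (hrefl p q) p = tri x p q" "tri (hrefl p q) p x = tri p q x"
  by (simp_all add: hrefl_def tri_swap(1)[of q p x] tri_swap(2)[of x q p])

text \<open>Repeating the braid move on a pair moves it along its line.\<close>

fun vseq :: "mvec \<Rightarrow> mvec \<Rightarrow> nat \<Rightarrow> mvec" where
  "vseq p q 0 = p" | "vseq p q (Suc 0) = q" | "vseq p q (Suc (Suc k)) = hrefl (vseq p q (Suc k)) (vseq p q k)"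

lemma vseq_in:
  assumes "braid_closed S" "a @ [p, q] @ b \<in> S" shows "a @ [vseq p q k, vseq p q (Suc k)] @ b \<in> S"
proof (induction k)
  case (Suc k)
  then show ?case using braidD(1)[OF assms(1) Suc] by simp
qed (use assms in simp)

lemma vseq_tri: "tri x (vseq p q k) (vseq p q (Suc k)) = tri x p q" "tri (vseq p q k) (vseq p q (Suc k)) x = tri p q x"
  by (induction k) simp_all

locale braid_set =
  fixes S :: "mvec list set"
  assumes S: "braid_closed S"
    and Sc: "\<And>Qs. Qs \<in> S \<Longrightarrow> closing Qs" and Sl: "\<And>Qs. Qs \<in> S \<Longrightarrow> length Qs \<ge> 5"
    and SY: "\<And>Qs. Qs \<in> S \<Longrightarrow> coherent Qs"
begin

lemma Sh: "Qs \<in> S \<Longrightarrow> x \<in> set Qs \<Longrightarrow> x \<in> hyp"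
  using Sc by (auto simp: closing_def)

text \<open>Moving the middle pair along its line keeps \<open>A\<close> and \<open>B\<close>, and
  coherence keeps \<open>A * g k\<close> positive. If \<open>A * B\<close> were not positive, each
  move would lower \<open>A * g k\<close> by at least \<open>A * A\<close>, which cannot go on
  forever.\<close>

lemma no_zigzag: assumes "a @ [p, q, r, s] @ b \<in> S" shows "tri p q r * tri q r s > 0"
proof (rule ccontr)
  define A where "A = tri p q r"
  define B where "B = tri q r s"
  define v where "v = vseq q r"
  define g where "g k = tri p (v k) s" for k
  assume "\<not> tri p q r * tri q r s > 0"
  then have AB: "A * B \<le> 0" by (simp add: A_def B_def)
  have "(a @ [p]) @ [q, r] @ ([s] @ b) \<in> S" using assms by simp
  then have "(a @ [p]) @ [v k, v (Suc k)] @ ([s] @ b) \<in> S" for k unfolding v_def by (rule vseq_in[OF S])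
  then have mem: "a @ [p, v k, v (Suc k), s] @ b \<in> S" for k by simp
  have tA: "tri p (v k) (v (Suc k)) = A" and tB: "tri (v k) (v (Suc k)) s = B" for k
    by (simp_all add: v_def vseq_tri A_def B_def)
  have g: "A * g k > 0" for k using SY[OF mem[of k]] tA[of k] unfolding coherent_def g_def by metis
  then have A0: "A * A > 0" by (metis mult_zero_left less_irrefl not_real_square_gt_zero)
  have h: "p \<in> hyp" "v (Suc k) \<in> hyp" "v k \<in> hyp" "s \<in> hyp" for k using Sh[OF mem[of k]] by auto
  have step: "A * g k \<ge> A * g (Suc k) + A * A" for k
  proof -
    have "tri (v k) (v (Suc k)) s *\<^sub>R p - tri p (v (Suc k)) s *\<^sub>R v k + tri p (v k) s *\<^sub>R v (Suc k) - tri p (v k) (v (Suc k)) *\<^sub>R s = 0"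
      by (rule cramer4)
    then have "mk (B *\<^sub>R p - g (Suc k) *\<^sub>R v k + g k *\<^sub>R v (Suc k) - A *\<^sub>R s) (v (Suc k)) = 0"
      unfolding tA tB g_def by simp
    then have e: "g k = g (Suc k) * mk (v k) (v (Suc k)) + A * mk s (v (Suc k)) - B * mk p (v (Suc k))"
      using h(2)[of k] by (simp add: hypD)
    have 1: "mk (v k) (v (Suc k)) \<ge> 1" "mk s (v (Suc k)) \<ge> 1" "mk p (v (Suc k)) \<ge> 1"
      using h by (auto intro!: mk_ge_1)
    have "A * g k = (A * g (Suc k)) * mk (v k) (v (Suc k)) + (A * A) * mk s (v (Suc k)) - (A * B) * mk p (v (Suc k))"
      unfolding e by (simp add: algebra_simps)
    moreover have "(A * g (Suc k)) * mk (v k) (v (Suc k)) \<ge> (A * g (Suc k)) * 1"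
      using g[of "Suc k"] 1 by (intro mult_left_mono) auto
    moreover have "(A * A) * mk s (v (Suc k)) \<ge> (A * A) * 1" using A0 1 by (intro mult_left_mono) auto
    moreover have "(A * B) * mk p (v (Suc k)) \<le> 0" by (rule mult_nonpos_nonneg[OF AB]) (use 1(3) in linarith)
    ultimately show ?thesis by linarith
  qed
  have "A * g 0 \<ge> A * g k + real k * (A * A)" for k
  proof (induction k)
    case (Suc k)
    then show ?case using step[of k] by (simp add: algebra_simps)
  qed simp
  then have "real k * (A * A) < A * g 0" for k using g[of k] by (smt (verit))
  then show False using reals_Archimedean3[OF A0] by (metis less_asym)
qed

definition tr :: "mvec list \<Rightarrow> nat \<Rightarrow> real" where "tr Qs i = tri (Qs ! i) (Qs ! Suc i) (Qs ! Suc (Suc i))"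

lemma split4: assumes "Suc (Suc (Suc i)) < length Qs"
  shows "Qs = take i Qs @ [Qs ! i, Qs ! Suc i, Qs ! Suc (Suc i), Qs ! Suc (Suc (Suc i))] @ drop (Suc (Suc (Suc (Suc i)))) Qs"
  using assms by (simp add: Cons_nth_drop_Suc)

lemma tr_sign: assumes "Qs \<in> S" "Suc (Suc i) < length Qs" shows "tr Qs 0 * tr Qs i > 0"
  using assms(2)
proof (induction i)
  case 0
  have "take 0 Qs @ [Qs ! 0, Qs ! Suc 0, Qs ! Suc (Suc 0), Qs ! Suc (Suc (Suc 0))] @ drop (Suc (Suc (Suc (Suc 0)))) Qs \<in> S"
    using split4[of 0 Qs] Sl[OF assms(1)] assms(1) by simp
  from no_zigzag[OF this] have "tr Qs 0 \<noteq> 0" by (auto simp: tr_def)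
  then show ?case by (metis not_real_square_gt_zero)
next
  case (Suc i)
  have "take i Qs @ [Qs ! i, Qs ! Suc i, Qs ! Suc (Suc i), Qs ! Suc (Suc (Suc i))] @ drop (Suc (Suc (Suc (Suc i)))) Qs \<in> S"
    using split4[of i Qs] Suc.prems assms(1) by simp
  from no_zigzag[OF this] have "tr Qs i * tr Qs (Suc i) > 0" by (simp add: tr_def)
  moreover have "tr Qs 0 * tr Qs i > 0" using Suc by simp
  ultimately show ?case by (auto simp: zero_less_mult_iff)
qed

definition Sp :: "mvec list set" where "Sp = {Qs \<in> S. tr Qs 0 > 0}"

lemma tr_append: "tr (a @ p # q # r # b) (length a) = tri p q r"
  by (simp add: tr_def nth_append)

lemma Sp_tri: assumes "a @ [p, q, r] @ b \<in> Sp" shows "tri p q r > 0"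
proof -
  have "tr (a @ p # q # r # b) 0 * tr (a @ p # q # r # b) (length a) > 0"
    by (rule tr_sign) (use assms in \<open>auto simp: Sp_def\<close>)
  then show ?thesis using assms unfolding tr_append by (simp add: Sp_def zero_less_mult_iff)
qed

lemma SpI: assumes "a @ [p, q, r] @ b \<in> S" "tri p q r > 0" shows "a @ [p, q, r] @ b \<in> Sp"
proof -
  have "tr (a @ p # q # r # b) 0 * tr (a @ p # q # r # b) (length a) > 0"
    by (rule tr_sign) (use assms in auto)
  then show ?thesis using assms unfolding tr_append by (simp add: Sp_def zero_less_mult_iff)
qed

lemma Sp_braid: "braid_closed Sp"
  unfolding braid_closed_def
proof (intro allI impI)
  fix a p q b assume m: "a @ [p, q] @ b \<in> Sp"
  then have mS: "a @ [p, q] @ b \<in> S" by (simp add: Sp_def)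
  note n = braidD[OF S mS]
  show "a @ [q, hrefl q p] @ b \<in> Sp \<and> a @ [hrefl p q, p] @ b \<in> Sp"
  proof (cases b)
    case (Cons r c)
    have "tri p q r > 0" using Sp_tri[of a p q r c] m Cons by simp
    then show ?thesis using SpI[of a q "hrefl q p" r c] SpI[of a "hrefl p q" p r c] n Cons by simp
  next
    case Nil
    have "a \<noteq> []" using Sl[OF mS] Nil by auto
    then obtain c x where a: "a = c @ [x]" by (metis rev_exhaust)
    have "tri x p q > 0" using Sp_tri[of c x p q "[]"] m Nil a by simp
    then show ?thesis using SpI[of c x q "hrefl q p" "[]"] SpI[of c x "hrefl p q" p "[]"] n Nil a by simp
  qed
qed

text \<open>Braid moves carry \<open>p\<close> and \<open>r\<close> past the points in between
  without changing them, which reduces the claim to consecutive points.\<close>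

lemma Sp_all: "a @ p # b @ q # c @ r # d \<in> Sp \<Longrightarrow> tri p q r > 0"
proof (induction "length b + length c" arbitrary: a b c d rule: less_induct)
  case less
  show ?case
  proof (cases b)
    case (Cons x b')
    have "a @ [p, x] @ (b' @ q # c @ r # d) \<in> Sp" using less(2) Cons by simp
    from braidD(2)[OF Sp_braid this] have "(a @ [hrefl p x]) @ p # b' @ q # c @ r # d \<in> Sp" by simp
    then show ?thesis by (rule less(1)[rotated]) (simp add: Cons)
  next
    case b: Nil
    show ?thesis
    proof (cases c rule: rev_cases)
      case Nil
      then show ?thesis using Sp_tri[of a p q r d] less(2) b by simp
    next
      case (snoc c' y)
      have "(a @ p # b @ q # c') @ [y, r] @ d \<in> Sp" using less(2) snoc by simp
      from braidD(1)[OF Sp_braid this] have "a @ p # b @ q # c' @ r # (hrefl r y # d) \<in> Sp" by simp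
      then show ?thesis by (rule less(1)[rotated]) (simp add: snoc)
    qed
  qed
qed

end

section \<open>Limits of braid moves at the end of a line\<close>

primrec hrun :: "mvec list \<Rightarrow> mvec \<Rightarrow> mvec" where
  "hrun [] v = v" | "hrun (x # m) v = hrun m (hrefl x v)"

lemma hrun_simps [simp]: "hrun m (u + v) = hrun m u + hrun m v" "hrun m (u - v) = hrun m u - hrun m v"
  "hrun m (r *\<^sub>R u) = r *\<^sub>R hrun m u"
  by (induction m arbitrary: u v) auto

lemma nullv_run: "set m \<subseteq> hyp \<Longrightarrow> nullv (run m z) = hrun m (nullv z)"
  by (induction m arbitrary: z) (auto simp: nullv_rf hypD)

text \<open>The sequence satisfies a linear recursion with characteristic roots \<open>l\<close> and
  \<open>1 / l\<close>; each combination isolates one root.\<close>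

lemma vseq_closed_form:
  assumes "mk p p = 1" "mk q q = 1" "l > 0" "l + 1 / l = 2 * mk p q"
  shows "vseq p q (Suc k) - (1 / l) *\<^sub>R vseq p q k = l ^ k *\<^sub>R (q - (1 / l) *\<^sub>R p)"
    "vseq p q (Suc k) - l *\<^sub>R vseq p q k = (1 / l) ^ k *\<^sub>R (q - l *\<^sub>R p)"
proof -
  have inv: "mk (vseq p q k) (vseq p q k) = 1 \<and> mk (vseq p q (Suc k)) (vseq p q (Suc k)) = 1 \<and> mk (vseq p q k) (vseq p q (Suc k)) = mk p q" for k
  proof (induction k)
    case (Suc k)
    then show ?case using mk_refl[of "vseq p q (Suc k)" "vseq p q (Suc k)" "vseq p q k"]
      by (simp add: mk_refl hrefl_self mk_sym)
  qed (use assms in simp)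
  have rec: "vseq p q (Suc (Suc k)) = (l + 1 / l) *\<^sub>R vseq p q (Suc k) - vseq p q k" for k
    using inv[of k] assms(4) by (simp add: hrefl_def mk_sym)
  show "vseq p q (Suc k) - (1 / l) *\<^sub>R vseq p q k = l ^ k *\<^sub>R (q - (1 / l) *\<^sub>R p)"
  proof (induction k)
    case (Suc k)
    have "vseq p q (Suc (Suc k)) - (1 / l) *\<^sub>R vseq p q (Suc k) = l *\<^sub>R (vseq p q (Suc k) - (1 / l) *\<^sub>R vseq p q k)"
      unfolding rec using assms(3) by (simp add: algebra_simps)
    then show ?case unfolding Suc by simp
  qed simp
  show "vseq p q (Suc k) - l *\<^sub>R vseq p q k = (1 / l) ^ k *\<^sub>R (q - l *\<^sub>R p)"
  proof (induction k)
    case (Suc k)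
    have "vseq p q (Suc (Suc k)) - l *\<^sub>R vseq p q (Suc k) = (1 / l) *\<^sub>R (vseq p q (Suc k) - l *\<^sub>R vseq p q k)"
      unfolding rec using assms(3) by (simp add: algebra_simps)
    then show ?case unfolding Suc by simp
  qed simp
qed

text \<open>As \<open>k\<close> grows, \<open>v\<^sub>k\<close> and \<open>v\<^sub>k\<^sub>+\<^sub>1\<close> approach the same end of the line, represented by
  the null vector \<open>E\<close>.\<close>

lemma tri_limit:
  assumes "mk p p = 1" "mk q q = 1" "l > 1" "l + 1 / l = 2 * mk p q"
    and pos: "\<And>k. tri (vseq p q k) (hrun m (vseq p q (Suc k))) s > 0"
  shows "tri (q - (1 / l) *\<^sub>R p) (hrun m (q - (1 / l) *\<^sub>R p)) s \<ge> 0"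
proof (rule ccontr)
  define E where "E = q - (1 / l) *\<^sub>R p"
  define F where "F = q - l *\<^sub>R p"
  define c where "c = l - 1 / l"
  have c: "c > 0" using assms(3) by (simp add: c_def field_simps) (smt (verit) less_1_mult)
  assume "\<not> tri (q - (1 / l) *\<^sub>R p) (hrun m (q - (1 / l) *\<^sub>R p)) s \<ge> 0"
  then have t: "tri E (hrun m E) s < 0" by (simp add: E_def)
  have l0: "l > 0" using assms(3) by simp
  have v: "c *\<^sub>R vseq p q k = l ^ k *\<^sub>R E - (1 / l) ^ k *\<^sub>R F"
    "c *\<^sub>R vseq p q (Suc k) = (l * l ^ k) *\<^sub>R E - ((1 / l) * (1 / l) ^ k) *\<^sub>R F" for k
  proof -
    note e = vseq_closed_form[OF assms(1,2) l0 assms(4), of k, folded E_def F_def]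
    show "c *\<^sub>R vseq p q k = l ^ k *\<^sub>R E - (1 / l) ^ k *\<^sub>R F"
      unfolding e[symmetric] c_def by (simp add: algebra_simps)
    have "(l * l ^ k) *\<^sub>R E - ((1 / l) * (1 / l) ^ k) *\<^sub>R F = l *\<^sub>R (l ^ k *\<^sub>R E) - (1 / l) *\<^sub>R ((1 / l) ^ k *\<^sub>R F)" by simp
    then show "c *\<^sub>R vseq p q (Suc k) = (l * l ^ k) *\<^sub>R E - ((1 / l) * (1 / l) ^ k) *\<^sub>R F"
      unfolding e[symmetric] c_def using l0 by (simp add: algebra_simps)
  qed
  \<comment> \<open>The terms with \<open>F\<close>, the other end of the line, stay bounded by
    \<open>C\<close>, while the leading term grows like the square of \<open>l ^ k\<close>;
    \<open>k\<close> is chosen to make it dominate.\<close>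
  define C where "C = \<bar>tri E (hrun m F) s\<bar> + l * \<bar>tri F (hrun m E) s\<bar> + \<bar>tri F (hrun m F) s\<bar>"
  obtain k where k: "C / (- tri E (hrun m E) s) < l ^ k" using real_arch_pow[OF assms(3)] by blast
  define x y where "x = l ^ k" "y = (1 / l) ^ k"
  have xy: "x * y = 1" "x \<ge> 1" "0 < y" "y \<le> 1"
    using l0 assms(3) by (auto simp: x_y_def power_one_over power_le_one)
  have "c * (c * tri (vseq p q k) (hrun m (vseq p q (Suc k))) s) = tri (c *\<^sub>R vseq p q k) (hrun m (c *\<^sub>R vseq p q (Suc k))) s"
    by simp
  also have "\<dots> = tri (x *\<^sub>R E - y *\<^sub>R F) (hrun m ((l * x) *\<^sub>R E - ((1 / l) * y) *\<^sub>R F)) s"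
    by (simp only: v x_y_def power_Suc)
  also have "\<dots> = l * x * x * tri E (hrun m E) s - (x * y) * (1 / l) * tri E (hrun m F) s
      - (x * y) * l * tri F (hrun m E) s + y * y * (1 / l) * tri F (hrun m F) s"
    by (simp add: algebra_simps)
  finally have e: "c * (c * tri (vseq p q k) (hrun m (vseq p q (Suc k))) s) =
     l * x * x * tri E (hrun m E) s - (1 / l) * tri E (hrun m F) s - l * tri F (hrun m E) s + y * y * (1 / l) * tri F (hrun m F) s"
    by (simp add: xy)
  have il: "0 \<le> 1 / l" "1 / l \<le> 1" using assms(3) by auto
  have "- ((1 / l) * tri E (hrun m F) s) \<le> (1 / l) * \<bar>tri E (hrun m F) s\<bar>"
    using il mult_left_mono[of "- tri E (hrun m F) s" "\<bar>tri E (hrun m F) s\<bar>" "1 / l"] by simp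
  also have "\<dots> \<le> \<bar>tri E (hrun m F) s\<bar>" using il by (intro mult_left_le_one_le) auto
  finally have 1: "- ((1 / l) * tri E (hrun m F) s) \<le> \<bar>tri E (hrun m F) s\<bar>" .
  have 2: "- (l * tri F (hrun m E) s) \<le> l * \<bar>tri F (hrun m E) s\<bar>"
    using l0 mult_left_mono[of "- tri F (hrun m E) s" "\<bar>tri F (hrun m E) s\<bar>" l] by simp
  have "y * y \<le> 1" using xy by (intro mult_le_one) auto
  then have yy: "0 \<le> y * y * (1 / l)" "y * y * (1 / l) \<le> 1"
    using mult_nonneg_nonneg[of "y * y" "1 / l"] mult_le_one[of "y * y" "1 / l"] xy(3) il by auto
  have "y * y * (1 / l) * tri F (hrun m F) s \<le> (y * y * (1 / l)) * \<bar>tri F (hrun m F) s\<bar>"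
    using yy mult_left_mono[of "tri F (hrun m F) s" "\<bar>tri F (hrun m F) s\<bar>" "y * y * (1 / l)"] by linarith
  also have "\<dots> \<le> \<bar>tri F (hrun m F) s\<bar>" using yy by (intro mult_left_le_one_le) auto
  finally have 3: "y * y * (1 / l) * tri F (hrun m F) s \<le> \<bar>tri F (hrun m F) s\<bar>" .
  have "C < x * (- tri E (hrun m E) s)" using k t pos_divide_less_eq[of "- tri E (hrun m E) s" C "l ^ k"] unfolding x_y_def by linarith
  moreover have "x * (- tri E (hrun m E) s) \<le> (l * x * x) * (- tri E (hrun m E) s)"
  proof (rule mult_right_mono)
    have "1 * 1 \<le> l * x" using assms(3) xy(2) by (intro mult_mono) auto
    then have "1 * x \<le> (l * x) * x" using xy(2) by (intro mult_right_mono) auto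
    then show "x \<le> l * x * x" by simp
  qed (use t in simp)
  ultimately have "c * (c * tri (vseq p q k) (hrun m (vseq p q (Suc k))) s) < 0"
    unfolding e using 1 2 3 by (simp add: C_def)
  then show False using c pos[of k] by (simp add: mult_less_0_iff)
qed

lemma turning_scale: assumes "c \<noteq> 0" shows "turning qs (c *\<^sub>R z) = turning qs z"
proof (induction qs arbitrary: z)
  case (Cons q qs)
  have "rf q (c *\<^sub>R z) / (c *\<^sub>R z) = rf q z / z" unfolding rf_simps(3) using assms by (simp add: scaleR_conv_of_real)
  then show ?case using Cons by simp
qed simp

text \<open>A prefix of \<open>rest\<close> cannot turn \<open>u\<close> beyond \<pi> without a
  vector to the right of \<open>u\<close> or on its line being met, since one reflection adds less
  than \<pi>. The whole of \<open>rest\<close> returns to the line of \<open>u\<close>, hence turns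
  it by exactly \<pi>, and so do the first two reflections.\<close>

lemma turning_2pi:
  assumes cl: "closing ([p, q] @ rest)" and len: "length rest \<ge> 2"
    and u: "u \<noteq> 0" "run [p, q] u = - (l *\<^sub>R u)" "l > 0"
    and om: "\<And>m d. rest = m @ d \<Longrightarrow> m \<noteq> [] \<Longrightarrow> d \<noteq> [] \<Longrightarrow> om u (run m u) > 0"
  shows "turning ([p, q] @ rest) u = 2 * pi"
proof -
  have hpq: "p \<in> hyp" "q \<in> hyp" and hr: "set rest \<subseteq> hyp" using cl by (auto simp: closing_def)
  have pre: "0 < turning m u \<and> turning m u < pi" if "rest = m @ d" "m \<noteq> []" "d \<noteq> []" for m d
    using that
  proof (induction m arbitrary: d rule: rev_induct)
    case (snoc s m)
    have hm: "set m \<subseteq> hyp" "s \<in> hyp" "set (m @ [s]) \<subseteq> hyp" using hr snoc.prems(1) by auto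
    have w: "run m u \<noteq> 0" by (rule run_nonzero[OF hm(1) u(1)])
    have "0 \<le> turning m u" "turning m u < pi"
      using snoc.IH[of "s # d"] snoc.prems by (cases "m = []"; auto)+
    then have up: "turning (m @ [s]) u < 2 * pi" using Arg_rf(2)[OF hm(2) w] by simp
    have lo: "turning (m @ [s]) u > 0" using turning_pos[OF hm(3) u(1)] by simp
    obtain c where c: "c > 0" "run (m @ [s]) u = of_real c * cis (turning (m @ [s]) u) * u"
      using run_polar[OF hm(3) u(1)] by blast
    have "om u (run (m @ [s]) u) > 0" by (rule om[OF snoc.prems])
    moreover have "om u (run (m @ [s]) u) = c * sin (turning (m @ [s]) u) * ((Re u)\<^sup>2 + (Im u)\<^sup>2)"
      unfolding c(2) by (simp add: om_def power2_eq_square algebra_simps)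
    moreover have "(Re u)\<^sup>2 + (Im u)\<^sup>2 > 0" using u(1) by (simp add: complex_eq_iff sum_power2_gt_zero_iff)
    ultimately have "sin (turning (m @ [s]) u) > 0" using c(1) by (simp add: zero_less_mult_iff)
    then have "turning (m @ [s]) u < pi" using up sin_le_zero by (meson not_le less_imp_le)
    then show ?case using lo by simp
  qed simp
  define m y where "m = butlast rest" "y = last rest"
  have my: "rest = m @ [y]" "m \<noteq> []" using len by (auto simp: m_y_def Suc_le_length_iff numeral_2_eq_2)
  have hm: "set m \<subseteq> hyp" "y \<in> hyp" using hr my by auto
  have w: "run m u \<noteq> 0" by (rule run_nonzero[OF hm(1) u(1)])
  have b: "0 < turning rest u" "turning rest u < 2 * pi"
    using pre[OF my(1,2)] Arg_rf[OF hm(2) w] unfolding my(1) by auto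
  obtain c where c: "c = 1 \<or> c = (-1::real)" "\<And>z. run ([p, q] @ rest) z = c *\<^sub>R z" using closing_sign[OF cl] by metis
  have "- (l *\<^sub>R run rest u) = c *\<^sub>R u" using c(2)[of u] unfolding run_append u(2) by simp
  then have "(1 / l) *\<^sub>R (l *\<^sub>R run rest u) = (1 / l) *\<^sub>R (- (c *\<^sub>R u))" by (metis minus_minus)
  then have rr: "run rest u = (- c / l) *\<^sub>R u" using u(3) by simp
  obtain k :: int where k: "turning rest u = k * pi" using run_real_turning[OF hr u(1) rr] by blast
  have "0 < k" "k < 2" using b unfolding k by (auto simp: zero_less_mult_iff)
  then have "k = 1" by simp
  then have "turning rest u = pi" using k by simp
  moreover have "turning rest (- (l *\<^sub>R u)) = turning rest u" using turning_scale[of l rest u] u(3) by simp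
  moreover have "turning [p, q] u = pi" using turning_pair_eigen(1)[OF hpq u(1), of "- l"] u(2) by simp
  ultimately show ?thesis unfolding turning_append u(2) by simp
qed

context braid_set
begin

lemma push: "p # q # m @ d \<in> Sp \<Longrightarrow> p # m @ hrun m q # d \<in> Sp"
proof -
  have "a @ q # m @ d \<in> Sp \<Longrightarrow> a @ m @ hrun m q # d \<in> Sp" for a
  proof (induction m arbitrary: a q)
    case (Cons x m)
    have "a @ [q, x] @ (m @ d) \<in> Sp" using Cons.prems by simp
    from braidD(1)[OF Sp_braid this] have "(a @ [x]) @ hrefl x q # m @ d \<in> Sp" by simp
    from Cons.IH[OF this] show ?case by simp
  qed simp
  from this[of "[p]"] show "p # q # m @ d \<in> Sp \<Longrightarrow> p # m @ hrun m q # d \<in> Sp" by simp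
qed

text \<open>When the pair has been moved \<open>k\<close> steps along its line, \<open>push\<close>
  and \<open>Sp_all\<close> yield a positive triple; \<open>tri_limit\<close> passes to the end of
  the line.\<close>

lemma tri_ends:
  assumes "p # q # m @ s # d \<in> Sp" "l > 1" "l + 1 / l = 2 * mk p q" "nullv u = q - (1 / l) *\<^sub>R p"
  shows "tri (nullv u) (nullv (run m u)) s \<ge> 0"
proof -
  have h: "x \<in> hyp" if "x \<in> set (p # q # m @ s # d)" for x
    by (rule Sh[OF _ that]) (use assms(1) in \<open>simp add: Sp_def\<close>)
  have pos: "tri (vseq p q k) (hrun m (vseq p q (Suc k))) s > 0" for k
  proof -
    have "[] @ [p, q] @ (m @ s # d) \<in> Sp" using assms(1) by simp
    from vseq_in[OF Sp_braid this] have "vseq p q k # vseq p q (Suc k) # m @ s # d \<in> Sp" by simp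
    from push[OF this] have "[] @ vseq p q k # m @ hrun m (vseq p q (Suc k)) # [] @ s # d \<in> Sp" by simp
    then show ?thesis by (rule Sp_all)
  qed
  have "nullv (run m u) = hrun m (nullv u)" using h by (intro nullv_run) auto
  then show ?thesis using tri_limit[OF _ _ assms(2,3) pos] h assms(4) by (simp add: hypD)
qed

text \<open>Induction on the prefix: \<open>tri_ends\<close> and \<open>tri_nullv\<close> give the
  weak inequality for the next point. Equality would force the following points onto one line,
  against the positivity of triples or, if only one point follows, against the closing
  relation.\<close>

lemma om_pos:
  assumes "p # q # m @ d \<in> Sp" "m \<noteq> []" "d \<noteq> []" "l > 1" "l + 1 / l = 2 * mk p q" "nullv u = q - (1 / l) *\<^sub>R p"
    "u \<noteq> 0" "run [p, q] u = - (l *\<^sub>R u)"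
  shows "om u (run m u) > 0"
  using assms(1-3)
proof (induction m arbitrary: d rule: rev_induct)
  case (snoc s m)
  have h: "x \<in> hyp" if "x \<in> set (p # q # (m @ [s]) @ d)" for x
    by (rule Sh[OF _ that]) (use snoc.prems in \<open>simp add: Sp_def\<close>)
  show ?case
  proof (cases "m = []")
    case True
    then show ?thesis using om_rf_pos[OF h assms(7), of s] by simp
  next
    case False
    define w where "w = run m u"
    have IH: "om u w > 0" unfolding w_def by (rule snoc.IH[of "s # d"]) (use snoc.prems False in auto)
    have ends: "tri (nullv u) (nullv w) x \<ge> 0" if "p # q # m @ x # d' \<in> Sp" for x d'
      unfolding w_def by (rule tri_ends[OF that assms(4-6)])
    have mem: "p # q # m @ s # d \<in> Sp" using snoc.prems by simp
    have e: "tri (nullv u) (nullv w) s = 2 * om u w * om u (rf s w)" by (rule tri_nullv)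
    have "om u (rf s w) \<ge> 0" using ends[OF mem] IH unfolding e by (simp add: zero_le_mult_iff)
    moreover have "om u (rf s w) \<noteq> 0"
    proof
      assume 0: "om u (rf s w) = 0"
      then have s0: "tri (nullv u) (nullv w) s = 0" by (simp add: e)
      \<comment> \<open>The two braid moves of \<open>s\<close> with its successor put
        \<open>y\<close> and \<open>hrefl s y\<close> into the position governed by
        \<open>ends\<close>; since \<open>s\<close> lies on the line, the two values are
        opposite.\<close>
      have next0: "tri (nullv u) (nullv w) y = 0" if "p # q # m @ s # y # d' \<in> Sp" for y d'
      proof -
        have "(p # q # m) @ [s, y] @ d' \<in> Sp" using that by simp
        from braidD[OF Sp_braid this]
        have "p # q # m @ y # (hrefl y s # d') \<in> Sp" "p # q # m @ hrefl s y # (s # d') \<in> Sp" by auto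
        from ends[OF this(1)] ends[OF this(2)] show ?thesis using s0 by (simp add: hrefl_def)
      qed
      show False
      proof (cases d)
        case Nil
        then show ?thesis using snoc.prems by simp
      next
        case d: (Cons y d')
        have y0: "tri (nullv u) (nullv w) y = 0" using next0[of y d'] mem d by simp
        show ?thesis
        proof (cases d')
          case Nil
          \<comment> \<open>Only \<open>s\<close> and \<open>y\<close> remain: \<open>rf s w\<close>
            is a multiple of \<open>u\<close>, and the relation would let \<open>rf y\<close>
            preserve the line of \<open>u\<close>.\<close>
          obtain r where r: "rf s w = r *\<^sub>R u" using 0 om_eq_0_iff[OF assms(7)] by blast
          have cl: "closing (p # q # m @ [s, y])" using Sc mem d Nil by (simp add: Sp_def)
          obtain c where c: "c = 1 \<or> c = (-1::real)" "\<And>z. run (p # q # m @ [s, y]) z = c *\<^sub>R z"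
            using closing_sign[OF cl] by metis
          have "run (m @ [s, y]) (run [p, q] u) = c *\<^sub>R u" using c(2)[of u] by simp
          then have "- (l *\<^sub>R rf y (r *\<^sub>R u)) = c *\<^sub>R u" unfolding assms(8) using r by (simp add: w_def)
          then have "om u (- (l *\<^sub>R rf y (r *\<^sub>R u))) = 0" by simp
          then have "l * r * om u (rf y u) = 0" by simp
          moreover have "om u (rf y u) > 0" using om_rf_pos[OF h assms(7), of y] d by simp
          ultimately have "r = 0" using assms(4) by simp
          then have "rf s w = 0" using r by simp
          moreover have "s \<in> hyp" using h by simp
          ultimately have "w = 0" by (simp add: rf_eq_0_iff)
          then show False using IH by simp
        next
          case d': (Cons z d'')
          have mem2: "(p # q # m @ [s]) @ [y, z] @ d'' \<in> Sp" using mem d d' by simp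
          from braidD(1)[OF Sp_braid mem2] have z0: "tri (nullv u) (nullv w) z = 0" using next0[of z] by simp
          \<comment> \<open>Any two vectors of the plane spanned by \<open>nullv u\<close> and
            \<open>nullv w\<close> are linearly dependent together with
            \<open>nullv u\<close>.\<close>
          have pair: "tri (nullv u) a b = 0" if "tri (nullv u) (nullv w) a = 0" "tri (nullv u) (nullv w) b = 0" for a b
          proof -
            have "tri (nullv w) a b *\<^sub>R nullv u - tri (nullv u) a b *\<^sub>R nullv w = 0"
              using cramer4[of "nullv w" a b "nullv u"] that by simp
            then have "mk (tri (nullv w) a b *\<^sub>R nullv u - tri (nullv u) a b *\<^sub>R nullv w) (nullv u) = 0" by simp
            then have "tri (nullv u) a b * mk (nullv w) (nullv u) = 0" by (simp add: mk_nullv)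
            then show ?thesis using IH om_swap[of u w] by (simp add: mk_nullv)
          qed
          have "tri y z (nullv u) = 0" "tri s z (nullv u) = 0" "tri s y (nullv u) = 0"
            using pair[OF y0 z0] pair[OF s0 z0] pair[OF s0 y0] by (metis tri_swap neg_equal_0_iff_equal)+
          then have "tri s y z *\<^sub>R nullv u = 0" using cramer4[of y z "nullv u" s] by simp
          moreover have "fst (nullv u) \<noteq> 0" using assms(7) by (simp add: nullv_def complex_eq_iff sum_power2_eq_zero_iff)
          ultimately have "tri s y z = 0" by auto
          moreover have "tri s y z > 0" using Sp_tri[of "p # q # m" s y z d''] mem d d' by simp
          ultimately show False by simp
        qed
      qed
    qed
    ultimately show ?thesis by (simp add: w_def)
  qed
qed simp

lemma Sp_turning: assumes "Qs \<in> Sp" obtains u where "u \<noteq> 0" "turning Qs u = 2 * pi"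
proof -
  have QS: "Qs \<in> S" using assms by (simp add: Sp_def)
  have len: "length Qs \<ge> 5" by (rule Sl[OF QS])
  then obtain p q r rs where Q: "Qs = p # q # r # rs" by (auto simp: numeral_eq_Suc Suc_le_length_iff)
  have h: "x \<in> hyp" if "x \<in> set Qs" for x using Sh QS that by auto
  have "tri p q r > 0" using Sp_tri[of "[]" p q r rs] assms Q by simp
  then have ne: "p \<noteq> q" by auto
  have hpq: "p \<in> hyp" "q \<in> hyp" using h Q by auto
  obtain l u where lu: "l > 1" "u \<noteq> 0" "nullv u = q - (1 / l) *\<^sub>R p" "run [p, q] u = - (l *\<^sub>R u)" "l + 1 / l = 2 * mk p q"
    by (rule eigen_pair[OF hpq ne]) blast
  have "turning ([p, q] @ (r # rs)) u = 2 * pi"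
  proof (rule turning_2pi[OF _ _ lu(2,4)])
    show "closing ([p, q] @ (r # rs))" using Sc[OF QS] Q by simp
    show "length (r # rs) \<ge> 2" using len Q by simp
    show "om u (run m u) > 0" if "r # rs = m @ d" "m \<noteq> []" "d \<noteq> []" for m d
      by (rule om_pos[of p q m d, OF _ that(2,3) lu(1,5,3,2,4)]) (use assms Q that in auto)
  qed (use lu(1) in simp)
  then have "turning Qs u = 2 * pi" by (simp add: Q)
  then show ?thesis using that lu(2) by blast
qed

end

section \<open>Both orientations: coherent braid-closed sets are extremal\<close>

lemma coherent_mir: assumes "coherent Qs" shows "coherent (map mir Qs)"
  unfolding coherent_def
proof (intro allI impI)
  fix a p q r s b assume "map mir Qs = a @ [p, q, r, s] @ b"
  then have "map mir (map mir Qs) = map mir (a @ [p, q, r, s] @ b)" by simp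
  then have "Qs = map mir a @ [mir p, mir q, mir r, mir s] @ map mir b" by (simp add: o_def)
  then have "tri (mir p) (mir q) (mir r) * tri (mir p) (mir q) (mir s) > 0" using assms unfolding coherent_def by blast
  then show "tri p q r * tri p q s > 0" by simp
qed

lemma braid_closed_mir: assumes "braid_closed S" shows "braid_closed (map mir ` S)"
  unfolding braid_closed_def
proof (intro allI impI)
  fix a p q b assume "a @ [p, q] @ b \<in> map mir ` S"
  then obtain Qs where Q: "Qs \<in> S" "map mir Qs = a @ [p, q] @ b" by auto
  then have "map mir (map mir Qs) = map mir (a @ [p, q] @ b)" by simp
  then have "Qs = map mir a @ [mir p, mir q] @ map mir b" by (simp add: o_def)
  then have "map mir a @ [mir q, hrefl (mir q) (mir p)] @ map mir b \<in> S" "map mir a @ [hrefl (mir p) (mir q), mir p] @ map mir b \<in> S"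
    using braidD[OF assms] Q(1) by blast+
  then have "map mir (map mir a @ [mir q, hrefl (mir q) (mir p)] @ map mir b) \<in> map mir ` S"
     "map mir (map mir a @ [hrefl (mir p) (mir q), mir p] @ map mir b) \<in> map mir ` S" by blast+
  then show "a @ [q, hrefl q p] @ b \<in> map mir ` S \<and> a @ [hrefl p q, p] @ b \<in> map mir ` S"
    by (simp add: mir_hrefl o_def)
qed

theorem braid_extremal:
  assumes "braid_closed S" "\<And>Qs. Qs \<in> S \<Longrightarrow> closing Qs \<and> length Qs \<ge> 5 \<and> coherent Qs" "Qs \<in> S"
  shows "extremal Qs"
proof -
  interpret b: braid_set S by unfold_locales (use assms in auto)
  interpret m: braid_set "map mir ` S"
    by unfold_locales (use assms braid_closed_mir coherent_mir in auto)
  have len: "length Qs \<ge> 5" and c: "closing Qs" using assms by auto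
  have "b.tr Qs 0 * b.tr Qs 0 > 0" by (rule b.tr_sign[OF assms(3)]) (use len in simp)
  then consider "b.tr Qs 0 > 0" | "b.tr Qs 0 < 0" by (auto simp: zero_less_mult_iff)
  then show ?thesis
  proof cases
    case 1
    then have "Qs \<in> b.Sp" using assms(3) by (simp add: b.Sp_def)
    then obtain u where "u \<noteq> 0" "turning Qs u = 2 * pi" by (rule b.Sp_turning)
    then show ?thesis using extremal_iff[OF c, of u 1] by simp
  next
    case 2
    have "Qs \<noteq> []" using len by auto
    then have "m.tr (map mir Qs) 0 > 0" using 2 len by (simp add: m.tr_def b.tr_def)
    then have "map mir Qs \<in> m.Sp" using assms(3) by (simp add: m.Sp_def)
    then obtain u where "u \<noteq> 0" "turning (map mir Qs) u = 2 * pi" by (rule m.Sp_turning)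
    then show ?thesis using extremal_iff[OF c, of 1 u] by simp
  qed
qed

section \<open>Coherence of extremal tuples\<close>

lemma line_shift:
  assumes "p \<in> hyp" "q \<in> hyp" "p \<noteq> q" "c \<in> hyp" "tri p q c = 0"
  shows "\<exists>p'. shift p q p' c" "\<exists>q'. shift p q c q'"
proof -
  obtain n d where n: "mk p n = 0" "mk n n = -1" "d > 0" "geo p n d = q"
    by (rule line_through[OF assms(1-3)]) blast
  have "tri p q c = sinh d * tri p n c" unfolding n(4)[symmetric] geo_def by simp
  then have "tri p n c = 0" using assms(5) n(3) by simp
  then obtain s where s: "geo p n s = c" using on_line_geo[OF assms(1) n(1,2) assms(4)] by blast
  have p0: "geo p n 0 = p" by (simp add: geo_def)
  have sh: "shift p q (geo p n a) (geo p n (a + d))" for a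
    unfolding shift_def using rf_geo[OF assms(1) n(1,2), of d 0] rf_geo[OF assms(1) n(1,2), of "a + d" a]
      geo_hyp[OF assms(1) n(1,2)] assms p0 n(4) by simp
  show "\<exists>p'. shift p q p' c" using sh[of "s - d"] s by (intro exI[of _ "geo p n (s - d)"]) simp
  show "\<exists>q'. shift p q c q'" using sh[of s] s by (intro exI[of _ "geo p n (s + d)"]) simp
qed

lemma common_point:
  assumes "r \<in> hyp" "s \<in> hyp" "tri p q r * tri p q s \<le> 0"
  obtains c where "c \<in> hyp" "tri p q c = 0" "tri r s c = 0"
proof (cases "tri p q r = 0")
  case True
  then show ?thesis using that[of r] assms by simp
next
  case r0: False
  \<comment> \<open>Weights for which the linear form \<open>tri p q\<close> vanishes at
    \<open>w\<close>; the normalised vector is the point where the segment from \<open>r\<close> to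
    \<open>s\<close> crosses the line.\<close>
  define a b where "a = \<bar>tri p q s\<bar>" "b = \<bar>tri p q r\<bar>"
  have ab: "a \<ge> 0" "b > 0" using r0 by (auto simp: a_b_def)
  define w where "w = a *\<^sub>R r + b *\<^sub>R s"
  have N: "mk w w = a * a + b * b + 2 * (a * b) * mk r s" using assms by (simp add: w_def hypD mk_sym[of s r] algebra_simps)
  have "mk r s \<ge> 1" by (rule mk_ge_1[OF assms(1,2)])
  then have "mk w w > 0" unfolding N using ab by (intro add_pos_nonneg add_nonneg_pos mult_nonneg_nonneg) auto
  define d where "d = sqrt (mk w w)"
  have d: "d > 0" "d * d = mk w w" using \<open>mk w w > 0\<close> by (simp_all add: d_def)
  have fw: "fst w > 0" using ab hypD[OF assms(1)] hypD[OF assms(2)] by (simp add: w_def add_nonneg_pos)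
  define c where "c = (1 / d) *\<^sub>R w"
  have "c \<in> hyp" using d(1) fw by (simp add: hyp_def c_def d(2)[symmetric])
  moreover have "a * tri p q r + b * tri p q s = 0" using assms(3) r0 by (auto simp: a_b_def abs_if mult_le_0_iff algebra_simps split: if_splits)
  then have "tri p q c = 0" by (simp add: c_def w_def)
  moreover have "tri r s c = 0" by (simp add: c_def w_def)
  ultimately show ?thesis using that by blast
qed

lemma closing_pair: "c \<in> hyp \<Longrightarrow> closing [c, c]"
  by (simp add: closing_def rf_rf_hyp)

lemma closing_remove: assumes "closing (a @ ps @ b)" "closing ps" shows "closing (a @ b)"
proof -
  obtain c where c: "c = 1 \<or> c = (-1::real)" "\<And>z. run (a @ ps @ b) z = c *\<^sub>R z" using closing_sign[OF assms(1)] by metis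
  obtain d where d: "d = 1 \<or> d = (-1::real)" "\<And>z. run ps z = d *\<^sub>R z" using closing_sign[OF assms(2)] by metis
  have "d *\<^sub>R run (a @ b) z = c *\<^sub>R z" for z using c(2)[of z] d(2) by simp
  then have "d *\<^sub>R (d *\<^sub>R run (a @ b) z) = d *\<^sub>R (c *\<^sub>R z)" for z by simp
  moreover have "d * d = 1" using d(1) by auto
  ultimately have "run (a @ b) z = (d * c) *\<^sub>R z" for z by (simp only: scaleR_scaleR scaleR_one)
  moreover have "d * c = 1 \<or> d * c = -1" using c(1) d(1) by auto
  ultimately have "(\<forall>z. run (a @ b) z = z) \<or> (\<forall>z. run (a @ b) z = - z)" by (metis scaleR_one scaleR_minus1_left)
  then show ?thesis using assms(1) by (simp add: closing_def)
qed

lemma extremal_no_double: assumes "length (a @ [c, c] @ b) \<ge> 5" shows "\<not> extremal (a @ [c, c] @ b)"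
proof
  assume e: "extremal (a @ [c, c] @ b)"
  then have cl: "closing (a @ [c, c] @ b)" by (simp add: extremal_def)
  then have c: "closing [c, c]" by (intro closing_pair) (auto simp: closing_def)
  have "\<not> extremal (a @ [c, c] @ b)"
    by (rule not_extremal_insert[OF c closing_remove[OF cl c]]) (use assms in auto)
  with e show False by simp
qed

text \<open>As for basic representations, a failure allows two shifts that create a double point,
  which \<open>extremal_no_double\<close> forbids. The regular tuple and all its braid moves thereby
  become coherent.\<close>

lemma extremal_coherent: assumes "extremal Qs" "length Qs \<ge> 5" shows "coherent Qs"
  unfolding coherent_def
proof (intro allI impI, rule ccontr)
  fix a p q r s b assume Q: "Qs = a @ [p, q, r, s] @ b" and "\<not> tri p q r * tri p q s > 0"
  then have le: "tri p q r * tri p q s \<le> 0" by simp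
  have cl: "closing Qs" using assms by (simp add: extremal_def)
  then have h: "p \<in> hyp" "q \<in> hyp" "r \<in> hyp" "s \<in> hyp" by (auto simp: closing_def Q)
  have pq: "p \<noteq> q" using extremal_no_double[of a p "[r, s] @ b"] assms Q by auto
  have rs: "r \<noteq> s" using extremal_no_double[of "a @ [p, q]" r b] assms Q by auto
  obtain c where c: "c \<in> hyp" "tri p q c = 0" "tri r s c = 0" by (rule common_point[OF h(3,4) le])
  obtain p' where p': "shift p q p' c" using line_shift(1)[OF h(1,2) pq c(1,2)] by blast
  obtain s' where s': "shift r s c s'" using line_shift(2)[OF h(3,4) rs c(1,3)] by blast
  have "extremal (a @ [p', c] @ ([r, s] @ b))"
    using shift_extremal[OF p', of a "[r, s] @ b"] assms(1) cl Q by simp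
  moreover from this have "closing (a @ [p', c] @ ([r, s] @ b))" by (simp add: extremal_def)
  ultimately have "extremal ((a @ [p', c]) @ [c, s'] @ b)" using shift_extremal[OF s', of "a @ [p', c]" b] by simp
  then show False using extremal_no_double[of "a @ [p']" c "[s'] @ b"] assms(2) Q by simp
qed

lemma shift_braid: assumes "p \<in> hyp" "q \<in> hyp" shows "shift p q q (hrefl q p)" "shift p q (hrefl p q) p"
  using assms by (auto simp: shift_def hrefl_hyp rf_refl hypD rf_rf_hyp)

lemma extremal_braid: "braid_closed {Qs. extremal Qs \<and> length Qs = n}"
  unfolding braid_closed_def
proof (intro allI impI)
  fix a p q b assume "a @ [p, q] @ b \<in> {Qs. extremal Qs \<and> length Qs = n}"
  then have e: "extremal (a @ [p, q] @ b)" "length (a @ [p, q] @ b) = n" by auto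
  then have cl: "closing (a @ [p, q] @ b)" by (simp add: extremal_def)
  then have h: "p \<in> hyp" "q \<in> hyp" by (auto simp: closing_def)
  show "a @ [q, hrefl q p] @ b \<in> {Qs. extremal Qs \<and> length Qs = n} \<and> a @ [hrefl p q, p] @ b \<in> {Qs. extremal Qs \<and> length Qs = n}"
    using shift_extremal[OF shift_braid(1)[OF h] cl] shift_extremal[OF shift_braid(2)[OF h] cl] e by simp
qed

section \<open>The regular tuple\<close>

text \<open>The midpoints of the sides of the regular \<open>n\<close>-gon with angles \<open>2\<pi> / n\<close>.\<close>

definition regA :: "nat \<Rightarrow> real" where "regA n = cot (pi / n)"
definition regB :: "nat \<Rightarrow> real" where "regB n = sqrt ((regA n)\<^sup>2 - 1)"
definition regQ :: "nat \<Rightarrow> nat \<Rightarrow> mvec" where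
  "regQ n i = (regA n, of_real (regB n) * cis (2 * real i * (pi / n)))"

lemma reg_trig:
  assumes "n \<ge> 5"
  shows "sin (pi / n) > 0" "cos (pi / n) > 0" "sin (2 * (pi / n)) > 0" "regA n > 1" "regA n * sin (pi / n) = cos (pi / n)"
    "regB n * regB n = (regA n)\<^sup>2 - 1" "regB n > 0"
proof -
  have th: "0 < pi / n" "pi / n < pi / 4" using assms by (auto simp: field_simps)
  have th2: "0 < 2 * (pi / n)" "2 * (pi / n) < pi" "pi / n < pi" "pi / n < pi / 2" using th by linarith+
  show s: "sin (pi / n) > 0" "cos (pi / n) > 0" "sin (2 * (pi / n)) > 0"
    by (rule sin_gt_zero[OF th(1) th2(3)] cos_gt_zero[OF th(1) th2(4)] sin_gt_zero[OF th2(1,2)])+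
  have "sin (pi / n) < sin (pi / 4)" by (rule sin_monotone_2pi) (use th in auto)
  moreover have "cos (pi / 4) < cos (pi / n)" by (rule cos_monotone_0_pi) (use th in auto)
  ultimately have "sin (pi / n) < cos (pi / n)" by (simp add: sin_45 cos_45)
  then show A: "regA n > 1" using s by (simp add: regA_def cot_def)
  show "regA n * sin (pi / n) = cos (pi / n)" using s by (simp add: regA_def cot_def)
  have "(regA n)\<^sup>2 > 1" using A by simp
  then show "regB n * regB n = (regA n)\<^sup>2 - 1" "regB n > 0" by (simp_all add: regB_def)
qed

lemma regQ_hyp: assumes "n \<ge> 5" shows "regQ n i \<in> hyp"
proof -
  define x where "x = 2 * real i * (pi / n)"
  have "mk (regQ n i) (regQ n i) = (regA n)\<^sup>2 - (regB n * cos x)\<^sup>2 - (regB n * sin x)\<^sup>2"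
    unfolding mk_def regQ_def x_def[symmetric] by (simp add: power2_eq_square)
  also have "\<dots> = (regA n)\<^sup>2 - regB n * regB n * ((cos x)\<^sup>2 + (sin x)\<^sup>2)"
    unfolding power_mult_distrib by (simp only: power2_eq_square algebra_simps) 
  also have "(cos x)\<^sup>2 + (sin x)\<^sup>2 = 1" by simp
  finally have "mk (regQ n i) (regQ n i) = 1" using reg_trig(6)[OF assms] by simp
  then show ?thesis using reg_trig(4)[OF assms] by (simp add: hyp_def) (simp add: regQ_def)
qed

text \<open>By the rotational symmetry, \<open>run\<close> of the regular tuple is, up to a rotation, the power \<open>b\<^sup>n\<close>.\<close>

context
  fixes n :: nat and b :: "complex \<Rightarrow> complex" and t :: real
  assumes n: "n \<ge> 5"
  defines "t \<equiv> pi / n"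
  defines "b \<equiv> \<lambda>z. rf (regQ n 0) (cis (- t) * z)"
begin

lemma reg_run: "run (map (regQ n) [1..<Suc j]) z = cis (real j * t) * (b ^^ j) z"
proof (induction j)
  case (Suc j)
  have "rf (regQ n (Suc j)) (cis (real j * t) * w) = cis (real (Suc j) * t) * b w" for w
  proof -
    have 1: "cis (real (Suc j) * t) * cis (- t) = cis (real j * t)" by (simp add: cis_mult algebra_simps)
    have 2: "cis (2 * real (Suc j) * t) * cis (- (real j * t)) = cis (real (Suc j) * t) * cis t" by (simp add: cis_mult algebra_simps)
    have "rf (regQ n (Suc j)) (cis (real j * t) * w) =
      \<i> * (of_real (regA n) * (cis (real j * t) * w) - of_real (regB n) * (cis (2 * real (Suc j) * t) * cis (- (real j * t))) * cnj w)"
      by (simp add: rf_def regQ_def t_def[symmetric] cis_cnj mult_ac)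
    also have "\<dots> = cis (real (Suc j) * t) * b w"
      unfolding 2 1[symmetric] by (simp add: rf_def regQ_def b_def cis_cnj algebra_simps)
    finally show ?thesis .
  qed
  then show ?case using Suc by simp
qed simp

lemma b_linear: "b (x + y) = b x + b y" "b (x - y) = b x - b y" "b (r *\<^sub>R x) = r *\<^sub>R b x" "b (- x) = - b x"
  by (simp_all add: b_def algebra_simps)

text \<open>Cayley-Hamilton: \<open>b\<close> has determinant 1 and trace
  \<open>2 * regA n * sin t\<close>, and \<open>regA\<close> is chosen to make this
  \<open>2 * cos t\<close>. So \<open>b\<close> has the eigenvalues \<open>cis t\<close> and
  \<open>cis (- t)\<close>, and its \<open>n\<close>-th power is -1.\<close>

lemma b_b: "b (b z) = (2 * cos t) *\<^sub>R b z - z"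
proof -
  define A B where "A = regA n" "B = regB n"
  have BB: "B * B = A * A - 1" and As: "A * sin t = cos t"
    using reg_trig(5,6)[OF n] by (simp_all add: A_B_def t_def power2_eq_square)
  have sc: "sin t * sin t + cos t * cos t = 1" by (metis power2_eq_square sin_cos_squared_add)
  have bz: "b z = \<i> * (of_real A * cis (- t) * z - of_real B * cis t * cnj z)" for z
    by (simp add: b_def rf_def regQ_def A_B_def cis_cnj mult_ac)
  show ?thesis
    unfolding complex_eq_iff bz using BB As sc
    apply (simp add: cis.ctr)
    apply (intro conjI)
    subgoal by algebra
    subgoal by algebra
    done
qed

lemma b_pow: "sin t *\<^sub>R (b ^^ j) z = sin (real j * t) *\<^sub>R b z - sin (real j * t - t) *\<^sub>R z"
proof (induction j)
  case (Suc j)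
  have "sin t *\<^sub>R (b ^^ Suc j) z = b (sin t *\<^sub>R (b ^^ j) z)" by (simp add: b_linear)
  also have "\<dots> = sin (real j * t) *\<^sub>R b (b z) - sin (real j * t - t) *\<^sub>R b z" unfolding Suc by (simp add: b_linear)
  also have "\<dots> = (2 * cos t * sin (real j * t) - sin (real j * t - t)) *\<^sub>R b z - sin (real j * t) *\<^sub>R z"
    unfolding b_b by (simp add: algebra_simps)
  also have "2 * cos t * sin (real j * t) - sin (real j * t - t) = sin (real (Suc j) * t)"
    by (simp add: sin_diff sin_add algebra_simps)
  also have "real j * t = real (Suc j) * t - t" by (simp add: algebra_simps)
  finally show ?case .
qed simp

lemma reg_closing: "closing (tuple n (regQ n))"
proof -
  have nt: "real n * t = pi" using n by (simp add: t_def)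
  have s: "sin t > 0" using reg_trig(1)[OF n] by (simp add: t_def)
  have "run (tuple n (regQ n)) z = z" for z
  proof -
    have "sin t *\<^sub>R (b ^^ n) z = - (sin t *\<^sub>R z)" unfolding b_pow nt by (simp add: sin_diff)
    then have "sin t *\<^sub>R ((b ^^ n) z + z) = 0" by (simp add: scaleR_add_right)
    then have "(b ^^ n) z = - z" using s by (simp add: eq_neg_iff_add_eq_0)
    then show ?thesis unfolding tuple_def reg_run nt by simp
  qed
  moreover have "set (tuple n (regQ n)) \<subseteq> hyp" using regQ_hyp[OF n] by (auto simp: tuple_def simp del: upt_Suc)
  ultimately show ?thesis by (simp add: closing_def)
qed

lemma reg_ne: "regQ n 1 \<noteq> regQ n 2"
proof
  assume "regQ n 1 = regQ n 2"
  then have "of_real (regB n) * cis (2 * t) = of_real (regB n) * cis (4 * t)" by (simp add: regQ_def t_def)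
  then have "cis (2 * t) = cis (4 * t)" using reg_trig(7)[OF n] by simp
  then have "cis (- (2 * t)) * cis (2 * t) = cis (- (2 * t)) * cis (4 * t)" by simp
  then have "cis (2 * t) = 1" by (simp add: cis_mult)
  then have "sin (2 * t) = 0" by (simp add: complex_eq_iff)
  then show False using reg_trig(3)[OF n] by (simp add: t_def)
qed

text \<open>As a function of \<open>j\<close>, \<open>G j\<close> vanishes at 0 and, because
  \<open>u\<close> is an eigenvector of the first two reflections, at 2. It is therefore a multiple
  of \<open>sin (j * t) * sin (j * t - 2 * t)\<close>, which has one sign for
  \<open>3 \<le> j < n\<close>; the sign is read off at \<open>j = 3\<close>.\<close>

lemma reg_extremal: "extremal (tuple n (regQ n))"
proof -
  let ?Q = "regQ n"
  have sp: "tuple n ?Q = [?Q 1, ?Q 2] @ map ?Q [3..<Suc n]"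
    unfolding tuple_def by (subst upt_split) (use n in simp_all)
  obtain l u where lu: "l > 1" "u \<noteq> 0" "run [?Q 1, ?Q 2] u = - (l *\<^sub>R u)"
    by (rule eigen_pair[OF regQ_hyp[OF n] regQ_hyp[OF n] reg_ne]) blast
  have s: "sin t > 0" "sin (2 * t) > 0" using reg_trig(1,3)[OF n] by (simp_all add: t_def)
  define G where "G j = om u (cis (real j * t) * (b ^^ j) u)" for j
  define P where "P = om u (b u) + sin t * ((Re u)\<^sup>2 + (Im u)\<^sup>2)"
  define R where "R = (Re u * Re (b u) + Im u * Im (b u)) - cos t * ((Re u)\<^sup>2 + (Im u)\<^sup>2)"
  have G: "sin t * G j = sin (real j * t) * (P * cos (real j * t) + R * sin (real j * t))" for j
  proof -
    have o1: "om u (cis x * u) = sin x * ((Re u)\<^sup>2 + (Im u)\<^sup>2)" for x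
      by (simp add: om_def power2_eq_square algebra_simps)
    have o2: "om u (cis x * w) = cos x * om u w + sin x * (Re u * Re w + Im u * Im w)" for x w
      by (simp add: om_def algebra_simps)
    have sr: "cis x * (r *\<^sub>R w) = r *\<^sub>R (cis x * w)" for x r and w :: complex by simp
    have "sin t * G j = om u (cis (real j * t) * (sin t *\<^sub>R (b ^^ j) u))" unfolding sr by (simp add: G_def)
    also have "\<dots> = sin (real j * t) * om u (cis (real j * t) * b u) - sin (real j * t - t) * om u (cis (real j * t) * u)"
      unfolding b_pow right_diff_distrib sr by simp
    also have "\<dots> = sin (real j * t) * (P * cos (real j * t) + R * sin (real j * t))"
      unfolding o1 o2[of _ "b u"] P_def R_def by (simp add: sin_diff algebra_simps)
    finally show ?thesis .
  qed
  have Gj: "om u (run (map ?Q [3..<Suc j]) u) = - (1 / l) * G j" if "2 \<le> j" for j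
  proof -
    have "map ?Q [1..<Suc j] = [?Q 1, ?Q 2] @ map ?Q [3..<Suc j]" by (subst upt_split) (use that in simp_all)
    then have "cis (real j * t) * (b ^^ j) u = run (map ?Q [3..<Suc j]) (run [?Q 1, ?Q 2] u)"
      using reg_run[of j u] by (metis run_append)
    then have "G j = - (l * om u (run (map ?Q [3..<Suc j]) u))" unfolding lu(3) G_def by simp
    then show ?thesis using lu(1) by simp
  qed
  have "G 2 = 0" using Gj[of 2] lu(1) by simp
  then have PR: "P * cos (2 * t) + R * sin (2 * t) = 0" using G[of 2] s by simp
  have GP: "sin (2 * t) * (sin t * G j) = - (P * (sin (real j * t) * sin (real j * t - 2 * t)))" for j
  proof -
    have "sin (2 * t) * (P * cos (real j * t) + R * sin (real j * t)) =
      P * (sin (2 * t) * cos (real j * t)) + (R * sin (2 * t)) * sin (real j * t)" by (simp add: algebra_simps)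
    also have "R * sin (2 * t) = - (P * cos (2 * t))" using PR by simp
    also have "P * (sin (2 * t) * cos (real j * t)) + - (P * cos (2 * t)) * sin (real j * t) = - (P * sin (real j * t - 2 * t))"
      by (simp add: sin_diff algebra_simps)
    finally have e: "sin (2 * t) * (P * cos (real j * t) + R * sin (real j * t)) = - (P * sin (real j * t - 2 * t))" .
    have "sin (2 * t) * (sin t * G j) = sin (real j * t) * (sin (2 * t) * (P * cos (real j * t) + R * sin (real j * t)))"
      unfolding G by (simp only: mult.left_commute)
    also have "\<dots> = - (P * (sin (real j * t) * sin (real j * t - 2 * t)))" unfolding e by (simp add: mult_ac)
    finally show ?thesis .
  qed
  have sj: "sin (real j * t) * sin (real j * t - 2 * t) > 0" if "3 \<le> j" "j < n" for j
  proof (rule mult_pos_pos)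
    have t0: "t > 0" using n by (simp add: t_def)
    have "real j * t < real n * t" using that t0 by simp
    then have jt: "real j * t < pi" using n by (simp add: t_def)
    have "real j * t > 2 * t" using that t0 by simp
    then show "0 < sin (real j * t)" "0 < sin (real j * t - 2 * t)" using jt t0 by (auto intro!: sin_gt_zero)
  qed
  have "om u (run (map ?Q [3..<Suc 3]) u) > 0" using om_rf_pos[OF regQ_hyp[OF n] lu(2), of 3] by simp
  then have "G 3 < 0" using Gj[of 3] lu(1) by (simp add: zero_less_divide_iff divide_less_0_iff)
  then have "sin (2 * t) * (sin t * G 3) < 0" using s by (simp add: mult_pos_neg)
  then have "0 < P * (sin (real 3 * t) * sin (real 3 * t - 2 * t))" unfolding GP by linarith
  moreover have "sin (real 3 * t) * sin (real 3 * t - 2 * t) > 0" by (rule sj) (use n in auto)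
  ultimately have P: "P > 0" using zero_less_mult_pos2 by blast
  have pos: "om u (run (map ?Q [3..<Suc j]) u) > 0" if "3 \<le> j" "j < n" for j
  proof -
    have "sin (2 * t) * (sin t * G j) < 0" using sj[OF that] P unfolding GP by simp
    then have "G j < 0" using s by (simp add: mult_less_0_iff)
    then show ?thesis using Gj[of j] that lu(1) by (simp add: divide_neg_pos)
  qed
  have "turning ([?Q 1, ?Q 2] @ map ?Q [3..<Suc n]) u = 2 * pi"
  proof (rule turning_2pi[OF _ _ lu(2,3)])
    show "closing ([?Q 1, ?Q 2] @ map ?Q [3..<Suc n])" using reg_closing sp by simp
    show "length (map ?Q [3..<Suc n]) \<ge> 2" using n by (simp del: upt_Suc)
    fix m d assume md: "map ?Q [3..<Suc n] = m @ d" "m \<noteq> []" "d \<noteq> []"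
    define j where "j = 2 + length m"
    have len: "length m + length d = n - 2" using arg_cong[OF md(1), of length] by (simp del: upt_Suc)
    have ld: "length m \<noteq> 0" "length d \<noteq> 0" using md by auto
    have j: "3 \<le> j" "j < n" using len ld unfolding j_def by linarith+
    have "m = take (length m) (map ?Q [3..<Suc n])" unfolding md(1) by simp
    also have "\<dots> = map ?Q [3..<3 + length m]" unfolding take_map using j by (subst take_upt) (simp_all add: j_def)
    also have "3 + length m = Suc j" by (simp add: j_def)
    finally show "om u (run m u) > 0" using pos[OF j] by simp
  qed (use lu(1) in simp)
  then show ?thesis using extremal_iff[OF reg_closing lu(2), of 1] sp by simp
qed

text \<open>\<open>(regA n)\<^sup>2\<close> is the hyperbolic cosine of the circumradius, so
  \<open>z\<close> lies outside the polygon. Beyond a side, \<open>z\<close> is closer to the image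
  of the centre under the reflection in its midpoint than to the centre, and this reflection lowers
  the height.\<close>

lemma reg_descent:
  assumes z: "z \<in> hyp" "fst z > (regA n)\<^sup>2"
  shows "\<exists>i\<in>{1..n}. fst (hrefl (regQ n i) z) < fst z"
proof -
  define A B where "A = regA n" "B = regB n"
  have A: "A > 1" "B > 0" "B * B = A * A - 1" "A * sin t = cos t" "sin t > 0" "cos t > 0"
    using reg_trig[OF n] by (simp_all add: A_B_def t_def power2_eq_square)
  have t0: "t > 0" "t < pi" using n by (auto simp: t_def field_simps)
  define f r where "f = fst z" "r = cmod (snd z)"
  have f: "f > A * A" using z(2) by (simp add: f_r_def A_B_def power2_eq_square)
  have rr: "r * r = f * f - 1" using fst_hyp[OF z(1)] by (simp add: f_r_def power2_eq_square)
  define phi where "phi = Arg (snd z)"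
  \<comment> \<open>The side whose midpoint has the direction closest to that of \<open>z\<close>;
    its index is then reduced to \<open>{1..n}\<close>, with \<open>n\<close> in place of the
    residue 0.\<close>
  define k where "k = round (phi / (2 * t))"
  define i where "i = (if k mod int n = 0 then n else nat (k mod int n))"
  have "0 \<le> k mod int n" "k mod int n < int n" using n by auto
  then have "1 \<le> nat (k mod int n) \<and> nat (k mod int n) \<le> n" if "k mod int n \<noteq> 0" using that by linarith
  then have i: "i \<in> {1..n}" using n unfolding i_def by simp
  obtain m :: int where m: "int i = k + int n * m"
  proof (cases "k mod int n = 0")
    case True
    then have "int i = k + int n * (1 - k div int n)" using div_mult_mod_eq[of k "int n"] by (simp add: i_def algebra_simps)
    then show ?thesis by (rule that)
  next
    case False
    have "k mod int n \<ge> 0" using n by simp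
    then have "int i = k mod int n" using False by (simp add: i_def)
    then have "int i = k + int n * (- (k div int n))" using div_mult_mod_eq[of k "int n"] by (simp add: algebra_simps)
    then show ?thesis by (rule that)
  qed
  have "\<bar>phi / (2 * t) - of_int k\<bar> \<le> 1 / 2" unfolding k_def using of_int_round_abs_le[of "phi / (2 * t)"] by (simp add: abs_minus_commute)
  then have "\<bar>phi / (2 * t) - of_int k\<bar> * (2 * t) \<le> 1 / 2 * (2 * t)" using t0 by (intro mult_right_mono) auto
  moreover have "\<bar>phi / (2 * t) - of_int k\<bar> * (2 * t) = \<bar>phi - 2 * of_int k * t\<bar>"
  proof -
    have "\<bar>phi / (2 * t) - of_int k\<bar> * (2 * t) = \<bar>(phi / (2 * t) - of_int k) * (2 * t)\<bar>" using t0 by (simp add: abs_mult)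
    also have "(phi / (2 * t) - of_int k) * (2 * t) = phi - 2 * of_int k * t" using t0 by (simp add: field_simps)
    finally show ?thesis .
  qed
  ultimately have ph: "\<bar>phi - 2 * of_int k * t\<bar> \<le> t" by simp
  have "cos (2 * real i * t - phi) = cos (2 * of_int k * t - phi)"
  proof -
    have "real i = of_int k + real n * of_int m" using m by (metis of_int_add of_int_mult of_int_of_nat_eq)
    moreover have "real n * t = pi" using n by (simp add: t_def)
    ultimately have e: "2 * real i * t - phi = (2 * of_int k * t - phi) + (2 * pi) * of_int m" by (simp add: algebra_simps)
    show ?thesis unfolding e cos_add[of "2 * of_int k * t - phi"] by (simp add: cos_int_2pin sin_int_2pin)
  qed
  also have "\<dots> = cos \<bar>phi - 2 * of_int k * t\<bar>" by (simp add: cos_diff)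
  also have "\<dots> \<ge> cos t" by (rule cos_monotone_0_pi_le) (use ph t0 in auto)
  finally have c: "cos (2 * real i * t - phi) \<ge> cos t" .
  have sz: "Re (snd z) = r * cos phi" "Im (snd z) = r * sin phi"
    unfolding f_r_def phi_def by (metis Re_rcis rcis_cmod_Arg, metis Im_rcis rcis_cmod_Arg)
  have "mk (regQ n i) z = A * f - B * r * cos (2 * real i * t - phi)"
    unfolding mk_def regQ_def A_B_def[symmetric] fst_conv snd_conv f_r_def(1)[symmetric] sz t_def[symmetric] cos_diff
    by (simp add: algebra_simps)
  also have "\<dots> \<le> A * f - B * r * cos t" using c A by (simp add: f_r_def mult_left_mono)
  finally have 1: "A * mk (regQ n i) z \<le> A * (A * f - B * r * cos t)" using A by simp
  have "A * (A * f - B * r * cos t) < f"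
  proof -
    have cc: "cos t * cos t = 1 - sin t * sin t" by (metis cos_squared_eq power2_eq_square)
    have d: "(A * cos t) * (A * cos t) - B * B = sin t * sin t"
    proof -
      have "(A * cos t) * (A * cos t) - B * B = A * A * (cos t * cos t) - (A * A - 1)" using A by (simp add: algebra_simps)
      also have "\<dots> = 1 - (A * sin t) * (A * sin t)" unfolding cc by (simp add: algebra_simps)
      also have "\<dots> = sin t * sin t" unfolding A(4) cc by simp
      finally show ?thesis .
    qed
    have "(A * cos t) * (A * cos t) < (f * f) * (sin t * sin t)"
    proof -
      have "A * cos t = (A * A) * sin t" using A(4) by simp
      also have "\<dots> < f * sin t" using f A by simp
      finally have lt: "A * cos t < f * sin t" .
      have nn: "0 \<le> A * cos t" using A by simp
      have "(A * cos t) * (A * cos t) < (f * sin t) * (f * sin t)" by (rule mult_strict_mono'[OF lt lt nn nn])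
      then show ?thesis by (simp add: mult_ac)
    qed
    then have "(A * cos t) * (A * cos t) < (f * f) * ((A * cos t) * (A * cos t) - B * B)" by (simp only: d)
    moreover have "((A * cos t) * (A * cos t)) * (r * r) = (f * f) * ((A * cos t) * (A * cos t)) - (A * cos t) * (A * cos t)"
      unfolding rr by (simp add: algebra_simps)
    moreover have "(f * f) * ((A * cos t) * (A * cos t) - B * B) = (f * f) * ((A * cos t) * (A * cos t)) - (f * f) * (B * B)"
      by (rule right_diff_distrib)
    ultimately have "(f * f) * (B * B) < ((A * cos t) * (A * cos t)) * (r * r)" by linarith
    then have "(f * B)\<^sup>2 < (A * cos t * r)\<^sup>2" by (simp add: power2_eq_square mult_ac)
    then have "f * B < A * cos t * r" by (rule power2_less_imp_less) (use A in \<open>simp add: f_r_def\<close>)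
    then have "B * (f * B) < B * (A * cos t * r)" using A by simp
    moreover have "B * (f * B) = (A * A - 1) * f" using A(3) by (simp add: mult_ac)
    ultimately show ?thesis by (simp add: algebra_simps)
  qed
  then have "A * mk (regQ n i) z < f" using 1 by simp
  moreover have "fst (hrefl (regQ n i) z) = 2 * (A * mk (regQ n i) z) - f"
    by (simp add: hrefl_def regQ_def f_r_def A_B_def)
  ultimately show ?thesis using i by (intro bexI[of _ i]) (auto simp: f_r_def)
qed

end

section \<open>Orbits of discrete representations\<close>

text \<open>The triangle inequality, in the form that the hyperbolic cosine of a sum is at most
  twice the product of the cosines. It follows from the Gram determinant being a square.\<close>

lemma mk_triangle: assumes "a \<in> hyp" "b \<in> hyp" "c \<in> hyp" shows "mk a c \<le> 2 * (mk a b * mk b c)"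
proof (rule ccontr)
  define X Y Z where "X = mk a c" "Y = mk a b" "Z = mk b c"
  have ge: "X \<ge> 1" "Y \<ge> 1" "Z \<ge> 1" using assms mk_ge_1 by (auto simp: X_Y_Z_def)
  assume "\<not> ?thesis"
  then have "X - 2 * (Y * Z) > 0" by (simp add: X_Y_Z_def)
  then have "X * (X - 2 * (Y * Z)) > 0" using ge by simp
  moreover have "(tri a c b)\<^sup>2 = 1 + 2 * X * Y * Z - Z\<^sup>2 - Y\<^sup>2 - X\<^sup>2"
    using gram[of a c b] assms by (simp add: hypD X_Y_Z_def mk_sym[of c b])
  then have "1 + 2 * X * Y * Z - Z\<^sup>2 - Y\<^sup>2 - X\<^sup>2 \<ge> 0" by (metis zero_le_power2)
  then have "X * (X - 2 * (Y * Z)) \<le> 1 - Z\<^sup>2 - Y\<^sup>2" by (simp add: algebra_simps power2_eq_square)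
  moreover have "Z\<^sup>2 \<ge> 1" "Y\<^sup>2 \<ge> 1" using ge by (auto simp: one_le_power)
  ultimately show False by linarith
qed

text \<open>The Lorentzian cross product: \<open>cross p q\<close> is normal to the line through
  \<open>p\<close> and \<open>q\<close>, so that \<open>tri p q\<close> becomes a pairing and
  \<open>gram\<close> applies to it.\<close>

definition cross :: "mvec \<Rightarrow> mvec \<Rightarrow> mvec" where
  "cross u v = (Re (snd u) * Im (snd v) - Im (snd u) * Re (snd v),
     Complex (fst u * Im (snd v) - Im (snd u) * fst v) (- (fst u * Re (snd v) - Re (snd u) * fst v)))"

lemma mk_cross: "mk (cross u v) w = tri u v w"
  by (simp add: mk_def cross_def tri_def algebra_simps)

lemma mk_cross': "mk w (cross u v) = tri u v w"
  by (subst mk_sym) (rule mk_cross)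

lemma mk_cross_cross: "mk (cross u v) (cross u v) = mk u u * mk v v - (mk u v)\<^sup>2"
  unfolding mk_def cross_def fst_conv snd_conv complex.sel by algebra

text \<open>Both inequalities compare the signed distances from two points to the line through \<open>p\<close> and \<open>q\<close>.\<close>

lemma side_gram:
  assumes "p \<in> hyp" "q \<in> hyp" "y \<in> hyp" "z \<in> hyp"
  shows "(tri p q y)\<^sup>2 + (tri p q z)\<^sup>2 - 2 * mk y z * tri p q y * tri p q z \<le> ((mk p q)\<^sup>2 - 1) * ((mk y z)\<^sup>2 - 1)"
proof -
  have "(tri y z (cross p q))\<^sup>2 = - ((mk p q)\<^sup>2 - 1) + 2 * mk y z * tri p q y * tri p q z - (tri p q z)\<^sup>2 - (tri p q y)\<^sup>2 + ((mk p q)\<^sup>2 - 1) * (mk y z)\<^sup>2"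
    using gram[of y z "cross p q"] assms unfolding mk_cross_cross unfolding mk_cross' by (simp add: hypD algebra_simps)
  then have "- ((mk p q)\<^sup>2 - 1) + 2 * mk y z * tri p q y * tri p q z - (tri p q z)\<^sup>2 - (tri p q y)\<^sup>2 + ((mk p q)\<^sup>2 - 1) * (mk y z)\<^sup>2 \<ge> 0"
    by (metis zero_le_power2)
  then show ?thesis by (simp add: algebra_simps)
qed

lemma opposite_sides_far:
  assumes "p \<in> hyp" "q \<in> hyp" "y \<in> hyp" "z \<in> hyp" "tri p q y * tri p q z \<le> 0" "mk y z \<le> D"
  shows "(tri p q y)\<^sup>2 \<le> ((mk p q)\<^sup>2 - 1) * D\<^sup>2"
proof -
  have N: "(mk p q)\<^sup>2 - 1 \<ge> 0" using mk_ge_1[OF assms(1,2)] by simp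
  have yz: "mk y z \<ge> 1" by (rule mk_ge_1[OF assms(3,4)])
  have "mk y z * (tri p q y * tri p q z) \<le> 0" by (rule mult_nonneg_nonpos[OF _ assms(5)]) (use yz in simp)
  then have "(tri p q y)\<^sup>2 \<le> ((mk p q)\<^sup>2 - 1) * ((mk y z)\<^sup>2 - 1)"
    using side_gram[OF assms(1-4)] zero_le_power2[of "tri p q z"] unfolding mult.assoc[of 2] mult.assoc[of "mk y z"] by linarith
  also have "(mk y z)\<^sup>2 \<le> D\<^sup>2" using yz assms(6) by (intro power_mono) auto
  then have "((mk p q)\<^sup>2 - 1) * ((mk y z)\<^sup>2 - 1) \<le> ((mk p q)\<^sup>2 - 1) * D\<^sup>2" using N by (intro mult_left_mono) auto
  finally show ?thesis .
qed

lemma near_far: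
  assumes "p \<in> hyp" "q \<in> hyp" "y \<in> hyp" "z \<in> hyp" "mk y z \<le> R" "\<bar>tri p q y\<bar> \<le> K"
  shows "tri p q z \<le> 2 * R * K + ((mk p q)\<^sup>2 - 1) * R\<^sup>2 + 1"
proof (rule ccontr)
  define N where "N = (mk p q)\<^sup>2 - 1"
  define s where "s = tri p q z"
  have N: "N \<ge> 0" using mk_ge_1[OF assms(1,2)] by (simp add: N_def)
  have yz: "mk y z \<ge> 1" by (rule mk_ge_1[OF assms(3,4)])
  have K: "K \<ge> 0" using assms(6) by linarith
  assume "\<not> ?thesis"
  then have s: "s > 2 * R * K + N * R\<^sup>2 + 1" by (simp add: s_def N_def)
  have RK: "0 \<le> R * K" "0 \<le> N * R\<^sup>2" using yz assms(5) K N by auto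
  then have s1: "s > 1" using s by linarith
  have "mk y z * (tri p q y * s) \<le> R * (K * s)"
  proof -
    have "tri p q y * s \<le> K * s" using assms(6) s1 by (intro mult_right_mono) auto
    then have "mk y z * (tri p q y * s) \<le> mk y z * (K * s)" using yz by (intro mult_left_mono) auto
    also have "\<dots> \<le> R * (K * s)" using assms(5) K s1 by (intro mult_right_mono) auto
    finally show ?thesis .
  qed
  moreover have "(mk y z)\<^sup>2 \<le> R\<^sup>2" using yz assms(5) by (intro power_mono) auto
  then have "N * ((mk y z)\<^sup>2 - 1) \<le> N * R\<^sup>2" using N by (intro mult_left_mono) auto
  ultimately have "s\<^sup>2 \<le> N * R\<^sup>2 + 2 * (R * (K * s))"
    using side_gram[OF assms(1-4)] zero_le_power2[of "tri p q y"] unfolding N_def[symmetric] s_def[symmetric] mult.assoc[of 2] mult.assoc[of "mk y z"] by linarith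
  then have "s * (s - 2 * R * K) \<le> N * R\<^sup>2" by (simp add: power2_eq_square algebra_simps)
  moreover have "1 * (s - 2 * R * K) \<le> s * (s - 2 * R * K)" using s s1 RK by (intro mult_right_mono) auto
  moreover define dd where "dd = s - 2 * R * K"
  ultimately have "1 * dd \<le> s * dd" "s * dd \<le> N * R\<^sup>2" by simp_all
  moreover have "dd > N * R\<^sup>2 + 1" using s by (simp add: dd_def)
  ultimately show False by linarith
qed

section \<open>Orbits, and finiteness of words of bounded displacement\<close>

primrec evh :: "(nat \<Rightarrow> mvec) \<Rightarrow> nat list \<Rightarrow> mvec \<Rightarrow> mvec" where
  "evh Q [] v = v" | "evh Q (i # w) v = hrefl (Q i) (evh Q w v)"

lemma evh_append [simp]: "evh Q (v @ w) x = evh Q v (evh Q w x)" by (induction v) auto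

lemma evh_simps [simp]: "evh Q w (a + b) = evh Q w a + evh Q w b" "evh Q w (r *\<^sub>R a) = r *\<^sub>R evh Q w a"
  by (induction w) auto

lemma nullv_span: "v = ((fst v - Im (snd v) + Re (snd v)) / 2) *\<^sub>R nullv 1 + ((fst v - Im (snd v) - Re (snd v)) / 2) *\<^sub>R nullv \<i>
   + (Im (snd v) / 2) *\<^sub>R nullv (1 + \<i>)"
  by (simp add: mvec_eq_iff nullv_def power2_eq_square field_simps)

definition base :: mvec where "base = (1, 0)"

lemma base_hyp: "base \<in> hyp" by (simp add: base_def hyp_def mk_def)

lemma mk_base: "mk base v = fst v" "mk v base = fst v" by (simp_all add: base_def mk_def)

locale closed_tuple =
  fixes n :: nat and Q :: "nat \<Rightarrow> mvec"
  assumes cl: "closing (tuple n Q)"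
begin

lemma Qh: "1 \<le> i \<Longrightarrow> i \<le> n \<Longrightarrow> Q i \<in> hyp" using closing_tuple_hyp[OF cl] .

lemma evh_nullv: "w \<in> wds n \<Longrightarrow> evh Q w (nullv z) = nullv (evw Q w z)"
  by (induction w) (auto simp: nullv_rf hypD Qh)

text \<open>The sign ambiguity of \<open>evw\<close> disappears on null vectors, and three of these
  span the space.\<close>

lemma weq_evh: assumes "weq n v w" shows "evh Q v x = evh Q w x"
proof -
  have w: "v \<in> wds n" "w \<in> wds n" using weq_wds[OF assms] by auto
  have "evh Q v (nullv z) = evh Q w (nullv z)" for z
    using weq_sound[OF cl assms] w by (auto simp: evh_nullv pm_def nullv_scale)
  then show ?thesis by (subst (1 2) nullv_span[of x]) simp
qed

lemma evh_hyp: "w \<in> wds n \<Longrightarrow> x \<in> hyp \<Longrightarrow> evh Q w x \<in> hyp"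
  by (induction w) (auto simp: hrefl_hyp Qh)

lemma mk_evh: "w \<in> wds n \<Longrightarrow> mk (evh Q w x) (evh Q w y) = mk x y"
  by (induction w) (auto simp: mk_refl hypD Qh)

lemma mk_evh_rev: "w \<in> wds n \<Longrightarrow> mk (evh Q (rev w) x) y = mk x (evh Q w y)"
  by (induction w arbitrary: x) (auto simp: mk_refl_left)

text \<open>The height of the image of \<open>base\<close> is half the squared Hilbert-Schmidt norm
  of the map of the plane; bounded displacement thus means bounded matrices.\<close>

lemma evh_base: assumes "w \<in> wds n" shows "fst (evh Q w base) = ((cmod (evw Q w 1))\<^sup>2 + (cmod (evw Q w \<i>))\<^sup>2) / 2"
proof -
  have "base = (1 / 2) *\<^sub>R nullv 1 + (1 / 2) *\<^sub>R nullv \<i>" by (simp add: mvec_eq_iff base_def nullv_def)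
  then have "evh Q w base = (1 / 2) *\<^sub>R nullv (evw Q w 1) + (1 / 2) *\<^sub>R nullv (evw Q w \<i>)"
    using assms by (metis evh_simps evh_nullv)
  then show ?thesis by (simp add: nullv_def cmod_power2 field_simps)
qed

lemma evw_norm: assumes "w \<in> wds n" "fst (evh Q w base) \<le> G" "G \<ge> 1"
  shows "cmod (evw Q w 1) \<le> 2 * G" "cmod (evw Q w \<i>) \<le> 2 * G" "cmod (evw Q w z) \<le> 4 * G * cmod z"
proof -
  have *: "x \<le> 2 * G" if "x\<^sup>2 \<le> 2 * G" for x
  proof (rule power2_le_imp_le)
    have "2 * G \<le> (2 * G)\<^sup>2" using assms(3) by (simp add: power2_eq_square)
    then show "x\<^sup>2 \<le> (2 * G)\<^sup>2" using that by simp
  qed (use assms in simp)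
  have "(cmod (evw Q w 1))\<^sup>2 + (cmod (evw Q w \<i>))\<^sup>2 \<le> 2 * G" using evh_base[OF assms(1)] assms(2) by simp
  then have "(cmod (evw Q w 1))\<^sup>2 \<le> 2 * G" "(cmod (evw Q w \<i>))\<^sup>2 \<le> 2 * G"
    using zero_le_power2[of "cmod (evw Q w \<i>)"] zero_le_power2[of "cmod (evw Q w 1)"] by linarith+
  then show 1: "cmod (evw Q w 1) \<le> 2 * G" and 2: "cmod (evw Q w \<i>) \<le> 2 * G" using * by blast+
  have "z = Re z *\<^sub>R 1 + Im z *\<^sub>R \<i>" by (simp add: complex_eq_iff)
  then have "evw Q w z = Re z *\<^sub>R evw Q w 1 + Im z *\<^sub>R evw Q w \<i>" by (metis evw_simps(1,2))
  then have "cmod (evw Q w z) \<le> \<bar>Re z\<bar> * cmod (evw Q w 1) + \<bar>Im z\<bar> * cmod (evw Q w \<i>)"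
    by (metis norm_triangle_ineq norm_scaleR)
  also have "\<dots> \<le> cmod z * (2 * G) + cmod z * (2 * G)"
    using 1 2 assms(3) by (intro add_mono mult_mono) (auto simp: abs_Re_le_cmod abs_Im_le_cmod)
  finally show "cmod (evw Q w z) \<le> 4 * G * cmod z" by simp
qed

lemma evw_rev: "w \<in> wds n \<Longrightarrow> \<exists>c\<in>{1, -1}. \<forall>z. c *\<^sub>R evw Q (rev w) (evw Q w z) = z"
proof (induction w)
  case (Cons i w)
  then obtain c where c: "c \<in> {1, -1}" "\<And>z. c *\<^sub>R evw Q (rev w) (evw Q w z) = z" by (metis wds_simps(2))
  have "- c *\<^sub>R evw Q (rev (i # w)) (evw Q (i # w) z) = z" for z
    using Cons.prems c(2)[of z] by (simp add: rf_rf_hyp Qh)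
  then show ?case using c(1) by (intro bexI[of _ "- c"]) auto
qed simp

text \<open>The matrices in question form a bounded set, and two that are close represent the same
  group element because the identity is isolated; a cover by finitely many small balls therefore
  leaves finitely many elements.\<close>

lemma finite_words:
  assumes "isolated_id n Q"
  shows "\<exists>W. finite W \<and> W \<subseteq> wds n \<and> (\<forall>w\<in>wds n. fst (evh Q w base) \<le> G \<longrightarrow> (\<exists>w'\<in>W. weq n w w'))"
proof -
  define H where "H = max G 1"
  have H: "H \<ge> 1" "G \<le> H" by (simp_all add: H_def)
  obtain e where e: "e > 0" "\<And>w c. w \<in> wds n \<Longrightarrow> c \<in> {1, -1} \<Longrightarrow>
    dist (c *\<^sub>R evw Q w 1) 1 < e \<Longrightarrow> dist (c *\<^sub>R evw Q w \<i>) \<i> < e \<Longrightarrow> weq n w []"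
    using assms unfolding isolated_id_def by blast
  \<comment> \<open>\<open>4 * H\<close> bounds the norm of the inverse of a word in
    \<open>X\<close> by \<open>evw_norm\<close>, so words closer than \<open>d\<close> differ by an
    element closer than \<open>e\<close> to 1.\<close>
  define d where "d = e / (4 * H)"
  have d: "d > 0" using e H by (simp add: d_def)
  define pr where "pr w = (evw Q w 1, evw Q w \<i>)" for w
  define X where "X = {w \<in> wds n. fst (evh Q w base) \<le> G}"
  have close: "weq n w v" if w: "w \<in> X" "v \<in> X" "dist (pr w) (pr v) < d" for v w
  proof -
    have wd: "w \<in> wds n" "v \<in> wds n" "fst (evh Q v base) \<le> H" using w H by (auto simp: X_def)
    obtain c where c: "c \<in> {1, -1}" "\<And>z. c *\<^sub>R evw Q (rev v) (evw Q v z) = z" using evw_rev[OF wd(2)] by blast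
    have "fst (evh Q (rev v) base) = fst (evh Q v base)"
      using mk_evh_rev[OF wd(2), of base base] by (simp add: mk_base)
    then have rv: "fst (evh Q (rev v) base) \<le> H" "rev v \<in> wds n" using wd by auto
    have small: "dist (c *\<^sub>R evw Q (rev v @ w) z) z < e" if "dist (evw Q w z) (evw Q v z) < d" for z
    proof -
      have "c *\<^sub>R evw Q (rev v @ w) z - z = c *\<^sub>R evw Q (rev v) (evw Q w z - evw Q v z)"
      proof -
        have "evw Q (rev v) (evw Q w z) = evw Q (rev v) ((evw Q w z - evw Q v z) + evw Q v z)" by simp
        also have "\<dots> = evw Q (rev v) (evw Q w z - evw Q v z) + evw Q (rev v) (evw Q v z)" by (rule evw_simps(1))
        finally show ?thesis using c(2)[of z] by (simp add: scaleR_add_right)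
      qed
      then have "dist (c *\<^sub>R evw Q (rev v @ w) z) z = cmod (evw Q (rev v) (evw Q w z - evw Q v z))"
        using c(1) by (auto simp: dist_norm)
      also have "\<dots> \<le> 4 * H * cmod (evw Q w z - evw Q v z)" by (rule evw_norm(3)[OF rv(2,1) H(1)])
      also have "\<dots> < 4 * H * d" using that H by (intro mult_strict_left_mono) (auto simp: dist_norm)
      also have "\<dots> = e" using H by (simp add: d_def)
      finally show ?thesis .
    qed
    have "dist (evw Q w 1) (evw Q v 1) \<le> dist (pr w) (pr v)" "dist (evw Q w \<i>) (evw Q v \<i>) \<le> dist (pr w) (pr v)"
      unfolding pr_def using dist_fst_le[of "(evw Q w 1, evw Q w \<i>)"] dist_snd_le[of "(evw Q w 1, evw Q w \<i>)"] by (metis fst_conv, metis snd_conv)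
    then have "weq n (rev v @ w) []" using small[of 1] small[of \<i>] w(3) c(1) wd by (intro e(2)[of _ c]) auto
    then have "weq n (v @ (rev v @ w)) (v @ [])" by (intro weq_append weq_refl wd)
    moreover have "weq n ((v @ rev v) @ w) ([] @ w)" by (intro weq_append weq_refl weq_inverse wd)
    ultimately show ?thesis by (metis append.assoc append_Nil append_Nil2 weq_sym weq_trans)
  qed
  have "bounded (pr ` X)"
  proof (rule boundedI)
    fix y assume "y \<in> pr ` X"
    then obtain w where w: "w \<in> X" "y = pr w" by blast
    then have "cmod (evw Q w 1) \<le> 2 * H" "cmod (evw Q w \<i>) \<le> 2 * H" using evw_norm[of w H] H by (auto simp: X_def)
    moreover have "norm y \<le> cmod (evw Q w 1) + cmod (evw Q w \<i>)" unfolding w(2) pr_def norm_Pair by (rule sqrt_sum_squares_le_sum) auto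
    ultimately show "norm y \<le> 4 * H" by linarith
  qed
  then have "compact (closure (pr ` X))" by (simp add: compact_closure)
  then obtain k where k: "finite k" "closure (pr ` X) \<subseteq> (\<Union>x\<in>k. ball x (d / 2))"
    using d compact_eq_totally_bounded[of "closure (pr ` X)"] by (meson half_gt_zero)
  define ch where "ch x = (SOME w. w \<in> X \<and> pr w \<in> ball x (d / 2))" for x
  define W where "W = ch ` {x \<in> k. \<exists>w. w \<in> X \<and> pr w \<in> ball x (d / 2)}"
  have chX: "ch x \<in> X \<and> pr (ch x) \<in> ball x (d / 2)" if "\<exists>w. w \<in> X \<and> pr w \<in> ball x (d / 2)" for x
    unfolding ch_def using someI_ex[OF that] .
  have "\<exists>w'\<in>W. weq n w w'" if w: "w \<in> X" for w
  proof -
    have "pr w \<in> closure (pr ` X)" by (rule closure_subset[THEN subsetD, OF imageI[OF w]])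
    then obtain x where x: "x \<in> k" "pr w \<in> ball x (d / 2)" using k(2) by blast
    then have ex: "\<exists>w. w \<in> X \<and> pr w \<in> ball x (d / 2)" using w by blast
    have "dist (pr w) (pr (ch x)) < d"
      using dist_triangle_half_r[of x "pr w" d "pr (ch x)"] chX[OF ex] x(2) by simp
    then have "weq n w (ch x)" using close w chX[OF ex] by blast
    moreover have "ch x \<in> W" using x(1) ex by (auto simp: W_def)
    ultimately show ?thesis by blast
  qed
  moreover have "finite W" using k(1) by (simp add: W_def)
  moreover have "W \<subseteq> wds n" using chX by (auto simp: W_def X_def)
  ultimately show ?thesis by (intro exI[of _ W]) (auto simp: X_def)
qed

lemma finite_words_mk:
  assumes "isolated_id n Q" "x \<in> hyp" "y \<in> hyp"
  shows "\<exists>W. finite W \<and> W \<subseteq> wds n \<and> (\<forall>w\<in>wds n. mk (evh Q w x) y \<le> G \<longrightarrow> (\<exists>w'\<in>W. weq n w w'))"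
proof -
  define G' where "G' = 2 * (fst x * (2 * (G * fst y)))"
  obtain W where W: "finite W" "W \<subseteq> wds n" "\<And>w. w \<in> wds n \<Longrightarrow> fst (evh Q w base) \<le> G' \<Longrightarrow> \<exists>w'\<in>W. weq n w w'"
    using finite_words[OF assms(1), of G'] by blast
  have "fst (evh Q w base) \<le> G'" if w: "w \<in> wds n" "mk (evh Q w x) y \<le> G" for w
  proof -
    have h: "evh Q w base \<in> hyp" "evh Q w x \<in> hyp" using evh_hyp[OF w(1)] base_hyp assms by auto
    have fx: "fst x > 0" "fst y > 0" using assms by (auto simp: hypD)
    have "mk (evh Q w x) base \<le> 2 * (mk (evh Q w x) y * mk y base)" by (rule mk_triangle[OF h(2) assms(3) base_hyp])
    also have "\<dots> \<le> 2 * (G * fst y)" using w(2) fx by (simp add: mk_base mult_right_mono)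
    finally have 1: "mk (evh Q w x) base \<le> 2 * (G * fst y)" .
    have "mk (evh Q w base) base \<le> 2 * (mk (evh Q w base) (evh Q w x) * mk (evh Q w x) base)"
      by (rule mk_triangle[OF h base_hyp])
    also have "\<dots> = 2 * (fst x * mk (evh Q w x) base)" by (simp add: mk_evh[OF w(1)] mk_base)
    also have "\<dots> \<le> G'" unfolding G'_def using 1 fx by (intro mult_left_mono) auto
    finally show ?thesis by (simp add: mk_base)
  qed
  then show ?thesis using W by blast
qed

end

lemma om_run_pair: "om u (run [p, q] u) = tri p q (nullv u)"
  unfolding om_def run.simps Re_rf Im_rf tri_def nullv_def fst_conv snd_conv power2_eq_square times_complex.sel by algebra

text \<open>Upper half-plane coordinates: \<open>u\<close> is the point at infinity and \<open>f\<close> the origin.\<close>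

definition uhp :: "complex \<Rightarrow> complex \<Rightarrow> real \<times> real \<Rightarrow> mvec" where
  "uhp u f z = (1 / 2) *\<^sub>R ((1 / snd z) *\<^sub>R nullv (fst z *\<^sub>R u + f) + snd z *\<^sub>R nullv u)"

lemma uhp_hyp: assumes "om u f = 1" "snd z > 0" shows "uhp u f z \<in> hyp"
proof -
  define w where "w = fst z *\<^sub>R u + f"
  have ow: "om u w = 1" using assms by (simp add: w_def)
  have "mk (uhp u f z) (uhp u f z) = 1"
    using assms(2) ow om_swap[of u w] by (simp add: uhp_def w_def[symmetric] mk_nullv)
  moreover have "w \<noteq> 0" using ow by auto
  then have "fst (nullv w) > 0" by (simp add: nullv_def sum_power2_gt_zero_iff complex_eq_iff)
  moreover have "fst (nullv u) \<ge> 0" by (simp add: nullv_def)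
  ultimately show ?thesis using assms(2) by (simp add: hyp_def) (simp add: uhp_def w_def[symmetric] add_pos_nonneg)
qed

lemma uhp_surj: assumes "om u f = 1" "v \<in> hyp" obtains z where "snd z > 0" "uhp u f z = v"
proof -
  have u0: "u \<noteq> 0" using assms(1) by auto
  define y where "y = 1 / mk v (nullv u)"
  have vy: "mk v (nullv u) > 0" by (rule mk_nullv_pos[OF assms(2) u0])
  then have y: "y > 0" "y * mk v (nullv u) = 1" by (simp_all add: y_def)
  define E where "E = (2 * y) *\<^sub>R (v - (y / 2) *\<^sub>R nullv u)"
  have "mk (v - (y / 2) *\<^sub>R nullv u) (v - (y / 2) *\<^sub>R nullv u) = 1 - y * mk v (nullv u)"
    using assms(2) by (simp add: hypD mk_nullv mk_sym[of "nullv u"])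
  then have EE: "mk E E = 0" using y by (simp add: E_def)
  have Ev: "mk v E > 0" using y assms(2) by (simp add: E_def hypD algebra_simps)
  have "fst E \<ge> 0"
  proof (rule ccontr)
    assume "\<not> fst E \<ge> 0"
    then obtain w where w: "- E = nullv w" using nullv_surj[of "- E"] EE by auto
    then have "mk v (nullv w) < 0" using Ev by (metis mk_simps(8) neg_less_0_iff_less)
    moreover have "mk v (nullv w) \<ge> 0" using mk_nullv_pos[OF assms(2), of w] by (cases "w = 0") (auto simp: nullv_def mk_def)
    ultimately show False by simp
  qed
  then obtain w' where w': "E = nullv w'" using nullv_surj[OF EE] by blast
  have "2 * (om u w')\<^sup>2 = mk E (nullv u)" unfolding w' mk_nullv using om_swap[of u w'] by simp
  also have "\<dots> = 2" using y by (simp add: E_def mk_nullv)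
  finally have "(om u w')\<^sup>2 = 1" by simp
  then have "om u w' = 1 \<or> om u w' = -1" by (simp add: power2_eq_1_iff)
  then obtain w where w: "om u w = 1" "E = nullv w"
    by (metis w' om_simps(8) minus_minus nullv_scale(2))
  have "om u f *\<^sub>R w = om w f *\<^sub>R u + om u w *\<^sub>R f" by (rule om_basis)
  then have wf: "w = om w f *\<^sub>R u + f" using assms(1) w(1) by simp
  have "uhp u f (om w f, y) = (1 / 2) *\<^sub>R ((1 / y) *\<^sub>R E + y *\<^sub>R nullv u)"
    unfolding uhp_def fst_conv snd_conv wf[symmetric] w(2) ..
  also have "\<dots> = v" using y by (simp add: E_def algebra_simps)
  finally show ?thesis using that[of "(om w f, y)"] y by simp
qed

text \<open>The line with ends at infinity and at the origin is the vertical axis, and the signed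
  distance from it depends on the slope \<open>fst z / snd z\<close> only.\<close>

lemma uhp_side:
  assumes "tri p q (nullv u) = 0" "tri p q (nullv f) = 0"
  shows "tri p q (uhp u f z) = (tri p q (nullv (u + f)) / 2) * (fst z / snd z)"
proof -
  have "nullv (x *\<^sub>R u + f) = x\<^sup>2 *\<^sub>R nullv u + nullv f + x *\<^sub>R (nullv (u + f) - nullv u - nullv f)" for x
    by (simp add: mvec_eq_iff nullv_def power2_eq_square algebra_simps)
  then show ?thesis using assms by (simp add: uhp_def)
qed

lemma continuous_uhp: "continuous_on {z. snd z > 0} (uhp u f)"
  unfolding uhp_def nullv_def by (intro continuous_intros) auto

text \<open>With the ends of the line at infinity and at the origin, the set is the image of the
  convex cone \<open>k * fst z > K * snd z\<close> in the upper half-plane.\<close>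

lemma connected_side:
  assumes "p \<in> hyp" "q \<in> hyp" "p \<noteq> q" shows "connected {z \<in> hyp. tri p q z > K}"
proof -
  obtain l u where u: "u \<noteq> 0" "nullv u = q - (1 / l) *\<^sub>R p" "l > 1" by (rule eigen_pair[OF assms]) blast
  obtain m f where f: "f \<noteq> 0" "nullv f = p - (1 / m) *\<^sub>R q" "m > 1" by (rule eigen_pair[OF assms(2,1)]) (use assms in auto)
  have tu: "tri p q (nullv u) = 0" "tri p q (nullv f) = 0" unfolding u f by simp_all
  have o: "om u f \<noteq> 0"
  proof
    assume "om u f = 0"
    then obtain r where r: "f = r *\<^sub>R u" using om_eq_0_iff[OF u(1)] by blast
    have "p - (1 / m) *\<^sub>R q = r\<^sup>2 *\<^sub>R (q - (1 / l) *\<^sub>R p)" unfolding u(2)[symmetric] f(2)[symmetric] r nullv_scale ..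
    then have eq: "(1 + r\<^sup>2 / l) *\<^sub>R p = (r\<^sup>2 + 1 / m) *\<^sub>R q" by (simp add: algebra_simps)
    have pos: "1 + r\<^sup>2 / l > 0" "r\<^sup>2 + 1 / m > 0" using u(3) f(3) by (intro add_pos_nonneg add_nonneg_pos; simp)+
    have "mk ((1 + r\<^sup>2 / l) *\<^sub>R p) ((1 + r\<^sup>2 / l) *\<^sub>R p) = mk ((r\<^sup>2 + 1 / m) *\<^sub>R q) ((r\<^sup>2 + 1 / m) *\<^sub>R q)" unfolding eq ..
    then have "(1 + r\<^sup>2 / l)\<^sup>2 = (r\<^sup>2 + 1 / m)\<^sup>2" using assms by (simp only: mk_simps hypD mult_1_right power2_eq_square)
    then have "1 + r\<^sup>2 / l = r\<^sup>2 + 1 / m" using pos by (simp only: power2_eq_iff) linarith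
    then have "(1 + r\<^sup>2 / l) *\<^sub>R p = (1 + r\<^sup>2 / l) *\<^sub>R q" using eq by simp
    then show False using pos(1) assms(3) by (metis less_irrefl scaleR_left_imp_eq)
  qed
  define g where "g = (1 / om u f) *\<^sub>R f"
  have g: "om u g = 1" "tri p q (nullv g) = 0" using o tu by (simp_all add: g_def nullv_scale)
  define k where "k = tri p q (nullv (u + g)) / 2"
  have side: "tri p q (uhp u g z) = k * (fst z / snd z)" for z
    unfolding k_def by (rule uhp_side[OF tu(1) g(2)])
  have "{z \<in> hyp. tri p q z > K} = uhp u g ` {z. snd z > 0 \<and> k * fst z - K * snd z > 0}"
  proof (intro equalityI subsetI)
    fix v assume v: "v \<in> {z \<in> hyp. tri p q z > K}"
    then obtain z where z: "snd z > 0" "uhp u g z = v" using uhp_surj[OF g(1)] by blast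
    have "k * (fst z / snd z) > K" using v z side[of z] by simp
    then have "k * fst z - K * snd z > 0" using z(1) by (simp add: field_simps)
    then show "v \<in> uhp u g ` {z. snd z > 0 \<and> k * fst z - K * snd z > 0}" using z by blast
  next
    fix v assume "v \<in> uhp u g ` {z. snd z > 0 \<and> k * fst z - K * snd z > 0}"
    then obtain z where z: "snd z > 0" "k * fst z - K * snd z > 0" "v = uhp u g z" by blast
    then have "k * (fst z / snd z) > K" by (simp add: field_simps)
    then show "v \<in> {z \<in> hyp. tri p q z > K}" using uhp_hyp[OF g(1) z(1)] side[of z] z(3) by simp
  qed
  moreover have "connected (uhp u g ` {z. snd z > 0 \<and> k * fst z - K * snd z > 0})"
  proof (rule connected_continuous_image)
    show "continuous_on {z. snd z > 0 \<and> k * fst z - K * snd z > 0} (uhp u g)"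
      by (rule continuous_on_subset[OF continuous_uhp]) auto
    have "convex {z :: real \<times> real. snd z > 0 \<and> k * fst z - K * snd z > 0}"
    proof (rule convexI)
      fix x y :: "real \<times> real" and a b :: real
      assume xy: "x \<in> {z. snd z > 0 \<and> k * fst z - K * snd z > 0}" "y \<in> {z. snd z > 0 \<and> k * fst z - K * snd z > 0}"
        and ab: "0 \<le> a" "0 \<le> b" "a + b = 1"
      have pos: "a * s + b * t > 0" if "s > 0" "t > 0" for s t :: real
        using that ab by (metis add.left_neutral add_nonneg_pos add_pos_nonneg less_eq_real_def mult_nonneg_nonneg mult_pos_pos mult_zero_left zero_neq_one)
      have "a * (k * fst x - K * snd x) + b * (k * fst y - K * snd y) > 0" by (rule pos) (use xy in auto)
      then have "k * fst (a *\<^sub>R x + b *\<^sub>R y) - K * snd (a *\<^sub>R x + b *\<^sub>R y) > 0" by (simp add: algebra_simps)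
      moreover have "snd (a *\<^sub>R x + b *\<^sub>R y) > 0" using pos[of "snd x" "snd y"] xy by simp
      ultimately show "a *\<^sub>R x + b *\<^sub>R y \<in> {z. snd z > 0 \<and> k * fst z - K * snd z > 0}" by simp
    qed
    then show "connected {z :: real \<times> real. snd z > 0 \<and> k * fst z - K * snd z > 0}" by (rule convex_connected)
  qed
  ultimately show ?thesis by simp
qed

text \<open>A fundamental domain for multiplication by \<open>L\<close>, applied in
  \<open>near_line\<close> to the translations along a line.\<close>

lemma pow_range:
  assumes "L > 1" "X > (0::real)"
  shows "(\<exists>k::nat. 1 \<le> X * L ^ k \<and> X * L ^ k \<le> L) \<or> (\<exists>k::nat. 1 \<le> X / L ^ k \<and> X / L ^ k \<le> L)"
proof (cases "X \<ge> 1")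
  case True
  obtain m where "X < L ^ m" using real_arch_pow[OF assms(1)] by blast
  then have ex: "\<exists>m. X / L ^ m < 1" using assms by (intro exI[of _ m]) (simp add: divide_less_eq)
  define k where "k = (LEAST m. X / L ^ m < 1)"
  have k: "X / L ^ k < 1" unfolding k_def using ex by (rule LeastI_ex)
  have "k \<noteq> 0" using k True by (metis div_by_1 not_less power_0)
  then obtain j where j: "k = Suc j" by (cases k) auto
  have "\<not> X / L ^ j < 1" using not_less_Least[of j "\<lambda>m. X / L ^ m < 1"] j unfolding k_def by simp
  moreover have "X / L ^ j \<le> L" using k assms unfolding j by (simp add: field_simps)
  ultimately show ?thesis by (intro disjI2 exI[of _ j] conjI) linarith+
next
  case False
  obtain m where "1 / X < L ^ m" using real_arch_pow[OF assms(1)] by blast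
  then have ex: "\<exists>m. X * L ^ m \<ge> 1" using assms by (intro exI[of _ m]) (simp add: divide_less_eq mult.commute)
  define k where "k = (LEAST m. X * L ^ m \<ge> 1)"
  have k: "X * L ^ k \<ge> 1" unfolding k_def using ex by (rule LeastI_ex)
  have "k \<noteq> 0" using k False by (metis mult_1_right power_0)
  then obtain j where j: "k = Suc j" by (cases k) auto
  have "\<not> X * L ^ j \<ge> 1" using not_less_Least[of j "\<lambda>m. X * L ^ m \<ge> 1"] j unfolding k_def by simp
  then have "L * (X * L ^ j) \<le> L * 1" using assms by (intro mult_left_mono) auto
  then have "X * L ^ k \<le> L" unfolding j by (simp add: mult_ac)
  then show ?thesis using k by blast
qed

section \<open>Translations along the line through two points of the tuple\<close>

definition cpow :: "nat \<Rightarrow> nat \<Rightarrow> nat \<Rightarrow> nat list" where "cpow i j k = concat (replicate k [i, j])"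

lemma cpow_Suc: "cpow i j (Suc k) = [i, j] @ cpow i j k" by (simp add: cpow_def)

lemma cpow_wds: "1 \<le> i \<Longrightarrow> i \<le> n \<Longrightarrow> 1 \<le> j \<Longrightarrow> j \<le> n \<Longrightarrow> cpow i j k \<in> wds n"
  by (auto simp: cpow_def wds_iff)

context closed_tuple
begin

lemma tri_cpow:
  assumes "1 \<le> i" "i \<le> n" "1 \<le> j" "j \<le> n"
  shows "tri (Q i) (Q j) (evh Q (cpow i j k) y) = tri (Q i) (Q j) y" "tri (Q j) (Q i) (evh Q (cpow i j k) y) = tri (Q j) (Q i) y"
proof -
  have h: "mk (Q i) (Q i) = 1" "mk (Q j) (Q j) = 1" using Qh assms by (auto simp: hypD)
  have r: "tri (Q i) (Q j) (hrefl (Q i) y) = - tri (Q i) (Q j) y" "tri (Q i) (Q j) (hrefl (Q j) y) = - tri (Q i) (Q j) y" for y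
    by (simp_all add: hrefl_def)
  have 1: "tri (Q i) (Q j) (evh Q (cpow i j k) y) = tri (Q i) (Q j) y"
  proof (induction k)
    case (Suc k)
    then show ?case by (simp only: cpow_Suc evh_append evh.simps r minus_minus)
  qed (simp add: cpow_def)
  then show "tri (Q i) (Q j) (evh Q (cpow i j k) y) = tri (Q i) (Q j) y" .
  show "tri (Q j) (Q i) (evh Q (cpow i j k) y) = tri (Q j) (Q i) y"
    using 1 by (metis tri_swap(1))
qed

lemma cpow_eigen:
  assumes "1 \<le> i" "i \<le> n" "1 \<le> j" "j \<le> n" "run [Q i, Q j] u = - (l *\<^sub>R u)"
  shows "mk (evh Q (cpow i j k) y) (nullv u) = mk y (nullv u) * (l\<^sup>2) ^ k"
proof (induction k)
  case (Suc k)
  have "hrefl (Q j) (hrefl (Q i) (nullv u)) = l\<^sup>2 *\<^sub>R nullv u"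
  proof -
    have "hrefl (Q j) (hrefl (Q i) (nullv u)) = nullv (run [Q i, Q j] u)" using Qh assms(1-4) by (simp add: nullv_rf hypD)
    also have "\<dots> = l\<^sup>2 *\<^sub>R nullv u" unfolding assms(5) by (simp add: nullv_scale)
    finally show ?thesis .
  qed
  then have "mk (evh Q (cpow i j (Suc k)) y) (nullv u) = mk (evh Q (cpow i j k) y) (l\<^sup>2 *\<^sub>R nullv u)"
    by (simp add: cpow_Suc mk_refl_left mk_refl_left)
  then show ?case using Suc by simp
qed (simp add: cpow_def)

text \<open>Translating along the line through \<open>Q i\<close> and \<open>Q j\<close>, every orbit point near that line is
  brought into a bounded set.\<close>

lemma near_line:
  assumes "1 \<le> i" "i \<le> n" "1 \<le> j" "j \<le> n" "Q i \<noteq> Q j"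
  shows "\<exists>G. \<forall>y\<in>hyp. \<bar>tri (Q i) (Q j) y\<bar> \<le> K \<longrightarrow>
    (\<exists>k. mk (evh Q (cpow i j k) y) (Q i) \<le> G) \<or> (\<exists>k. mk (evh Q (cpow j i k) y) (Q i) \<le> G)"
proof -
  define p q where "p = Q i" "q = Q j"
  have pq: "p \<in> hyp" "q \<in> hyp" "p \<noteq> q" using Qh assms by (auto simp: p_q_def)
  obtain l u where u: "u \<noteq> 0" "nullv u = q - (1 / l) *\<^sub>R p" "l > 1" "run [p, q] u = - (l *\<^sub>R u)" "l + 1 / l = 2 * mk p q"
    by (rule eigen_pair[OF pq]) blast
  have qp: "q \<noteq> p" using pq by simp
  obtain m f where f0: "f \<noteq> 0" "nullv f = p - (1 / m) *\<^sub>R q" "m > 1" "run [q, p] f = - (m *\<^sub>R f)" "m + 1 / m = 2 * mk q p"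
    by (rule eigen_pair[OF pq(2,1) qp]) blast
  have "m = l"
  proof -
    have "(m - l) * (m * l - 1) = 0"
    proof -
      have "m + 1 / m = l + 1 / l" using f0(5) u(5) mk_sym[of p q] by simp
      then have "(m + 1 / m) * (m * l) = (l + 1 / l) * (m * l)" by simp
      moreover have "(m + 1 / m) * (m * l) = m * m * l + l" "(l + 1 / l) * (m * l) = l * l * m + m"
        using u(3) f0(3) by (simp_all add: distrib_right)
      ultimately show ?thesis by (simp add: algebra_simps)
    qed
    moreover have "m * l > 1" using u(3) f0(3) by (rule less_1_mult[rotated])
    ultimately show ?thesis by simp
  qed
  note f = f0[unfolded this]
  define E F where "E = nullv u" "F = nullv f"
  have l2: "l\<^sup>2 > 1" using u(3) by simp
  define c where "c = l - 1 / l"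
  have c: "c > 0" using u(3) by (simp add: c_def field_simps) (smt (verit) less_1_mult)
  have pE: "c *\<^sub>R p = E + l *\<^sub>R F"
    using u(3) unfolding E_F_def u(2) f(2) by (simp add: c_def algebra_simps)
  define e where "e = mk E F"
  have tEF: "tri E F y = (1 / l * (1 / l) - 1) * tri p q y" for y
    unfolding E_F_def u(2) f(2) using u(3) by (simp add: tri_swap(1)[of q p] algebra_simps)
  have e: "e > 0"
  proof -
    have "mk (c *\<^sub>R p) (c *\<^sub>R p) = 2 * l * e"
      unfolding pE by (simp add: e_def mk_sym[of F E]) (simp add: E_F_def mk_nullv)
    then have "c * c = 2 * l * e" using pq by (simp add: hypD)
    then show ?thesis using c u(3) by (metis mult_pos_pos zero_less_mult_pos zero_less_numeral less_trans zero_less_one)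
  qed
  \<comment> \<open>By \<open>gram\<close> the product \<open>mk y E * mk y F\<close> is controlled
    by the distance from the line. The translations scale the factor \<open>mk y E\<close> by powers
    of \<open>l\<^sup>2\<close>, so it can be normalised, and then both factors are bounded.\<close>
  define C where "C = (e\<^sup>2 + K\<^sup>2) / (2 * e)"
  have XY: "mk y E * mk y F \<le> C" if "y \<in> hyp" "\<bar>tri p q y\<bar> \<le> K" for y
  proof -
    have "(tri E F y)\<^sup>2 = 2 * e * (mk y E * mk y F) - e\<^sup>2"
    proof -
      have m: "mk E E = 0" "mk F F = 0" "mk y y = 1" "mk E y = mk y E" "mk F y = mk y F" "mk F E = e" "mk E F = e"
        using that by (simp_all add: E_F_def mk_nullv hypD mk_sym e_def)
      show ?thesis using gram[of E F y] unfolding m by (simp add: power2_eq_square algebra_simps)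
    qed
    moreover have "\<bar>tri E F y\<bar> \<le> K"
    proof -
      have "0 \<le> 1 / l" "1 / l \<le> 1" using u(3) by auto
      then have "0 \<le> 1 / l * (1 / l)" "1 / l * (1 / l) \<le> 1" using mult_nonneg_nonneg mult_le_one by blast+
      then have "\<bar>1 / l * (1 / l) - 1\<bar> \<le> 1" by linarith
      then have "\<bar>tri E F y\<bar> \<le> 1 * \<bar>tri p q y\<bar>" unfolding tEF abs_mult by (rule mult_right_mono) simp
      then show ?thesis using that by simp
    qed
    then have "(tri E F y)\<^sup>2 \<le> K\<^sup>2" by (metis abs_ge_zero power2_abs power_mono)
    ultimately have "mk y E * mk y F * (2 * e) \<le> e\<^sup>2 + K\<^sup>2" by (simp add: algebra_simps)
    then show ?thesis using e by (simp add: C_def pos_le_divide_eq)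
  qed
  define G where "G = (l\<^sup>2 + l * C) / c"
  have bound: "mk y p \<le> G" if "y \<in> hyp" "\<bar>tri p q y\<bar> \<le> K" "1 \<le> mk y E" "mk y E \<le> l\<^sup>2" for y
  proof -
    have F0: "mk y F > 0" unfolding E_F_def by (rule mk_nullv_pos[OF that(1) f(1)])
    have "1 * mk y F \<le> mk y E * mk y F" using that(3) F0 by (intro mult_right_mono) auto
    then have "mk y F \<le> C" using XY[OF that(1,2)] by simp
    then have "l * mk y F \<le> l * C" using u(3) by (intro mult_left_mono) auto
    moreover have "c * mk y p = mk y E + l * mk y F" using arg_cong[OF pE, of "mk y"] by simp
    ultimately have "mk y p * c \<le> l\<^sup>2 + l * C" using that(4) by (simp add: mult.commute)
    then show ?thesis using c by (simp add: G_def pos_le_divide_eq)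
  qed
  have down: "mk (evh Q (cpow j i k) y) E = mk y E / (l\<^sup>2) ^ k" for k y
  proof -
    have "rf p (rf q u) = - ((1 / l) *\<^sub>R u)"
    proof -
      have e1: "rf q (rf p u) = - (l *\<^sub>R u)" using u(4) by simp
      have "rf p (rf q (rf q (rf p u))) = u" using pq by (simp add: rf_rf_hyp)
      then have "- (l *\<^sub>R rf p (rf q u)) = u" unfolding e1 by simp
      then have "(1 / l) *\<^sub>R (- (l *\<^sub>R rf p (rf q u))) = (1 / l) *\<^sub>R u" by simp
      then have "- rf p (rf q u) = (1 / l) *\<^sub>R u" using u(3) by simp
      then show ?thesis by (metis minus_minus)
    qed
    then have "run [Q j, Q i] u = - ((1 / l) *\<^sub>R u)" by (simp add: p_q_def)
    from cpow_eigen[OF assms(3,4,1,2) this] show ?thesis by (simp add: E_F_def power_one_over power_divide)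
  qed
  have up: "mk (evh Q (cpow i j k) y) E = mk y E * (l\<^sup>2) ^ k" for k y
    unfolding E_F_def by (rule cpow_eigen) (use assms u(4) in \<open>auto simp: p_q_def\<close>)
  show ?thesis
  proof (intro exI[of _ G] ballI impI)
    fix y assume y: "y \<in> hyp" "\<bar>tri (Q i) (Q j) y\<bar> \<le> K"
    have y1: "evh Q (cpow i j k) y \<in> hyp" "evh Q (cpow j i k) y \<in> hyp" for k
      using evh_hyp[OF cpow_wds y(1)] assms by auto
    have y2: "\<bar>tri p q (evh Q (cpow i j k) y)\<bar> \<le> K" "\<bar>tri p q (evh Q (cpow j i k) y)\<bar> \<le> K" for k
      using y(2) tri_cpow[OF assms(1-4)] tri_cpow[OF assms(3,4,1,2)] by (auto simp: p_q_def)
    have "mk y E > 0" unfolding E_F_def by (rule mk_nullv_pos[OF y(1) u(1)])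
    from pow_range[OF l2 this] show "(\<exists>k. mk (evh Q (cpow i j k) y) (Q i) \<le> G) \<or> (\<exists>k. mk (evh Q (cpow j i k) y) (Q i) \<le> G)"
    proof (elim disjE exE)
      fix k assume "1 \<le> mk y E * (l\<^sup>2) ^ k \<and> mk y E * (l\<^sup>2) ^ k \<le> l\<^sup>2"
      then show ?thesis using bound[OF y1(1) y2(1), of k] up[of k y] by (auto simp: p_q_def)
    next
      fix k assume "1 \<le> mk y E / (l\<^sup>2) ^ k \<and> mk y E / (l\<^sup>2) ^ k \<le> l\<^sup>2"
      then show ?thesis using bound[OF y1(2) y2(2), of k] down[of k y] by (auto simp: p_q_def)
    qed
  qed
qed

end

text \<open>The orbit of \<open>Q i\<close> under the powers of one product of reflections thus runs
  through both sequences, one towards each end of the line.\<close>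

lemma evh_vseq:
  assumes "mk (Q i) (Q i) = 1" "mk (Q j) (Q j) = 1"
  shows "evh Q (cpow j i k) (Q i) = vseq (Q i) (Q j) (2 * k)" "evh Q (cpow i j k) (Q i) = vseq (Q j) (Q i) (Suc (2 * k))"
proof -
  have s: "hrefl p (vseq p q k) = vseq q p (Suc k)" "hrefl q (vseq p q (Suc k)) = vseq q p k" if "mk p p = 1" "mk q q = 1" for p q k
  proof -
    have lin: "hrefl p (hrefl x y) = hrefl (hrefl p x) (hrefl p y)" if "mk p p = 1" for p x y
      using that by (simp add: hrefl_def algebra_simps mk_sym)
    have "hrefl p (vseq p q k) = vseq q p (Suc k) \<and> hrefl p (vseq p q (Suc k)) = vseq q p (Suc (Suc k))
       \<and> hrefl q (vseq p q (Suc k)) = vseq q p k \<and> hrefl q (vseq p q (Suc (Suc k))) = vseq q p (Suc k)"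
    proof (induction k)
      case 0
      then show ?case using that by (simp add: hrefl_self hrefl_refl)
    next
      case (Suc k)
      then have i: "hrefl p (vseq p q k) = vseq q p (Suc k)" "hrefl p (vseq p q (Suc k)) = vseq q p (Suc (Suc k))"
        "hrefl q (vseq p q (Suc k)) = vseq q p k" "hrefl q (vseq p q (Suc (Suc k))) = vseq q p (Suc k)" by blast+
      have "hrefl p (vseq p q (Suc (Suc k))) = vseq q p (Suc (Suc (Suc k)))"
        unfolding vseq.simps(3)[of p q k] lin[OF that(1)] i by simp
      moreover have "hrefl q (vseq p q (Suc (Suc (Suc k)))) = vseq q p (Suc (Suc k))"
        unfolding vseq.simps(3)[of p q "Suc k"] lin[OF that(2)] i by simp
      ultimately show ?case using i by blast
    qed
    then show "hrefl p (vseq p q k) = vseq q p (Suc k)" "hrefl q (vseq p q (Suc k)) = vseq q p k" by auto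
  qed
  show "evh Q (cpow j i k) (Q i) = vseq (Q i) (Q j) (2 * k)"
  proof (induction k)
    case (Suc k)
    then show ?case using s(1)[OF assms, of "2 * k"] s(2)[OF assms(2,1)] by (simp add: cpow_Suc s[OF assms] s[OF assms(2,1)] del: vseq.simps)
  qed (simp add: cpow_def)
  show "evh Q (cpow i j k) (Q i) = vseq (Q j) (Q i) (Suc (2 * k))"
  proof (induction k)
    case (Suc k)
    then show ?case using s[OF assms] s[OF assms(2,1)] by (simp add: cpow_Suc s[OF assms] s[OF assms(2,1)] del: vseq.simps)
  qed (simp add: cpow_def)
qed

text \<open>The first two reflections keep the line of one of their eigenvectors, and the third
  reflection turns every vector out of its line.\<close>

lemma om3_not_scalar:
  assumes "p \<in> hyp" "q \<in> hyp" "r \<in> hyp" shows "\<exists>z. om3 p q r z \<noteq> c *\<^sub>R z"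
proof -
  obtain u d where u: "u \<noteq> 0" "run [p, q] u = d *\<^sub>R u" "d \<noteq> 0"
  proof (cases "p = q")
    case True
    then show ?thesis using that[of 1 "-1"] assms by (simp add: rf_rf_hyp)
  next
    case False
    obtain l u where "l > 1" "u \<noteq> 0" "run [p, q] u = - (l *\<^sub>R u)" by (rule eigen_pair[OF assms(1,2) False]) blast
    then show ?thesis using that[of u "- l"] by simp
  qed
  have "om u (om3 p q r u) = d * om u (rf r u)" using u(2) by (simp add: om3_def)
  then have "om u (om3 p q r u) \<noteq> 0" using u(3) om_rf_pos[OF assms(3) u(1)] by simp
  then have "om3 p q r u \<noteq> c *\<^sub>R u" by auto
  then show ?thesis ..
qed

text \<open>A vector over a common end is an eigenvector of both pairs, each of which turns it by
  \<pi>; the remaining points would push the angle beyond 2\<pi>.\<close>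

lemma extremal_no_common_end:
  assumes "extremal (a @ [p, q, r, s] @ b)" "a @ b \<noteq> []" "u \<noteq> 0"
    "tri p q (nullv u) = 0" "tri r s (nullv u) = 0"
  shows False
proof -
  have *: False if t: "turning ([p, q, r, s] @ d) u = 2 * pi" and cl: "closing ([p, q, r, s] @ d)" and d: "d \<noteq> []" and u: "u \<noteq> 0"
    and z: "tri p q (nullv u) = 0" "tri r s (nullv u) = 0" for p q r s d u
  proof -
    have h: "p \<in> hyp" "q \<in> hyp" "r \<in> hyp" "s \<in> hyp" "set d \<subseteq> hyp" using cl by (auto simp: closing_def)
    obtain c where c: "run [p, q] u = c *\<^sub>R u" using om_run_pair[of u p q] z(1) om_eq_0_iff[OF u] by metis
    obtain c' where c': "run [r, s] u = c' *\<^sub>R u" using om_run_pair[of u r s] z(2) om_eq_0_iff[OF u] by metis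
    have t1: "turning [p, q] u = pi" "c < 0" using turning_pair_eigen[OF h(1,2) u c] by auto
    have t2: "turning [r, s] u = pi" "c' < 0" using turning_pair_eigen[OF h(3,4) u c'] by auto
    have "turning [r, s] (c *\<^sub>R u) = turning [r, s] u" by (rule turning_scale) (use t1 in simp)
    moreover have "turning d (run [r, s] (c *\<^sub>R u)) > 0"
      by (rule turning_pos[OF h(5) _ d]) (use t1 t2 u c' in \<open>simp del: run.simps\<close>)
    moreover have "turning ([p, q] @ [r, s] @ d) u = turning [p, q] u + (turning [r, s] (c *\<^sub>R u) + turning d (run [r, s] (c *\<^sub>R u)))"
      unfolding turning_append c ..
    ultimately show False using t t1 t2 by simp
  qed
  have "extremal (([p, q, r, s] @ b) @ a)" by (rule extremal_rotate) (use assms(1) in simp)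
  then have e: "extremal ([p, q, r, s] @ (b @ a))" by simp
  then have cl: "closing ([p, q, r, s] @ (b @ a))" by (simp add: extremal_def)
  have cu: "cnj u \<noteq> 0" using assms(3) by simp
  from e consider "turning ([p, q, r, s] @ (b @ a)) u = 2 * pi" | "turning (map mir ([p, q, r, s] @ (b @ a))) (cnj u) = 2 * pi"
    using extremal_iff[OF cl assms(3) cu] by blast
  then show False
  proof cases
    case 1
    then show False using *[OF 1 cl _ assms(3-5)] assms(2) by auto
  next
    case 2
    have n: "nullv (cnj u) = mir (nullv u)" by (simp add: nullv_def mir_def)
    have cm: "closing ([mir p, mir q, mir r, mir s] @ map mir (b @ a))" using cl closing_mir[of "[p, q, r, s] @ (b @ a)"] by simp
    have d: "map mir (b @ a) \<noteq> []" using assms(2) by auto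
    show False by (rule *[OF _ cm d cu]) (use 2 assms in \<open>simp_all add: n\<close>)
  qed
qed

text \<open>By \<open>vseq_closed_form\<close> the values are driven by \<open>l ^ k * A\<close>,
  where \<open>A\<close> is the value at the end of the line. A negative \<open>A\<close> would make
  them sink below 0, so they grow geometrically.\<close>

lemma vseq_unbounded:
  assumes "mk r r = 1" "mk s s = 1" "l > 1" "l + 1 / l = 2 * mk r s"
    and pos: "\<And>k. f (vseq r s k) > (0::real)" and lin: "\<And>x y. f (x - y) = f x - f y" "\<And>c x. f (c *\<^sub>R x) = c * f x"
    and ne: "f (s - (1 / l) *\<^sub>R r) \<noteq> 0"
  shows "\<exists>k0. \<forall>k\<ge>k0. f (vseq r s k) > K"
proof -
  define A where "A = f (s - (1 / l) *\<^sub>R r)"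
  have l0: "l > 0" using assms(3) by simp
  have rec: "f (vseq r s (Suc k)) = (1 / l) * f (vseq r s k) + l ^ k * A" for k
  proof -
    have "f (vseq r s (Suc k) - (1 / l) *\<^sub>R vseq r s k) = f (l ^ k *\<^sub>R (s - (1 / l) *\<^sub>R r))"
      using vseq_closed_form(1)[OF assms(1,2) l0 assms(4), of k] by simp
    then have "f (vseq r s (Suc k)) - (1 / l) * f (vseq r s k) = l ^ k * A" unfolding lin A_def .
    then show ?thesis by simp
  qed
  have "A > 0"
  proof (rule ccontr)
    assume "\<not> A > 0"
    then have A: "A < 0" using ne by (simp add: A_def)
    have le: "f (vseq r s (Suc k)) \<le> f (vseq r s k) + A" for k
    proof -
      have "(1 / l) * f (vseq r s k) \<le> 1 * f (vseq r s k)" using pos[of k] assms(3) by (intro mult_right_mono) auto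
      moreover have "l ^ k * A \<le> 1 * A" using A assms(3) by (intro mult_right_mono_neg) auto
      ultimately show ?thesis unfolding rec by simp
    qed
    have "f (vseq r s k) \<le> f r + real k * A" for k
    proof (induction k)
      case (Suc k)
      then show ?case using le[of k] by (simp add: algebra_simps)
    qed simp
    then have "real k * (- A) < f r" for k using pos[of k] by (smt (verit) mult_minus_right)
    moreover obtain k where "f r < real k * (- A)" using reals_Archimedean3[of "- A"] A by auto
    ultimately show False by (metis less_asym)
  qed
  obtain k0 where k0: "K / A < l ^ k0" using real_arch_pow[OF assms(3)] by blast
  have "f (vseq r s k) > K" if "k \<ge> Suc k0" for k
  proof -
    define j where "j = k - 1"
    have j: "k = Suc j" "j \<ge> k0" using that by (auto simp: j_def)
    have "l ^ k0 \<le> l ^ j" using j(2) assms(3) by (intro power_increasing) auto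
    then have "K / A < l ^ j" using k0 by simp
    then have "K < l ^ j * A" using \<open>A > 0\<close> by (simp add: divide_less_eq)
    moreover have "(1 / l) * f (vseq r s j) > 0" using pos[of j] l0 by simp
    ultimately show ?thesis unfolding j(1) rec by simp
  qed
  then show ?thesis by blast
qed

text \<open>The recursion has the coefficient \<open>2 * mk r s\<close>, which is at least 2; an
  increase from a negative to a positive value is never undone.\<close>

lemma vseq_sign:
  assumes "mk r r = 1" "mk s s = 1" "mk r s \<ge> 1" "f r < 0" "f s > (0::real)"
    and lin: "\<And>x y. f (x - y) = f x - f y" "\<And>c x. f (c *\<^sub>R x) = c * f x"
  shows "f (vseq r s (Suc k)) > 0"
proof -
  have inv: "mk (vseq r s k) (vseq r s (Suc k)) = mk r s \<and> mk (vseq r s k) (vseq r s k) = 1 \<and> mk (vseq r s (Suc k)) (vseq r s (Suc k)) = 1" for k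
  proof (induction k)
    case (Suc k)
    then show ?case using mk_refl[of "vseq r s (Suc k)" "vseq r s (Suc k)" "vseq r s k"]
      by (simp add: mk_refl hrefl_self mk_sym)
  qed (use assms in simp)
  have gen: "f (vseq r s (Suc k)) > 0 \<and> f (vseq r s (Suc k)) \<ge> f (vseq r s k)"
  proof (induction k)
    case (Suc k)
    define a b where "a = f (vseq r s k)" and "b = f (vseq r s (Suc k))"
    have ab: "b > 0" "b \<ge> a" using Suc by (auto simp: a_def b_def)
    have "f (vseq r s (Suc (Suc k))) = 2 * mk r s * b - a"
      using inv[of k] by (simp add: hrefl_def lin a_def b_def mk_sym)
    moreover have "2 * mk r s * b \<ge> 2 * 1 * b" using assms(3) ab by (intro mult_right_mono) auto
    ultimately show ?case using ab unfolding a_def b_def by linarith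
  qed (use assms in simp)
  then show ?thesis by simp
qed

section \<open>Discrete faithful representations satisfy the orientation condition\<close>

lemma evw_subst:
  assumes "\<And>j. 1 \<le> j \<Longrightarrow> j \<le> n \<Longrightarrow> pm (rf (Q' j)) (evw Q (h j))" "w \<in> wds n"
  shows "pm (evw Q' w) (evw Q (concat (map h w)))"
  using assms(2)
proof (induction w)
  case (Cons i w)
  then have "pm (evw Q' w) (evw Q (concat (map h w)))" "pm (rf (Q' i)) (evw Q (h i))" using assms(1) by auto
  then show ?case unfolding pm_def by auto
qed (simp add: pm_def)

lemma isolated_id_word:
  assumes "isolated_id n Q" "w \<in> wds n" "pm (evw Q w) (\<lambda>z. z)" shows "weq n w []"
proof -
  obtain e where e: "e > 0" "\<And>w c. w \<in> wds n \<Longrightarrow> c \<in> {1, -1} \<Longrightarrow>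
    dist (c *\<^sub>R evw Q w 1) 1 < e \<Longrightarrow> dist (c *\<^sub>R evw Q w \<i>) \<i> < e \<Longrightarrow> weq n w []"
    using assms(1) unfolding isolated_id_def by metis
  from assms(3) show ?thesis unfolding pm_def
  proof
    assume "\<forall>z. evw Q w z = z" then show ?thesis using e(2)[OF assms(2), of 1] e(1) by simp
  next
    assume "\<forall>z. evw Q w z = - z" then show ?thesis using e(2)[OF assms(2), of "-1"] e(1) by simp
  qed
qed

text \<open>The injectivity of the substitution \<open>h\<close> on the group comes from a reference
  pair: if the substituted word is trivial, it acts trivially for \<open>Q0\<close>, hence
  \<open>w\<close> acts trivially for \<open>Q0'\<close>, where this implies that \<open>w\<close>
  is trivial.\<close>

lemma isolated_id_subst:
  assumes "isolated_id n Q" "\<And>j. 1 \<le> j \<Longrightarrow> j \<le> n \<Longrightarrow> h j \<in> wds n"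
    "\<And>j. 1 \<le> j \<Longrightarrow> j \<le> n \<Longrightarrow> pm (rf (Q' j)) (evw Q (h j))"
    "closing (tuple n Q0)" "isolated_id n Q0'" "\<And>j. 1 \<le> j \<Longrightarrow> j \<le> n \<Longrightarrow> pm (rf (Q0' j)) (evw Q0 (h j))"
  shows "isolated_id n Q'"
proof -
  obtain e where e: "e > 0" "\<And>w c. w \<in> wds n \<Longrightarrow> c \<in> {1, -1} \<Longrightarrow>
    dist (c *\<^sub>R evw Q w 1) 1 < e \<Longrightarrow> dist (c *\<^sub>R evw Q w \<i>) \<i> < e \<Longrightarrow> weq n w []"
    using assms(1) unfolding isolated_id_def by metis
  show ?thesis unfolding isolated_id_def
  proof (intro exI[of _ e] conjI ballI impI e(1))
    fix w and c :: real assume w: "w \<in> wds n" and c: "c \<in> {1, -1}"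
      and d: "dist (c *\<^sub>R evw Q' w 1) 1 < e" "dist (c *\<^sub>R evw Q' w \<i>) \<i> < e"
    define v where "v = concat (map h w)"
    have v: "v \<in> wds n" using w assms(2) unfolding v_def by (induction w) auto
    have "pm (evw Q' w) (evw Q v)" unfolding v_def by (rule evw_subst[OF assms(3) w])
    then obtain s where s: "s \<in> {1, -1::real}" "\<And>z. evw Q' w z = s *\<^sub>R evw Q v z"
      unfolding pm_def by (metis insertI1 insertI2 scaleR_minus1_left scaleR_one)
    have "weq n v []" by (rule e(2)[OF v, of "c * s"]) (use c s d in auto)
    then have "pm (evw Q0 v) (\<lambda>z. z)" using weq_sound[OF assms(4), of v "[]"] by (simp add: pm_def)
    moreover have "pm (evw Q0' w) (evw Q0 v)" unfolding v_def by (rule evw_subst[OF assms(6) w])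
    ultimately have "pm (evw Q0' w) (\<lambda>z. z)" using pm_trans by blast
    then show "weq n w []" by (rule isolated_id_word[OF assms(5) w])
  qed
qed

section \<open>Braid moves preserve the isolated identity\<close>

definition nth_point :: "mvec list \<Rightarrow> nat \<Rightarrow> mvec" where "nth_point Qs i = Qs ! (i - 1)"

lemma tuple_nth_point: "length Qs = n \<Longrightarrow> tuple n (nth_point Qs) = Qs"
  by (rule nth_equalityI) (auto simp: tuple_def nth_point_def simp del: upt_Suc)

lemma nth_point_tuple: "1 \<le> i \<Longrightarrow> i \<le> n \<Longrightarrow> nth_point (tuple n Q) i = Q i"
  by (auto simp: tuple_def nth_point_def simp del: upt_Suc)

text \<open>The words that express the reflections of the tuple after a braid move by those before it.\<close>

definition braid_up :: "nat \<Rightarrow> nat \<Rightarrow> nat list" where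
  "braid_up i j = (if j = i then [Suc i] else if j = Suc i then [Suc i, i, Suc i] else [j])"

definition braid_down :: "nat \<Rightarrow> nat \<Rightarrow> nat list" where
  "braid_down i j = (if j = i then [i, Suc i, i] else if j = Suc i then [i] else [j])"

lemma nth_point_pair:
  "nth_point (a @ [p, q] @ b) (Suc (length a)) = p" "nth_point (a @ [p, q] @ b) (Suc (Suc (length a))) = q"
  "j \<noteq> Suc (length a) \<Longrightarrow> j \<noteq> Suc (Suc (length a)) \<Longrightarrow> 1 \<le> j \<Longrightarrow> nth_point (a @ [p, q] @ b) j = nth_point (a @ [p', q'] @ b) j"
  by (auto simp: nth_point_def nth_append nth_Cons split: nat.splits)

lemma braid_pm:
  assumes "1 \<le> j"
  shows "mk q q = 1 \<Longrightarrow> pm (rf (nth_point (a @ [q, hrefl q p] @ b) j)) (evw (nth_point (a @ [p, q] @ b)) (braid_up (Suc (length a)) j))"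
    "mk p p = 1 \<Longrightarrow> pm (rf (nth_point (a @ [hrefl p q, p] @ b) j)) (evw (nth_point (a @ [p, q] @ b)) (braid_down (Suc (length a)) j))"
proof -
  consider "j = Suc (length a)" | "j = Suc (Suc (length a))" | "j \<noteq> Suc (length a)" "j \<noteq> Suc (Suc (length a))" by blast
  then have "(mk q q = 1 \<longrightarrow> pm (rf (nth_point (a @ [q, hrefl q p] @ b) j)) (evw (nth_point (a @ [p, q] @ b)) (braid_up (Suc (length a)) j))) \<and>
    (mk p p = 1 \<longrightarrow> pm (rf (nth_point (a @ [hrefl p q, p] @ b) j)) (evw (nth_point (a @ [p, q] @ b)) (braid_down (Suc (length a)) j)))"
  proof cases
    case 3
    have "nth_point (a @ [q, hrefl q p] @ b) j = nth_point (a @ [p, q] @ b) j" "nth_point (a @ [hrefl p q, p] @ b) j = nth_point (a @ [p, q] @ b) j"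
      using nth_point_pair(3)[OF 3 assms] by blast+
    then show ?thesis using 3 by (simp add: braid_up_def braid_down_def pm_def)
  qed (simp_all only: nth_point_pair, auto simp: braid_up_def braid_down_def pm_def rf_refl nth_point_pair[simplified])
  then show "mk q q = 1 \<Longrightarrow> pm (rf (nth_point (a @ [q, hrefl q p] @ b) j)) (evw (nth_point (a @ [p, q] @ b)) (braid_up (Suc (length a)) j))"
    "mk p p = 1 \<Longrightarrow> pm (rf (nth_point (a @ [hrefl p q, p] @ b) j)) (evw (nth_point (a @ [p, q] @ b)) (braid_down (Suc (length a)) j))" by blast+
qed

lemma isolated_braid_closed:
  assumes "n \<ge> 5" shows "braid_closed {Qs. length Qs = n \<and> closing Qs \<and> isolated_id n (nth_point Qs)}"
  unfolding braid_closed_def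
proof (intro allI impI)
  fix a p q b assume "a @ [p, q] @ b \<in> {Qs. length Qs = n \<and> closing Qs \<and> isolated_id n (nth_point Qs)}"
  then have l: "length (a @ [p, q] @ b) = n" and cl: "closing (a @ [p, q] @ b)" and iso: "isolated_id n (nth_point (a @ [p, q] @ b))"
    by blast+
  have h: "p \<in> hyp" "q \<in> hyp" using cl by (auto simp: closing_def)
  \<comment> \<open>The regular tuple, split at the same position, is the reference; after the braid
    move it is still extremal and so has an isolated identity.\<close>
  define Rs where "Rs = tuple n (regQ n)"
  have e: "extremal Rs" unfolding Rs_def by (rule reg_extremal[OF assms])
  have lR: "length Rs = n" by (simp add: Rs_def tuple_def del: upt_Suc)
  define a0 where "a0 = take (length a) Rs"
  define p0 q0 b0 where "p0 = Rs ! length a" and "q0 = Rs ! Suc (length a)" and "b0 = drop (Suc (Suc (length a))) Rs"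
  have "length a < length Rs" "Suc (length a) < length Rs" using l lR by auto
  then have R: "Rs = a0 @ [p0, q0] @ b0" unfolding a0_def p0_def q0_def b0_def
    by (simp add: Cons_nth_drop_Suc)
  have la: "length a0 = length a" unfolding a0_def using l lR by simp
  have clR: "closing (tuple n (nth_point Rs))" using e lR by (simp add: tuple_nth_point extremal_def)
  have h0: "mk p0 p0 = 1" "mk q0 q0 = 1" using e R by (auto simp: extremal_def closing_def hypD)
  have mem: "a0 @ [p0, q0] @ b0 \<in> {Qs. extremal Qs \<and> length Qs = n}" using e lR R by simp
  note eb = braidD[OF extremal_braid mem]
  have i0: "isolated_id n (nth_point (a0 @ [q0, hrefl q0 p0] @ b0))" "isolated_id n (nth_point (a0 @ [hrefl p0 q0, p0] @ b0))"
    using eb by (auto intro!: extremal_isolated[OF assms] simp: tuple_nth_point)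
  have w: "braid_up (Suc (length a)) j \<in> wds n" "braid_down (Suc (length a)) j \<in> wds n" if "1 \<le> j" "j \<le> n" for j
    using that l by (auto simp: braid_up_def braid_down_def)
  have 1: "isolated_id n (nth_point (a @ [q, hrefl q p] @ b))"
    by (rule isolated_id_subst[OF iso w(1) braid_pm(1) clR i0(1)])
      (use braid_pm(1)[OF _ h0(2), of _ a0 p0 b0] h hypD in \<open>auto simp: la R\<close>)
  have 2: "isolated_id n (nth_point (a @ [hrefl p q, p] @ b))"
    by (rule isolated_id_subst[OF iso w(2) braid_pm(2) clR i0(2)])
      (use braid_pm(2)[OF _ h0(1), of _ a0 q0 b0] h hypD in \<open>auto simp: la R\<close>)
  show "a @ [q, hrefl q p] @ b \<in> {Qs. length Qs = n \<and> closing Qs \<and> isolated_id n (nth_point Qs)} \<and>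
      a @ [hrefl p q, p] @ b \<in> {Qs. length Qs = n \<and> closing Qs \<and> isolated_id n (nth_point Qs)}"
    using 1 2 l cl shift_closing[OF shift_braid(1)[OF h], of a b] shift_closing[OF shift_braid(2)[OF h], of a b] by simp
qed

text \<open>The point of minimal height in an orbit is bounded by \<open>reg_descent\<close>.\<close>

lemma reg_cocompact:
  assumes "n \<ge> 5" "x \<in> hyp"
  shows "\<exists>R. \<forall>z\<in>hyp. \<exists>w\<in>wds n. mk (evh (regQ n) w x) z \<le> R"
proof -
  interpret closed_tuple n "regQ n" by unfold_locales (rule reg_closing[OF assms(1)])
  have iso: "isolated_id n (regQ n)" by (rule extremal_isolated[OF assms(1) reg_extremal[OF assms(1)]])
  show ?thesis
  proof (intro exI ballI)
    fix z assume z: "z \<in> hyp"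
    have bh: "base \<in> hyp" by (rule base_hyp)
    have "\<exists>W. finite W \<and> W \<subseteq> wds n \<and> (\<forall>w\<in>wds n. mk (evh (regQ n) w z) base \<le> fst z \<longrightarrow> (\<exists>w'\<in>W. weq n w w'))"
      by (rule finite_words_mk[OF iso z bh])
    then obtain W where W: "finite W" "W \<subseteq> wds n" "\<And>w. w \<in> wds n \<Longrightarrow> mk (evh (regQ n) w z) base \<le> fst z \<Longrightarrow> \<exists>w'\<in>W. weq n w w'"
      by blast
    define f where "f w = fst (evh (regQ n) w z)" for w
    have "\<exists>w'\<in>W. weq n [] w'" by (rule W(3)) (simp_all add: mk_base)
    then have ne: "W \<noteq> {}" by blast
    obtain w where w: "w \<in> W" "\<And>w'. w' \<in> W \<Longrightarrow> f w \<le> f w'"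
      using ex_is_arg_min_if_finite[OF W(1) ne, of f] by (auto simp: is_arg_min_def not_less)
    have wn: "w \<in> wds n" using w W by blast
    have hz: "evh (regQ n) w z \<in> hyp" by (rule evh_hyp[OF wn z])
    have fz: "f w \<le> fst z"
    proof -
      obtain w' where "w' \<in> W" "weq n [] w'" using \<open>\<exists>w'\<in>W. weq n [] w'\<close> by blast
      then show ?thesis using w(2)[of w'] weq_evh[of "[]" w' z] by (simp add: f_def)
    qed
    have "f w \<le> (regA n)\<^sup>2"
    proof (rule ccontr)
      assume "\<not> f w \<le> (regA n)\<^sup>2"
      then have "fst (evh (regQ n) w z) > (regA n)\<^sup>2" by (simp add: f_def)
      from reg_descent[OF assms(1) hz this] obtain i where i: "i \<in> {1..n}" "fst (evh (regQ n) (i # w) z) < f w"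
        by (auto simp: f_def)
      have iw: "i # w \<in> wds n" using i wn by auto
      have "\<exists>w'\<in>W. weq n (i # w) w'" by (rule W(3)[OF iw]) (use i fz in \<open>simp add: mk_base\<close>)
      then obtain w' where "w' \<in> W" "weq n (i # w) w'" by blast
      then show False using w(2)[of w'] weq_evh[of "i # w" w' z] i(2) by (simp add: f_def)
    qed
    then have 1: "mk (evh (regQ n) w z) base \<le> (regA n)\<^sup>2" by (simp add: f_def mk_base)
    have "mk (evh (regQ n) (rev w) x) z = mk x (evh (regQ n) w z)" by (rule mk_evh_rev[OF wn])
    also have "\<dots> \<le> 2 * (mk x base * mk base (evh (regQ n) w z))" by (rule mk_triangle[OF assms(2) bh hz])
    also have "\<dots> \<le> 2 * (mk x base * (regA n)\<^sup>2)"
      using 1 mk_ge_1[OF assms(2) bh] by (simp add: mk_sym[of base] mult_left_mono)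
    finally show "\<exists>v\<in>wds n. mk (evh (regQ n) v x) z \<le> 2 * (mk x base * (regA n)\<^sup>2)" using wn by auto
  qed
qed

text \<open>\<open>Q\<close> is the tuple under study and \<open>Q0\<close> the cocompact reference.
  Both realise the same abstract group, so the orbit points \<open>evh Q0 w x0\<close> and
  \<open>evh Q w x\<close> correspond to each other.\<close>

locale compare =
  a: closed_tuple n Q + b: closed_tuple n Q0 for n :: nat and Q Q0 :: "nat \<Rightarrow> mvec" +
  assumes n5: "n \<ge> 5" and iso: "isolated_id n Q" and ext0: "extremal (tuple n Q0)"
    and cocomp: "\<And>x. x \<in> hyp \<Longrightarrow> \<exists>R. \<forall>z\<in>hyp. \<exists>w\<in>wds n. mk (evh Q0 w x) z \<le> R"
begin

lemma iso0: "isolated_id n Q0" by (rule extremal_isolated[OF n5 ext0])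

text \<open>For collinear points of \<open>Q\<close> the square of the product of the three
  generators would be trivial by \<open>om3_square\<close>, hence also in the reference group, where
  it would make the product itself a scalar.\<close>

lemma triple_nonzero:
  assumes "1 \<le> i" "i \<le> n" "1 \<le> j" "j \<le> n" "1 \<le> k" "k \<le> n" "tri (Q0 i) (Q0 j) (Q0 k) \<noteq> 0"
  shows "tri (Q i) (Q j) (Q k) \<noteq> 0"
proof
  assume z: "tri (Q i) (Q j) (Q k) = 0"
  have m: "mk (Q x) (Q x) = 1" "mk (Q0 x) (Q0 x) = 1" if "1 \<le> x" "x \<le> n" for x
    using a.Qh[OF that] b.Qh[OF that] by (auto simp: hypD)
  define w where "w = [k, j, i, k, j, i]"
  have w: "w \<in> wds n" using assms by (simp add: w_def)
  have e: "evw P w x = om3 (P i) (P j) (P k) (om3 (P i) (P j) (P k) x)" for P x by (simp add: w_def om3_def)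
  have "pm (evw Q w) (\<lambda>x. x)" unfolding pm_def e
    using om3_square[of "Q i" "Q j" "Q k"] m assms z by simp
  then have "weq n w []" by (rule isolated_id_word[OF iso w])
  then have "pm (evw Q0 w) (\<lambda>x. x)" using weq_sound[OF b.cl, of w "[]"] by (simp add: pm_def)
  moreover define t where "t = tri (Q0 i) (Q0 j) (Q0 k)"
  moreover have "evw Q0 w x = - x - (2 * t) *\<^sub>R om3 (Q0 i) (Q0 j) (Q0 k) x" for x
    unfolding e t_def by (rule om3_square) (use m assms in auto)
  ultimately consider "\<And>x. - x - (2 * t) *\<^sub>R om3 (Q0 i) (Q0 j) (Q0 k) x = x" | "\<And>x. - x - (2 * t) *\<^sub>R om3 (Q0 i) (Q0 j) (Q0 k) x = - x"
    unfolding pm_def by metis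
  then obtain c where "\<And>x. om3 (Q0 i) (Q0 j) (Q0 k) x = c *\<^sub>R x"
  proof cases
    case 1
    have "om3 (Q0 i) (Q0 j) (Q0 k) x = (- 1 / t) *\<^sub>R x" for x
    proof -
      have "(2 * t) *\<^sub>R om3 (Q0 i) (Q0 j) (Q0 k) x = - (2 *\<^sub>R x)" using 1[of x] by (simp add: algebra_simps scaleR_2 eq_neg_iff_add_eq_0)
      then have "(1 / (2 * t)) *\<^sub>R ((2 * t) *\<^sub>R om3 (Q0 i) (Q0 j) (Q0 k) x) = (1 / (2 * t)) *\<^sub>R (- (2 *\<^sub>R x))" by simp
      then show ?thesis using assms(7) by (simp add: t_def)
    qed
    then show ?thesis using that by blast
  next
    case 2
    then have "om3 (Q0 i) (Q0 j) (Q0 k) x = 0 *\<^sub>R x" for x using 2[of x] assms(7) by (simp add: t_def)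
    then show ?thesis using that by blast
  qed
  then show False using om3_not_scalar[of "Q0 i" "Q0 j" "Q0 k" c] b.Qh assms by metis
qed

text \<open>An orbit point near the line through \<open>Q i\<close> and \<open>Q j\<close> is, up to the translations along that line,
  one of finitely many; hence the corresponding orbit point of \<open>Q0\<close> is near the corresponding line.\<close>

lemma near_line_transfer:
  assumes "1 \<le> i" "i \<le> n" "1 \<le> j" "j \<le> n" "Q i \<noteq> Q j" "x \<in> hyp"
  shows "\<exists>K0\<ge>0. \<forall>w\<in>wds n. \<bar>tri (Q i) (Q j) (evh Q w x)\<bar> \<le> K \<longrightarrow> \<bar>tri (Q0 i) (Q0 j) (evh Q0 w x0)\<bar> \<le> K0"
proof -
  obtain G where G: "\<And>y. y \<in> hyp \<Longrightarrow> \<bar>tri (Q i) (Q j) y\<bar> \<le> K \<Longrightarrow>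
    (\<exists>k. mk (evh Q (cpow i j k) y) (Q i) \<le> G) \<or> (\<exists>k. mk (evh Q (cpow j i k) y) (Q i) \<le> G)"
    using a.near_line[OF assms(1-5), of K] by blast
  have Qi: "Q i \<in> hyp" using a.Qh assms by blast
  obtain W where W: "finite W" "\<And>w. w \<in> wds n \<Longrightarrow> mk (evh Q w x) (Q i) \<le> G \<Longrightarrow> \<exists>w'\<in>W. weq n w w'"
    using a.finite_words_mk[OF iso assms(6) Qi, of G] by blast
  define s where "s w = \<bar>tri (Q0 i) (Q0 j) (evh Q0 w x0)\<bar>" for w
  define K0 where "K0 = Max (insert 0 (s ` W))"
  have K0: "s w' \<le> K0" if "w' \<in> W" for w' unfolding K0_def using W(1) that by (intro Max_ge) auto
  have K00: "0 \<le> K0" unfolding K0_def using W(1) by (intro Max_ge) auto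
  have "s w \<le> K0" if w: "w \<in> wds n" "\<bar>tri (Q i) (Q j) (evh Q w x)\<bar> \<le> K" for w
  proof -
    have h: "evh Q w x \<in> hyp" by (rule a.evh_hyp[OF w(1) assms(6)])
    obtain c where c: "c \<in> wds n" "mk (evh Q (c @ w) x) (Q i) \<le> G" "tri (Q0 i) (Q0 j) (evh Q0 (c @ w) x0) = tri (Q0 i) (Q0 j) (evh Q0 w x0)"
      using G[OF h w(2)]
    proof (elim disjE exE)
      fix k assume "mk (evh Q (cpow i j k) (evh Q w x)) (Q i) \<le> G"
      then show ?thesis using that[of "cpow i j k"] cpow_wds[OF assms(1-4)] b.tri_cpow(1)[OF assms(1-4)] by simp
    next
      fix k assume "mk (evh Q (cpow j i k) (evh Q w x)) (Q i) \<le> G"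
      then show ?thesis using that[of "cpow j i k"] cpow_wds[OF assms(3,4,1,2)] b.tri_cpow(2)[OF assms(3,4,1,2)] by simp
    qed
    have cw: "c @ w \<in> wds n" using c w by simp
    obtain w' where w': "w' \<in> W" "weq n (c @ w) w'" using W(2)[OF cw c(2)] by blast
    have "evh Q0 (c @ w) x0 = evh Q0 w' x0" by (rule b.weq_evh[OF w'(2)])
    then have "s w = s w'" using c(3) by (simp add: s_def)
    then show ?thesis using K0[OF w'(1)] by simp
  qed
  then show ?thesis using K00 unfolding s_def by blast
qed

text \<open>Displacements up to \<open>M\<close> in the reference orbit are due to finitely many
  group elements, and these move \<open>x\<close> by a bounded amount.\<close>

lemma distance_transfer:
  assumes "x \<in> hyp" "x0 \<in> hyp"
  shows "\<exists>D\<ge>0. \<forall>v\<in>wds n. \<forall>w\<in>wds n. mk (evh Q0 v x0) (evh Q0 w x0) \<le> M \<longrightarrow> mk (evh Q v x) (evh Q w x) \<le> D"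
proof -
  obtain W where W: "finite W" "\<And>w. w \<in> wds n \<Longrightarrow> mk (evh Q0 w x0) x0 \<le> M \<Longrightarrow> \<exists>w'\<in>W. weq n w w'"
    using b.finite_words_mk[OF iso0 assms(2,2), of M] by blast
  define s where "s w = mk (evh Q w x) x" for w
  define D where "D = Max (insert 0 (s ` W))"
  have D: "s w' \<le> D" if "w' \<in> W" for w' unfolding D_def using W(1) that by (intro Max_ge) auto
  have D0: "0 \<le> D" unfolding D_def using W(1) by (intro Max_ge) auto
  have "mk (evh Q v x) (evh Q w x) \<le> D" if vw: "v \<in> wds n" "w \<in> wds n" and le: "mk (evh Q0 v x0) (evh Q0 w x0) \<le> M" for v w
  proof -
    have u: "rev w @ v \<in> wds n" using vw by simp
    have "mk (evh Q0 (rev w @ v) x0) x0 \<le> M" using b.mk_evh_rev[OF vw(2), of "evh Q0 v x0" x0] le by simp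
    then obtain w' where w': "w' \<in> W" "weq n (rev w @ v) w'" using W(2)[OF u] by blast
    have "mk (evh Q v x) (evh Q w x) = s (rev w @ v)" using a.mk_evh_rev[OF vw(2), of "evh Q v x" x] by (simp add: s_def)
    also have "\<dots> = s w'" using a.weq_evh[OF w'(2)] by (simp add: s_def)
    finally show ?thesis using D[OF w'(1)] by simp
  qed
  then show ?thesis using D0 by blast
qed

text \<open>The region \<open>U\<close> deep on one side of the reference line is connected, and
  every point of it is near the orbit. The corresponding points of the other orbit are far from
  their line, and neighbours correspond to points at bounded distance, which cannot lie on different
  sides. So the side is locally constant on \<open>U\<close>.\<close>

lemma same_side:
  assumes ij: "1 \<le> i" "i \<le> n" "1 \<le> j" "j \<le> n" "Q i \<noteq> Q j" "Q0 i \<noteq> Q0 j" and x: "x \<in> hyp" "x0 \<in> hyp"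
    and e: "e0 \<in> {1, -1}"
  shows "\<exists>K2. \<forall>v\<in>wds n. \<forall>w\<in>wds n. e0 * tri (Q0 i) (Q0 j) (evh Q0 v x0) > K2 \<longrightarrow>
    e0 * tri (Q0 i) (Q0 j) (evh Q0 w x0) > K2 \<longrightarrow> tri (Q i) (Q j) (evh Q v x) * tri (Q i) (Q j) (evh Q w x) > 0"
proof -
  define sg where "sg w = tri (Q i) (Q j) (evh Q w x)" for w
  have h: "Q i \<in> hyp" "Q j \<in> hyp" "Q0 i \<in> hyp" "Q0 j \<in> hyp" using ij a.Qh b.Qh by auto
  \<comment> \<open>Exchanging the two points of the reference line absorbs the sign
    \<open>e0\<close>.\<close>
  obtain p q where pq: "p \<in> hyp" "q \<in> hyp" "p \<noteq> q" "\<And>y. tri p q y = e0 * tri (Q0 i) (Q0 j) y"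
  proof (cases "e0 = 1")
    case True
    then show ?thesis using that[OF h(3,4) ij(6)] by simp
  next
    case False
    then show ?thesis using that[OF h(4,3)] ij(6) e tri_swap(1)[of "Q0 j" "Q0 i"] by force
  qed
  obtain R0 where R0: "\<And>z. z \<in> hyp \<Longrightarrow> \<exists>w\<in>wds n. mk (evh Q0 w x0) z \<le> R0" using cocomp[OF x(2)] by blast
  define R where "R = max 1 R0"
  have R: "\<exists>w\<in>wds n. mk (evh Q0 w x0) z \<le> R" if "z \<in> hyp" for z using R0[OF that] unfolding R_def by (metis max.coboundedI2)
  have R1: "R \<ge> 1" by (simp add: R_def)
  \<comment> \<open>Bounds the distance of orbit points that are within \<open>R\<close> of two
    points of \<open>U\<close> with \<open>mk y z \<le> 2\<close>, by two triangle
    inequalities.\<close>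
  define M where "M = 2 * (R * (2 * (2 * R)))"
  obtain D where D: "D \<ge> 0" "\<And>v w. v \<in> wds n \<Longrightarrow> w \<in> wds n \<Longrightarrow> mk (evh Q0 v x0) (evh Q0 w x0) \<le> M \<Longrightarrow> mk (evh Q v x) (evh Q w x) \<le> D"
    using distance_transfer[OF x, of M] by blast
  define m where "m = mk (Q i) (Q j)"
  have m: "m \<ge> 1" unfolding m_def by (rule mk_ge_1[OF h(1,2)])
  \<comment> \<open>Beyond the signed distance \<open>K\<close>, a displacement by at most
    \<open>D\<close> cannot cross the line, by \<open>opposite_sides_far\<close>.\<close>
  define K where "K = m * D"
  obtain K0 where K0: "K0 \<ge> 0" "\<And>w. w \<in> wds n \<Longrightarrow> \<bar>sg w\<bar> \<le> K \<Longrightarrow> \<bar>tri (Q0 i) (Q0 j) (evh Q0 w x0)\<bar> \<le> K0"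
    using near_line_transfer[OF ij(1-5) x(1), of K x0] unfolding sg_def by blast
  define K1 where "K1 = 2 * R * K0 + ((mk p q)\<^sup>2 - 1) * R\<^sup>2 + 1"
  define U where "U = {z \<in> hyp. tri p q z > K1}"
  have con: "connected U" unfolding U_def by (rule connected_side[OF pq(1-3)])
  have deep: "\<bar>sg w\<bar> > K" if "z \<in> U" "w \<in> wds n" "mk (evh Q0 w x0) z \<le> R" for z w
  proof (rule ccontr)
    assume "\<not> \<bar>sg w\<bar> > K"
    then have "\<bar>tri (Q0 i) (Q0 j) (evh Q0 w x0)\<bar> \<le> K0" using K0(2)[OF that(2)] by simp
    then have "\<bar>tri p q (evh Q0 w x0)\<bar> \<le> K0" unfolding pq(4) using e by auto
    from near_far[OF pq(1,2) b.evh_hyp[OF that(2) x(2)] _ that(3) this] show False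
      using that(1) by (simp add: U_def K1_def)
  qed
  have step: "sg v * sg w > 0" if zz: "y \<in> U" "z \<in> U" "mk y z \<le> 2" and v: "v \<in> wds n" "mk (evh Q0 v x0) y \<le> R"
    and w: "w \<in> wds n" "mk (evh Q0 w x0) z \<le> R" for y z v w
  proof (rule ccontr)
    assume "\<not> sg v * sg w > 0"
    then have le: "tri (Q i) (Q j) (evh Q v x) * tri (Q i) (Q j) (evh Q w x) \<le> 0" by (simp add: sg_def)
    have hy: "y \<in> hyp" "z \<in> hyp" using zz by (auto simp: U_def)
    have hv: "evh Q0 v x0 \<in> hyp" "evh Q0 w x0 \<in> hyp" using b.evh_hyp v w x by auto
    have "mk y (evh Q0 w x0) \<le> 2 * (mk y z * mk z (evh Q0 w x0))" by (rule mk_triangle[OF hy hv(2)])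
    also have "\<dots> \<le> 2 * (2 * R)" using zz(3) w(2) mk_ge_1[OF hy] mk_ge_1[OF hv(2) hy(2)]
      by (intro mult_left_mono mult_mono) (auto simp: mk_sym[of z])
    finally have 1: "mk y (evh Q0 w x0) \<le> 2 * (2 * R)" .
    have "mk (evh Q0 v x0) (evh Q0 w x0) \<le> 2 * (mk (evh Q0 v x0) y * mk y (evh Q0 w x0))" by (rule mk_triangle[OF hv(1) hy(1) hv(2)])
    also have "\<dots> \<le> M" unfolding M_def using 1 v(2) R1 mk_ge_1[OF hy(1) hv(2)] mk_ge_1[OF hv(1) hy(1)]
      by (intro mult_left_mono mult_mono) auto
    finally have "mk (evh Q v x) (evh Q w x) \<le> D" by (rule D(2)[OF v(1) w(1)])
    then have "(sg v)\<^sup>2 \<le> (m\<^sup>2 - 1) * D\<^sup>2" unfolding sg_def m_def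
      by (rule opposite_sides_far[OF h(1,2) a.evh_hyp[OF v(1) x(1)] a.evh_hyp[OF w(1) x(1)] le])
    also have "\<dots> \<le> K\<^sup>2" unfolding K_def by (simp add: power_mult_distrib mult_right_mono)
    finally have "\<bar>sg v\<bar> \<le> \<bar>K\<bar>" unfolding abs_le_square_iff .
    then show False using deep[OF zz(1) v] m D(1) by (simp add: K_def)
  qed
  define P where "P z \<longleftrightarrow> (\<exists>w\<in>wds n. mk (evh Q0 w x0) z \<le> R \<and> sg w > 0)" for z
  have mono: "P z" if "P y" "y \<in> U" "z \<in> U" "mk y z \<le> 2" for y z
  proof -
    obtain v where v: "v \<in> wds n" "mk (evh Q0 v x0) y \<le> R" "sg v > 0" using \<open>P y\<close> unfolding P_def by blast
    obtain w where w: "w \<in> wds n" "mk (evh Q0 w x0) z \<le> R" using R[of z] \<open>z \<in> U\<close> unfolding U_def by blast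
    have "sg v * sg w > 0" by (rule step[OF that(2-4) v(1,2) w])
    then have "sg w > 0" using v(3) by (simp add: zero_less_mult_iff)
    then show ?thesis using w unfolding P_def by blast
  qed
  have const: "P y = P z" if "y \<in> U" "z \<in> U" for y z
  proof (rule connected_local_const[OF con that], intro ballI)
    fix y assume y: "y \<in> U"
    have "((\<lambda>z. mk y z) \<longlongrightarrow> mk y y) (at y within U)" unfolding mk_def by (intro tendsto_intros)
    moreover have "mk y y < 2" using y by (simp add: U_def hypD)
    ultimately have "\<forall>\<^sub>F z in at y within U. mk y z < 2" by (rule order_tendstoD)
    moreover have "\<forall>\<^sub>F z in at y within U. z \<in> U" by (simp add: eventually_at_filter)
    ultimately show "\<forall>\<^sub>F z in at y within U. P y = P z"
    proof eventually_elim
      case (elim z)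
      then have "mk y z \<le> 2" "mk z y \<le> 2" using mk_sym[of y z] by auto
      then show ?case using mono y elim(2) by blast
    qed
  qed
  show ?thesis
  proof (intro exI[of _ K1] ballI impI)
    fix v w assume vw: "v \<in> wds n" "w \<in> wds n"
      and g: "e0 * tri (Q0 i) (Q0 j) (evh Q0 v x0) > K1" "e0 * tri (Q0 i) (Q0 j) (evh Q0 w x0) > K1"
    define y z where "y = evh Q0 v x0" and "z = evh Q0 w x0"
    have hyz: "y \<in> hyp" "z \<in> hyp" unfolding y_def z_def using b.evh_hyp vw x by auto
    have U: "y \<in> U" "z \<in> U" using g hyz unfolding U_def pq(4) by (auto simp: y_def z_def)
    have one: "mk y y \<le> R" "mk z z \<le> R" "mk y y \<le> 2" "mk z z \<le> 2" using hyz R1 by (auto simp: hypD)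
    have p: "sg u > 0 \<longleftrightarrow> P t" if "u \<in> wds n" "t = evh Q0 u x0" "t \<in> U" "mk t t \<le> R" "mk t t \<le> 2" for u t
    proof
      assume "sg u > 0" then show "P t" unfolding P_def using that by blast
    next
      assume "P t"
      then obtain w where w: "w \<in> wds n" "mk (evh Q0 w x0) t \<le> R" "sg w > 0" unfolding P_def by blast
      have "mk (evh Q0 u x0) t \<le> R" using that by simp
      then have "sg w * sg u > 0" by (rule step[OF that(3,3,5) w(1,2) that(1)])
      then show "sg u > 0" using w(3) by (simp add: zero_less_mult_iff)
    qed
    have "sg v > 0 \<longleftrightarrow> sg w > 0"
      using p[OF vw(1) y_def U(1) one(1,3)] p[OF vw(2) z_def U(2) one(2,4)] const[OF U] by blast
    moreover have nz: "sg v \<noteq> 0" "sg w \<noteq> 0"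
      using step[OF U(1,1) one(3) vw(1) _ vw(1)] step[OF U(2,2) one(4) vw(2) _ vw(2)] one by (auto simp: y_def z_def)
    ultimately show "tri (Q i) (Q j) (evh Q v x) * tri (Q i) (Q j) (evh Q w x) > 0"
      unfolding sg_def[symmetric] zero_less_mult_iff by linarith
  qed
qed

end

section \<open>The two ends of a line through neighbouring points\<close>

lemma vseq_in_rev:
  assumes "braid_closed S" "a @ [q, p] @ b \<in> S" shows "a @ [vseq p q (Suc k), vseq p q k] @ b \<in> S"
proof (induction k)
  case (Suc k)
  then show ?case using braidD(2)[OF assms(1) Suc] by simp
qed (use assms in simp)

lemma extremal_vseq_pos:
  assumes "extremal (a @ [p, q, r, s] @ b)" "length (a @ [p, q, r, s] @ b) \<ge> 5" "e * tri p q r > 0"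
  shows "e * tri p q (vseq r s k) > 0" "e * tri p q (vseq s r k) > 0"
proof -
  define S where "S = {Qs. extremal Qs \<and> length Qs = length (a @ [p, q, r, s] @ b)}"
  have bc: "braid_closed S" unfolding S_def by (rule extremal_braid)
  have m: "(a @ [p, q]) @ [r, s] @ b \<in> S" using assms by (simp add: S_def)
  have c: "tri p q x * tri p q y > 0" if "(a @ [p, q]) @ [x, y] @ b \<in> S" for x y
  proof -
    have "coherent (a @ [p, q, x, y] @ b)" using that assms(2) by (intro extremal_coherent) (auto simp: S_def)
    then show ?thesis unfolding coherent_def by blast
  qed
  have sg: "e * y > 0" if "e * x > 0" "x * y > 0" for x y :: real using that by (auto simp: zero_less_mult_iff)
  show "e * tri p q (vseq r s k) > 0"
  proof (induction k)
    case (Suc k)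
    then show ?case using sg c[OF vseq_in[OF bc m, of k]] by blast
  qed (use assms in simp)
  show "e * tri p q (vseq s r k) > 0"
  proof (induction k)
    case 0
    then show ?case using sg[OF assms(3) c[OF m]] by simp
  next
    case (Suc k)
    then show ?case using sg c[OF vseq_in_rev[OF bc m, of k]] by (metis mult.commute)
  qed
qed

text \<open>Coherence keeps the sequences in both directions on one side of the line through
  \<open>p\<close> and \<open>q\<close>. Neither tends to an end of that line
  (\<open>extremal_no_common_end\<close>), so the signed distance grows without bound.\<close>

lemma extremal_vseq_unbounded:
  assumes "extremal (a @ [p, q, r, s] @ b)" "length (a @ [p, q, r, s] @ b) \<ge> 5" "e * tri p q r > 0"
  shows "\<exists>k0. \<forall>k\<ge>k0. e * tri p q (vseq r s k) > K \<and> e * tri p q (vseq s r k) > K"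
proof -
  have h: "r \<in> hyp" "s \<in> hyp" using assms(1) by (auto simp: extremal_def closing_def)
  have ne: "r \<noteq> s" using extremal_no_double[of "a @ [p, q]" r b] assms by auto
  have ab: "a @ b \<noteq> []" using assms(2) by auto
  have e: "e \<noteq> 0" using assms(3) by auto
  have *: "\<exists>k0. \<forall>k\<ge>k0. e * tri p q (vseq x y k) > K"
    if x: "x \<in> hyp" "y \<in> hyp" "x \<noteq> y" and pos: "\<And>k. e * tri p q (vseq x y k) > 0" and z: "tri r s x = 0" "tri r s y = 0" for x y
  proof -
    obtain l u where u: "l > 1" "u \<noteq> 0" "nullv u = y - (1 / l) *\<^sub>R x" "l + 1 / l = 2 * mk x y"
      by (rule eigen_pair[OF x]) blast
    have t: "tri r s (nullv u) = 0" unfolding u(3) by (simp add: z)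
    have "tri p q (nullv u) \<noteq> 0" using extremal_no_common_end[OF assms(1) ab u(2) _ t] by blast
    then have nz: "e * tri p q (y - (1 / l) *\<^sub>R x) \<noteq> 0" using e unfolding u(3) by simp
    show ?thesis
      by (rule vseq_unbounded[OF _ _ u(1,4) pos _ _ nz]) (use x in \<open>auto simp: hypD algebra_simps\<close>)
  qed
  obtain k1 where k1: "\<And>k. k \<ge> k1 \<Longrightarrow> e * tri p q (vseq r s k) > K"
    using *[OF h ne extremal_vseq_pos(1)[OF assms]] by auto
  obtain k2 where k2: "\<And>k. k \<ge> k2 \<Longrightarrow> e * tri p q (vseq s r k) > K"
    using *[OF h(2,1) _ extremal_vseq_pos(2)[OF assms]] ne by auto
  show ?thesis by (rule exI[of _ "max k1 k2"]) (use k1 k2 in auto)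
qed

lemma tuple_split4:
  assumes "i + 4 \<le> n"
  shows "tuple n Q = map Q [1..<Suc i] @ [Q (Suc i), Q (Suc (Suc i)), Q (Suc (Suc (Suc i))), Q (Suc (Suc (Suc (Suc i))))]
    @ map Q [Suc (Suc (Suc (Suc (Suc i))))..<Suc n]"
proof -
  have "[1..<Suc n] = [1..<Suc i] @ [Suc i..<Suc n]" using upt_add_eq_append[of 1 "Suc i" "n - i"] assms by (simp del: upt_Suc)
  moreover have "[Suc i..<Suc n] = [Suc i, Suc (Suc i), Suc (Suc (Suc i)), Suc (Suc (Suc (Suc i)))] @ [Suc (Suc (Suc (Suc (Suc i))))..<Suc n]"
    using assms by (simp add: upt_conv_Cons del: upt_Suc)
  ultimately show ?thesis unfolding tuple_def by simp
qed

theorem isolated_coherent: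
  assumes "n \<ge> 5" "closing (tuple n Q)" "isolated_id n Q" shows "coherent (tuple n Q)"
  unfolding coherent_def
proof (intro allI impI, rule ccontr)
  fix a p q r s b assume T: "tuple n Q = a @ [p, q, r, s] @ b" and np: "\<not> tri p q r * tri p q s > 0"
  define Q0 where "Q0 = regQ n"
  interpret compare n Q Q0
    by unfold_locales (use assms reg_closing reg_extremal reg_cocompact in \<open>auto simp: Q0_def\<close>)
  define i1 i2 i3 i4 where "i1 = Suc (length a)" and "i2 = Suc i1" and "i3 = Suc i2" and "i4 = Suc i3"
  have len: "length a + 4 \<le> n" using arg_cong[OF T, of length] by (simp add: tuple_def del: upt_Suc)
  have ir: "1 \<le> i1" "i1 \<le> n" "1 \<le> i2" "i2 \<le> n" "1 \<le> i3" "i3 \<le> n" "1 \<le> i4" "i4 \<le> n"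
    using len by (auto simp: i1_def i2_def i3_def i4_def)
  have sp: "tuple n P = map P [1..<i1] @ [P i1, P i2, P i3, P i4] @ map P [Suc i4..<Suc n]" for P
    using tuple_split4[OF len, of P] unfolding i1_def i2_def i3_def i4_def .
  have "a @ [p, q, r, s] @ b = map Q [1..<i1] @ [Q i1, Q i2, Q i3, Q i4] @ map Q [Suc i4..<Suc n]"
    using T sp[of Q] by simp
  then have Q: "p = Q i1" "q = Q i2" "r = Q i3" "s = Q i4"
    by (auto simp: append_eq_append_conv i1_def simp del: upt_Suc)
  define a0 b0 where "a0 = map Q0 [1..<i1]" and "b0 = map Q0 [Suc i4..<Suc n]"
  have s0: "tuple n Q0 = a0 @ [Q0 i1, Q0 i2, Q0 i3, Q0 i4] @ b0" unfolding a0_def b0_def by (rule sp)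
  have e0: "extremal (a0 @ [Q0 i1, Q0 i2, Q0 i3, Q0 i4] @ b0)" using ext0 s0 by simp
  have l0: "length (a0 @ [Q0 i1, Q0 i2, Q0 i3, Q0 i4] @ b0) \<ge> 5" unfolding s0[symmetric] using n5 by (simp add: tuple_def del: upt_Suc)
  have y0: "tri (Q0 i1) (Q0 i2) (Q0 i3) * tri (Q0 i1) (Q0 i2) (Q0 i4) > 0"
    using extremal_coherent[OF e0 l0] unfolding coherent_def by blast
  then have t0: "tri (Q0 i1) (Q0 i2) (Q0 i3) \<noteq> 0" "tri (Q0 i1) (Q0 i2) (Q0 i4) \<noteq> 0" by auto
  have t: "tri p q r \<noteq> 0" "tri p q s \<noteq> 0" unfolding Q by (rule triple_nonzero; use ir t0 in simp)+
  have pq: "Q i1 \<noteq> Q i2" using t(1) unfolding Q by auto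
  have pq0: "Q0 i1 \<noteq> Q0 i2" using t0(1) by auto
  have h: "r \<in> hyp" "s \<in> hyp" "Q0 i3 \<in> hyp" "Q0 i4 \<in> hyp" using a.Qh b.Qh ir by (auto simp: Q)
  define e where "e = sgn (tri p q s)"
  have e: "e * tri p q r < 0" "e * tri p q s > 0" using np t unfolding e_def sgn_if by (auto simp: zero_less_mult_iff)
  define f where "f = sgn (tri (Q0 i1) (Q0 i2) (Q0 i3))"
  have f: "f \<in> {1, -1}" "f * tri (Q0 i1) (Q0 i2) (Q0 i3) > 0" using t0 by (auto simp: f_def sgn_if)
  obtain K2 where K2: "\<And>v w. v \<in> wds n \<Longrightarrow> w \<in> wds n \<Longrightarrow> f * tri (Q0 i1) (Q0 i2) (evh Q0 v (Q0 i3)) > K2 \<Longrightarrow>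
    f * tri (Q0 i1) (Q0 i2) (evh Q0 w (Q0 i3)) > K2 \<Longrightarrow> tri p q (evh Q v r) * tri p q (evh Q w r) > 0"
    using same_side[OF ir(1-4) pq pq0 h(1,3) f(1)] unfolding Q by blast
  obtain k where k: "\<And>j. j \<ge> k \<Longrightarrow> f * tri (Q0 i1) (Q0 i2) (vseq (Q0 i3) (Q0 i4) j) > K2 \<and> f * tri (Q0 i1) (Q0 i2) (vseq (Q0 i4) (Q0 i3) j) > K2"
    using extremal_vseq_unbounded[OF e0 l0 f(2), of K2] by blast
  \<comment> \<open>The exponent \<open>Suc k\<close> makes the indices in \<open>ev\<close>
    positive, as \<open>vseq_sign\<close> requires.\<close>
  define v w where "v = cpow i4 i3 (Suc k)" and "w = cpow i3 i4 (Suc k)"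
  have vw: "v \<in> wds n" "w \<in> wds n" using cpow_wds ir by (auto simp: v_def w_def)
  have m: "mk r r = 1" "mk s s = 1" "mk (Q0 i3) (Q0 i3) = 1" "mk (Q0 i4) (Q0 i4) = 1" using h by (auto simp: hypD)
  have ev0: "evh Q0 v (Q0 i3) = vseq (Q0 i3) (Q0 i4) (2 * Suc k)" "evh Q0 w (Q0 i3) = vseq (Q0 i4) (Q0 i3) (Suc (2 * Suc k))"
    unfolding v_def w_def by (rule evh_vseq; use m in simp)+
  have "2 * Suc k \<ge> k" "Suc (2 * Suc k) \<ge> k" by auto
  then have "tri p q (evh Q v r) * tri p q (evh Q w r) > 0"
    using K2[OF vw] k[of "2 * Suc k"] k[of "Suc (2 * Suc k)"] unfolding ev0 by blast
  moreover have ev: "evh Q v r = vseq r s (Suc (Suc (2 * k)))" "evh Q w r = vseq s r (Suc (2 * Suc k))"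
    using evh_vseq[of Q i3 i4 "Suc k"] m unfolding v_def w_def Q by simp_all
  moreover have "e * tri p q (vseq r s (Suc (Suc (2 * k)))) > 0"
    by (rule vseq_sign[OF m(1,2) mk_ge_1[OF h(1,2)] e]) (auto simp: algebra_simps)
  moreover have "(- e) * tri p q (vseq s r (Suc (2 * Suc k))) > 0"
    by (rule vseq_sign[OF m(2,1) mk_ge_1[OF h(2,1)]]) (use e in \<open>auto simp: algebra_simps\<close>)
  ultimately have "(e * tri p q (evh Q v r)) * (- e * tri p q (evh Q w r)) > 0" "tri p q (evh Q v r) * tri p q (evh Q w r) > 0"
    by (simp_all only: mult_pos_pos)
  moreover have "(e * tri p q (evh Q v r)) * (- e * tri p q (evh Q w r)) = - (e\<^sup>2 * (tri p q (evh Q v r) * tri p q (evh Q w r)))"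
    by (simp add: power2_eq_square)
  ultimately show False by (smt (verit) zero_le_power2 mult_nonneg_nonneg)
qed

theorem isolated_extremal:
  assumes "n \<ge> 5" "closing (tuple n Q)" "isolated_id n Q" shows "extremal (tuple n Q)"
proof (rule braid_extremal[OF isolated_braid_closed[OF assms(1)]])
  fix Qs assume "Qs \<in> {Qs. length Qs = n \<and> closing Qs \<and> isolated_id n (nth_point Qs)}"
  then show "closing Qs \<and> length Qs \<ge> 5 \<and> coherent Qs" using isolated_coherent[of n "nth_point Qs"] assms(1) tuple_nth_point[of Qs n] by simp
next
  have l: "length (tuple n Q) = n" by (simp add: tuple_def del: upt_Suc)
  have q: "evw (nth_point (tuple n Q)) w = evw Q w" if "w \<in> wds n" for w
    using that by (induction w) (auto simp: nth_point_tuple)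
  have "isolated_id n (nth_point (tuple n Q))" using assms(3) q by (simp add: isolated_id_def)
  then show "tuple n Q \<in> {Qs. length Qs = n \<and> closing Qs \<and> isolated_id n (nth_point Qs)}" using l assms(2) by blast
qed

section \<open>Representations and tuples of points\<close>

text \<open>Matrices of \<open>SU(1,1)\<close> preserve the real plane of the vectors
  \<open>(z, cnj z)\<close>; this is their action on it, and for a reflection matrix it is
  \<open>rf\<close>.\<close>

definition mact :: "complex ^ 2 ^ 2 \<Rightarrow> complex \<Rightarrow> complex" where
  "mact A z = A$1$1 * z + A$1$2 * cnj z"

lemma mact_mult: "B \<in> carrier SU11 \<Longrightarrow> mact (A ** B) z = mact A (mact B z)"
  by (simp add: mact_def SU11_iff matrix_matrix_mult_def sum_2 algebra_simps)

lemma mact_one [simp]: "mact (Finite_Cartesian_Product.mat 1) z = z"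
  by (simp add: mact_def Finite_Cartesian_Product.mat_def)

lemma mact_uminus [simp]: "mact (- A) z = - mact A z"
  by (simp add: mact_def)

lemma mact_inj:
  assumes "A \<in> carrier SU11" "B \<in> carrier SU11" "\<And>z. mact A z = mact B z" shows "A = B"
proof -
  have 1: "A$1$1 + A$1$2 = B$1$1 + B$1$2" using assms(3)[of 1] by (simp add: mact_def)
  have "\<i> * (A$1$1 - A$1$2) = \<i> * (B$1$1 - B$1$2)" using assms(3)[of \<i>] by (simp add: mact_def algebra_simps)
  then have 2: "A$1$1 - A$1$2 = B$1$1 - B$1$2" by simp
  have "2 * A$1$1 = 2 * B$1$1" using arg_cong2[OF 1 2, of "(+)"] by simp
  then have 3: "A$1$1 = B$1$1" by simp
  then have "A$1$2 = B$1$2" using 1 by simp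
  with 3 show ?thesis using assms(1,2) by (simp add: SU11_iff vec_eq_iff forall_2)
qed

lemma PU11_class_eq_iff:
  assumes "A \<in> carrier SU11" "B \<in> carrier SU11"
  shows "PU11_class A = PU11_class B \<longleftrightarrow> pm (mact A) (mact B)"
proof -
  have "PU11_class A = PU11_class B \<longleftrightarrow> A = B \<or> A = - B" by (auto simp: PU11_class_eq doubleton_eq_iff)
  also have "\<dots> \<longleftrightarrow> pm (mact A) (mact B)"
    unfolding pm_def using mact_inj[OF assms] mact_inj[OF assms(1) uminus_SU11[OF assms(2)]] by auto
  finally show ?thesis .
qed

lemma mact_point_reflection: "mact (point_reflection_matrix q) z = rf (hy q) z"
proof -
  define d where "d = 1 - (cmod q)\<^sup>2"
  have d: "1 - q * cnj q = of_real d" "1 + q * cnj q = of_real (1 + (cmod q)\<^sup>2)"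
    by (simp_all add: d_def complex_norm_square del: of_real_power)
  show ?thesis unfolding mact_def point_reflection_matrix_def Let_def rf_def hy_def d d_def[symmetric]
    by (simp add: scaleR_conv_of_real algebra_simps add_divide_distrib)
qed

lemma SU11_mult: "A \<in> carrier SU11 \<Longrightarrow> B \<in> carrier SU11 \<Longrightarrow> A ** B \<in> carrier SU11"
  using monoid.m_closed[OF group.is_monoid[OF group_SU11]] by (simp add: SU11_def)

lemma SU11_one: "Finite_Cartesian_Product.mat 1 \<in> carrier SU11"
  using monoid.one_closed[OF group.is_monoid[OF group_SU11]] by (simp add: SU11_def)

lemma PU11_class_mult:
  assumes "A \<in> carrier SU11" "B \<in> carrier SU11"
  shows "PU11_class A \<otimes>\<^bsub>PU11\<^esub> PU11_class B = PU11_class (A ** B)"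
  using hom_mult[OF normal.r_coset_hom_Mod[OF normal_pm1_SU11] assms]
  by (simp add: PU11_def PU11_class_def SU11_def)

lemma PU11_one: "\<one>\<^bsub>PU11\<^esub> = PU11_class (Finite_Cartesian_Product.mat 1)"
  by (simp add: PU11_def PU11_class_eq)

lemma PU11_class_in: "A \<in> carrier SU11 \<Longrightarrow> PU11_class A \<in> carrier PU11"
  using PU11_class_carrier by blast

text \<open>Equality in the quotient allows a sign, but a map and its negative cannot both turn
  counterclockwise.\<close>

lemma point_reflection_inj:
  assumes "p \<in> poincare_disc" "q \<in> poincare_disc" "point_reflection p = point_reflection q" shows "p = q"
proof -
  have S: "point_reflection_matrix p \<in> carrier SU11" "point_reflection_matrix q \<in> carrier SU11"
    using point_reflection_matrix_SU11 assms by auto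
  have "pm (rf (hy p)) (rf (hy q))"
    using assms(3) PU11_class_eq_iff[OF S] by (simp add: point_reflection_def mact_point_reflection pm_def)
  moreover have "\<not> (\<forall>z. rf (hy p) z = - rf (hy q) z)"
  proof
    assume "\<forall>z. rf (hy p) z = - rf (hy q) z"
    then have "om 1 (rf (hy p) 1) = - om 1 (rf (hy q) 1)" by simp
    moreover have "om 1 (rf (hy p) 1) > 0" "om 1 (rf (hy q) 1) > 0" using assms by (auto intro: om_rf_pos hy_hyp)
    ultimately show False by simp
  qed
  ultimately have e: "rf (hy p) z = rf (hy q) z" for z by (auto simp: pm_def)
  have A: "point_reflection_matrix p = point_reflection_matrix q"
    by (rule mact_inj[OF S]) (simp add: mact_point_reflection e)
  have "hy p = hy q"
    using e[of 1] e[of \<i>] by (simp add: mvec_eq_iff complex_eq_iff Re_rf Im_rf)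
  then show ?thesis using assms hy_inj by blast
qed

lemma point_reflection_ne_one: "q \<in> poincare_disc \<Longrightarrow> point_reflection q \<noteq> \<one>\<^bsub>PU11\<^esub>"
proof
  assume q: "q \<in> poincare_disc" and "point_reflection q = \<one>\<^bsub>PU11\<^esub>"
  then have "pm (rf (hy q)) (\<lambda>z. z)"
    using PU11_class_eq_iff[OF point_reflection_matrix_SU11[OF q] SU11_one]
    by (simp add: point_reflection_def PU11_one mact_point_reflection pm_def)
  then have "om 1 (rf (hy q) 1) = 0" unfolding pm_def by (auto simp del: rf_simps)
  then show False using om_rf_pos[OF hy_hyp[OF q], of 1] by simp
qed

text \<open>An element of \<open>SU(1,1)\<close> whose square is \<open>1\<close> or \<open>-1\<close> has trace zero unless it is \<open>1\<close> or \<open>-1\<close>,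
  and the elements of trace zero are the reflections in points, up to the sign.\<close>

lemma involution_point_reflection:
  assumes "X \<in> carrier PU11" "X \<otimes>\<^bsub>PU11\<^esub> X = \<one>\<^bsub>PU11\<^esub>" "X \<noteq> \<one>\<^bsub>PU11\<^esub>"
  obtains q where "q \<in> poincare_disc" "X = point_reflection q"
proof -
  obtain A where A: "A \<in> carrier SU11" "X = PU11_class A" using assms(1) PU11_class_carrier by blast
  define a b where "a = A$1$1" and "b = A$1$2"
  have ab: "a * cnj a - b * cnj b = 1" using A(1) by (simp add: SU11_iff a_def b_def)
  have "pm (mact (A ** A)) (mact (Finite_Cartesian_Product.mat 1))"
    using assms(2) PU11_class_mult[OF A(1,1)] PU11_class_eq_iff[OF SU11_mult[OF A(1,1)] SU11_one] by (simp add: A(2) PU11_one)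
  then have sq: "pm (\<lambda>z. mact A (mact A z)) (\<lambda>z. z)" by (simp add: pm_def mact_mult[OF A(1)])
  have m: "mact A z = a * z + b * cnj z" for z by (simp add: mact_def a_def b_def)
  define u v where "u = a * a + b * cnj b" and "v = b * (a + cnj a)"
  have aa: "mact A (mact A z) = u * z + v * cnj z" for z by (simp add: m u_def v_def algebra_simps)
  have uv: "v = 0 \<and> (u = 1 \<or> u = - 1)"
  proof -
    have "(u + v = 1 \<and> \<i> * (u - v) = \<i> * 1) \<or> (u + v = -1 \<and> \<i> * (u - v) = \<i> * (- 1))"
      using sq unfolding pm_def aa
    proof
      assume h: "\<forall>z. u * z + v * cnj z = z"
      show ?thesis using h[rule_format, of 1] h[rule_format, of \<i>] by (simp add: algebra_simps)
    next
      assume h: "\<forall>z. u * z + v * cnj z = - z"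
      show ?thesis using h[rule_format, of 1] h[rule_format, of \<i>] by (simp add: algebra_simps)
    qed
    then have "(u + v = 1 \<and> u - v = 1) \<or> (u + v = -1 \<and> u - v = - 1)" unfolding mult_cancel_left by simp
    then show ?thesis
    proof
      assume h: "u + v = 1 \<and> u - v = 1"
      then have "2 * v = 0" by (metis add_diff_cancel_left' add_diff_eq diff_add_cancel mult_2 right_minus_eq)
      then show ?thesis using h by simp
    next
      assume h: "u + v = -1 \<and> u - v = -1"
      then have "2 * v = 0" by (metis add_diff_cancel_left' add_diff_eq diff_add_cancel mult_2 right_minus_eq)
      then show ?thesis using h by simp
    qed
  qed
  have Re: "Re a = 0"
  proof (rule ccontr)
    assume ra: "Re a \<noteq> 0"
    have "a + cnj a \<noteq> 0" using ra by (simp add: complex_eq_iff)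
    then have b: "b = 0" using uv by (simp add: v_def)
    then have "a * a = 1 \<or> a * a = - 1" using uv by (simp add: u_def)
    then have "a = 1 \<or> a = - 1"
    proof
      assume "a * a = 1" then show ?thesis by (simp add: square_eq_1_iff)
    next
      assume "a * a = - 1"
      then have e: "Re (a * a) = - 1" "Im (a * a) = 0" by simp_all
      have "Im a = 0" using e(2) ra by simp
      then have "Re a * Re a = - 1" using e(1) by simp
      then show ?thesis by (metis not_one_le_zero neg_0_le_iff_le zero_le_square)
    qed
    then have "pm (mact A) (mact (Finite_Cartesian_Product.mat 1))" by (auto simp: pm_def m b)
    then show False using assms(3) PU11_class_eq_iff[OF A(1) SU11_one] by (simp add: A(2) PU11_one)
  qed
  define y where "y = Im a"
  have a: "a = \<i> * of_real y" using Re by (simp add: complex_eq_iff y_def)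
  have yb: "y * y - ((Re b)\<^sup>2 + (Im b)\<^sup>2) = 1"
    using arg_cong[OF ab, of Re] Re by (simp add: y_def power2_eq_square)
  moreover have "(Re b)\<^sup>2 + (Im b)\<^sup>2 \<ge> 0" by simp
  ultimately have "y * y > 0" by linarith
  then have "y \<noteq> 0" by auto
  \<comment> \<open>Selects, of the two lifts, the one whose vector \<open>w\<close> is future
    directed.\<close>
  define s where "s = sgn y"
  have s: "s = 1 \<or> s = -1" "s * y > 0" using \<open>y \<noteq> 0\<close> by (auto simp: s_def sgn_if)
  define w where "w = (s * y, of_real s * (\<i> * b))"
  have "s * s = 1" using s by auto
  then have "mk w w = y * y - ((Re b)\<^sup>2 + (Im b)\<^sup>2)" using s(1) by (auto simp: w_def mk_def power2_eq_square)
  then have w: "w \<in> hyp" using yb s(2) by (simp add: hyp_def w_def)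
  define q where "q = pdisc w"
  have q: "q \<in> poincare_disc" "hy q = w" unfolding q_def using pdisc_disc[OF w] hy_pdisc[OF w] by auto
  have "rf w z = of_real s * mact A z" for z by (simp add: rf_def w_def m a algebra_simps)
  then have "pm (mact A) (rf w)" using s(1) by (auto simp: pm_def)
  then have "PU11_class A = point_reflection q"
    unfolding point_reflection_def PU11_class_eq_iff[OF A(1) point_reflection_matrix_SU11[OF q(1)]]
    by (simp add: pm_def mact_point_reflection q(2))
  then show ?thesis using that q(1) A(2) by blast
qed

section \<open>Representations and their tuples\<close>

primrec wmat :: "complex list \<Rightarrow> nat list \<Rightarrow> complex ^ 2 ^ 2" where
  "wmat qs [] = Finite_Cartesian_Product.mat 1"
| "wmat qs (i # w) = point_reflection_matrix (qs ! (i - 1)) ** wmat qs w"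

definition hy_tuple :: "complex list \<Rightarrow> nat \<Rightarrow> mvec" where "hy_tuple qs = nth_point (map hy qs)"

lemma tuple_hy: "length qs = n \<Longrightarrow> tuple n (hy_tuple qs) = map hy qs"
  by (simp add: hy_tuple_def tuple_nth_point)

lemma wmat:
  assumes "set qs \<subseteq> poincare_disc" "length qs = n" "w \<in> wds n"
  shows "wmat qs w \<in> carrier SU11 \<and> (\<forall>z. mact (wmat qs w) z = evw (hy_tuple qs) w z)"
  using assms(3)
proof (induction w)
  case (Cons i w)
  then have i: "i - 1 < length qs" "w \<in> wds n" using assms(2) by auto
  then have "qs ! (i - 1) \<in> poincare_disc" using assms(1) nth_mem by blast
  then have "point_reflection_matrix (qs ! (i - 1)) \<in> carrier SU11" by (rule point_reflection_matrix_SU11)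
  then show ?case using Cons.IH[OF i(2)] i(1)
    by (simp add: SU11_mult mact_mult mact_point_reflection hy_tuple_def nth_point_def)
qed (simp add: SU11_one)

definition H_class :: "nat \<Rightarrow> nat list \<Rightarrow> (nat \<times> bool) list set" where
  "H_class n w = word_class {1..n} (H_relators n) (tw w)"

lemma H_class_eq: "w \<in> wds n \<Longrightarrow> H_class n v = H_class n w \<longleftrightarrow> weq n w v"
  unfolding H_class_def weq_def using word_class_eq_iff[of "tw w" "{1..n}" "H_relators n" "tw v"] by auto

lemma H_class_carrier: "carrier (H_group n) = H_class n ` wds n"
proof -
  have "word_class {1..n} (H_relators n) w = H_class n (map fst w) \<and> map fst w \<in> wds n" if "w \<in> group_words {1..n}" for w
    using word_equiv_tw[OF that] word_class_eq_iff[OF that] that by (auto simp: H_class_def wds_iff group_words_def)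
  moreover have "tw w \<in> group_words {1..n}" if "w \<in> wds n" for w using that by simp
  ultimately show ?thesis unfolding H_group_def presented_group_def H_class_def by fastforce
qed

lemma H_class_mult: "v \<in> wds n \<Longrightarrow> w \<in> wds n \<Longrightarrow> H_class n v \<otimes>\<^bsub>H_group n\<^esub> H_class n w = H_class n (v @ w)"
  unfolding H_class_def H_group_def tw_append by (rule presented_group_mult) auto

lemma H_class_one: "\<one>\<^bsub>H_group n\<^esub> = H_class n []"
  by (simp add: H_class_def H_group_def presented_group_def tw_def)

lemma H_gen_H_class: "H_gen n i = H_class n [i]"
  by (simp add: H_gen_def H_class_def tw_def)

lemma group_H: "group (H_group n)" unfolding H_group_def by (rule group_presented_group)

lemma rep_word:
  assumes "\<rho> \<in> PH n" "given_by n \<rho> qs" "w \<in> wds n"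
  shows "\<rho> (H_class n w) = PU11_class (wmat qs w)"
  using assms(3)
proof (induction w)
  case Nil
  interpret group_hom "H_group n" PU11 \<rho>
    by (intro group_hom.intro group_H group_PU11 group_hom_axioms.intro) (use assms(1) in \<open>simp add: PH_def\<close>)
  show ?case using hom_one by (simp add: H_class_one PU11_one)
next
  case (Cons i w)
  then have i: "i \<in> {1..n}" "w \<in> wds n" "[i] \<in> wds n" by auto
  have g: "set qs \<subseteq> poincare_disc" "length qs = n" "\<rho> (H_class n [i]) = point_reflection (qs ! (i - 1))"
    using assms(2) i(1) by (auto simp: given_by_def H_gen_H_class)
  have "qs ! (i - 1) \<in> poincare_disc" using g(1,2) i(1) by (metis One_nat_def Suc_le_lessD Suc_pred atLeastAtMost_iff nth_mem subsetD less_le_trans zero_less_one)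
  then have S: "point_reflection_matrix (qs ! (i - 1)) \<in> carrier SU11" by (rule point_reflection_matrix_SU11)
  have W: "wmat qs w \<in> carrier SU11" using wmat[OF g(1,2) i(2)] by blast
  have "\<rho> (H_class n (i # w)) = \<rho> (H_class n [i] \<otimes>\<^bsub>H_group n\<^esub> H_class n w)" using H_class_mult[OF i(3,2)] by simp
  also have "\<dots> = \<rho> (H_class n [i]) \<otimes>\<^bsub>PU11\<^esub> \<rho> (H_class n w)"
    by (rule hom_mult[of \<rho> "H_group n"]) (use assms(1) i in \<open>auto simp: PH_def H_class_carrier\<close>)
  also have "\<dots> = PU11_class (wmat qs (i # w))"
    unfolding g(3) Cons.IH[OF i(2)] point_reflection_def using PU11_class_mult[OF S W] by simp
  finally show ?case .
qed

lemma rep_eq_iff: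
  assumes "\<rho> \<in> PH n" "given_by n \<rho> qs" "v \<in> wds n" "w \<in> wds n"
  shows "\<rho> (H_class n v) = \<rho> (H_class n w) \<longleftrightarrow> pm (evw (hy_tuple qs) v) (evw (hy_tuple qs) w)"
proof -
  have g: "set qs \<subseteq> poincare_disc" "length qs = n" using assms(2) by (auto simp: given_by_def)
  show ?thesis unfolding rep_word[OF assms(1,2,3)] rep_word[OF assms(1,2,4)]
    using wmat[OF g assms(3)] wmat[OF g assms(4)] by (simp add: PU11_class_eq_iff pm_def)
qed

lemma rep_closing:
  assumes "\<rho> \<in> PH n" "given_by n \<rho> qs" shows "closing (map hy qs)"
proof -
  have g: "set qs \<subseteq> poincare_disc" "length qs = n" using assms(2) by (auto simp: given_by_def)
  have w: "rev [1..<Suc n] \<in> wds n" by (auto simp: wds_iff)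
  have "H_class n [] = H_class n (rev [1..<Suc n])" using H_class_eq[OF w, of "[]"] weq_relator by blast
  then have "pm (evw (hy_tuple qs) (rev [1..<Suc n])) (evw (hy_tuple qs) [])" using rep_eq_iff[OF assms w, of "[]"] by simp
  then have "pm (run (map hy qs)) (\<lambda>z. z)"
    unfolding evw_run pm_def tuple_hy[OF g(2), symmetric] tuple_def by simp
  moreover have "set (map hy qs) \<subseteq> hyp" using g hy_hyp by auto
  ultimately show ?thesis by (simp add: closing_def pm_def)
qed

lemma given_by_ex:
  assumes "\<rho> \<in> PH n" shows "\<exists>qs. given_by n \<rho> qs"
proof -
  have hom: "\<rho> \<in> hom (H_group n) PU11" using assms by (simp add: PH_def)
  have "\<exists>q. q \<in> poincare_disc \<and> \<rho> (H_gen n i) = point_reflection q" if i: "i \<in> {1..n}" for i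
  proof -
    have w: "[i] \<in> wds n" "[i, i] \<in> wds n" "[] \<in> wds n" using i by auto
    have c: "H_class n [i] \<in> carrier (H_group n)" using w by (auto simp: H_class_carrier)
    interpret group_hom "H_group n" PU11 \<rho>
      by (intro group_hom.intro group_H group_PU11 group_hom_axioms.intro hom)
    have "weq n [i, i] []" using weq_cancel[of "[]" n "[]" i] i by simp
    then have "H_class n [i, i] = H_class n []" using H_class_eq[OF w(2), of "[]"] by simp
    then have "H_class n [i] \<otimes>\<^bsub>H_group n\<^esub> H_class n [i] = \<one>\<^bsub>H_group n\<^esub>" using H_class_mult[OF w(1,1)] by (simp add: H_class_one)
    then have "\<rho> (H_class n [i]) \<otimes>\<^bsub>PU11\<^esub> \<rho> (H_class n [i]) = \<one>\<^bsub>PU11\<^esub>" using hom_mult[OF c c] hom_one by simp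
    moreover have "\<rho> (H_class n [i]) \<noteq> \<one>\<^bsub>PU11\<^esub>" using assms i by (auto simp: PH_def H_gen_H_class)
    moreover have "\<rho> (H_class n [i]) \<in> carrier PU11" by (rule hom_closed[OF c])
    ultimately show ?thesis using involution_point_reflection unfolding H_gen_H_class by metis
  qed
  then obtain f where f: "\<And>i. i \<in> {1..n} \<Longrightarrow> f i \<in> poincare_disc \<and> \<rho> (H_gen n i) = point_reflection (f i)" by metis
  have "given_by n \<rho> (map f [1..<Suc n])" unfolding given_by_def using f by (auto simp del: upt_Suc)
  then show ?thesis ..
qed

lemma given_by_unique:
  assumes "given_by n \<rho> ps" "given_by n \<rho> qs" shows "ps = qs"
proof (rule nth_equalityI)
  show l: "length ps = length qs" using assms by (simp add: given_by_def)
  fix i assume i: "i < length ps"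
  then have "Suc i \<in> {1..n}" using assms by (auto simp: given_by_def)
  then have "point_reflection (ps ! i) = point_reflection (qs ! i)" using assms unfolding given_by_def by (metis diff_Suc_1)
  moreover have "ps ! i \<in> poincare_disc" "qs ! i \<in> poincare_disc"
    using assms i l nth_mem unfolding given_by_def by (metis subsetD)+
  ultimately show "ps ! i = qs ! i" by (simp add: point_reflection_inj)
qed

lemma rep_ex:
  assumes "closing (map hy qs)" "set qs \<subseteq> poincare_disc" "length qs = n"
  shows "\<exists>\<rho>\<in>PH n. given_by n \<rho> qs"
proof -
  \<comment> \<open>The value on a class is computed from a chosen word; \<open>weq_sound\<close>
    makes it independent of the choice.\<close>
  define \<rho> where "\<rho> X = PU11_class (wmat qs (SOME w. w \<in> wds n \<and> X = H_class n w))" for X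
  have cl: "closing (tuple n (hy_tuple qs))" using assms by (simp add: tuple_hy)
  have rho: "\<rho> (H_class n w) = PU11_class (wmat qs w)" if w: "w \<in> wds n" for w
  proof -
    define v where "v = (SOME v. v \<in> wds n \<and> H_class n w = H_class n v)"
    have v: "v \<in> wds n \<and> H_class n w = H_class n v" unfolding v_def by (rule someI[of _ w]) (use w in simp)
    then have "weq n v w" using H_class_eq by blast
    then have "pm (evw (hy_tuple qs) v) (evw (hy_tuple qs) w)" by (rule weq_sound[OF cl])
    then have "PU11_class (wmat qs v) = PU11_class (wmat qs w)"
      using wmat[OF assms(2,3), of v] wmat[OF assms(2,3), of w] v w by (simp add: PU11_class_eq_iff pm_def)
    then show ?thesis by (simp add: \<rho>_def v_def)
  qed
  have ev: "wmat qs (v @ w) = wmat qs v ** wmat qs w" for v w by (induction v) (simp_all add: matrix_mul_assoc)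
  have "\<rho> \<in> hom (H_group n) PU11"
  proof (rule homI)
    fix X assume "X \<in> carrier (H_group n)"
    then obtain w where "w \<in> wds n" "X = H_class n w" unfolding H_class_carrier by blast
    then show "\<rho> X \<in> carrier PU11" using rho wmat[OF assms(2,3)] PU11_class_in by simp
  next
    fix X Y assume "X \<in> carrier (H_group n)" "Y \<in> carrier (H_group n)"
    then obtain v w where vw: "v \<in> wds n" "X = H_class n v" "w \<in> wds n" "Y = H_class n w" unfolding H_class_carrier by blast
    then show "\<rho> (X \<otimes>\<^bsub>H_group n\<^esub> Y) = \<rho> X \<otimes>\<^bsub>PU11\<^esub> \<rho> Y"
      using wmat[OF assms(2,3)] by (simp add: H_class_mult rho PU11_class_mult ev)
  qed
  moreover have gen: "\<rho> (H_gen n i) = point_reflection (qs ! (i - 1))" if "i \<in> {1..n}" for i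
    using that rho[of "[i]"] by (simp add: H_gen_H_class point_reflection_def)
  moreover have "qs ! (i - 1) \<in> poincare_disc" if "i \<in> {1..n}" for i
    using that assms(2,3) nth_mem[of "i - 1" qs] by auto
  ultimately have "\<rho> \<in> PH n" unfolding PH_def using point_reflection_ne_one by auto
  moreover have "given_by n \<rho> qs" using gen assms by (simp add: given_by_def)
  ultimately show ?thesis by blast
qed

section \<open>Discrete and faithful means isolated identity\<close>

lemma SU11_near_one:
  assumes "A \<in> carrier SU11" "dist (mact A 1) 1 < e" "dist (mact A \<i>) \<i> < e"
  shows "dist A (Finite_Cartesian_Product.mat 1) < 4 * e"
proof -
  define a b where "a = A$1$1 - 1" and "b = A$1$2"
  have 1: "cmod (a + b) < e" using assms(2) by (simp add: mact_def dist_norm a_def b_def algebra_simps)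
  have "mact A \<i> - \<i> = \<i> * (a - b)" by (simp add: mact_def a_def b_def algebra_simps)
  then have 2: "cmod (a - b) < e" using assms(3) by (simp add: dist_norm norm_mult)
  have "cmod (2 * a) = cmod ((a + b) + (a - b))" "cmod (2 * b) = cmod ((a + b) - (a - b))" by (simp_all add: algebra_simps)
  then have "cmod (2 * a) \<le> cmod (a + b) + cmod (a - b)" "cmod (2 * b) \<le> cmod (a + b) + cmod (a - b)"
    using norm_triangle_ineq[of "a + b" "a - b"] norm_triangle_ineq4[of "a + b" "a - b"] by metis+
  then have ab: "cmod a < e" "cmod b < e" using 1 2 by (auto simp: norm_mult)
  define D where "D = A - Finite_Cartesian_Product.mat 1"
  have D: "D$1$1 = a" "D$1$2 = b" "D$2$1 = cnj b" "D$2$2 = cnj a"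
    using assms(1) by (simp_all add: D_def a_def b_def SU11_iff Finite_Cartesian_Product.mat_def)
  have nv: "norm v \<le> norm (v$1) + norm (v$2)" for v :: "'x::real_normed_vector ^ 2"
    using L2_set_le_sum[of UNIV "\<lambda>i. norm (v$i)"] by (simp add: norm_vec_def sum_2)
  have "norm D \<le> norm (D$1) + norm (D$2)" by (rule nv)
  also have "\<dots> \<le> (cmod a + cmod b) + (cmod b + cmod a)" using nv[of "D$1"] nv[of "D$2"] by (simp add: D)
  also have "\<dots> < 4 * e" using ab by simp
  finally show ?thesis by (simp add: dist_norm D_def)
qed

lemma discrete_faithful_isolated:
  assumes "\<rho> \<in> PH n" "given_by n \<rho> qs" "discrete_rep n \<rho>" "faithful_rep n \<rho>"
  shows "isolated_id n (hy_tuple qs)"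
proof -
  have g: "set qs \<subseteq> poincare_disc" "length qs = n" using assms(2) by (auto simp: given_by_def)
  interpret group_hom "H_group n" PU11 \<rho>
    by (intro group_hom.intro group_H group_PU11 group_hom_axioms.intro) (use assms(1) in \<open>simp add: PH_def\<close>)
  let ?I = "\<rho> ` carrier (H_group n)"
  have one: "\<rho> (H_class n []) = \<one>\<^bsub>PU11\<^esub>" using hom_one by (simp add: H_class_one)
  have c0: "H_class n [] \<in> carrier (H_group n)" by (auto simp: H_class_carrier)
  then have "\<one>\<^bsub>PU11\<^esub> \<in> ?I" using one by (metis imageI)
  then have "openin (subtopology PU11_topology ?I) {\<one>\<^bsub>PU11\<^esub>}"
    using assms(3) by (simp add: discrete_rep_def discrete_in_def)
  then obtain U where U: "openin PU11_topology U" "{\<one>\<^bsub>PU11\<^esub>} = U \<inter> ?I"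
    unfolding openin_subtopology by blast
  then have "openin (top_of_set (carrier SU11)) {A \<in> carrier SU11. PU11_class A \<in> U}" by (simp add: openin_PU11_topology)
  then obtain T where T: "open T" "{A \<in> carrier SU11. PU11_class A \<in> U} = carrier SU11 \<inter> T" by (auto simp: openin_open)
  have "PU11_class (Finite_Cartesian_Product.mat 1) \<in> U" using U(2) PU11_one by auto
  then have "Finite_Cartesian_Product.mat 1 \<in> T" using T(2) SU11_one by blast
  then obtain d where d: "d > 0" "\<And>A. dist A (Finite_Cartesian_Product.mat 1) < d \<Longrightarrow> A \<in> T"
    using T(1) by (auto simp: open_dist)
  show ?thesis unfolding isolated_id_def
  proof (intro exI[of _ "d / 4"] conjI ballI impI)
    fix w and c :: real assume w: "w \<in> wds n" and c: "c \<in> {1, -1}"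
      and s: "dist (c *\<^sub>R evw (hy_tuple qs) w 1) 1 < d / 4" "dist (c *\<^sub>R evw (hy_tuple qs) w \<i>) \<i> < d / 4"
    have W: "wmat qs w \<in> carrier SU11" "\<And>z. mact (wmat qs w) z = evw (hy_tuple qs) w z" using wmat[OF g w] by auto
    define A where "A = (if c = 1 then wmat qs w else - wmat qs w)"
    have A: "A \<in> carrier SU11" "\<And>z. mact A z = c *\<^sub>R evw (hy_tuple qs) w z" "PU11_class A = PU11_class (wmat qs w)"
      using W c by (auto simp: A_def uminus_SU11 PU11_class_eq)
    have "dist A (Finite_Cartesian_Product.mat 1) < 4 * (d / 4)"
      by (rule SU11_near_one) (use A s in auto)
    then have "A \<in> T" using d(2) by simp
    then have "PU11_class A \<in> U" using T(2) A(1) by blast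
    then have "\<rho> (H_class n w) \<in> U" using rep_word[OF assms(1,2) w] A(3) by simp
    moreover have cw: "H_class n w \<in> carrier (H_group n)" using w by (auto simp: H_class_carrier)
    ultimately have "\<rho> (H_class n w) = \<rho> (H_class n [])" using U(2) one by blast
    then have "H_class n w = H_class n []" using assms(4) cw c0 by (auto simp: faithful_rep_def dest: inj_onD)
    then show "weq n w []" using H_class_eq[of "[]" n w] weq_sym by simp
  qed (use d in simp)
qed

lemma isolated_discrete_faithful:
  assumes "\<rho> \<in> PH n" "given_by n \<rho> qs" "isolated_id n (hy_tuple qs)"
  shows "discrete_rep n \<rho>" "faithful_rep n \<rho>"
proof -
  have g: "set qs \<subseteq> poincare_disc" "length qs = n" using assms(2) by (auto simp: given_by_def)
  have cl: "closing (tuple n (hy_tuple qs))" using rep_closing[OF assms(1,2)] g by (simp add: tuple_hy)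
  interpret group_hom "H_group n" PU11 \<rho>
    by (intro group_hom.intro group_H group_PU11 group_hom_axioms.intro) (use assms(1) in \<open>simp add: PH_def\<close>)
  obtain e where e: "e > 0" "\<And>w c. w \<in> wds n \<Longrightarrow> c \<in> {1, -1} \<Longrightarrow> dist (c *\<^sub>R evw (hy_tuple qs) w 1) 1 < e \<Longrightarrow>
    dist (c *\<^sub>R evw (hy_tuple qs) w \<i>) \<i> < e \<Longrightarrow> weq n w []"
    using assms(3) unfolding isolated_id_def by metis
  have quot: "weq n v w" if "v \<in> wds n" "w \<in> wds n" "weq n (rev v @ w) []" for v w
  proof -
    have "weq n (v @ (rev v @ w)) (v @ [])" by (rule weq_append[OF weq_refl[OF that(1)] that(3)])
    moreover have "weq n ((v @ rev v) @ w) ([] @ w)" by (rule weq_append[OF weq_inverse[OF that(1)] weq_refl[OF that(2)]])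
    ultimately show ?thesis using weq_trans weq_sym by (metis append.assoc append_Nil append_Nil2)
  qed
  show "faithful_rep n \<rho>" unfolding faithful_rep_def
  proof (rule inj_onI)
    fix X Y assume "X \<in> carrier (H_group n)" "Y \<in> carrier (H_group n)" and eq: "\<rho> X = \<rho> Y"
    then obtain v w where vw: "v \<in> wds n" "X = H_class n v" "w \<in> wds n" "Y = H_class n w" unfolding H_class_carrier by blast
    have "pm (evw (hy_tuple qs) v) (evw (hy_tuple qs) w)" using eq rep_eq_iff[OF assms(1,2) vw(1,3)] vw by simp
    moreover have "pm (evw (hy_tuple qs) (rev v @ v)) (evw (hy_tuple qs) [])" by (rule weq_sound[OF cl weq_inverse'[OF vw(1)]])
    ultimately have "pm (evw (hy_tuple qs) (rev v @ w)) (\<lambda>z. z)" unfolding pm_def by (auto; metis evw_simps(3) minus_minus)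
    then have "weq n (rev v @ w) []" using isolated_id_word[OF assms(3)] vw by simp
    then have "weq n v w" using quot vw by blast
    then show "X = Y" using H_class_eq[OF vw(1), of w] vw by simp
  qed
  let ?I = "\<rho> ` carrier (H_group n)"
  have top: "topspace PU11_topology = carrier PU11"
    using quotient_imp_surjective_map[OF quotient_map_PU11_class] PU11_class_carrier by simp
  have "openin (subtopology PU11_topology ?I) {X}" if XI: "X \<in> ?I" for X
  proof -
    obtain v where v: "v \<in> wds n" "X = \<rho> (H_class n v)" using XI unfolding H_class_carrier by blast
    define V where "V = wmat qs (rev v)"
    have V: "V \<in> carrier SU11" "\<And>z. mact V z = evw (hy_tuple qs) (rev v) z" using wmat[OF g, of "rev v"] v by (auto simp: V_def)
    \<comment> \<open>The matrices \<open>A\<close> for which \<open>V ** A\<close> is close to the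
      scalar \<open>c\<close>. The union over both signs is closed under negation, so it is the full
      preimage of \<open>U\<close>, and \<open>U\<close> is open in the quotient.\<close>
    define B where "B c = {A \<in> carrier SU11. dist (c *\<^sub>R mact V (mact A 1)) 1 < e \<and> dist (c *\<^sub>R mact V (mact A \<i>)) \<i> < e}" for c :: real
    define U where "U = PU11_class ` (B 1 \<union> B (-1))"
    have mV: "mact V (- z) = - mact V z" for z by (simp add: mact_def)
    have neg: "- A \<in> B 1 \<union> B (-1)" if "A \<in> B 1 \<union> B (-1)" for A
      using that by (auto simp: B_def uminus_SU11 mV)
    have pre: "{A \<in> carrier SU11. PU11_class A \<in> U} = B 1 \<union> B (-1)"
    proof (intro equalityI subsetI)
      fix A assume "A \<in> {A \<in> carrier SU11. PU11_class A \<in> U}"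
      then obtain A' where "A' \<in> B 1 \<union> B (-1)" "PU11_class A = PU11_class A'" unfolding U_def by blast
      then show "A \<in> B 1 \<union> B (-1)" using neg[of A'] by (auto simp: PU11_class_eq doubleton_eq_iff)
    next
      fix A assume "A \<in> B 1 \<union> B (-1)"
      then show "A \<in> {A \<in> carrier SU11. PU11_class A \<in> U}" unfolding U_def B_def by blast
    qed
    have "openin (top_of_set (carrier SU11)) (B c)" for c
    proof -
      have c: "continuous_on UNIV (\<lambda>A. mact V (mact A z))" for z unfolding mact_def by (intro continuous_intros)
      have "open {A. dist (c *\<^sub>R mact V (mact A 1)) 1 < e \<and> dist (c *\<^sub>R mact V (mact A \<i>)) \<i> < e}"
        by (intro open_Collect_conj open_Collect_less continuous_intros c)
      then show ?thesis unfolding B_def openin_open by blast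
    qed
    then have "openin (top_of_set (carrier SU11)) {A \<in> carrier SU11. PU11_class A \<in> U}" unfolding pre by (intro openin_Un)
    moreover have "U \<subseteq> carrier PU11" unfolding U_def B_def using PU11_class_in by blast
    ultimately have oU: "openin PU11_topology U" by (simp add: openin_PU11_topology)
    have "U \<inter> ?I = {X}"
    proof (intro equalityI subsetI)
      fix Y assume "Y \<in> U \<inter> ?I"
      then obtain w where w: "w \<in> wds n" "Y = \<rho> (H_class n w)" "Y \<in> U" unfolding H_class_carrier by blast
      have W: "wmat qs w \<in> carrier SU11" "\<And>z. mact (wmat qs w) z = evw (hy_tuple qs) w z" using wmat[OF g w(1)] by auto
      have "wmat qs w \<in> B 1 \<union> B (-1)" using w W rep_word[OF assms(1,2) w(1)] pre by auto
      then obtain c where c: "c \<in> {1, -1}" "wmat qs w \<in> B c" by blast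
      have "weq n (rev v @ w) []" by (rule e(2)[OF _ c(1)]) (use c(2) v w W V in \<open>auto simp: B_def\<close>)
      then have "weq n v w" using quot v w by blast
      then have "H_class n w = H_class n v" using H_class_eq[OF v(1), of w] by simp
      then show "Y \<in> {X}" using v w by simp
    next
      fix Y assume "Y \<in> {X}"
      then have Y: "Y = PU11_class (wmat qs v)" using v rep_word[OF assms(1,2) v(1)] by simp
      have W: "wmat qs v \<in> carrier SU11" "\<And>z. mact (wmat qs v) z = evw (hy_tuple qs) v z" using wmat[OF g v(1)] by auto
      have "pm (evw (hy_tuple qs) (rev v @ v)) (evw (hy_tuple qs) [])" by (rule weq_sound[OF cl weq_inverse'[OF v(1)]])
      then have "wmat qs v \<in> B 1 \<union> B (-1)" using W V e(1) by (auto simp: B_def pm_def)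
      then show "Y \<in> U \<inter> ?I" using Y XI \<open>Y \<in> {X}\<close> unfolding U_def by blast
    qed
    then show ?thesis using oU unfolding openin_subtopology by blast
  qed
  moreover have sub: "?I \<subseteq> topspace PU11_topology" unfolding top using hom_closed by blast
  ultimately have "discrete_topology ?I = subtopology PU11_topology ?I"
    unfolding discrete_topology_unique by (simp add: topspace_subtopology Int_absorb1)
  then show "discrete_rep n \<rho>" unfolding discrete_rep_def discrete_in_def using img_is_subgroup sub by simp
qed

section \<open>Bending-deformations\<close>

lemma tuple_bending_extremal:
  assumes "tuple_bending qs qs'" "extremal (map hy qs)" "length qs \<ge> 2" "set qs \<subseteq> poincare_disc"
  shows "extremal (map hy qs')"
proof -
  obtain i j \<gamma> a b t where i: "i < length qs" "j = Suc i mod length qs" and g: "geodesic_line \<gamma>" "\<gamma> a = qs ! i" "\<gamma> b = qs ! j"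
    and q': "qs' = qs[i := \<gamma> (a + t), j := \<gamma> (b + t)]"
    using assms(1) unfolding tuple_bending_def by metis
  have h: "hy (\<gamma> x) \<in> hyp" for x using g(1) by (auto simp: geodesic_line_def intro!: hy_hyp)
  define x y x' y' where "x = hy (\<gamma> a)" and "y = hy (\<gamma> b)" and "x' = hy (\<gamma> (a + t))" and "y' = hy (\<gamma> (b + t))"
  have sh: "shift x y x' y'" unfolding shift_def x_def y_def x'_def y'_def using h geodesic_shift[OF g(1)] by simp
  have cl: "closing (map hy qs)" using assms(2) by (simp add: extremal_def)
  show ?thesis
  proof (cases "Suc i < length qs")
    case True
    then have j: "j = Suc i" using i by simp
    have e: "map hy qs = map hy (take i qs) @ [x, y] @ map hy (drop (Suc (Suc i)) qs)"
      using True unfolding x_def y_def g j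
      by (metis (no_types) append_Cons append_Nil append_take_drop_id Cons_nth_drop_Suc Suc_lessD list.simps(9) map_append)
    have "qs' = take i qs @ [\<gamma> (a + t), \<gamma> (b + t)] @ drop (Suc (Suc i)) qs"
      unfolding q' j using True by (simp add: upd_conv_take_nth_drop take_Suc_conv_app_nth list_update_append nth_append)
    then have e': "map hy qs' = map hy (take i qs) @ [x', y'] @ map hy (drop (Suc (Suc i)) qs)" by (simp add: x'_def y'_def)
    show ?thesis using shift_extremal[OF sh, of "map hy (take i qs)"] assms(2) cl unfolding e e' by blast
  next
    case False
    \<comment> \<open>The pair is \<open>(q\<^sub>n, q\<^sub>1)\<close>: a cyclic rotation makes it
      adjacent, the shift is applied there, and the rotation is undone.\<close>
    then have l: "length qs = Suc i" using i(1) by simp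
    then have j: "j = 0" "Suc i = length qs" using i(2) by simp_all
    obtain p qs1 where p: "qs = p # qs1" using i by (cases qs) auto
    then have "qs1 \<noteq> []" using assms(3) by auto
    then obtain m q where m: "qs1 = m @ [q]" by (metis rev_exhaust)
    have qs: "qs = p # m @ [q]" "i = Suc (length m)" using p m j by auto
    have xy: "y = hy p" "x = hy q" unfolding x_def y_def g j(1) qs by (simp_all add: nth_append)
    have q2: "map hy qs' = [y'] @ (map hy m @ [x'])" unfolding q' j(1) qs by (simp add: x'_def y'_def list_update_append)
    have "extremal ([y] @ (map hy m @ [x]))" using assms(2) by (simp add: qs xy)
    then have e: "extremal ((map hy m @ [x]) @ [y])" by (rule extremal_rotate)
    then have "closing (map hy m @ [x, y] @ [])" by (simp add: extremal_def)
    from shift_extremal[OF sh this] e have "extremal ((map hy m @ [x']) @ [y'])" by simp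
    then show ?thesis unfolding q2 by (rule extremal_rotate)
  qed
qed

lemma bending_deformation_PH:
  assumes "bending_deformation n \<rho> \<sigma>" "\<rho> \<in> PH n" shows "\<sigma> \<in> PH n"
  using assms unfolding bending_deformation_def by (induction rule: rtranclp_induct) (auto simp: bending_def)

lemma bending_deformation_extremal:
  assumes "bending_deformation n \<rho> \<sigma>" "n \<ge> 2" "given_by n \<rho> qs" "extremal (map hy qs)"
  shows "\<exists>qs'. given_by n \<sigma> qs' \<and> extremal (map hy qs')"
  using assms(1) unfolding bending_deformation_def
proof (induction rule: rtranclp_induct)
  case base
  then show ?case using assms by blast
next
  case (step \<sigma> \<tau>)
  then obtain rs where rs: "given_by n \<sigma> rs" "extremal (map hy rs)" by blast
  obtain ps ps' where ps: "given_by n \<sigma> ps" "given_by n \<tau> ps'" "tuple_bending ps ps'" using step(2) unfolding bending_def by blast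
  have "ps = rs" by (rule given_by_unique[OF ps(1) rs(1)])
  then have "extremal (map hy ps')" using tuple_bending_extremal[OF ps(3)] rs assms(2) by (auto simp: given_by_def)
  then show ?case using ps(2) by blast
qed

lemma extremal_basic:
  assumes "n \<ge> 5" "\<rho> \<in> PH n" "given_by n \<rho> qs" "extremal (map hy qs)" shows "basic_rep n \<rho>"
proof -
  have False if d: "bending_deformation n \<rho> \<sigma>" and k: "k \<ge> 1" "l \<ge> 1" "k + l = n" and c: "is_concatenation k l i \<rho>1 \<rho>2 \<sigma>" for \<sigma> k l i \<rho>1 \<rho>2
  proof -
    obtain ps qs where r: "\<rho>1 \<in> PH k" "\<rho>2 \<in> PH l" "i \<le> l" "given_by k \<rho>1 ps" "given_by l \<rho>2 qs"
      "given_by (k + l) \<sigma> (take i qs @ ps @ drop i qs)"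
      using c unfolding is_concatenation_def by blast
    obtain rs where rs: "given_by n \<sigma> rs" "extremal (map hy rs)" using bending_deformation_extremal[OF d _ assms(3,4)] assms(1) by auto
    have e: "rs = take i qs @ ps @ drop i qs" using given_by_unique[OF rs(1)] r(6) k(3) by simp
    have len: "length ps = k" "length qs = l" using r by (auto simp: given_by_def)
    have "closing (map hy (take i qs) @ map hy (drop i qs))"
      using rep_closing[OF r(2,5)] by (simp flip: map_append)
    moreover have "closing (map hy ps)" by (rule rep_closing[OF r(1,4)])
    ultimately have "\<not> extremal (map hy (take i qs) @ map hy ps @ map hy (drop i qs))"
      by (intro not_extremal_insert) (use len k r(3) assms(1) in \<open>auto simp flip: map_append\<close>)
    then show False using rs(2) e by simp
  qed
  then show ?thesis using assms(2) unfolding basic_rep_def by blast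
qed

section \<open>Tuples of bending-deformations of a basic representation\<close>

definition deformation_tuples :: "nat \<Rightarrow> H_rep \<Rightarrow> mvec list set" where
  "deformation_tuples n \<rho> = {map hy qs | \<sigma> qs. bending_deformation n \<rho> \<sigma> \<and> given_by n \<sigma> qs}"

text \<open>The moved tuple is again closed, so \<open>rep_ex\<close> provides its representation;
  bendings can then be carried out on tuples alone.\<close>

lemma deformation_bend:
  assumes "\<rho> \<in> PH n" "map hy (a @ [\<gamma> x, \<gamma> y] @ b) \<in> deformation_tuples n \<rho>" "set a \<subseteq> poincare_disc" "set b \<subseteq> poincare_disc"
    "geodesic_line \<gamma>" "\<gamma> x \<noteq> \<gamma> y"
  shows "map hy (a @ [\<gamma> (x + t), \<gamma> (y + t)] @ b) \<in> deformation_tuples n \<rho>"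
proof -
  obtain \<sigma> qs where s: "bending_deformation n \<rho> \<sigma>" "given_by n \<sigma> qs" "map hy (a @ [\<gamma> x, \<gamma> y] @ b) = map hy qs"
    using assms(2) unfolding deformation_tuples_def by blast
  have g: "\<gamma> z \<in> poincare_disc" for z using assms(5) by (auto simp: geodesic_line_def)
  have inj: "inj_on hy poincare_disc" using hy_inj by (auto simp: inj_on_def)
  have "a @ [\<gamma> x, \<gamma> y] @ b = qs"
    by (rule map_inj_on[OF s(3)], rule inj_on_subset[OF inj]) (use s(2) assms(3,4) g in \<open>auto simp: given_by_def\<close>)
  note gb = s(2)[folded this]
  have sP: "\<sigma> \<in> PH n" by (rule bending_deformation_PH[OF s(1) assms(1)])
  define qs' where "qs' = a @ [\<gamma> (x + t), \<gamma> (y + t)] @ b"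
  have sh: "shift (hy (\<gamma> x)) (hy (\<gamma> y)) (hy (\<gamma> (x + t))) (hy (\<gamma> (y + t)))"
    unfolding shift_def using g hy_hyp geodesic_shift[OF assms(5)] by simp
  have cl: "closing (map hy qs')"
    using rep_closing[OF sP gb] shift_closing[OF sh, of "map hy a" "map hy b"] by (simp add: qs'_def)
  have len: "length qs' = n" using gb by (simp add: qs'_def given_by_def)
  have "set qs' \<subseteq> poincare_disc" using assms(3,4) g by (auto simp: qs'_def)
  from rep_ex[OF cl this len] obtain \<tau> where tau: "\<tau> \<in> PH n" "given_by n \<tau> qs'" by blast
  have "tuple_bending (a @ [\<gamma> x, \<gamma> y] @ b) qs'"
    unfolding tuple_bending_def
    by (rule exI[of _ "length a"], rule exI[of _ "Suc (length a)"], rule exI[of _ \<gamma>], rule exI[of _ x], rule exI[of _ y], rule exI[of _ t])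
      (use assms(5,6) in \<open>simp add: qs'_def nth_append list_update_append\<close>)
  then have "bending n \<sigma> \<tau>" unfolding bending_def using sP tau gb by blast
  then have "bending_deformation n \<rho> \<tau>" using s(1) unfolding bending_deformation_def by simp
  then show ?thesis using tau(2) unfolding deformation_tuples_def qs'_def by blast
qed

lemma map_split4:
  assumes "map f qs = a @ [p, q] @ b"
  obtains a' p' q' b' where "qs = a' @ [p', q'] @ b'" "a = map f a'" "p = f p'" "q = f q'" "b = map f b'"
proof -
  obtain a' r where 1: "qs = a' @ r" "map f a' = a" "map f r = [p, q] @ b" using assms by (auto simp: map_eq_append_conv)
  obtain p' r' where 2: "r = p' # r'" "f p' = p" "map f r' = q # b" using 1(3) by auto
  obtain q' b' where "r' = q' # b'" "f q' = q" "map f b' = b" using 2(3) by auto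
  then show ?thesis using that 1 2 by simp
qed

lemma basic_no_double:
  assumes "basic_rep n \<rho>" "n \<ge> 5" shows "a @ [c, c] @ b \<notin> deformation_tuples n \<rho>"
proof
  assume "a @ [c, c] @ b \<in> deformation_tuples n \<rho>"
  then obtain \<sigma> qs where s: "bending_deformation n \<rho> \<sigma>" "given_by n \<sigma> qs" "map hy qs = a @ [c, c] @ b"
    unfolding deformation_tuples_def by auto
  obtain a' x y b' where q: "qs = a' @ [x, y] @ b'" "a = map hy a'" "c = hy x" "c = hy y" "b = map hy b'"
    by (rule map_split4[OF s(3)])
  have rP: "\<rho> \<in> PH n" using assms(1) by (simp add: basic_rep_def)
  have sP: "\<sigma> \<in> PH n" by (rule bending_deformation_PH[OF s(1) rP])
  have d: "set qs \<subseteq> poincare_disc" "length qs = n" using s(2) by (auto simp: given_by_def)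
  then have xy: "x = y" "x \<in> poincare_disc" using q hy_inj[of x y] by auto
  have c2: "closing (map hy [x, x])" using closing_pair[OF hy_hyp[OF xy(2)]] by simp
  have "closing (map hy a' @ map hy [x, x] @ map hy b')" using rep_closing[OF sP s(2)] xy by (simp add: q)
  then have cab: "closing (map hy (a' @ b'))" using closing_remove[OF _ c2] by simp
  \<comment> \<open>A pair of equal points is a representation of the cancellation group, and
    removing it leaves a closed tuple: the two factors of a concatenation.\<close>
  obtain \<rho>1 where r1: "\<rho>1 \<in> PH 2" "given_by 2 \<rho>1 [x, x]" using rep_ex[OF c2, of 2] xy by auto
  have l: "length (a' @ b') = n - 2" "set (a' @ b') \<subseteq> poincare_disc" using d by (auto simp: q)
  obtain \<rho>2 where r2: "\<rho>2 \<in> PH (n - 2)" "given_by (n - 2) \<rho>2 (a' @ b')" using rep_ex[OF cab l(2,1)] by blast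
  have n2: "2 + (n - 2) = n" using assms(2) by simp
  have "is_concatenation 2 (n - 2) (length a') \<rho>1 \<rho>2 \<sigma>"
    unfolding is_concatenation_def n2
  proof (intro conjI exI r1 r2 sP)
    show "length a' \<le> n - 2" using l(1) by simp
    show "given_by n \<sigma> (take (length a') (a' @ b') @ [x, x] @ drop (length a') (a' @ b'))"
      using s(2) xy by (simp add: q)
  qed (use r1 r2 in simp_all)
  moreover have "(2::nat) \<ge> 1" "n - 2 \<ge> 1" using assms(2) by auto
  ultimately show False using assms(1) s(1) n2 unfolding basic_rep_def by blast
qed

lemma deformation_hyp:
  assumes "\<rho> \<in> PH n" "Qs \<in> deformation_tuples n \<rho>" shows "closing Qs" "length Qs = n"
proof -
  obtain \<sigma> qs where s: "bending_deformation n \<rho> \<sigma>" "given_by n \<sigma> qs" "Qs = map hy qs"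
    using assms(2) unfolding deformation_tuples_def by blast
  show "closing Qs" unfolding s(3) by (rule rep_closing[OF bending_deformation_PH[OF s(1) assms(1)] s(2)])
  show "length Qs = n" using s by (simp add: given_by_def)
qed

text \<open>All four are bendings along the line from \<open>geodesic_through\<close>: by the length
  of the pair in both directions, and by the amounts that bring one or the other point to
  \<open>c\<close>.\<close>

lemma deformation_moves:
  assumes "\<rho> \<in> PH n" "a @ [p, q] @ b \<in> deformation_tuples n \<rho>" "p \<noteq> q"
  shows "a @ [q, hrefl q p] @ b \<in> deformation_tuples n \<rho>" "a @ [hrefl p q, p] @ b \<in> deformation_tuples n \<rho>"
    "c \<in> hyp \<Longrightarrow> tri p q c = 0 \<Longrightarrow> \<exists>p'. a @ [p', c] @ b \<in> deformation_tuples n \<rho>"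
    "c \<in> hyp \<Longrightarrow> tri p q c = 0 \<Longrightarrow> \<exists>q'. a @ [c, q'] @ b \<in> deformation_tuples n \<rho>"
proof -
  obtain \<sigma> qs where s: "bending_deformation n \<rho> \<sigma>" "given_by n \<sigma> qs" "map hy qs = a @ [p, q] @ b"
    using assms(2) unfolding deformation_tuples_def by auto
  obtain a' x y b' where e: "qs = a' @ [x, y] @ b'" "a = map hy a'" "p = hy x" "q = hy y" "b = map hy b'"
    by (rule map_split4[OF s(3)])
  have d: "set a' \<subseteq> poincare_disc" "set b' \<subseteq> poincare_disc" "x \<in> poincare_disc" "y \<in> poincare_disc"
    using s(2) by (auto simp: given_by_def e)
  have ne: "x \<noteq> y" using assms(3) by (auto simp: e)
  obtain \<gamma> t where g: "geodesic_line \<gamma>" "\<gamma> 0 = x" "\<gamma> t = y" "hy (\<gamma> (t + t)) = hrefl (hy y) (hy x)" "hy (\<gamma> (- t)) = hrefl (hy x) (hy y)"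
    "\<And>c. c \<in> poincare_disc \<Longrightarrow> tri (hy x) (hy y) (hy c) = 0 \<Longrightarrow> \<exists>s. \<gamma> s = c"
    by (rule geodesic_through[OF d(3,4) ne]) blast
  have m: "map hy (a' @ [\<gamma> 0, \<gamma> t] @ b') \<in> deformation_tuples n \<rho>" using assms(2) by (simp add: e g)
  have "\<gamma> 0 \<noteq> \<gamma> t" using ne by (simp add: g)
  note bend = deformation_bend[OF assms(1) m d(1,2) g(1) this]
  show "a @ [q, hrefl q p] @ b \<in> deformation_tuples n \<rho>" using bend[of t] by (simp add: e g g(4)[simplified])
  show "a @ [hrefl p q, p] @ b \<in> deformation_tuples n \<rho>" using bend[of "- t"] by (simp add: e g)
  assume c: "c \<in> hyp" "tri p q c = 0"
  have "tri (hy x) (hy y) (hy (pdisc c)) = 0" using c by (simp add: hy_pdisc e)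
  then obtain u where "\<gamma> u = pdisc c" using g(6) pdisc_disc[OF c(1)] by blast
  then have u: "hy (\<gamma> u) = c" using hy_pdisc[OF c(1)] by simp
  show "\<exists>p'. a @ [p', c] @ b \<in> deformation_tuples n \<rho>" by (rule exI[of _ "hy (\<gamma> (u - t))"]) (use bend[of "u - t"] in \<open>simp add: e u\<close>)
  show "\<exists>q'. a @ [c, q'] @ b \<in> deformation_tuples n \<rho>" by (rule exI[of _ "hy (\<gamma> (t + u))"]) (use bend[of u] in \<open>simp add: e u\<close>)
qed

lemma basic_extremal:
  assumes "n \<ge> 5" "basic_rep n \<rho>" "given_by n \<rho> qs" shows "extremal (map hy qs)"
proof (rule braid_extremal[of "deformation_tuples n \<rho>"])
  have rP: "\<rho> \<in> PH n" using assms(2) by (simp add: basic_rep_def)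
  have ne: "p \<noteq> q" if "a @ [p, q] @ b \<in> deformation_tuples n \<rho>" for a p q b
    using that basic_no_double[OF assms(2,1)] by blast
  show "braid_closed (deformation_tuples n \<rho>)"
    unfolding braid_closed_def using deformation_moves(1,2)[OF rP _ ne] by blast
  show "map hy qs \<in> deformation_tuples n \<rho>"
    unfolding deformation_tuples_def bending_deformation_def using assms(3) by blast
  fix Qs assume Qs: "Qs \<in> deformation_tuples n \<rho>"
  have "coherent Qs" unfolding coherent_def
  proof (intro allI impI, rule ccontr)
    fix a p q r s b assume Q: "Qs = a @ [p, q, r, s] @ b" and np: "\<not> tri p q r * tri p q s > 0"
    have h: "r \<in> hyp" "s \<in> hyp" using deformation_hyp(1)[OF rP Qs] by (auto simp: Q closing_def)
    have "tri p q r * tri p q s \<le> 0" using np by simp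
    then obtain c where c: "c \<in> hyp" "tri p q c = 0" "tri r s c = 0" by (rule common_point[OF h])
    have "a @ [p, q] @ ([r, s] @ b) \<in> deformation_tuples n \<rho>" using Qs Q by simp
    from deformation_moves(3)[OF rP this ne[OF this] c(1,2)] obtain p' where "a @ [p', c] @ ([r, s] @ b) \<in> deformation_tuples n \<rho>" by blast
    then have m: "(a @ [p', c]) @ [r, s] @ b \<in> deformation_tuples n \<rho>" by simp
    from deformation_moves(4)[OF rP this ne[OF this] c(1,3)] obtain s' where "(a @ [p', c]) @ [c, s'] @ b \<in> deformation_tuples n \<rho>" by blast
    then have "(a @ [p']) @ [c, c] @ ([s'] @ b) \<in> deformation_tuples n \<rho>" by simp
    then show False using basic_no_double[OF assms(2,1)] by blast
  qed
  then show "closing Qs \<and> length Qs \<ge> 5 \<and> coherent Qs" using deformation_hyp[OF rP Qs] assms(1) by simp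
qed

theorem theorem4p8:
  fixes n :: nat and \<rho> :: H_rep
  assumes "n \<ge> 5" and "\<rho> \<in> PH n"
  shows "basic_rep n \<rho> \<longleftrightarrow> discrete_rep n \<rho> \<and> faithful_rep n \<rho>"
proof -
  obtain qs where qs: "given_by n \<rho> qs" using given_by_ex[OF assms(2)] by blast
  have t: "tuple n (hy_tuple qs) = map hy qs" using qs by (simp add: tuple_hy given_by_def)
  have cl: "closing (tuple n (hy_tuple qs))" using rep_closing[OF assms(2) qs] by (simp add: t)
  have "basic_rep n \<rho> \<longleftrightarrow> extremal (map hy qs)"
    using extremal_basic[OF assms qs] basic_extremal[OF assms(1) _ qs] by blast
  also have "\<dots> \<longleftrightarrow> isolated_id n (hy_tuple qs)"
    using extremal_isolated[OF assms(1), of "hy_tuple qs"] isolated_extremal[OF assms(1) cl] by (auto simp: t)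
  also have "\<dots> \<longleftrightarrow> discrete_rep n \<rho> \<and> faithful_rep n \<rho>"
    using discrete_faithful_isolated[OF assms(2) qs] isolated_discrete_faithful[OF assms(2) qs] by blast
  finally show ?thesis .
qed

end
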